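(* For every Coxeter system $(W,S)$, every maximal distinguished matching $(Q,\phi)$ on $W$ is reducible.
   Context: $W$ has Coxeter matrix $(m_{st})$, and carries the Bruhat order $\le$ and the length function $\ell$; $x\lhd y$ means that $y$ covers $x$; $\mathrm{coat}(y)=\{x : x\lhd y\}$. A subset $Q\subseteq W$ is decreasing if $q\in Q$ and $x\le q$ imply $x\in Q$. A partial distinguished matching of $W$ is a pair $(Q,\phi)$ with $Q\subseteq W$ decreasing and $\phi:Q\to Q$ such that: (i) $\phi(\phi(u))=u$ for all $u$; (ii) for all $u\in Q$, $u\lhd\phi(u)$ or $\phi(u)\lhd u$; (iii) for all $u\in Q$ with $u\lhd\phi(u)$, $\mathrm{coat}(\phi(u))=\{u\}\cup\{\phi(v): v\lhd u,\ v\lhd\phi(v)\}$. It is maximal if it is maximal for the order: $(Q_1,\phi_1)\le(Q_2,\phi_2)$ iff $Q_1\subseteq Q_2$ and $\phi_2$ extends $\phi_1$. For $s,t\in S$ with $m_{st}<\infty$, $M_{st}=sts\cdots$ ($m_{st}$ factors) is the longest element of $\langle s,t\rangle$. An element $w\in W$ is full if for all $s,t\in S$ one has $m_{st}<\infty$ and $M_{st}\le w$. An element $s\in S$ is left regular for $(Q,\phi)$ if $Q$ is stable under $x\mapsto sx$ and $\phi(sx)=s\phi(x)$ for all $x\in Q$; right regular is defined analogously with $x\mapsto xs$. Left and right descent sets: $D_g(w)=\{s\in S: sw\lhd w\}$, $D_d(w)=\{s\in S: ws\lhd w\}$. An orbit of the involution $\phi$ on $Q$ is written $\{m,M\}$ with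 $m\lhd M=\phi(m)$. The orbit is full if $M$ is full. It is reducible if $D_g(m)$ contains a left regular element or $D_d(m)$ contains a right regular element. The maximal matching $(Q,\phi)$ is reducible if $|S|\le2$ or every full orbit is reducible. *)

theory Defs
  imports "HOL-Algebra.Generated_Groups" "HOL-Library.Extended_Nat"
begin

text \<open>Words over \<open>S\<close> and the rewriting of words by the Coxeter relations
  \<open>(s t)^m(s,t) = 1\<close>, one relation for each pair with \<open>m s t\<close> finite.  Since \<open>m s s = 1\<close> in a
  Coxeter matrix, \<open>s s = 1\<close> is among the relations, so that formal inverses of the generators
  are not needed: the quotient of the free monoid on \<open>S\<close> by the generated congruence is the group
  presented by these relations.\<close>

inductive relator_deletion ::
  "'a set \<Rightarrow> ('a \<Rightarrow> 'a \<Rightarrow> enat) \<Rightarrow> 'a list \<Rightarrow> 'a list \<Rightarrow> bool"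
  for S :: "'a set" and m :: "'a \<Rightarrow> 'a \<Rightarrow> enat" where
  "\<lbrakk>us \<in> lists S; vs \<in> lists S; s \<in> S; t \<in> S; m s t = enat k\<rbrakk>
    \<Longrightarrow> relator_deletion S m (us @ concat (replicate k [s, t]) @ vs) (us @ vs)"

primrec alternating :: "nat \<Rightarrow> 'a \<Rightarrow> 'a \<Rightarrow> 'a list" where
  "alternating 0 s t = []"
| "alternating (Suc n) s t = s # alternating n t s"

text \<open>The set \<open>S\<close> may be infinite.  The last assumption says that \<open>W\<close> is presented by the
  generators \<open>S\<close> and the Coxeter relations.\<close>

locale coxeter_system = group W for W (structure) +
  fixes S :: "'a set" and m :: "'a \<Rightarrow> 'a \<Rightarrow> enat"
  assumes gens_closed: "S \<subseteq> carrier W"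
    and gens_generate: "generate W S = carrier W"
    and matrix_diag: "s \<in> S \<Longrightarrow> m s s = 1"
    and matrix_off_diag: "\<lbrakk>s \<in> S; t \<in> S; s \<noteq> t\<rbrakk> \<Longrightarrow> 2 \<le> m s t"
    and matrix_sym: "\<lbrakk>s \<in> S; t \<in> S\<rbrakk> \<Longrightarrow> m s t = m t s"
    and presentation: "\<lbrakk>us \<in> lists S; vs \<in> lists S\<rbrakk> \<Longrightarrow>
      foldr (\<otimes>) us \<one> = foldr (\<otimes>) vs \<one> \<longleftrightarrow> equivclp (relator_deletion S m) us vs"
begin

definition word_length :: "'a \<Rightarrow> nat" where
  "word_length w = (LEAST n. \<exists>ws \<in> lists S. length ws = n \<and> foldr (\<otimes>) ws \<one> = w)"

definition reflections :: "'a set" where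
  "reflections = {w \<otimes> s \<otimes> inv w | w s. w \<in> carrier W \<and> s \<in> S}"

definition bruhat_step :: "'a \<Rightarrow> 'a \<Rightarrow> bool" where
  "bruhat_step x y \<longleftrightarrow> x \<in> carrier W \<and> word_length x < word_length y \<and>
     (\<exists>r \<in> reflections. y = x \<otimes> r)"

definition bruhat_le :: "'a \<Rightarrow> 'a \<Rightarrow> bool" where
  "bruhat_le x y \<longleftrightarrow> x \<in> carrier W \<and> y \<in> carrier W \<and> bruhat_step\<^sup>*\<^sup>* x y"

definition covered_by :: "'a \<Rightarrow> 'a \<Rightarrow> bool" where
  "covered_by x y \<longleftrightarrow> bruhat_le x y \<and> x \<noteq> y \<and>
     (\<forall>z. bruhat_le x z \<and> bruhat_le z y \<longrightarrow> z = x \<or> z = y)"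

definition coat :: "'a \<Rightarrow> 'a set" where
  "coat y = {x. covered_by x y}"

definition decreasing :: "'a set \<Rightarrow> bool" where
  "decreasing Q \<longleftrightarrow> (\<forall>q \<in> Q. \<forall>x. bruhat_le x q \<longrightarrow> x \<in> Q)"

text \<open>A map \<open>Q \<rightarrow> Q\<close> is represented by a total function, of which only the values on \<open>Q\<close> matter.\<close>

definition partial_distinguished_matching :: "'a set \<Rightarrow> ('a \<Rightarrow> 'a) \<Rightarrow> bool" where
  "partial_distinguished_matching Q \<phi> \<longleftrightarrow>
     Q \<subseteq> carrier W \<and> decreasing Q \<and> \<phi> ` Q \<subseteq> Q \<and>
     (\<forall>u \<in> Q. \<phi> (\<phi> u) = u) \<and>
     (\<forall>u \<in> Q. covered_by u (\<phi> u) \<or> covered_by (\<phi> u) u) \<and>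
     (\<forall>u \<in> Q. covered_by u (\<phi> u) \<longrightarrow>
        coat (\<phi> u) = {u} \<union> {\<phi> v | v. covered_by v u \<and> covered_by v (\<phi> v)})"

definition matching_le :: "'a set \<Rightarrow> ('a \<Rightarrow> 'a) \<Rightarrow> 'a set \<Rightarrow> ('a \<Rightarrow> 'a) \<Rightarrow> bool" where
  "matching_le Q1 \<phi>1 Q2 \<phi>2 \<longleftrightarrow> Q1 \<subseteq> Q2 \<and> (\<forall>u \<in> Q1. \<phi>2 u = \<phi>1 u)"

definition maximal_distinguished_matching :: "'a set \<Rightarrow> ('a \<Rightarrow> 'a) \<Rightarrow> bool" where
  "maximal_distinguished_matching Q \<phi> \<longleftrightarrow>
     partial_distinguished_matching Q \<phi> \<and>
     (\<forall>Q' \<phi>'. partial_distinguished_matching Q' \<phi>' \<and> matching_le Q \<phi> Q' \<phi>' \<longrightarrow>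
        matching_le Q' \<phi>' Q \<phi>)"

text \<open>The element \<open>M\<^sub>s\<^sub>t = s t s \<dots>\<close> (\<open>m s t\<close> factors), meaningful only if \<open>m s t < \<infinity>\<close>.\<close>

definition dihedral_longest :: "'a \<Rightarrow> 'a \<Rightarrow> 'a" where
  "dihedral_longest s t = foldr (\<otimes>) (alternating (the_enat (m s t)) s t) \<one>"

definition full_element :: "'a \<Rightarrow> bool" where
  "full_element w \<longleftrightarrow> w \<in> carrier W \<and>
     (\<forall>s \<in> S. \<forall>t \<in> S. m s t < \<infinity> \<and> bruhat_le (dihedral_longest s t) w)"

definition left_regular :: "'a set \<Rightarrow> ('a \<Rightarrow> 'a) \<Rightarrow> 'a \<Rightarrow> bool" where
  "left_regular Q \<phi> s \<longleftrightarrow> s \<in> S \<and> (\<forall>x \<in> Q. s \<otimes> x \<in> Q \<and> \<phi> (s \<otimes> x) = s \<otimes> \<phi> x)"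

definition right_regular :: "'a set \<Rightarrow> ('a \<Rightarrow> 'a) \<Rightarrow> 'a \<Rightarrow> bool" where
  "right_regular Q \<phi> s \<longleftrightarrow> s \<in> S \<and> (\<forall>x \<in> Q. x \<otimes> s \<in> Q \<and> \<phi> (x \<otimes> s) = \<phi> x \<otimes> s)"

definition left_descents :: "'a \<Rightarrow> 'a set" where
  "left_descents w = {s \<in> S. covered_by (s \<otimes> w) w}"

definition right_descents :: "'a \<Rightarrow> 'a set" where
  "right_descents w = {s \<in> S. covered_by (w \<otimes> s) w}"

text \<open>An orbit of \<open>\<phi>\<close> on \<open>Q\<close> is represented by its lower element, i.e. by the \<open>u \<in> Q\<close> such that
  \<open>\<phi> u\<close> covers \<open>u\<close>.\<close>

definition orbit_bottom :: "'a set \<Rightarrow> ('a \<Rightarrow> 'a) \<Rightarrow> 'a \<Rightarrow> bool" where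
  "orbit_bottom Q \<phi> u \<longleftrightarrow> u \<in> Q \<and> covered_by u (\<phi> u)"

definition full_orbit :: "'a set \<Rightarrow> ('a \<Rightarrow> 'a) \<Rightarrow> 'a \<Rightarrow> bool" where
  "full_orbit Q \<phi> u \<longleftrightarrow> orbit_bottom Q \<phi> u \<and> full_element (\<phi> u)"

definition reducible_orbit :: "'a set \<Rightarrow> ('a \<Rightarrow> 'a) \<Rightarrow> 'a \<Rightarrow> bool" where
  "reducible_orbit Q \<phi> u \<longleftrightarrow> orbit_bottom Q \<phi> u \<and>
     ((\<exists>s \<in> left_descents u. left_regular Q \<phi> s) \<or>
      (\<exists>s \<in> right_descents u. right_regular Q \<phi> s))"

definition reducible_matching :: "'a set \<Rightarrow> ('a \<Rightarrow> 'a) \<Rightarrow> bool" where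
  "reducible_matching Q \<phi> \<longleftrightarrow>
     (finite S \<and> card S \<le> 2) \<or> (\<forall>u. full_orbit Q \<phi> u \<longrightarrow> reducible_orbit Q \<phi> u)"

end

end

theory Submission
  imports Defs Complex_Main "HOL-Library.Sublist"
begin

text \<open>
  Write \<open>s = \<phi> 1\<close>.  A matching is determined by its coatom conditions, because an element outside the rank two
  parabolic subgroups is determined by its coatoms.  Therefore \<open>\<phi>\<close> commutes with left multiplication by a
  generator as soon as it does so on the dihedral subgroups \<open>\<langle>s, t\<rangle>\<close> containing this generator, and on a maximal
  matching such a generator is left regular.

  A generator \<open>t\<close> that does not commute with \<open>s\<close> is of right type if \<open>\<phi> t = t s\<close>, and of left type if \<open>\<phi> t = s t\<close>.
  Monotonicity of the passage to the upper element of an orbit forbids many words in \<open>Q\<close>, for instance \<open>l s r\<close>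
  with \<open>l\<close> of left type and \<open>r\<close> of right type: the upper element has one more letter, but it would have to
  contain too many words that are the unique reduced words of their elements.  If the orbit \<open>{u, \<phi> u}\<close> is full,
  then \<open>u\<close> contains almost all dihedral words, and at most one dihedral subgroup \<open>\<langle>s, t\<rangle>\<close> carries a matching
  that is not a one-sided multiplication by \<open>s\<close>.  If the orbit is irreducible as well, all descents of \<open>u\<close> lie in
  \<open>{s, t}\<close>.  Splitting off from \<open>u\<close> the longest prefix in the letters \<open>s\<close> and \<open>t\<close>, the forbidden words exclude any
  nonempty remainder, so that \<open>u\<close> lies in \<open>\<langle>s, t\<rangle>\<close> and \<open>S \<subseteq> {s, t}\<close>.
\<close>

subsection \<open>Words, reflections and the exchange condition\<close>

text \<open>The obstacle is that reduced words are not canonical, so that Bruhat relations do not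
  translate into relations between words. They do for elements with exactly one reduced word
  (\<open>unique_word\<close>): that word is a subword of every reduced word of every larger
  element. The upper element of an orbit has at most one letter more than a given word of the orbit,
  so a few incompatible unique words that it must contain put the word outside \<open>Q\<close>.
  Dihedral words shorter than \<open>ord s t\<close> are unique, which is why all deviations from
  one-sided multiplication are recorded strictly below the longest element. Fullness makes all
  orders finite and puts all longest dihedral elements into \<open>Q\<close>. Moreover, passing to
  the lower element is monotone and loses at most one letter; hence words in \<open>\<phi> 1\<close>
  and \<open>t\<close> of length at most two less than their order lie below \<open>u\<close>.
  Maximality enters through extension: if left multiplication by \<open>r\<close> commutes with
  \<open>\<phi>\<close> wherever both sides make sense, the matching extends to \<open>Q\<close>
  together with its translate by \<open>r\<close>. Inversion in the group exchanges left and right,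
  so most arguments are carried out on one side only.\<close>

context coxeter_system
begin

definition word_value :: "'a list \<Rightarrow> 'a" where
  "word_value \<omega> = foldr (\<otimes>) \<omega> \<one>"

lemma word_value_simps [simp]:
  "word_value [] = \<one>" "word_value (s # \<omega>) = s \<otimes> word_value \<omega>"
  by (simp_all add: word_value_def)

lemma gen_closed [simp, intro]: "s \<in> S \<Longrightarrow> s \<in> carrier W"
  using gens_closed by blast

lemma word_value_closed [simp, intro]: "set \<omega> \<subseteq> S \<Longrightarrow> word_value \<omega> \<in> carrier W"
  by (induction \<omega>) auto

lemma word_value_append [simp]:
  "set u \<subseteq> S \<Longrightarrow> set v \<subseteq> S \<Longrightarrow> word_value (u @ v) = word_value u \<otimes> word_value v"
  by (induction u) (auto simp: m_assoc)

text \<open>This turns the presentation into a universal property: a function of words descends to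
  the group once single relator deletions preserve it. It is applied to the parity of reflection
  counts and to the geometric representation.\<close>

lemma word_value_invariant:
  assumes "set us \<subseteq> S" "set vs \<subseteq> S" "word_value us = word_value vs"
    and "\<And>xs ys. relator_deletion S m xs ys \<Longrightarrow> f xs = f ys"
  shows "f us = f vs"
proof -
  have "equivclp (relator_deletion S m) us vs"
    using presentation[of us vs] assms by (auto simp: word_value_def)
  then show ?thesis
    by (induction rule: equivclp_induct) (use assms(4) in \<open>fastforce\<close>)+
qed

lemma gen_square [simp]:
  assumes "s \<in> S" shows "s \<otimes> s = \<one>"
proof -
  have "relator_deletion S m ([] @ concat (replicate 1 [s, s]) @ []) ([] @ [])"
    using assms matrix_diag[of s] by (intro relator_deletion.intros) (auto simp: one_enat_def)
  then have "equivclp (relator_deletion S m) [s, s] []"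
    by (simp add: r_into_equivclp)
  then have "word_value [s, s] = word_value []"
    using presentation[of "[s, s]" "[]"] assms by (auto simp: word_value_def)
  then show ?thesis using assms by simp
qed

lemma inv_cancel_left [simp]:
  "x \<in> carrier W \<Longrightarrow> y \<in> carrier W \<Longrightarrow> inv x \<otimes> (x \<otimes> y) = y"
  "x \<in> carrier W \<Longrightarrow> y \<in> carrier W \<Longrightarrow> x \<otimes> (inv x \<otimes> y) = y"
  using m_assoc[of "inv x" x y] m_assoc[of x "inv x" y] by simp_all

lemma gen_inv [simp]: "s \<in> S \<Longrightarrow> inv s = s"
  by (metis gen_closed gen_square inv_equality)

lemma gen_cancel_left [simp]: "s \<in> S \<Longrightarrow> x \<in> carrier W \<Longrightarrow> s \<otimes> (s \<otimes> x) = x"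
  by (metis gen_closed gen_square l_one m_assoc)

lemma gen_cancel_right [simp]: "s \<in> S \<Longrightarrow> x \<in> carrier W \<Longrightarrow> x \<otimes> s \<otimes> s = x"
  by (metis gen_closed gen_square m_assoc r_one)

lemma word_value_rev: "set \<omega> \<subseteq> S \<Longrightarrow> word_value (rev \<omega>) = inv (word_value \<omega>)"
  by (induction \<omega>) (auto simp: word_value_append inv_mult_group)

lemma ex_word:
  assumes "w \<in> carrier W" shows "\<exists>\<omega>. set \<omega> \<subseteq> S \<and> word_value \<omega> = w"
proof -
  have "w \<in> generate W S" using assms gens_generate by simp
  then show ?thesis
  proof (induction rule: generate.induct)
    case one
    then show ?case by (intro exI[of _ "[]"]) auto
  next
    case (incl h)
    then show ?case by (intro exI[of _ "[h]"]) auto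
  next
    case (inv h)
    then show ?case by (intro exI[of _ "[h]"]) auto
  next
    case (eng h1 h2)
    then obtain u v where "set u \<subseteq> S" "word_value u = h1" "set v \<subseteq> S" "word_value v = h2" by blast
    then show ?case by (intro exI[of _ "u @ v"]) auto
  qed
qed

abbreviation "len \<equiv> word_length"

definition reduced :: "'a list \<Rightarrow> bool" where
  "reduced \<omega> \<longleftrightarrow> set \<omega> \<subseteq> S \<and> len (word_value \<omega>) = length \<omega>"

lemma len_le: "set \<omega> \<subseteq> S \<Longrightarrow> len (word_value \<omega>) \<le> length \<omega>"
  unfolding word_length_def word_value_def by (rule Least_le) auto

lemma ex_reduced:
  assumes "w \<in> carrier W" shows "\<exists>\<omega>. reduced \<omega> \<and> word_value \<omega> = w"
proof -
  obtain \<omega>0 where "set \<omega>0 \<subseteq> S" "word_value \<omega>0 = w" using ex_word[OF assms] by blast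
  then have "\<exists>n. \<exists>ws \<in> lists S. length ws = n \<and> word_value ws = w" by auto
  from LeastI_ex[OF this[unfolded word_value_def]] obtain \<omega> where "\<omega> \<in> lists S" "length \<omega> = len w" "word_value \<omega> = w"
    unfolding word_length_def word_value_def by blast
  then show ?thesis unfolding reduced_def by auto
qed

lemma reducedD [simp, dest]: "reduced \<omega> \<Longrightarrow> set \<omega> \<subseteq> S"
  by (simp add: reduced_def)

lemma reduced_len: "reduced \<omega> \<Longrightarrow> len (word_value \<omega>) = length \<omega>"
  by (simp add: reduced_def)

lemma reduced_closed [simp, intro]: "reduced \<omega> \<Longrightarrow> word_value \<omega> \<in> carrier W"
  by auto

lemma len_one [simp]: "len \<one> = 0"
  using len_le[of "[]"] by simp

lemma len_eq_0: "w \<in> carrier W \<Longrightarrow> len w = 0 \<longleftrightarrow> w = \<one>"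
  using ex_reduced[of w] by (auto simp: reduced_def)

lemma reduced_Nil [simp]: "reduced []"
  by (simp add: reduced_def)

lemma len_mult_le:
  assumes "x \<in> carrier W" "y \<in> carrier W" shows "len (x \<otimes> y) \<le> len x + len y"
proof -
  obtain u where "reduced u" "word_value u = x" using ex_reduced[OF assms(1)] by blast
  moreover obtain v where "reduced v" "word_value v = y" using ex_reduced[OF assms(2)] by blast
  ultimately show ?thesis
    using len_le[of "u @ v"] by (auto simp: reduced_def)
qed

lemma len_inv [simp]:
  assumes "x \<in> carrier W" shows "len (inv x) = len x"
proof -
  have *: "len (inv y) \<le> len y" if y: "y \<in> carrier W" for y
  proof -
    obtain u where "reduced u" "word_value u = y" using ex_reduced[OF y] by blast
    then show ?thesis using len_le[of "rev u"] by (auto simp: word_value_rev reduced_def)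
  qed
  show ?thesis using *[OF assms] *[of "inv x"] assms by auto
qed

lemma reduced_rev [simp]: "reduced (rev \<omega>) \<longleftrightarrow> reduced \<omega>"
  unfolding reduced_def using word_value_rev[of \<omega>] by auto

lemma reduced_append:
  assumes "reduced (u @ v)" shows "reduced u" "reduced v"
proof -
  have S: "set u \<subseteq> S" "set v \<subseteq> S" using assms[THEN reducedD] by auto
  have "length u + length v = len (word_value u \<otimes> word_value v)"
    using assms S by (simp add: reduced_def word_value_append)
  also have "\<dots> \<le> len (word_value u) + len (word_value v)"
    using S by (intro len_mult_le) auto
  finally show "reduced u" "reduced v"
    using len_le[OF S(1)] len_le[OF S(2)] S by (auto simp: reduced_def)
qed

lemma reduced_ConsD: "reduced (a # v) \<Longrightarrow> reduced v"
  using reduced_append[of "[a]" v] by simp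

lemma reduced_replace:
  assumes "reduced (u @ v)" "reduced u'" "word_value u' = word_value u"
  shows "reduced (u' @ v)" "word_value (u' @ v) = word_value (u @ v)"
proof -
  have "set u \<subseteq> S" "set v \<subseteq> S" "set u' \<subseteq> S" using assms(1,2)[THEN reducedD] by auto
  then show "word_value (u' @ v) = word_value (u @ v)" using assms by (simp add: word_value_append)
  moreover have "length u' = length u"
    using assms reduced_append(1)[OF assms(1)] unfolding reduced_def by metis
  ultimately show "reduced (u' @ v)" using assms unfolding reduced_def by auto
qed

lemma reduced_replace2:
  assumes "reduced (u @ v)" "reduced v'" "word_value v' = word_value v"
  shows "reduced (u @ v')" "word_value (u @ v') = word_value (u @ v)"
proof -
  have "set u \<subseteq> S" "set v \<subseteq> S" "set v' \<subseteq> S" using assms(1,2)[THEN reducedD] by auto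
  then show "word_value (u @ v') = word_value (u @ v)" using assms by (simp add: word_value_append)
  moreover have "length v' = length v"
    using assms reduced_append(2)[OF assms(1)] unfolding reduced_def by metis
  ultimately show "reduced (u @ v')" using assms unfolding reduced_def by auto
qed

text \<open>Up to repetitions, \<open>reflection_count \<omega> r\<close> is the number of prefixes \<open>p @ [a]\<close> of \<open>\<omega>\<close> with
  \<open>r = p a p\<^sup>-\<^sup>1\<close>.  Its parity depends only on the value of \<open>\<omega>\<close>; this replaces the action of the group on
  signed reflections in the proof of the exchange condition.\<close>

primrec reflection_count :: "'a list \<Rightarrow> 'a \<Rightarrow> nat" where
  "reflection_count [] r = 0"
| "reflection_count (s # \<omega>) r = (if r = s then 1 else 0) + reflection_count \<omega> (s \<otimes> r \<otimes> s)"

lemma reflection_count_append: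
  assumes "set u \<subseteq> S" "set v \<subseteq> S" "r \<in> carrier W"
  shows "reflection_count (u @ v) r
    = reflection_count u r + reflection_count v (inv (word_value u) \<otimes> r \<otimes> word_value u)"
  using assms
proof (induction u arbitrary: r)
  case (Cons s u)
  then have "reflection_count (u @ v) (s \<otimes> r \<otimes> s) = reflection_count u (s \<otimes> r \<otimes> s)
     + reflection_count v (inv (word_value u) \<otimes> (s \<otimes> r \<otimes> s) \<otimes> word_value u)"
    by auto
  moreover have "inv (word_value u) \<otimes> (s \<otimes> r \<otimes> s) \<otimes> word_value u
     = inv (s \<otimes> word_value u) \<otimes> r \<otimes> (s \<otimes> word_value u)"
    using Cons.prems by (auto simp: inv_mult_group m_assoc)
  ultimately show ?case by simp
qed simp

text \<open>Conjugation by \<open>s \<otimes> t\<close> moves the reflection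
  \<open>(s \<otimes> t) [^] j \<otimes> s\<close> two steps along the dihedral sequence, so each
  further block \<open>[s, t]\<close> of a relator shifts the counted indices by two.\<close>

lemma relator_conj_shift:
  assumes "s \<in> S" "t \<in> S" "r \<in> carrier W"
  shows "t \<otimes> (s \<otimes> r \<otimes> s) \<otimes> t = (s \<otimes> t) [^] (j::nat) \<otimes> s \<longleftrightarrow> r = (s \<otimes> t) [^] (j + 2) \<otimes> s"
proof -
  have p: "(s \<otimes> t) [^] (j + 2) \<otimes> s = (s \<otimes> t) \<otimes> ((s \<otimes> t) [^] j \<otimes> s) \<otimes> (t \<otimes> s)"
  proof -
    have "(s \<otimes> t) [^] (j + 2) = (s \<otimes> t) [^] (1 + j + 1)" by simp
    also have "\<dots> = (s \<otimes> t) \<otimes> (s \<otimes> t) [^] j \<otimes> (s \<otimes> t)"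
      using assms by (simp only: nat_pow_mult[symmetric] nat_pow_closed m_closed gen_closed) simp
    finally show ?thesis using assms by (simp add: m_assoc)
  qed
  show ?thesis
  proof
    assume "t \<otimes> (s \<otimes> r \<otimes> s) \<otimes> t = (s \<otimes> t) [^] j \<otimes> s"
    then have "(s \<otimes> t) \<otimes> ((s \<otimes> t) [^] j \<otimes> s) \<otimes> (t \<otimes> s) = (s \<otimes> t) \<otimes> (t \<otimes> (s \<otimes> r \<otimes> s) \<otimes> t) \<otimes> (t \<otimes> s)"
      by simp
    also have "\<dots> = r" using assms by (simp add: m_assoc)
    finally show "r = (s \<otimes> t) [^] (j + 2) \<otimes> s" using p by simp
  next
    assume "r = (s \<otimes> t) [^] (j + 2) \<otimes> s"
    then show "t \<otimes> (s \<otimes> r \<otimes> s) \<otimes> t = (s \<otimes> t) [^] j \<otimes> s"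
      unfolding p using assms by (simp add: m_assoc)
  qed
qed

lemma reflection_count_relator:
  assumes "s \<in> S" "t \<in> S" "r \<in> carrier W"
  shows "reflection_count (concat (replicate k [s, t])) r
    = (\<Sum>j<2*k. if r = (s \<otimes> t) [^] j \<otimes> s then 1 else 0)"
  using assms
proof (induction k arbitrary: r)
  case (Suc k)
  have 1: "s \<otimes> r \<otimes> s = t \<longleftrightarrow> r = (s \<otimes> t) [^] (1::nat) \<otimes> s"
    using Suc.prems by (auto simp: m_assoc)
  have "reflection_count (concat (replicate (Suc k) [s, t])) r
     = (if r = s then 1 else 0) + ((if s \<otimes> r \<otimes> s = t then 1 else 0)
       + reflection_count (concat (replicate k [s, t])) (t \<otimes> (s \<otimes> r \<otimes> s) \<otimes> t))"
    by simp
  also have "reflection_count (concat (replicate k [s, t])) (t \<otimes> (s \<otimes> r \<otimes> s) \<otimes> t)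
    = (\<Sum>j<2*k. if r = (s \<otimes> t) [^] (j + 2) \<otimes> s then 1 else 0)"
    using Suc.prems by (subst Suc.IH) (auto simp: relator_conj_shift)
  also have "(if r = s then 1 else 0) + ((if s \<otimes> r \<otimes> s = t then 1 else 0) + \<dots>)
    = (\<Sum>j<2*Suc k. if r = (s \<otimes> t) [^] j \<otimes> s then 1 else 0)"
    unfolding 1 using Suc.prems
    by (simp add: sum.lessThan_Suc_shift del: sum.lessThan_Suc nat_pow_Suc)
  finally show ?case .
qed simp

lemma relator_value:
  "s \<in> S \<Longrightarrow> t \<in> S \<Longrightarrow> word_value (concat (replicate k [s, t])) = (s \<otimes> t) [^] k"
proof (induction k)
  case (Suc k)
  have "word_value (concat (replicate (Suc k) [s, t])) = (s \<otimes> t) \<otimes> (s \<otimes> t) [^] k"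
    using Suc by (simp add: m_assoc)
  also have "\<dots> = (s \<otimes> t) [^] Suc k" using Suc.prems nat_pow_Suc2[of "s \<otimes> t" k] by simp
  finally show ?case .
qed simp

lemma set_relator: "set (concat (replicate k [s, t])) \<subseteq> {s, t}"
  by (induction k) auto

lemma matrix_pow:
  assumes "s \<in> S" "t \<in> S" "m s t = enat k" shows "(s \<otimes> t) [^] k = \<one>"
proof -
  have "relator_deletion S m ([] @ concat (replicate k [s, t]) @ []) ([] @ [])"
    using assms by (intro relator_deletion.intros) auto
  then have "equivclp (relator_deletion S m) (concat (replicate k [s, t])) []"
    by (simp add: r_into_equivclp)
  moreover have "concat (replicate k [s, t]) \<in> lists S"
    using set_relator[of k s t] assms by auto
  ultimately show ?thesis using presentation[of "concat (replicate k [s, t])" "[]"] relator_value[of s t k] assms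
    by (auto simp: word_value_def)
qed

lemma reflection_count_parity:
  assumes "set us \<subseteq> S" "set vs \<subseteq> S" "word_value us = word_value vs" "r \<in> carrier W"
  shows "even (reflection_count us r) = even (reflection_count vs r)"
proof (rule word_value_invariant[OF assms(1-3)])
  fix xs ys assume "relator_deletion S m xs ys"
  then obtain us vs s t k where *: "us \<in> lists S" "vs \<in> lists S" "s \<in> S" "t \<in> S" "m s t = enat k"
     "xs = us @ concat (replicate k [s, t]) @ vs" "ys = us @ vs"
    by cases auto
  define c where "c = concat (replicate k [s, t])"
  have c: "set c \<subseteq> S" "word_value c = \<one>"
    using set_relator[of k s t] * relator_value[of s t k] matrix_pow[of s t k] by (auto simp: c_def)
  have ev: "even (reflection_count c r')" if r': "r' \<in> carrier W" for r'
  proof -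
    define g :: "nat \<Rightarrow> nat" where "g j = (if r' = (s \<otimes> t) [^] j \<otimes> s then 1 else 0)" for j
    \<comment> \<open>Since \<open>(s \<otimes> t) [^] k = \<one>\<close>, the second half of the
      \<open>2 * k\<close> reflections of the relator repeats the first half, which makes every
      count even.\<close>
    have gk: "g (j + k) = g j" for j
      using * matrix_pow[of s t k] nat_pow_mult[of "s \<otimes> t" j k, symmetric] by (simp add: g_def)
    have "reflection_count c r' = (\<Sum>j<2*k. g j)"
      using reflection_count_relator[of s t r' k] * r' by (simp add: c_def g_def)
    also have "\<dots> = (\<Sum>j<k. g j) + (\<Sum>j<k. g (j + k))"
      using sum.atLeastLessThan_concat[of 0 k "2*k" g] sum.shift_bounds_nat_ivl[of g 0 k k]
      by (simp add: lessThan_atLeast0 mult_2)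
    finally show ?thesis by (simp add: gk)
  qed
  have U: "set us \<subseteq> S" "set vs \<subseteq> S" using * by auto
  have "reflection_count xs r = reflection_count us r
     + (reflection_count c (inv (word_value us) \<otimes> r \<otimes> word_value us)
     + reflection_count vs (inv (word_value us) \<otimes> r \<otimes> word_value us))"
    using U c assms by (simp add: * c_def[symmetric] reflection_count_append)
  moreover have "reflection_count ys r = reflection_count us r
     + reflection_count vs (inv (word_value us) \<otimes> r \<otimes> word_value us)"
    using U assms by (simp add: * reflection_count_append)
  ultimately show "even (reflection_count xs r) = even (reflection_count ys r)"
    using ev[of "inv (word_value us) \<otimes> r \<otimes> word_value us"] U assms by auto
qed

lemma reflection_closed [simp, intro]: "r \<in> reflections \<Longrightarrow> r \<in> carrier W"
  by (auto simp: reflections_def)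

lemma reflectionE:
  assumes "r \<in> reflections"
  obtains w s where "w \<in> carrier W" "s \<in> S" "r = w \<otimes> s \<otimes> inv w"
  using assms unfolding reflections_def by blast

lemma reflection_square [simp]: "r \<in> reflections \<Longrightarrow> r \<otimes> r = \<one>"
proof -
  assume "r \<in> reflections"
  then obtain w s where ws: "w \<in> carrier W" "s \<in> S" "r = w \<otimes> s \<otimes> inv w"
    unfolding reflections_def by blast
  show ?thesis
    unfolding ws(3) using ws(1,2) by (simp add: m_assoc)
qed

lemma reflection_cancel [simp]: "r \<in> reflections \<Longrightarrow> x \<in> carrier W \<Longrightarrow> r \<otimes> (r \<otimes> x) = x"
  using m_assoc[of r r x] reflection_closed[of r] reflection_square[of r] by (metis l_one)

lemma gen_reflection [simp]: "s \<in> S \<Longrightarrow> s \<in> reflections"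
  unfolding reflections_def by (rule CollectI, rule exI[of _ "\<one>"], rule exI[of _ s]) simp

lemma reflection_conj:
  assumes "r \<in> reflections" "x \<in> carrier W" shows "x \<otimes> r \<otimes> inv x \<in> reflections"
proof -
  obtain w s where "w \<in> carrier W" "s \<in> S" "r = w \<otimes> s \<otimes> inv w" using assms by (elim reflectionE)
  then have "x \<otimes> r \<otimes> inv x = (x \<otimes> w) \<otimes> s \<otimes> inv (x \<otimes> w)"
    using assms(2) by (simp add: m_assoc inv_mult_group)
  then show ?thesis unfolding reflections_def using \<open>w \<in> carrier W\<close> \<open>s \<in> S\<close> assms(2)
    by (intro CollectI exI[of _ "x \<otimes> w"] exI[of _ s]) simp
qed

text \<open>If \<open>r\<close> is the conjugate of a letter by the prefix before it, multiplying by
  \<open>r\<close> on the left cancels exactly that letter.\<close>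

lemma ex_deletion_if_counted:
  assumes "set \<omega> \<subseteq> S" "r \<in> carrier W" "reflection_count \<omega> r > 0"
  shows "\<exists>u a v. \<omega> = u @ a # v \<and> r \<otimes> word_value \<omega> = word_value (u @ v)"
  using assms
proof (induction \<omega> arbitrary: r)
  case (Cons s \<omega>)
  show ?case
  proof (cases "r = s")
    case True
    then show ?thesis using Cons.prems by (intro exI[of _ "[]"]) auto
  next
    case False
    then obtain u a v where uv: "\<omega> = u @ a # v" "(s \<otimes> r \<otimes> s) \<otimes> word_value \<omega> = word_value (u @ v)"
      using Cons.IH[of "s \<otimes> r \<otimes> s"] Cons.prems by auto
    have "s \<otimes> word_value (u @ v) = r \<otimes> word_value (s # \<omega>)"
      unfolding uv(2)[symmetric] using Cons.prems by (simp add: m_assoc)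
    then show ?thesis using uv(1) by (intro exI[of _ "s # u"] exI[of _ a] exI[of _ v]) simp
  qed
qed simp

text \<open>Compare with \<open>u @ rev u\<close>, whose count is even because its value is
  \<open>\<one>\<close>: the palindrome has one additional letter in the middle, and that letter
  contributes exactly one.\<close>

lemma reflection_count_self:
  assumes "set u \<subseteq> S" "s \<in> S" "word_value u \<otimes> s \<otimes> inv (word_value u) = r"
  shows "odd (reflection_count (u @ s # rev u) r)"
proof -
  have r: "r \<in> carrier W" "inv (word_value u) \<otimes> r \<otimes> word_value u = s"
    using assms by (auto simp: m_assoc)
  have "even (reflection_count (u @ rev u) r) = even (reflection_count [] r)"
    using assms r by (intro reflection_count_parity) (auto simp: word_value_rev)
  moreover have "reflection_count (u @ rev u) r = reflection_count u r + reflection_count (rev u) s"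
    using assms r by (subst reflection_count_append) auto
  moreover have "reflection_count (u @ s # rev u) r = reflection_count u r + (1 + reflection_count (rev u) s)"
    using assms r by (subst reflection_count_append) auto
  ultimately show ?thesis by simp
qed

text \<open>If \<open>r\<close> is counted evenly in \<open>\<omega>\<close>, it is counted oddly in
  any word of \<open>r \<otimes> word_value \<omega>\<close>. Deletion in a reduced such word then
  shows that multiplication by \<open>r\<close> made the element longer. The weak inequality in the
  hypothesis also yields that a reflection never preserves the length.\<close>

lemma strong_exchange:
  assumes "set \<omega> \<subseteq> S" "r \<in> reflections" "len (r \<otimes> word_value \<omega>) \<le> len (word_value \<omega>)"
  shows "\<exists>u a v. \<omega> = u @ a # v \<and> r \<otimes> word_value \<omega> = word_value (u @ v)"
proof (cases "odd (reflection_count \<omega> r)")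
  case True
  then show ?thesis using ex_deletion_if_counted[OF assms(1), of r] assms
    by (metis odd_pos reflection_closed)
next
  case False
  obtain w s where ws: "w \<in> carrier W" "s \<in> S" "r = w \<otimes> s \<otimes> inv w" using assms by (elim reflectionE)
  obtain u where u: "set u \<subseteq> S" "word_value u = w" using ex_word ws by blast
  define \<rho> where "\<rho> = u @ s # rev u"
  have \<rho>: "set \<rho> \<subseteq> S" using u ws by (simp add: \<rho>_def)
  have \<rho>v: "word_value \<rho> = r" using u ws(1,2) unfolding \<rho>_def ws(3) by (simp add: word_value_rev m_assoc)
  have \<rho>o: "odd (reflection_count \<rho> r)"
    unfolding \<rho>_def using u ws by (intro reflection_count_self) simp_all
  have rc: "r \<in> carrier W" using assms by auto
  have x: "inv r \<otimes> r \<otimes> r = r" using assms rc by (simp add: m_assoc)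
  obtain \<eta> where \<eta>: "reduced \<eta>" "word_value \<eta> = r \<otimes> word_value \<omega>"
    using ex_reduced[of "r \<otimes> word_value \<omega>"] assms rc by auto
  have "even (reflection_count \<eta> r) = even (reflection_count (\<rho> @ \<omega>) r)"
    using \<eta> \<rho> \<rho>v assms(1) rc by (intro reflection_count_parity) simp_all
  then have "odd (reflection_count \<eta> r)"
    using False \<rho> \<rho>v \<rho>o assms(1) rc by (simp add: reflection_count_append x)
  then obtain u' a v' where d: "\<eta> = u' @ a # v'" "r \<otimes> word_value \<eta> = word_value (u' @ v')"
    using ex_deletion_if_counted[of \<eta> r] \<eta> rc by (metis odd_pos reducedD)
  then have "word_value \<omega> = word_value (u' @ v')" using \<eta> assms rc by simp
  then have "len (word_value \<omega>) \<le> length (u' @ v')" using len_le[of "u' @ v'"] d \<eta> by auto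
  also have "\<dots> < len (r \<otimes> word_value \<omega>)" using d(1) \<eta>(2) reduced_len[OF \<eta>(1)] by simp
  finally show ?thesis using assms by simp
qed

lemma len_reflection_neq:
  assumes "r \<in> reflections" "x \<in> carrier W" shows "len (r \<otimes> x) \<noteq> len x"
proof
  assume eq: "len (r \<otimes> x) = len x"
  obtain \<omega> where \<omega>: "reduced \<omega>" "word_value \<omega> = x" using ex_reduced assms by blast
  then obtain u a v where d: "\<omega> = u @ a # v" "r \<otimes> x = word_value (u @ v)"
    using strong_exchange[of \<omega> r] assms eq by (metis order_refl reducedD)
  then have "len (r \<otimes> x) < len x" using len_le[of "u @ v"] \<omega> unfolding reduced_def by auto
  then show False using eq by simp
qed

lemma exchange:
  assumes "set \<omega> \<subseteq> S" "s \<in> S" "len (s \<otimes> word_value \<omega>) < len (word_value \<omega>)"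
  shows "\<exists>u a v. \<omega> = u @ a # v \<and> s \<otimes> word_value \<omega> = word_value (u @ v)"
  using strong_exchange[of \<omega> s] assms by simp

lemma len_gen_mult:
  assumes "s \<in> S" "x \<in> carrier W"
  shows "len (s \<otimes> x) = Suc (len x) \<or> Suc (len (s \<otimes> x)) = len x"
proof -
  have s: "len s \<le> 1" using len_le[of "[s]"] assms by simp
  have "len (s \<otimes> x) \<le> Suc (len x)" using len_mult_le[of s x] assms s by auto
  moreover have "len x \<le> Suc (len (s \<otimes> x))" using len_mult_le[of s "s \<otimes> x"] assms s by auto
  ultimately show ?thesis using len_reflection_neq[of s x] assms by force
qed

lemma len_mult_gen:
  assumes "s \<in> S" "x \<in> carrier W"
  shows "len (x \<otimes> s) = Suc (len x) \<or> Suc (len (x \<otimes> s)) = len x"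
  using len_gen_mult[of s "inv x"] len_inv[of "x \<otimes> s"] assms by (auto simp: inv_mult_group)

lemma len_gen [simp]: "s \<in> S \<Longrightarrow> len s = 1"
  using len_gen_mult[of s \<one>] by simp

lemma reduced_Cons_iff:
  "reduced (a # \<omega>) \<longleftrightarrow> a \<in> S \<and> reduced \<omega> \<and> len (word_value \<omega>) < len (a \<otimes> word_value \<omega>)"
proof
  assume R: "reduced (a # \<omega>)"
  then show "a \<in> S \<and> reduced \<omega> \<and> len (word_value \<omega>) < len (a \<otimes> word_value \<omega>)"
    using reduced_ConsD[OF R] by (auto simp: reduced_def)
next
  assume "a \<in> S \<and> reduced \<omega> \<and> len (word_value \<omega>) < len (a \<otimes> word_value \<omega>)"
  then show "reduced (a # \<omega>)" using len_gen_mult[of a "word_value \<omega>"] by (auto simp: reduced_def)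
qed

lemma reduced_Cons_descent:
  assumes "a \<in> S" "w \<in> carrier W" "len (a \<otimes> w) < len w" "reduced \<omega>" "word_value \<omega> = a \<otimes> w"
  shows "reduced (a # \<omega>)" "word_value (a # \<omega>) = w"
  using assms by (auto simp: reduced_Cons_iff)

lemma reduced_snoc_iff:
  "reduced (\<omega> @ [a]) \<longleftrightarrow> a \<in> S \<and> reduced \<omega> \<and> len (word_value \<omega>) < len (word_value \<omega> \<otimes> a)"
proof -
  have "reduced (\<omega> @ [a]) \<longleftrightarrow> reduced (a # rev \<omega>)"
    using reduced_rev[of "\<omega> @ [a]"] by simp
  also have "\<dots> \<longleftrightarrow> a \<in> S \<and> reduced \<omega> \<and> len (word_value (rev \<omega>)) < len (a \<otimes> word_value (rev \<omega>))"
    by (simp add: reduced_Cons_iff)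
  also have "\<dots> \<longleftrightarrow> a \<in> S \<and> reduced \<omega> \<and> len (word_value \<omega>) < len (word_value \<omega> \<otimes> a)"
  proof (rule conj_cong[OF refl], rule conj_cong[OF refl])
    assume a: "a \<in> S" "reduced \<omega>"
    then have "inv (word_value \<omega> \<otimes> a) = a \<otimes> word_value (rev \<omega>)"
      by (auto simp: word_value_rev inv_mult_group)
    moreover have "len (inv (word_value \<omega> \<otimes> a)) = len (word_value \<omega> \<otimes> a)" using a by (intro len_inv) auto
    ultimately show "(len (word_value (rev \<omega>)) < len (a \<otimes> word_value (rev \<omega>)))
       = (len (word_value \<omega>) < len (word_value \<omega> \<otimes> a))"
      using a by (simp add: word_value_rev reducedD)
  qed
  finally show ?thesis .
qed

text \<open>The deletion condition, by induction from the right end: a new first letter either keeps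
  the chosen subword reduced or, by exchange, cancels one of its letters.\<close>

lemma ex_reduced_subseq:
  assumes "set \<omega> \<subseteq> S"
  shows "\<exists>\<eta>. reduced \<eta> \<and> subseq \<eta> \<omega> \<and> word_value \<eta> = word_value \<omega>"
  using assms
proof (induction \<omega>)
  case (Cons a \<omega>)
  then obtain \<eta> where \<eta>: "reduced \<eta>" "subseq \<eta> \<omega>" "word_value \<eta> = word_value \<omega>" by auto
  show ?case
  proof (cases "reduced (a # \<eta>)")
    case True
    then show ?thesis using \<eta> by (intro exI[of _ "a # \<eta>"]) auto
  next
    case False
    then have "len (a \<otimes> word_value \<eta>) < len (word_value \<eta>)"
      using \<eta> Cons.prems len_reflection_neq[of a "word_value \<eta>"] by (auto simp: reduced_Cons_iff reducedD)
    then obtain u b v where d: "\<eta> = u @ b # v" "a \<otimes> word_value \<eta> = word_value (u @ v)"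
      using exchange[of \<eta> a] \<eta> Cons.prems by (metis list.set_intros(1) reducedD subsetD)
    have s: "set (u @ v) \<subseteq> S" using \<eta>(1)[THEN reducedD] d by simp
    have "len (word_value (u @ v)) \<ge> length (u @ v)"
      using len_gen_mult[of a "word_value \<eta>"] \<eta>(1) Cons.prems d reduced_len[OF \<eta>(1)] by auto
    then have "reduced (u @ v)" using len_le[OF s] s by (simp add: reduced_def)
    moreover have "subseq (u @ v) \<eta>" unfolding d by (intro list_emb_append_mono) auto
    moreover have "subseq (u @ v) (a # \<omega>)"
      using calculation(2) \<eta>(2) subseq_order.order_trans by blast
    ultimately show ?thesis using \<eta> d by (intro exI[of _ "u @ v"]) simp
  qed
qed (intro exI[of _ "[]"], simp)

end

subsection \<open>Dihedral words and uniqueness of reduced words\<close>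

lemma length_alternating [simp]: "length (alternating n s t) = n"
  by (induction n arbitrary: s t) auto

lemma set_alternating: "set (alternating n s t) \<subseteq> {s, t}"
proof (induction n arbitrary: s t)
  case (Suc n)
  show ?case using Suc[of t s] by auto
qed simp

lemma alternating_add:
  "alternating (a + b) s t = alternating a s t @ (if even a then alternating b s t else alternating b t s)"
  by (induction a arbitrary: s t) auto

lemma alternating_snoc: "alternating (Suc n) s t = alternating n s t @ [if even n then s else t]"
  using alternating_add[of n 1 s t] by auto

lemma rev_alternating:
  "rev (alternating n s t) = (if even n then alternating n t s else alternating n s t)"
proof (induction n arbitrary: s t)
  case (Suc n)
  have "rev (alternating (Suc n) s t) = (if even n then s else t) # rev (alternating n s t)"
    by (simp only: alternating_snoc rev_append) simp
  then show ?case unfolding Suc by auto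
qed simp

lemma alternating_append_rev:
  assumes "even a = even b"
  shows "alternating a s t @ rev (alternating b t s) = alternating (a + b) s t"
  using assms by (auto simp: alternating_add rev_alternating)

lemma alternating_double: "alternating (2 * n) s t = concat (replicate n [s, t])"
  by (induction n) (auto simp: numeral_2_eq_2)

text \<open>Unlike \<open>alternating\<close>, this does not fix the first letter, so it treats both
  words of a given length alike and is stable under reversal and under passage to factors.\<close>

definition dihedral_word :: "'a \<Rightarrow> 'a \<Rightarrow> 'a list \<Rightarrow> bool" where
  "dihedral_word s t \<omega> \<longleftrightarrow> set \<omega> \<subseteq> {s, t} \<and> distinct_adj \<omega>"

lemma dihedral_word_eq:
  "dihedral_word s t \<omega> \<Longrightarrow> \<omega> \<noteq> [] \<Longrightarrow> hd \<omega> = s \<Longrightarrow> \<omega> = alternating (length \<omega>) s t"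
proof (induction \<omega> arbitrary: s t)
  case (Cons a \<omega>)
  show ?case
  proof (cases \<omega>)
    case (Cons b \<omega>')
    then have "b = t" using Cons.prems by (auto simp: dihedral_word_def)
    then have "\<omega> = alternating (length \<omega>) t s"
      using Cons.IH[of t s] Cons Cons.prems by (auto simp: dihedral_word_def insert_commute)
    then show ?thesis using Cons.prems by simp
  qed (use Cons.prems in simp)
qed simp

lemma dihedral_word_alternating: "s \<noteq> t \<Longrightarrow> dihedral_word s t (alternating n s t)"
proof (induction n arbitrary: s t)
  case (Suc n)
  have "dihedral_word t s (alternating n t s)" using Suc.IH[of t s] Suc.prems by simp
  moreover have "hd (alternating n t s) = t" if "n > 0" using that by (cases n) auto
  ultimately show ?case using Suc.prems
    by (cases n) (auto simp: dihedral_word_def distinct_adj_Cons)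
qed (simp add: dihedral_word_def)

lemma dihedral_word_commute: "dihedral_word s t = dihedral_word t s"
  by (auto simp: dihedral_word_def fun_eq_iff)

lemma dihedral_word_hd_eq:
  assumes "dihedral_word s t \<omega>" "dihedral_word s t \<eta>" "length \<omega> = length \<eta>" "\<omega> \<noteq> []" "hd \<omega> = hd \<eta>"
  shows "\<omega> = \<eta>"
proof -
  have ne: "\<eta> \<noteq> []" using assms by auto
  have "hd \<omega> \<in> {s, t}" using assms hd_in_set[of \<omega>] by (auto simp: dihedral_word_def)
  then show ?thesis
    using dihedral_word_eq[of s t \<omega>] dihedral_word_eq[of s t \<eta>] dihedral_word_eq[of t s \<omega>]
      dihedral_word_eq[of t s \<eta>] assms ne dihedral_word_commute[of s t] by auto
qed

lemma dihedral_word_hd: "dihedral_word s t \<omega> \<Longrightarrow> \<omega> \<noteq> [] \<Longrightarrow> hd \<omega> \<in> {s, t}"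
  using hd_in_set[of \<omega>] unfolding dihedral_word_def by blast

lemma dihedral_word_last: "dihedral_word s t \<omega> \<Longrightarrow> \<omega> \<noteq> [] \<Longrightarrow> last \<omega> \<in> {s, t}"
  using last_in_set[of \<omega>] unfolding dihedral_word_def by blast

lemma dihedral_word_append:
  "dihedral_word s t (u @ v) \<Longrightarrow> dihedral_word s t u \<and> dihedral_word s t v"
  by (auto simp: dihedral_word_def)

section \<open>The geometric representation and the order of a product of two generators\<close>

context coxeter_system
begin

text \<open>The contragredient geometric representation, on all functions \<open>S \<rightarrow> \<real>\<close>: since \<open>S\<close> may be infinite, this
  avoids linear combinations of simple roots.  It is used only to see that \<open>s t\<close> has order exactly \<open>m s t\<close>.\<close>

definition geo_form :: "'a \<Rightarrow> 'a \<Rightarrow> real" where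
  "geo_form u v = (case m u v of enat k \<Rightarrow> - cos (pi / real k) | \<infinity> \<Rightarrow> -1)"

definition geo_reflection :: "'a \<Rightarrow> ('a \<Rightarrow> real) \<Rightarrow> 'a \<Rightarrow> real" where
  "geo_reflection u f w = f w - 2 * geo_form u w * f u"

lemma geo_form_self [simp]: "s \<in> S \<Longrightarrow> geo_form s s = 1"
  using matrix_diag[of s] by (simp add: geo_form_def one_enat_def)

context
  fixes s t :: 'a and k :: nat
  assumes st: "s \<in> S" "t \<in> S" "s \<noteq> t" and k: "m s t = enat k"
begin

lemma dihedral_k: "2 \<le> k"
  using matrix_off_diag[of s t] st k by (simp add: numeral_eq_enat)

lemma geo_form_pair: "geo_form s t = - cos (pi / k)" "geo_form t s = - cos (pi / k)"
  using k matrix_sym[of s t] st by (simp_all add: geo_form_def)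

lemma sin_angle: "sin (pi / k) > 0"
proof -
  have "real k \<ge> 2" using dihedral_k by simp
  then have "pi / k > 0" "pi / k < pi" by (auto simp: divide_simps pi_gt_zero)
  then show ?thesis by (rule sin_gt_zero)
qed

text \<open>The product \<open>s t\<close> fixes a complement \<open>f0\<close> of the plane spanned by the two forms; in this plane it shifts
  the phase of the trigonometric solutions \<open>h\<close> of the recurrence \<open>h (y + \<theta>) + h (y - \<theta>) = 2 cos \<theta> h y\<close>.\<close>

lemma geo_pair_power:
  fixes f0 :: "'a \<Rightarrow> real" and P Q x :: real
  assumes f0: "f0 s = 0" "f0 t = 0"
  defines "h \<equiv> \<lambda>x. P * sin x + Q * cos x"
  defines "vec \<equiv> \<lambda>l \<mu> w. f0 w + l * geo_form s w + \<mu> * geo_form t w"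
  shows "foldr geo_reflection (concat (replicate n [s, t])) (vec (h (x + pi / k)) (h x))
    = vec (h (x + 2 * real n * (pi / k) + pi / k)) (h (x + 2 * real n * (pi / k)))"
proof (induction n)
  case (Suc n)
  define \<theta> where "\<theta> = pi / k"
  have hs: "h (y + \<theta> + \<theta>) = 2 * cos \<theta> * h (y + \<theta>) - h y" for y
  proof -
    have "sin (y + \<theta> + \<theta>) + sin (y + \<theta> - \<theta>) = 2 * cos \<theta> * sin (y + \<theta>)"
      "cos (y + \<theta> + \<theta>) + cos (y + \<theta> - \<theta>) = 2 * cos \<theta> * cos (y + \<theta>)"
      unfolding sin_add[of "y + \<theta>"] sin_diff[of "y + \<theta>"] cos_add[of "y + \<theta>"] cos_diff[of "y + \<theta>"]
      by (simp_all add: algebra_simps)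
    then have E: "sin (y + \<theta> + \<theta>) = 2 * cos \<theta> * sin (y + \<theta>) - sin y"
      "cos (y + \<theta> + \<theta>) = 2 * cos \<theta> * cos (y + \<theta>) - cos y" by simp_all
    show ?thesis unfolding h_def E by (simp add: algebra_simps)
  qed
  have rt: "geo_reflection t (vec l \<mu>) = vec l (2 * cos \<theta> * l - \<mu>)" for l \<mu>
    using st f0 geo_form_pair by (auto simp: geo_reflection_def vec_def \<theta>_def algebra_simps fun_eq_iff)
  have rs: "geo_reflection s (vec l \<mu>) = vec (2 * cos \<theta> * \<mu> - l) \<mu>" for l \<mu>
    using st f0 geo_form_pair by (auto simp: geo_reflection_def vec_def \<theta>_def algebra_simps fun_eq_iff)
  define y where "y = x + 2 * real n * \<theta>"
  have y2: "x + 2 * real (Suc n) * \<theta> = y + \<theta> + \<theta>" by (simp add: y_def algebra_simps)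
  have "foldr geo_reflection (concat (replicate (Suc n) [s, t])) (vec (h (x + \<theta>)) (h x))
    = geo_reflection s (geo_reflection t (vec (h (y + \<theta>)) (h y)))"
    using Suc by (simp add: \<theta>_def y_def)
  also have "\<dots> = vec (h (y + \<theta> + \<theta> + \<theta>)) (h (y + \<theta> + \<theta>))"
    using hs[of y] hs[of "y + \<theta>"] by (simp add: rt rs)
  finally show ?case unfolding \<theta>_def[symmetric] y2 .
qed simp

lemma geo_pair_relator: "foldr geo_reflection (concat (replicate k [s, t])) g = g"
proof -
  define \<theta> where "\<theta> = pi / k"
  have sn: "sin \<theta> > 0" using sin_angle by (simp add: \<theta>_def)
  \<comment> \<open>\<open>l\<close> and \<open>\<mu>\<close> solve the linear system that makes
    \<open>f0\<close> vanish at \<open>s\<close> and \<open>t\<close>; its determinant is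
    \<open>1 - (cos \<theta>)\<^sup>2\<close>, which is positive by
    \<open>sin_angle\<close>.\<close>
  define \<mu> where "\<mu> = (g t + cos \<theta> * g s) / (sin \<theta>)\<^sup>2"
  define l where "l = g s + \<mu> * cos \<theta>"
  define f0 where "f0 w = g w - l * geo_form s w - \<mu> * geo_form t w" for w
  have m: "\<mu> * (sin \<theta>)\<^sup>2 = g t + cos \<theta> * g s" using sn by (simp add: \<mu>_def)
  have z: "f0 s = 0" "f0 t = 0"
  proof -
    show "f0 s = 0" using st geo_form_pair by (simp add: f0_def l_def \<theta>_def)
    have "f0 t = g t + cos \<theta> * g s - \<mu> * (1 - (cos \<theta>)\<^sup>2)"
      using st geo_form_pair by (simp add: f0_def l_def \<theta>_def algebra_simps power2_eq_square)
    also have "\<dots> = 0" using m by (simp add: sin_squared_eq)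
    finally show "f0 t = 0" .
  qed
  \<comment> \<open>With this amplitude the trigonometric solution has value \<open>\<mu>\<close> at
    \<open>0\<close> and \<open>l\<close> at \<open>\<theta>\<close>, so \<open>k\<close> rotations
    by \<open>2 * \<theta>\<close> are one full period.\<close>
  define P where "P = (l - \<mu> * cos \<theta>) / sin \<theta>"
  have kk: "2 * real k * \<theta> = 2 * pi" using dihedral_k by (simp add: \<theta>_def)
  have P: "P * sin \<theta> + \<mu> * cos \<theta> = l" using sn by (simp add: P_def)
  have "foldr geo_reflection (concat (replicate k [s, t]))
     (\<lambda>w. f0 w + l * geo_form s w + \<mu> * geo_form t w)
     = (\<lambda>w. f0 w + l * geo_form s w + \<mu> * geo_form t w)"
    using geo_pair_power[OF z, where n = k and P = P and Q = \<mu> and x = 0] P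
    unfolding \<theta>_def[symmetric] add_0_left kk by (simp add: sin_add cos_add)
  moreover have "(\<lambda>w. f0 w + l * geo_form s w + \<mu> * geo_form t w) = g" by (simp add: f0_def)
  ultimately show ?thesis by simp
qed

end

lemma geo_relator:
  assumes "s \<in> S" "t \<in> S" "m s t = enat k"
  shows "foldr geo_reflection (concat (replicate k [s, t])) g = g"
proof (cases "s = t")
  case True
  then have "k = 1" using assms matrix_diag[of s] by (simp add: one_enat_def)
  then show ?thesis using True assms by (auto simp: geo_reflection_def fun_eq_iff)
qed (use geo_pair_relator assms in blast)

text \<open>If the power were trivial, it would act trivially in the representation. Its action
  shifts phases by \<open>2 * n * \<theta>\<close>, so this angle would be a multiple of
  \<open>2 * pi\<close> and \<open>k\<close> would divide \<open>n\<close>.\<close>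

lemma dihedral_order:
  assumes st: "s \<in> S" "t \<in> S" "s \<noteq> t" and k: "m s t = enat k" and n: "0 < n" "n < k"
  shows "(s \<otimes> t) [^] n \<noteq> \<one>"
proof
  assume "(s \<otimes> t) [^] n = \<one>"
  define c where "c = concat (replicate n [s, t])"
  have "foldr geo_reflection c = foldr geo_reflection []"
  proof (rule word_value_invariant)
    show "set c \<subseteq> S" using set_relator[of n s t] st by (auto simp: c_def)
    show "word_value c = word_value []" using \<open>(s \<otimes> t) [^] n = \<one>\<close> st by (simp add: c_def relator_value)
    fix xs ys assume "relator_deletion S m xs ys"
    then show "foldr geo_reflection xs = foldr geo_reflection ys"
      by cases (simp add: fun_eq_iff geo_relator)
  qed simp
  define \<theta> where "\<theta> = pi / k"
  have sn: "sin \<theta> > 0" using sin_angle[OF st k] by (simp add: \<theta>_def)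
  \<comment> \<open>Normalised by \<open>h 0 = 0\<close> and \<open>h \<theta> = 1\<close>, so that
    the starting vector is the single form \<open>geo_form s\<close>.\<close>
  define h where "h x = (1 / sin \<theta>) * sin x + 0 * cos x" for x
  define \<phi> where "\<phi> = 2 * real n * \<theta>"
  have "foldr geo_reflection c (\<lambda>w. 0 + h (0 + \<theta>) * geo_form s w + h 0 * geo_form t w)
     = (\<lambda>w. 0 + h (0 + \<phi> + \<theta>) * geo_form s w + h (0 + \<phi>) * geo_form t w)"
    unfolding h_def c_def \<phi>_def \<theta>_def
    using geo_pair_power[OF st k, where n = n and P = "1 / sin (pi / k)" and Q = 0 and x = 0 and ?f0.0 = "\<lambda>_. 0"]
    by simp
  then have eq: "h \<theta> * geo_form s w + h 0 * geo_form t w = h (\<phi> + \<theta>) * geo_form s w + h \<phi> * geo_form t w" for w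
    using \<open>foldr geo_reflection c = foldr geo_reflection []\<close> by (simp add: fun_eq_iff)
  have h0: "h \<theta> = 1" "h 0 = 0" using sn by (simp_all add: h_def)
  have e1: "1 = h (\<phi> + \<theta>) - h \<phi> * cos \<theta>" and e2: "- cos \<theta> = - (h (\<phi> + \<theta>) * cos \<theta>) + h \<phi>"
    using eq[of s] eq[of t] h0 st geo_form_pair[OF st k] by (simp_all add: \<theta>_def)
  have "h \<phi> * (1 - (cos \<theta>)\<^sup>2) = (- cos \<theta> + h (\<phi> + \<theta>) * cos \<theta>) - h \<phi> * (cos \<theta>)\<^sup>2"
    using e2 by (simp add: algebra_simps)
  also have "\<dots> = cos \<theta> * (h (\<phi> + \<theta>) - h \<phi> * cos \<theta> - 1)" by (simp add: algebra_simps power2_eq_square)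
  also have "\<dots> = 0" using e1 by simp
  finally have "h \<phi> * (sin \<theta>)\<^sup>2 = 0" by (simp add: sin_squared_eq)
  then have hp: "h \<phi> = 0" using sn by simp
  then have "h (\<phi> + \<theta>) = 1" using e1 by simp
  then have "sin (\<phi> + \<theta>) = sin \<theta>" "sin \<phi> = 0" using hp sn by (simp_all add: h_def)
  then have "cos \<phi> = 1" using sn by (simp add: sin_add)
  then obtain j :: int where "\<phi> = of_int j * 2 * pi" using cos_one_2pi_int by blast
  then have "real n = of_int j * real k" using n by (simp add: \<phi>_def \<theta>_def field_simps)
  then have "int n = j * int k" by (metis of_int_eq_iff of_int_mult of_int_of_nat_eq)
  then have "int k dvd int n" by simp
  then show False using n by (auto dest: dvd_imp_le)
qed

section \<open>Reduced words in dihedral subgroups\<close>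

lemma alternating_double_value:
  "s \<in> S \<Longrightarrow> t \<in> S \<Longrightarrow> word_value (alternating (n + n) s t) = (s \<otimes> t) [^] n"
  using relator_value[of s t n] alternating_double[of n s t] by (simp add: mult_2)

lemma alternating_closed: "s \<in> S \<Longrightarrow> t \<in> S \<Longrightarrow> set (alternating n s t) \<subseteq> S"
  using set_alternating[of n s t] by auto

lemma reduced_distinct_adj:
  assumes "reduced \<omega>" shows "distinct_adj \<omega>"
  using assms
proof (induction \<omega>)
  case (Cons a \<omega>)
  have R: "reduced \<omega>" using Cons.prems by (rule reduced_ConsD)
  moreover have "\<omega> = [] \<or> a \<noteq> hd \<omega>"
  proof (rule ccontr)
    assume "\<not> (\<omega> = [] \<or> a \<noteq> hd \<omega>)"
    then obtain \<omega>' where w: "\<omega> = a # \<omega>'" by (cases \<omega>) auto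
    have S: "a \<in> S" "set \<omega>' \<subseteq> S" using Cons.prems[THEN reducedD] w by auto
    have "word_value (a # \<omega>) = word_value \<omega>'" using w S by simp
    then show False using len_le[OF S(2)] reduced_len[OF Cons.prems] w by simp
  qed
  ultimately show ?case using Cons.IH by (simp add: distinct_adj_Cons)
qed simp

lemma reduced_dihedral_word: "reduced \<omega> \<Longrightarrow> set \<omega> \<subseteq> {s, t} \<Longrightarrow> dihedral_word s t \<omega>"
  by (simp add: dihedral_word_def reduced_distinct_adj)

context
  fixes s t :: 'a and k :: nat
  assumes st: "s \<in> S" "t \<in> S" "s \<noteq> t" and k: "m s t = enat k"
begin

lemma alternating_value_eq_iff_aux:
  assumes "even a = even b" "word_value (alternating a s t) = word_value (alternating b t s)"
  shows "word_value (alternating (a + b) s t) = \<one>"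
  using assms alternating_append_rev[OF assms(1), of s t, symmetric]
    alternating_closed[OF st(1,2), of a] alternating_closed[OF st(2,1), of b]
  by (simp add: word_value_rev)

lemma alternating_longest_eq: "word_value (alternating k s t) = word_value (alternating k t s)"
proof -
  have c: "set (alternating k s t) \<subseteq> S" "set (alternating k t s) \<subseteq> S"
    using alternating_closed st by blast+
  have "word_value (alternating (k + k) s t) = \<one>"
    using alternating_double_value[OF st(1,2)] matrix_pow[OF st(1,2) k] by simp
  then have "word_value (alternating k s t @ rev (alternating k t s)) = \<one>"
    by (simp add: alternating_append_rev)
  then have "word_value (alternating k s t) \<otimes> inv (word_value (alternating k t s)) = \<one>"
    using c by (simp add: word_value_rev)
  then show ?thesis using c by (simp add: inv_solve_right')
qed

end

lemma alternating_value_neq: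
  assumes st: "s \<in> S" "t \<in> S" "s \<noteq> t" and k: "m s t = enat k" and n: "0 < n" "n < k"
  shows "word_value (alternating n s t) \<noteq> word_value (alternating n t s)"
  using alternating_value_eq_iff_aux[OF st k, of n n] alternating_double_value[OF st(1,2), of n]
    dihedral_order[OF st k n] by auto

lemma reduced_alternating:
  assumes "s \<in> S" "t \<in> S" "s \<noteq> t" "m s t = enat k" "n \<le> k"
  shows "reduced (alternating n s t)"
  using assms
proof (induction n arbitrary: s t)
  case (Suc n)
  note st = Suc.prems(1-3) and k = Suc.prems(4)
  have k': "m t s = enat k" using matrix_sym[of s t] st k by simp
  have R: "reduced (alternating n t s)" using Suc.IH[of t s] st k' Suc.prems by auto
  show ?case
  proof (rule ccontr)
    assume "\<not> reduced (alternating (Suc n) s t)"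
    then have "\<not> len (word_value (alternating n t s)) < len (s \<otimes> word_value (alternating n t s))"
      using R st by (simp add: reduced_Cons_iff)
    then have dsc: "Suc (len (s \<otimes> word_value (alternating n t s))) = n"
      using len_gen_mult[of s "word_value (alternating n t s)"] R st reduced_len[OF R] by auto
    then have "len (s \<otimes> word_value (alternating n t s)) < len (word_value (alternating n t s))"
      using reduced_len[OF R] by simp
    then obtain u a v where uv: "alternating n t s = u @ a # v"
      "s \<otimes> word_value (alternating n t s) = word_value (u @ v)"
      using exchange[of "alternating n t s" s] R st by (metis reducedD)
    have luv: "Suc (length (u @ v)) = n" using uv(1) length_alternating[of n t s] by simp
    have suv: "set (u @ v) \<subseteq> {t, s}" using uv(1) set_alternating[of n t s] by auto
    have "set (u @ v) \<subseteq> S" using suv st by blast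
    then have "reduced (u @ v)" unfolding reduced_def uv(2)[symmetric] using luv dsc by simp
    then have dw: "dihedral_word t s (u @ v)" using suv reduced_dihedral_word by blast
    define n' where "n' = length (u @ v)"
    have n': "n = Suc n'" using luv by (simp add: n'_def)
    have cl: "word_value (alternating n' s t) \<in> carrier W" "word_value (alternating n' t s) \<in> carrier W"
      using alternating_closed st by auto
    have neq: "s \<otimes> t \<noteq> \<one>" using st by (metis gen_cancel_left gen_closed r_one)
    \<comment> \<open>After the exchange a reduced alternating word of length \<open>n - 1\<close>
      remains. If it starts with \<open>t\<close>, comparison gives
      \<open>(s \<otimes> t) [^] n = \<one>\<close> with \<open>n < k\<close>; in the two other
      cases \<open>s \<otimes> t = \<one>\<close>.\<close>
    consider "n' = 0" | "n' > 0" "u @ v = alternating n' t s" | "n' > 0" "u @ v = alternating n' s t"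
    proof (cases "u @ v = []")
      case False
      then have n0: "n' > 0" by (simp add: n'_def del: length_append)
      consider "hd (u @ v) = t" | "hd (u @ v) = s" using dihedral_word_hd[OF dw False] by blast
      then show ?thesis
      proof cases
        case 1
        then show ?thesis using that(2)[OF n0] dihedral_word_eq[OF dw False 1] unfolding n'_def by blast
      next
        case 2
        then show ?thesis
          using that(3)[OF n0] dihedral_word_eq[OF dw[unfolded dihedral_word_commute[of t s]] False 2]
          unfolding n'_def by blast
      qed
    qed (use that(1) in \<open>simp add: n'_def\<close>)
    then show False
    proof cases
      case 1
      then show False using uv(2) neq st n' by (simp add: n'_def)
    next
      case 2
      then have "word_value (alternating (Suc n) s t) = word_value (alternating n' t s)" using uv(2) by simp
      then have "word_value (alternating (Suc n + n') s t) = \<one>"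
        using alternating_value_eq_iff_aux[OF st k, of "Suc n" n'] n' by simp
      moreover have "Suc n + n' = n + n" using n' by simp
      ultimately show False
        using alternating_double_value[OF st(1,2), of n] dihedral_order[OF st k, of n] Suc.prems n' by simp
    next
      case 3
      then have "s \<otimes> (t \<otimes> word_value (alternating n' s t)) = word_value (alternating n' s t)"
        using uv(2) n' by simp
      then have "(s \<otimes> t) \<otimes> word_value (alternating n' s t) = \<one> \<otimes> word_value (alternating n' s t)"
        using cl st by (simp add: m_assoc)
      then have "s \<otimes> t = \<one>" using cl st by (simp del: l_one)
      then show False using neq by simp
    qed
  qed
qed simp

text \<open>An alternating prefix is lengthened by one letter at a time. The letter lost in the
  exchange cannot belong to the prefix, since then a reduced alternating word of length at most
  \<open>k\<close> would have a shorter expression; hence it is lost in the tail.\<close>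

lemma two_descents:
  assumes ab: "a \<in> S" "b \<in> S" "a \<noteq> b" "m a b = enat k"
    and w: "w \<in> carrier W" "len (a \<otimes> w) < len w" "len (b \<otimes> w) < len w"
  shows "\<exists>q. reduced (alternating k a b @ q) \<and> word_value (alternating k a b @ q) = w"
proof -
  have extend: "\<exists>q. reduced (alternating (Suc n) a b @ q) \<and> word_value (alternating (Suc n) a b @ q) = w"
    if ab: "a \<in> S" "b \<in> S" "a \<noteq> b" "m a b = enat k" and d: "len (a \<otimes> w) < len w" and n: "Suc n \<le> k"
      and q: "reduced (alternating n b a @ q)" "word_value (alternating n b a @ q) = w"
    for a b n q
  proof -
    have Sq: "set q \<subseteq> S" "set (alternating n b a) \<subseteq> S" using q(1)[THEN reducedD] by auto
    obtain u c v where uv: "alternating n b a @ q = u @ c # v" "a \<otimes> w = word_value (u @ v)"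
      using exchange[of "alternating n b a @ q" a] q d ab(1) by (metis reducedD)
    show ?thesis
    proof (cases "length u < n")
      case True
      then obtain v1 where v1: "alternating n b a = u @ c # v1" "v = v1 @ q"
        using uv(1) that by (auto simp: append_eq_append_conv2 append_eq_Cons_conv dest: arg_cong[where f = length])
      have S1: "set (u @ v1) \<subseteq> S" using Sq(2) v1(1) by auto
      have "a \<otimes> word_value (alternating n b a @ q) = word_value ((u @ v1) @ q)"
        using uv(2) v1(2) unfolding q(2) by simp
      then have "(a \<otimes> word_value (alternating n b a)) \<otimes> word_value q = word_value (u @ v1) \<otimes> word_value q"
        unfolding word_value_append[OF S1 Sq(1)] word_value_append[OF Sq(2,1)]
        using Sq ab(1) by (simp add: m_assoc)
      then have "a \<otimes> word_value (alternating n b a) = word_value (u @ v1)"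
        using Sq word_value_closed[OF S1] ab(1) by simp
      then have "len (word_value (alternating (Suc n) a b)) \<le> length (u @ v1)"
        using len_le[OF S1] by simp
      also have "\<dots> < n" using v1(1) length_alternating[of n b a] by simp
      finally show ?thesis using reduced_len[OF reduced_alternating[OF ab n]] by simp
    next
      case False
      then obtain q1 where q1: "u = alternating n b a @ q1" "q = q1 @ c # v"
        using uv(1) that by (auto simp: append_eq_append_conv2 append_eq_Cons_conv not_less
            dest: arg_cong[where f = length])
      have S1: "set (q1 @ v) \<subseteq> S" using Sq(1) q1 by auto
      have val: "word_value (alternating (Suc n) a b @ (q1 @ v)) = w"
      proof -
        have "word_value (alternating (Suc n) a b @ (q1 @ v)) = a \<otimes> word_value (alternating n b a @ q1 @ v)"
          by simp
        also have "\<dots> = a \<otimes> (a \<otimes> w)" using uv(2) q1 by simp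
        finally show ?thesis using ab(1) w(1) by simp
      qed
      moreover have "reduced (alternating (Suc n) a b @ (q1 @ v))"
      proof -
        have "len w = n + length q" using q reduced_len by fastforce
        then show ?thesis unfolding reduced_def val using S1 alternating_closed[OF ab(1,2), of "Suc n"] q1 by auto
      qed
      ultimately show ?thesis by blast
    qed
  qed
  have ba: "m b a = enat k" using matrix_sym[of a b] ab by simp
  have "n \<le> k \<Longrightarrow> (\<exists>q. reduced (alternating n a b @ q) \<and> word_value (alternating n a b @ q) = w) \<and>
     (\<exists>q. reduced (alternating n b a @ q) \<and> word_value (alternating n b a @ q) = w)" for n
  proof (induction n)
    case 0
    then show ?case using ex_reduced[OF w(1)] by simp
  next
    case (Suc n)
    then obtain q1 q2 where "reduced (alternating n a b @ q1)" "word_value (alternating n a b @ q1) = w"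
      "reduced (alternating n b a @ q2)" "word_value (alternating n b a @ q2) = w" by auto
    then show ?case using extend[of a b n q2] extend[of b a n q1] ab ba w Suc.prems by auto
  qed
  then show ?thesis by blast
qed

text \<open>This enumerates reduced words one letter at a time: \<open>R\<close> contains those of
  \<open>w\<close>. A reduced word of \<open>a \<otimes> w\<close> that starts with another letter
  \<open>b\<close> makes both letters descents, so \<open>two_descents\<close> produces a member of
  \<open>R\<close> that completes a braid with \<open>a\<close>, which \<open>no_braid\<close>
  excludes.\<close>

lemma reduced_words_Cons:
  assumes fin: "\<And>b. b \<in> S \<Longrightarrow> m a b \<noteq> \<infinity>" and a: "a \<in> S" "w \<in> carrier W"
    and R: "\<And>\<omega>. reduced \<omega> \<Longrightarrow> word_value \<omega> = w \<Longrightarrow> \<omega> \<in> R"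
    and up: "len w < len (a \<otimes> w)"
    and no_braid: "\<And>\<omega> b. \<omega> \<in> R \<Longrightarrow> b \<in> S \<Longrightarrow> b \<noteq> a \<Longrightarrow> \<not> prefix (alternating (the_enat (m a b)) a b) (a # \<omega>)"
    and \<eta>: "reduced \<eta>" "word_value \<eta> = a \<otimes> w"
  shows "\<exists>\<omega> \<in> R. \<eta> = a # \<omega>"
proof -
  have "\<eta> \<noteq> []" using reduced_len[OF \<eta>(1)] up \<eta>(2) by auto
  then obtain b \<eta>' where e: "\<eta> = b # \<eta>'" by (cases \<eta>) auto
  have b: "b \<in> S" "reduced \<eta>'" using \<eta>(1) e by (auto simp: reduced_Cons_iff)
  have bv: "b \<otimes> word_value \<eta>' = a \<otimes> w" using \<eta>(2) e by simp
  show ?thesis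
  proof (cases "b = a")
    case True
    then have "word_value \<eta>' = w" using bv b a by simp
    then show ?thesis using R[of \<eta>'] b e True by blast
  next
    case False
    obtain k where k: "m a b = enat k" using fin[OF b(1)] by (cases "m a b") auto
    have k2: "2 \<le> k" using dihedral_k[OF a(1) b(1) _ k] False by auto
    have "len (b \<otimes> (a \<otimes> w)) < len (a \<otimes> w)"
      using \<eta>(1) b unfolding e bv[symmetric] by (simp add: reduced_Cons_iff)
    moreover have "len (a \<otimes> (a \<otimes> w)) < len (a \<otimes> w)" using up a by simp
    ultimately obtain q where q: "reduced (alternating k a b @ q)" "word_value (alternating k a b @ q) = a \<otimes> w"
      using two_descents[of a b k "a \<otimes> w"] a b False k by auto
    obtain k' where k': "k = Suc k'" using k2 by (cases k) auto
    have r: "reduced (alternating k' b a @ q)" using q(1) k' by (simp add: reduced_Cons_iff)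
    moreover have "word_value (alternating k' b a @ q) = w"
    proof -
      have "a \<otimes> word_value (alternating k' b a @ q) = a \<otimes> w" using q(2) k' by simp
      then show ?thesis using a reduced_closed[OF r] by (simp del: word_value_append)
    qed
    ultimately have "alternating k' b a @ q \<in> R" using R by blast
    then have "\<not> prefix (alternating (the_enat (m a b)) a b) (a # alternating k' b a @ q)"
      using no_braid b False by blast
    then show ?thesis using k k' by simp
  qed
qed

text \<open>For these words the Bruhat order can be read off from any reduced word of the larger
  element, see \<open>unique_word_subseq\<close>.\<close>

definition unique_word :: "'a list \<Rightarrow> bool" where
  "unique_word \<omega> \<longleftrightarrow> reduced \<omega> \<and> (\<forall>\<eta>. reduced \<eta> \<and> word_value \<eta> = word_value \<omega> \<longrightarrow> \<eta> = \<omega>)"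

lemma unique_word_Nil [simp]: "unique_word []"
  unfolding unique_word_def using reduced_len by fastforce

lemma unique_word_reduced [simp]: "unique_word \<omega> \<Longrightarrow> reduced \<omega>"
  by (simp add: unique_word_def)

lemma unique_word_Cons:
  assumes fin: "\<And>b. b \<in> S \<Longrightarrow> m a b \<noteq> \<infinity>" and a: "a \<in> S" and U: "unique_word \<omega>" and hd: "\<omega> = [] \<or> hd \<omega> \<noteq> a"
    and no_braid: "\<And>b. b \<in> S \<Longrightarrow> b \<noteq> a \<Longrightarrow> \<not> prefix (alternating (the_enat (m a b)) a b) (a # \<omega>)"
  shows "unique_word (a # \<omega>)"
proof -
  have R: "reduced \<omega>" using U by simp
  have up: "len (word_value \<omega>) < len (a \<otimes> word_value \<omega>)"
  proof (rule ccontr)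
    assume "\<not> ?thesis"
    then have d: "len (a \<otimes> word_value \<omega>) < len (word_value \<omega>)"
      using len_gen_mult[of a "word_value \<omega>"] a R by auto
    obtain \<eta> where \<eta>: "reduced \<eta>" "word_value \<eta> = a \<otimes> word_value \<omega>"
      using ex_reduced[of "a \<otimes> word_value \<omega>"] a R by auto
    have "a # \<eta> = \<omega>" using reduced_Cons_descent[OF a _ d \<eta>] R U unfolding unique_word_def by auto
    then show False using hd by auto
  qed
  moreover have "\<eta> = a # \<omega>" if \<eta>: "reduced \<eta>" "word_value \<eta> = word_value (a # \<omega>)" for \<eta>
    using reduced_words_Cons[OF fin a reduced_closed[OF R], of "{\<omega>}" \<eta>] U up no_braid \<eta>
    unfolding unique_word_def by auto
  ultimately show ?thesis using R a unfolding unique_word_def by (auto simp: reduced_Cons_iff)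
qed

lemma prefix_alternating_ConsD:
  "2 \<le> k \<Longrightarrow> prefix (alternating k a b) (a # \<omega>) \<Longrightarrow> \<omega> \<noteq> [] \<and> hd \<omega> = b \<and> k \<le> Suc (length \<omega>)"
proof -
  assume k: "2 \<le> k" and p: "prefix (alternating k a b) (a # \<omega>)"
  obtain j where "k = Suc (Suc j)" using k by (metis Suc_le_D numeral_2_eq_2 Suc_le_mono)
  then show ?thesis using p prefix_length_le[OF p] by (cases \<omega>) auto
qed

lemma non_commuting_order:
  assumes "a \<in> S" "b \<in> S" "a \<otimes> b \<noteq> b \<otimes> a" "m a b = enat k" shows "3 \<le> k"
proof -
  have ne: "a \<noteq> b" using assms by auto
  have "k \<noteq> 2"
  proof
    assume "k = 2"
    then have "(a \<otimes> b) [^] (2::nat) = \<one>" using matrix_pow[of a b k] assms by simp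
    then have "a \<otimes> b \<otimes> (a \<otimes> b) = \<one>" using assms(1,2) by (simp add: numeral_2_eq_2)
    then have "a \<otimes> b = inv (a \<otimes> b)" using assms(1,2) by (metis inv_equality gen_closed m_closed)
    then show False using assms by (simp add: inv_mult_group)
  qed
  then show ?thesis using dihedral_k[OF assms(1,2) ne assms(4)] by simp
qed

end

text \<open>The situation created by the existence of a full element; orders can then be handled as
  natural numbers.\<close>

locale finite_order_coxeter_system = coxeter_system +
  assumes orders_finite: "s \<in> S \<Longrightarrow> t \<in> S \<Longrightarrow> m s t \<noteq> \<infinity>"
begin

definition ord :: "'a \<Rightarrow> 'a \<Rightarrow> nat" where
  "ord s t = the_enat (m s t)"

lemma m_ord: "s \<in> S \<Longrightarrow> t \<in> S \<Longrightarrow> m s t = enat (ord s t)"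
  using orders_finite[of s t] by (auto simp: ord_def)

lemma ord_sym: "s \<in> S \<Longrightarrow> t \<in> S \<Longrightarrow> ord s t = ord t s"
  by (simp add: ord_def matrix_sym)

lemma ord_ge_2: "s \<in> S \<Longrightarrow> t \<in> S \<Longrightarrow> s \<noteq> t \<Longrightarrow> 2 \<le> ord s t"
  using dihedral_k[OF _ _ _ m_ord] by blast

lemma ord_ge_3: "s \<in> S \<Longrightarrow> t \<in> S \<Longrightarrow> s \<otimes> t \<noteq> t \<otimes> s \<Longrightarrow> 3 \<le> ord s t"
  using non_commuting_order[OF _ _ _ m_ord] by blast

lemma unique_word_Cons':
  assumes "a \<in> S" "unique_word \<omega>" "\<omega> = [] \<or> hd \<omega> \<noteq> a"
    "\<omega> \<noteq> [] \<Longrightarrow> \<not> prefix (alternating (ord a (hd \<omega>)) a (hd \<omega>)) (a # \<omega>)"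
  shows "unique_word (a # \<omega>)"
proof (rule unique_word_Cons)
  fix b assume b: "b \<in> S" "b \<noteq> a"
  show "\<not> prefix (alternating (the_enat (m a b)) a b) (a # \<omega>)"
  proof
    assume p: "prefix (alternating (the_enat (m a b)) a b) (a # \<omega>)"
    then have "\<omega> \<noteq> [] \<and> hd \<omega> = b"
      using prefix_alternating_ConsD[of "ord a b" a b \<omega>] ord_ge_2[of a b] b assms(1) unfolding ord_def by blast
    then show False using p assms(4) unfolding ord_def by auto
  qed
qed (use assms orders_finite in auto)

lemma unique_word_single [simp]: "a \<in> S \<Longrightarrow> unique_word [a]"
  by (rule unique_word_Cons') auto

text \<open>No braid relation fits into fewer than \<open>ord s t\<close> alternating letters. The
  bound is sharp, because the longest element has two reduced words.\<close>

lemma unique_word_dihedral: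
  assumes st: "s \<in> S" "t \<in> S" "s \<noteq> t"
  shows "dihedral_word s t \<omega> \<Longrightarrow> length \<omega> < ord s t \<Longrightarrow> unique_word \<omega>"
proof (induction \<omega>)
  case (Cons a \<omega>)
  have a: "a \<in> {s, t}" and d: "dihedral_word s t \<omega>" "\<omega> = [] \<or> hd \<omega> \<noteq> a"
    using Cons.prems by (auto simp: dihedral_word_def distinct_adj_Cons)
  show ?case
  proof (rule unique_word_Cons')
    assume ne: "\<omega> \<noteq> []"
    then have "hd \<omega> \<in> {s, t}" "hd \<omega> \<noteq> a" using d dihedral_word_hd[of s t \<omega>] by auto
    then have "ord a (hd \<omega>) = ord s t" using a st ord_sym[of s t] by auto
    then show "\<not> prefix (alternating (ord a (hd \<omega>)) a (hd \<omega>)) (a # \<omega>)"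
      using Cons.prems(2) by (auto dest: prefix_length_le)
  qed (use a st d Cons in auto)
qed simp

lemma unique_word_dihedral_snoc:
  assumes st: "s \<in> S" "t \<in> S" "s \<noteq> t" and c: "c \<in> S" "c \<notin> {s, t}"
  shows "dihedral_word s t \<omega> \<Longrightarrow> length \<omega> < ord s t \<Longrightarrow> \<omega> \<noteq> [] \<Longrightarrow> c \<otimes> last \<omega> \<noteq> last \<omega> \<otimes> c
    \<Longrightarrow> unique_word (\<omega> @ [c])"
proof (induction \<omega>)
  case (Cons a \<omega>)
  have a: "a \<in> {s, t}" and d: "dihedral_word s t \<omega>" "\<omega> = [] \<or> hd \<omega> \<noteq> a"
    using Cons.prems by (auto simp: dihedral_word_def distinct_adj_Cons)
  have aS: "a \<in> S" using a st by auto
  show ?case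
  proof (cases "\<omega> = []")
    case True
    have "3 \<le> ord a c" using ord_ge_3[of a c] aS c Cons.prems True by auto
    then have "unique_word (a # [c])"
      using aS c a by (intro unique_word_Cons') (auto dest: prefix_length_le)
    then show ?thesis using True by simp
  next
    case False
    have "unique_word (a # (\<omega> @ [c]))"
    proof (rule unique_word_Cons')
      show "unique_word (\<omega> @ [c])" using Cons False d by auto
      show "\<omega> @ [c] = [] \<or> hd (\<omega> @ [c]) \<noteq> a" using d False by auto
      have h: "hd \<omega> \<in> {s, t}" "hd \<omega> \<noteq> a" using d False dihedral_word_hd[of s t \<omega>] by auto
      then have o: "ord a (hd \<omega>) = ord s t" using a st ord_sym[of s t] by auto
      show "\<not> prefix (alternating (ord a (hd (\<omega> @ [c]))) a (hd (\<omega> @ [c]))) (a # \<omega> @ [c])"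
      proof
        assume p: "prefix (alternating (ord a (hd (\<omega> @ [c]))) a (hd (\<omega> @ [c]))) (a # \<omega> @ [c])"
        then have p: "prefix (alternating (ord s t) a (hd \<omega>)) (a # \<omega> @ [c])" using o False by simp
        \<comment> \<open>The dihedral part has at most \<open>ord s t\<close> letters, as its tail
          is shorter than the given word. A braid prefix that does not fit there would be the whole
          word, including the foreign letter \<open>c\<close>.\<close>
        then have "ord s t = length (a # \<omega> @ [c])"
          using prefix_length_le[OF p] Cons.prems(2) by simp
        then have "alternating (ord s t) a (hd \<omega>) = a # \<omega> @ [c]"
          using p by (metis length_alternating not_equal_is_parallel parallelE prefix_order.refl)
        then have "c \<in> {a, hd \<omega>}" using set_alternating[of "ord s t" a "hd \<omega>"] by auto
        then show False using c a h by auto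
      qed
    qed (use aS in auto)
    then show ?thesis by simp
  qed
qed simp

lemma unique_word_Cons_dihedral:
  assumes st: "s \<in> S" "t \<in> S" "s \<noteq> t" and c: "c \<in> S" "c \<notin> {s, t}"
    and \<omega>: "dihedral_word s t \<omega>" "length \<omega> < ord s t" "\<omega> \<noteq> []" "c \<otimes> hd \<omega> \<noteq> hd \<omega> \<otimes> c"
  shows "unique_word (c # \<omega>)"
proof (rule unique_word_Cons')
  have h: "hd \<omega> \<in> {s, t}" using \<omega>(1,3) by (rule dihedral_word_hd)
  then have hS: "hd \<omega> \<in> S" using st by auto
  show "\<not> prefix (alternating (ord c (hd \<omega>)) c (hd \<omega>)) (c # \<omega>)"
  proof
    assume p: "prefix (alternating (ord c (hd \<omega>)) c (hd \<omega>)) (c # \<omega>)"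
    have "3 \<le> ord c (hd \<omega>)" using ord_ge_3[of c "hd \<omega>"] hS c \<omega> by auto
    then obtain j where "ord c (hd \<omega>) = Suc (Suc (Suc j))"
      using le_Suc_ex[of 3 "ord c (hd \<omega>)"] by (auto simp: numeral_3_eq_3)
    then obtain zs where "\<omega> = hd \<omega> # c # alternating j (hd \<omega>) c @ zs" using p by (auto simp: prefix_def)
    then have "c \<in> set \<omega>" by (cases \<omega>) auto
    then show False using \<omega> c by (auto simp: dihedral_word_def)
  qed
  show "\<omega> = [] \<or> hd \<omega> \<noteq> c" using h c by auto
qed (use c unique_word_dihedral[OF st \<omega>(1,2)] in auto)

end

subsection \<open>The Bruhat order\<close>

lemma subseq_subset: "subseq \<eta> \<omega> \<Longrightarrow> set \<eta> \<subseteq> set \<omega>"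
  by (induction rule: list_emb.induct) auto

lemma subseq_rev: "subseq xs ys \<Longrightarrow> subseq (rev xs) (rev ys)"
proof (induction rule: list_emb.induct)
  case (list_emb_Cons xs ys y)
  then show ?case by (simp add: subseq_rev_drop_many)
qed (auto intro: list_emb_append_mono)

context coxeter_system
begin

lemma bruhat_stepD:
  assumes "bruhat_step x y"
  shows "x \<in> carrier W" "y \<in> carrier W" "len x < len y" "\<exists>r \<in> reflections. y = r \<otimes> x"
proof -
  obtain r where r: "x \<in> carrier W" "len x < len y" "r \<in> reflections" "y = x \<otimes> r"
    using assms unfolding bruhat_step_def by blast
  then show "x \<in> carrier W" "y \<in> carrier W" "len x < len y" by simp_all
  have "x \<otimes> r \<otimes> inv x \<in> reflections" using reflection_conj r by blast
  moreover have "y = (x \<otimes> r \<otimes> inv x) \<otimes> x" using r by (simp add: m_assoc)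
  ultimately show "\<exists>r \<in> reflections. y = r \<otimes> x" by blast
qed

lemma bruhat_step_left:
  assumes "x \<in> carrier W" "r \<in> reflections" "len x < len (r \<otimes> x)"
  shows "bruhat_step x (r \<otimes> x)"
proof -
  have "inv x \<otimes> r \<otimes> inv (inv x) \<in> reflections" using reflection_conj[of r "inv x"] assms by simp
  moreover have "r \<otimes> x = x \<otimes> (inv x \<otimes> r \<otimes> inv (inv x))" using assms by (simp add: m_assoc)
  ultimately show ?thesis unfolding bruhat_step_def using assms by blast
qed

lemma bruhat_refl [simp]: "x \<in> carrier W \<Longrightarrow> bruhat_le x x"
  by (simp add: bruhat_le_def)

lemma bruhat_trans [trans]: "bruhat_le x y \<Longrightarrow> bruhat_le y z \<Longrightarrow> bruhat_le x z"
  unfolding bruhat_le_def by (meson rtranclp_trans)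

lemma bruhat_leD: "bruhat_le x y \<Longrightarrow> x \<in> carrier W" "bruhat_le x y \<Longrightarrow> y \<in> carrier W"
  by (simp_all add: bruhat_le_def)

lemma bruhat_step_le: "bruhat_step x y \<Longrightarrow> bruhat_le x y"
  using bruhat_stepD(1,2)[of x y] by (simp add: bruhat_le_def)

lemma bruhat_le_induct [consumes 1, case_names refl step]:
  assumes "bruhat_le x y" "x \<in> carrier W \<Longrightarrow> P x"
    "\<And>y z. bruhat_le x y \<Longrightarrow> bruhat_step y z \<Longrightarrow> P y \<Longrightarrow> P z"
  shows "P y"
proof -
  have "bruhat_step\<^sup>*\<^sup>* x y" "x \<in> carrier W" using assms(1) by (simp_all add: bruhat_le_def)
  then show ?thesis
  proof (induction rule: rtranclp_induct)
    case base
    then show ?case using assms(2) by simp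
  next
    case (step y z)
    moreover have "bruhat_le x y"
      using step.hyps step.prems bruhat_stepD(1)[of y z] by (simp add: bruhat_le_def)
    ultimately show ?case using assms(3) by blast
  qed
qed

lemma bruhat_len: "bruhat_le x y \<Longrightarrow> x = y \<or> len x < len y"
proof (induction rule: bruhat_le_induct)
  case (step y z)
  then show ?case using bruhat_stepD(3)[of y z] by auto
qed simp

lemma bruhat_len_eq: "bruhat_le x y \<Longrightarrow> len y \<le> len x \<Longrightarrow> x = y"
  using bruhat_len by fastforce

lemma bruhat_gen_up: "s \<in> S \<Longrightarrow> x \<in> carrier W \<Longrightarrow> len x < len (s \<otimes> x) \<Longrightarrow> bruhat_le x (s \<otimes> x)"
  using bruhat_step_left[of x s] bruhat_step_le by simp

lemma bruhat_gen_down: "s \<in> S \<Longrightarrow> x \<in> carrier W \<Longrightarrow> len (s \<otimes> x) < len x \<Longrightarrow> bruhat_le (s \<otimes> x) x"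
  using bruhat_gen_up[of s "s \<otimes> x"] by simp

text \<open>In the essential case \<open>s \<otimes> x\<close> is longer than \<open>x\<close>. If
  \<open>s \<otimes> y\<close> were not longer than \<open>s \<otimes> x\<close>, strong exchange in
  \<open>s # \<omega>\<close> would delete either \<open>s\<close>, giving
  \<open>s \<otimes> x = y\<close>, or a letter of \<open>\<omega>\<close>, making \<open>y\<close>
  shorter than \<open>x\<close>.\<close>

lemma bruhat_step_gen:
  assumes xy: "bruhat_step x y" and s: "s \<in> S"
  shows "bruhat_le (s \<otimes> x) y \<or> bruhat_le (s \<otimes> x) (s \<otimes> y)"
proof -
  note c = bruhat_stepD(1-3)[OF xy]
  obtain r where r: "r \<in> reflections" "y = r \<otimes> x" using bruhat_stepD(4)[OF xy] by blast
  have rc: "r \<in> carrier W" "s \<in> carrier W" using r s by simp_all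
  show ?thesis
  proof (cases "s \<otimes> x = y \<or> len (s \<otimes> x) < len x")
    case True
    then show ?thesis
      using bruhat_gen_down[OF s c(1)] bruhat_step_le[OF xy] bruhat_trans c by auto
  next
    case False
    then have ux: "len (s \<otimes> x) = Suc (len x)" "s \<otimes> x \<noteq> y" using len_gen_mult[OF s c(1)] by auto
    have r': "s \<otimes> r \<otimes> s \<in> reflections" using reflection_conj[of r s] r s by simp
    have sy: "s \<otimes> y = (s \<otimes> r \<otimes> s) \<otimes> (s \<otimes> x)" using r rc s c by (simp add: m_assoc)
    have "len (s \<otimes> x) < len (s \<otimes> y)"
    proof (rule ccontr)
      assume "\<not> ?thesis"
      then have le: "len (s \<otimes> y) \<le> len (s \<otimes> x)" by simp
      obtain \<omega> where \<omega>: "reduced \<omega>" "word_value \<omega> = x" using ex_reduced c by blast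
      have "\<exists>u a v. s # \<omega> = u @ a # v \<and> (s \<otimes> r \<otimes> s) \<otimes> word_value (s # \<omega>) = word_value (u @ v)"
        using \<omega> s r' le sy by (intro strong_exchange) simp_all
      then obtain u a v where uv: "s # \<omega> = u @ a # v" "s \<otimes> y = word_value (u @ v)"
        using \<omega> sy by auto
      show False
      proof (cases u)
        case Nil
        then have "s \<otimes> (s \<otimes> y) = s \<otimes> x" using uv \<omega> by simp
        then show False using ux s c by simp
      next
        case (Cons b u')
        then have u': "b = s" "\<omega> = u' @ a # v" using uv by simp_all
        have S': "set (u' @ v) \<subseteq> S" using \<omega>(1)[THEN reducedD] u' by simp
        have "s \<otimes> y = s \<otimes> word_value (u' @ v)" using uv(2) Cons u' by simp
        then have "y = word_value (u' @ v)" using s c word_value_closed[OF S'] by simp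
        then have "len y \<le> length (u' @ v)" using len_le[OF S'] by simp
        also have "\<dots> < len x" using u' \<omega> reduced_len[OF \<omega>(1)] by simp
        finally show False using c by simp
      qed
    qed
    then have "bruhat_step (s \<otimes> x) (s \<otimes> y)"
      unfolding sy using bruhat_step_left[of "s \<otimes> x" "s \<otimes> r \<otimes> s"] r' s c by simp
    then show ?thesis using bruhat_step_le by blast
  qed
qed

lemma bruhat_gen_mult:
  assumes "bruhat_le x y" and s: "s \<in> S"
  shows "bruhat_le (s \<otimes> x) y \<or> bruhat_le (s \<otimes> x) (s \<otimes> y)"
  using assms(1)
proof (induction rule: bruhat_le_induct)
  case refl
  then show ?case using s by simp
next
  case (step y z)
  then show ?case
    using bruhat_step_gen[OF step.hyps(2) s] bruhat_step_le[OF step.hyps(2)] bruhat_trans by blast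
qed

lemma bruhat_gen_mult_up:
  assumes "bruhat_le x y" "s \<in> S" "len y < len (s \<otimes> y)"
  shows "bruhat_le (s \<otimes> x) (s \<otimes> y)"
  using bruhat_gen_mult[OF assms(1,2)] bruhat_gen_up[OF assms(2) bruhat_leD(2)[OF assms(1)] assms(3)]
    bruhat_trans by blast

lemma bruhat_step_deletion:
  assumes "bruhat_step x y" "set \<omega> \<subseteq> S" "word_value \<omega> = y"
  shows "\<exists>\<eta>. subseq \<eta> \<omega> \<and> word_value \<eta> = x"
proof -
  obtain r where r: "r \<in> reflections" "y = r \<otimes> x" using bruhat_stepD(4)[OF assms(1)] by blast
  have x: "x = r \<otimes> y" using r bruhat_stepD(1)[OF assms(1)] by simp
  have "len (r \<otimes> word_value \<omega>) \<le> len (word_value \<omega>)"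
    using x assms(3) bruhat_stepD(3)[OF assms(1)] by simp
  then obtain u a v where "\<omega> = u @ a # v" "x = word_value (u @ v)"
    using strong_exchange[OF assms(2) r(1)] unfolding assms(3) x[symmetric] by blast
  moreover have "subseq (u @ v) (u @ a # v)" by (intro list_emb_append_mono) auto
  ultimately show ?thesis by blast
qed

lemma bruhat_subword:
  assumes "bruhat_le x y" "set \<omega> \<subseteq> S" "word_value \<omega> = y"
  shows "\<exists>\<eta>. reduced \<eta> \<and> subseq \<eta> \<omega> \<and> word_value \<eta> = x"
proof -
  have "\<exists>\<eta>. subseq \<eta> \<omega> \<and> word_value \<eta> = x"
    using assms
  proof (induction arbitrary: \<omega> rule: bruhat_le_induct)
    case refl
    then show ?case by blast
  next
    case (step y z)
    then obtain \<omega>1 where \<omega>1: "subseq \<omega>1 \<omega>" "word_value \<omega>1 = y" using bruhat_step_deletion by blast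
    moreover have "set \<omega>1 \<subseteq> S" using subseq_subset[OF \<omega>1(1)] step.prems by blast
    ultimately show ?case using step.IH[of \<omega>1] subseq_order.order_trans by blast
  qed
  then obtain \<eta> where \<eta>: "subseq \<eta> \<omega>" "word_value \<eta> = x" by blast
  then have "set \<eta> \<subseteq> S" using subseq_subset[OF \<eta>(1)] assms by blast
  from ex_reduced_subseq[OF this] show ?thesis using \<eta> subseq_order.order_trans by blast
qed

lemma subseq_bruhat:
  "reduced \<omega> \<Longrightarrow> subseq \<eta> \<omega> \<Longrightarrow> bruhat_le (word_value \<eta>) (word_value \<omega>)"
proof (induction \<omega> arbitrary: \<eta>)
  case (Cons a \<omega>)
  have r: "a \<in> S" "reduced \<omega>" "len (word_value \<omega>) < len (a \<otimes> word_value \<omega>)"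
    using Cons.prems(1) by (simp_all add: reduced_Cons_iff)
  have up: "bruhat_le (word_value \<omega>) (word_value (a # \<omega>))" using bruhat_gen_up[of a "word_value \<omega>"] r by simp
  consider "subseq \<eta> \<omega>" | \<eta>' where "\<eta> = a # \<eta>'" "subseq \<eta>' \<omega>"
    using Cons.prems(2) by (cases \<eta>) (auto split: if_splits)
  then show ?case
  proof cases
    case 1
    then show ?thesis using Cons.IH[OF r(2)] up bruhat_trans by blast
  next
    case 2
    then have "bruhat_le (word_value \<eta>') (word_value \<omega>)" using Cons.IH[OF r(2)] by blast
    then show ?thesis using bruhat_gen_mult_up[of "word_value \<eta>'" "word_value \<omega>" a] r 2 by simp
  qed
next
  case Nil
  then have "\<eta> = []" by (cases \<eta>) auto
  then show ?case by simp
qed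

text \<open>The subword property yields some reduced word of the smaller element inside
  \<open>\<zeta>\<close>; uniqueness says which one. All exclusions of words from \<open>Q\<close>
  rest on this.\<close>

lemma unique_word_subseq:
  assumes "unique_word \<omega>" "bruhat_le (word_value \<omega>) z" "reduced \<zeta>" "word_value \<zeta> = z"
  shows "subseq \<omega> \<zeta>"
  using bruhat_subword[OF assms(2) _ assms(4)] assms unfolding unique_word_def by auto

text \<open>A reduced word of \<open>y\<close> can be chosen to start with \<open>s\<close>. A
  reduced subword for \<open>x\<close> cannot use this letter, because \<open>s\<close> is not a
  descent of \<open>x\<close>.\<close>

lemma bruhat_lift:
  assumes "bruhat_le x y" "s \<in> S" "len (s \<otimes> y) < len y" "len x < len (s \<otimes> x)"
  shows "bruhat_le x (s \<otimes> y)" "bruhat_le (s \<otimes> x) y"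
proof -
  note c = bruhat_leD[OF assms(1)]
  obtain \<omega> where \<omega>: "reduced \<omega>" "word_value \<omega> = s \<otimes> y" using ex_reduced[of "s \<otimes> y"] c assms(2) by auto
  have r: "reduced (s # \<omega>)" "word_value (s # \<omega>) = y"
    using reduced_Cons_descent[OF assms(2) c(2) assms(3) \<omega>] by blast+
  obtain \<eta> where \<eta>: "reduced \<eta>" "subseq \<eta> (s # \<omega>)" "word_value \<eta> = x"
    using bruhat_subword[OF assms(1) reducedD[OF r(1)] r(2)] by blast
  have "subseq \<eta> \<omega>"
  proof (cases \<eta>)
    case (Cons b \<eta>')
    show ?thesis
    proof (cases "b = s")
      case True
      have "s \<otimes> x = word_value \<eta>'" using \<eta>(1,3) Cons True assms(2) by (auto simp: reduced_Cons_iff)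
      then have "len (s \<otimes> x) < len x"
        using \<eta> Cons reduced_len[OF \<eta>(1)] len_le[of \<eta>'] by (auto simp: reduced_Cons_iff)
      then show ?thesis using assms(4) by simp
    next
      case False
      then show ?thesis using \<eta>(2) Cons by auto
    qed
  qed simp
  then show "bruhat_le x (s \<otimes> y)" using subseq_bruhat[OF \<omega>(1)] \<omega> \<eta> by auto
  have "subseq (s # \<eta>) (s # \<omega>)" using \<open>subseq \<eta> \<omega>\<close> by simp
  then show "bruhat_le (s \<otimes> x) y" using subseq_bruhat[OF r(1)] r(2) \<eta>(3) by fastforce
qed

lemma bruhat_lift_down:
  assumes "bruhat_le x y" "s \<in> S" "len (s \<otimes> y) < len y" "len (s \<otimes> x) < len x"
  shows "bruhat_le (s \<otimes> x) (s \<otimes> y)"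
proof -
  have "bruhat_le (s \<otimes> x) y"
    using bruhat_gen_down[of s x] assms bruhat_leD[OF assms(1)] bruhat_trans by blast
  then show ?thesis using bruhat_lift(1)[of "s \<otimes> x" y s] assms bruhat_leD[OF assms(1)] by simp
qed

lemma bruhat_inv:
  assumes "bruhat_le x y" shows "bruhat_le (inv x) (inv y)"
proof -
  note c = bruhat_leD[OF assms]
  obtain \<omega> where \<omega>: "reduced \<omega>" "word_value \<omega> = y" using ex_reduced c by blast
  obtain \<eta> where \<eta>: "reduced \<eta>" "subseq \<eta> \<omega>" "word_value \<eta> = x"
    using bruhat_subword[OF assms reducedD[OF \<omega>(1)] \<omega>(2)] by blast
  have "subseq (rev \<eta>) (rev \<omega>)" using subseq_rev[OF \<eta>(2)] .
  then show ?thesis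
    using subseq_bruhat[of "rev \<omega>" "rev \<eta>"] \<omega> \<eta> by (simp add: word_value_rev)
qed

lemma bruhat_inv_iff [simp]:
  "x \<in> carrier W \<Longrightarrow> y \<in> carrier W \<Longrightarrow> bruhat_le (inv x) (inv y) \<longleftrightarrow> bruhat_le x y"
  using bruhat_inv[of x y] bruhat_inv[of "inv x" "inv y"] by auto

text \<open>Gradedness of the Bruhat order. The induction strips a left descent \<open>s\<close> of
  \<open>y\<close>; if \<open>s\<close> is a descent of \<open>x\<close> too, the coatom found
  between \<open>s \<otimes> x\<close> and \<open>s \<otimes> y\<close> is either multiplied back by
  \<open>s\<close>, or already has \<open>s\<close> as a descent, and then \<open>x\<close> lies
  below \<open>s \<otimes> y\<close>.\<close>

lemma bruhat_coatom:
  assumes "bruhat_le x y" "x \<noteq> y"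
  shows "\<exists>z. bruhat_le x z \<and> bruhat_le z y \<and> len y = Suc (len z)"
proof -
  obtain n where "n = len y" by simp
  then show ?thesis using assms
  proof (induction n arbitrary: x y rule: less_induct)
    case (less n)
    note xy = less.prems(2)
    note c = bruhat_leD[OF xy]
    have "len x < len y" using bruhat_len xy less.prems by blast
    obtain \<omega> where \<omega>: "reduced \<omega>" "word_value \<omega> = y" using ex_reduced c by blast
    then obtain s \<omega>' where w: "\<omega> = s # \<omega>'" using \<open>len x < len y\<close> reduced_len[OF \<omega>(1)] by (cases \<omega>) auto
    have s: "s \<in> S" and \<omega>': "reduced \<omega>'" using \<omega> w by (auto simp: reduced_Cons_iff)
    have sy: "s \<otimes> y = word_value \<omega>'" using \<omega> w s \<omega>' by auto
    have dy: "len y = Suc (len (s \<otimes> y))" using \<omega> w sy reduced_len[OF \<omega>'] reduced_len[OF \<omega>(1)] by simp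
    have syle: "bruhat_le (s \<otimes> y) y" using bruhat_gen_down[OF s c(2)] dy by simp
    show ?case
    proof (cases "len (s \<otimes> x) < len x")
      case False
      then have "len x < len (s \<otimes> x)" using len_gen_mult[OF s c(1)] by auto
      then have "bruhat_le x (s \<otimes> y)" using bruhat_lift(1)[OF xy s] dy by simp
      then show ?thesis using dy syle by blast
    next
      case True
      then have sxy: "bruhat_le (s \<otimes> x) (s \<otimes> y)" using bruhat_lift_down[OF xy s] dy by simp
      moreover have "s \<otimes> x \<noteq> s \<otimes> y" using less.prems s c by simp
      moreover have "len (s \<otimes> y) < n" using dy less.prems by simp
      ultimately obtain z where z: "bruhat_le (s \<otimes> x) z" "bruhat_le z (s \<otimes> y)" "len (s \<otimes> y) = Suc (len z)"
        using less.IH by blast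
      note zc = bruhat_leD(2)[OF z(1)]
      have up: "len (s \<otimes> x) < len (s \<otimes> (s \<otimes> x))" using True s c by simp
      show ?thesis
      proof (cases "len z < len (s \<otimes> z)")
        case True
        have "bruhat_le (s \<otimes> z) (s \<otimes> (s \<otimes> y))"
          using bruhat_gen_mult_up[OF z(2) s] dy s c by simp
        moreover have "bruhat_le (s \<otimes> (s \<otimes> x)) (s \<otimes> z)" using bruhat_gen_mult_up[OF z(1) s True] .
        moreover have "len (s \<otimes> z) = Suc (len z)" using True len_gen_mult[OF s zc] by simp
        ultimately show ?thesis using dy z(3) s c by auto
      next
        case False
        then have "len (s \<otimes> z) < len z" using len_gen_mult[OF s zc] by auto
        then have "bruhat_le (s \<otimes> (s \<otimes> x)) z" using bruhat_lift(2)[OF z(1) s] up by blast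
        then have "bruhat_le x (s \<otimes> y)" using bruhat_trans z(2) s c by auto
        then show ?thesis using dy syle by blast
      qed
    qed
  qed
qed

lemma covered_by_iff: "covered_by x y \<longleftrightarrow> bruhat_le x y \<and> len y = Suc (len x)"
proof
  assume c: "covered_by x y"
  then have xy: "bruhat_le x y" "x \<noteq> y" by (simp_all add: covered_by_def)
  then obtain z where "bruhat_le x z" "bruhat_le z y" "len y = Suc (len z)" using bruhat_coatom by blast
  moreover then have "z = x" using c unfolding covered_by_def by fastforce
  ultimately show "bruhat_le x y \<and> len y = Suc (len x)" using xy by simp
next
  assume a: "bruhat_le x y \<and> len y = Suc (len x)"
  have "z = x \<or> z = y" if "bruhat_le x z" "bruhat_le z y" for z
    using bruhat_len[OF that(1)] bruhat_len[OF that(2)] a by auto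
  then show "covered_by x y" using a unfolding covered_by_def by auto
qed

lemma bruhat_chain_induct [consumes 1, case_names refl cover]:
  assumes "bruhat_le x y" "P y"
    "\<And>x z. covered_by x z \<Longrightarrow> bruhat_le z y \<Longrightarrow> P z \<Longrightarrow> P x"
  shows "P x"
proof -
  have chain: "covered_by\<^sup>*\<^sup>* x y" if "bruhat_le x y" "n = len y" for n x y
    using that
  proof (induction n arbitrary: y rule: less_induct)
    case (less n)
    show ?case
    proof (cases "x = y")
      case False
      then obtain z where z: "bruhat_le x z" "bruhat_le z y" "len y = Suc (len z)"
        using bruhat_coatom less.prems by blast
      then have "covered_by\<^sup>*\<^sup>* x z" using less by simp
      moreover have "covered_by z y" using z covered_by_iff by blast
      ultimately show ?thesis by simp
    qed simp
  qed
  have "covered_by\<^sup>*\<^sup>* x y" using chain[OF assms(1)] by blast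
  moreover have yc: "y \<in> carrier W" using bruhat_leD[OF assms(1)] by blast
  ultimately have "P x \<and> bruhat_le x y"
  proof (induction rule: converse_rtranclp_induct)
    case base
    then show ?case using assms(2) by simp
  next
    case (step x z)
    then show ?case using assms(3)[of x z] bruhat_trans covered_by_iff by blast
  qed
  then show ?thesis by blast
qed

lemma gen_le_iff:
  assumes "reduced \<omega>" "a \<in> S" shows "bruhat_le a (word_value \<omega>) \<longleftrightarrow> a \<in> set \<omega>"
proof
  assume "bruhat_le a (word_value \<omega>)"
  then obtain \<eta> where \<eta>: "reduced \<eta>" "subseq \<eta> \<omega>" "word_value \<eta> = a"
    using bruhat_subword assms(1) by blast
  then have "length \<eta> = 1" using reduced_len[OF \<eta>(1)] assms by simp
  then obtain b where "\<eta> = [b]" by (auto simp: length_Suc_conv)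
  then have "\<eta> = [a]" using \<eta> by (auto dest!: reducedD)
  then show "a \<in> set \<omega>" using subseq_subset[OF \<eta>(2)] by simp
next
  assume "a \<in> set \<omega>"
  then have "subseq [a] \<omega>" by (simp add: subseq_singleton_left)
  then show "bruhat_le a (word_value \<omega>)" using subseq_bruhat[OF assms(1)] assms by fastforce
qed

lemma reduced_set_eq:
  assumes "reduced \<omega>" "reduced \<eta>" "word_value \<omega> = word_value \<eta>" shows "set \<omega> = set \<eta>"
  using gen_le_iff[OF assms(1)] gen_le_iff[OF assms(2)] assms(3) reducedD[OF assms(1)] reducedD[OF assms(2)]
  by auto

lemma reduced_set_subset:
  assumes "reduced \<eta>" "set \<omega> \<subseteq> S" "word_value \<eta> = word_value \<omega>" shows "set \<eta> \<subseteq> set \<omega>"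
proof -
  obtain \<xi> where \<xi>: "reduced \<xi>" "subseq \<xi> \<omega>" "word_value \<xi> = word_value \<omega>"
    using ex_reduced_subseq[OF assms(2)] by blast
  have "set \<eta> = set \<xi>" using reduced_set_eq[OF assms(1) \<xi>(1)] \<xi> assms by simp
  then show ?thesis using subseq_subset[OF \<xi>(2)] by simp
qed

lemma bruhat_one: "x \<in> carrier W \<Longrightarrow> bruhat_le \<one> x"
  using ex_reduced[of x] subseq_bruhat[of _ "[]"] by fastforce

end

subsection \<open>Distinguished matchings\<close>

context coxeter_system
begin

definition parabolic :: "'a set \<Rightarrow> 'a set" where
  "parabolic I = {word_value \<omega> | \<omega>. set \<omega> \<subseteq> I}"

lemma reduced_parabolic_iff:
  assumes "reduced \<omega>" "I \<subseteq> S" shows "word_value \<omega> \<in> parabolic I \<longleftrightarrow> set \<omega> \<subseteq> I"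
proof
  assume "word_value \<omega> \<in> parabolic I"
  then obtain \<eta> where \<eta>: "word_value \<omega> = word_value \<eta>" "set \<eta> \<subseteq> I" unfolding parabolic_def by blast
  then have "set \<eta> \<subseteq> S" using assms(2) by blast
  then show "set \<omega> \<subseteq> I" using reduced_set_subset[OF assms(1) _ \<eta>(1)] \<eta>(2) by blast
qed (auto simp: parabolic_def)

lemma parabolic_closed: "I \<subseteq> S \<Longrightarrow> x \<in> parabolic I \<Longrightarrow> x \<in> carrier W"
  unfolding parabolic_def by blast

lemma parabolic_bruhat:
  assumes "bruhat_le x y" "y \<in> parabolic I" "I \<subseteq> S" shows "x \<in> parabolic I"
proof -
  obtain \<omega> where \<omega>: "reduced \<omega>" "word_value \<omega> = y" using ex_reduced bruhat_leD(2)[OF assms(1)] by blast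
  then have "set \<omega> \<subseteq> I" using reduced_parabolic_iff[OF \<omega>(1) assms(3)] assms(2) by simp
  moreover obtain \<eta> where "subseq \<eta> \<omega>" "word_value \<eta> = x"
    using bruhat_subword[OF assms(1) reducedD[OF \<omega>(1)] \<omega>(2)] by blast
  ultimately show ?thesis using subseq_subset[of \<eta> \<omega>] unfolding parabolic_def by blast
qed

lemma ex_left_descent:
  assumes "x \<in> carrier W" "x \<noteq> \<one>" shows "\<exists>s \<in> S. len (s \<otimes> x) < len x"
proof -
  obtain \<omega> where \<omega>: "reduced \<omega>" "word_value \<omega> = x" using ex_reduced assms by blast
  then obtain s \<omega>' where w: "\<omega> = s # \<omega>'" using assms(2) by (cases \<omega>) auto
  then have "s \<in> S" "reduced \<omega>'" using \<omega> by (simp_all add: reduced_Cons_iff)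
  moreover have "s \<otimes> x = word_value \<omega>'" using \<omega>(2) w calculation by auto
  moreover have "len x = Suc (length \<omega>')" using reduced_len[OF \<omega>(1)] \<omega>(2) w by (metis length_Cons)
  ultimately have "len (s \<otimes> x) < len x" using reduced_len[of \<omega>'] by simp
  then show ?thesis using \<open>s \<in> S\<close> by blast
qed

lemma left_descent_covered:
  "s \<in> S \<Longrightarrow> x \<in> carrier W \<Longrightarrow> covered_by (s \<otimes> x) x \<longleftrightarrow> len (s \<otimes> x) < len x"
  unfolding covered_by_iff using bruhat_gen_down[of s x] len_gen_mult[of s x] by linarith

lemma gen_up_covered:
  "s \<in> S \<Longrightarrow> x \<in> carrier W \<Longrightarrow> len x < len (s \<otimes> x) \<Longrightarrow> covered_by x (s \<otimes> x)"
  using bruhat_gen_up[of s x] len_gen_mult[of s x] by (auto simp: covered_by_iff)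

text \<open>The coatom \<open>s \<otimes> x\<close> of \<open>x\<close> lies below \<open>y\<close>;
  lifting by the common descent \<open>s\<close> gives \<open>x\<close> below \<open>y\<close>, and
  the lengths agree.\<close>

lemma coat_descent_unique:
  assumes c: "x \<in> carrier W" "y \<in> carrier W" and le: "coat x \<subseteq> coat y" and l: "len x = len y"
    and s: "s \<in> S" "len (s \<otimes> x) < len x" "len (s \<otimes> y) < len y"
  shows "x = y"
proof -
  have "covered_by (s \<otimes> x) y" using left_descent_covered[OF s(1) c(1)] s(2) le by (auto simp: coat_def)
  then have "bruhat_le (s \<otimes> x) y" by (simp add: covered_by_iff)
  then have "bruhat_le (s \<otimes> (s \<otimes> x)) y" using bruhat_lift(2)[of "s \<otimes> x" y s] s c by simp
  then show ?thesis using bruhat_len_eq[of x y] s(1) c l by simp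
qed

text \<open>Dropping the last letter of \<open>x\<close> leaves a coatom, which lies below
  \<open>y\<close>. It does not have the descent \<open>t\<close>, for otherwise exchange would give
  \<open>x\<close> this descent; so lifting by \<open>t\<close> reaches an element below
  \<open>y\<close> of the same length.\<close>

lemma coat_shift:
  assumes c: "x \<in> carrier W" "y \<in> carrier W" and le: "coat x \<subseteq> coat y" and l: "len x = len y"
    and t: "t \<in> S" "len (t \<otimes> y) < len y" "\<not> len (t \<otimes> x) < len x"
    and \<omega>: "reduced (\<omega> @ [r])" "word_value (\<omega> @ [r]) = x"
  shows "reduced (t # \<omega>)" "word_value (t # \<omega>) = y"
proof -
  note R = reduced_append[OF \<omega>(1)]
  have rS: "r \<in> S" "set \<omega> \<subseteq> S" using \<omega>(1)[THEN reducedD] by auto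
  define z where "z = word_value \<omega>"
  have zc: "z \<in> carrier W" using R by (simp add: z_def)
  have lz: "len x = Suc (len z)" using reduced_len[OF \<omega>(1)] reduced_len[OF R(1)] \<omega>(2) by (simp add: z_def)
  have "subseq \<omega> (\<omega> @ [r])" by (rule subseq_rev_drop_many) simp
  then have "bruhat_le z x" using subseq_bruhat[OF \<omega>(1)] \<omega>(2) unfolding z_def by metis
  then have "covered_by z x" using lz by (simp add: covered_by_iff)
  then have zy: "bruhat_le z y" using le by (auto simp: coat_def covered_by_iff)
  have "\<not> len (t \<otimes> z) < len z"
  proof
    assume d: "len (t \<otimes> z) < len z"
    then obtain u a v where uv: "\<omega> = u @ a # v" "t \<otimes> z = word_value (u @ v)"
      using exchange[OF rS(2) t(1)] unfolding z_def by blast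
    have S': "set ((u @ v) @ [r]) \<subseteq> S" using uv(1) rS by auto
    have "word_value ((u @ v) @ [r]) = (t \<otimes> z) \<otimes> r"
      unfolding uv(2) using S' rS by (subst word_value_append) auto
    also have "\<dots> = t \<otimes> x" using \<omega>(2) rS t(1) zc by (simp add: z_def m_assoc)
    finally have "len (t \<otimes> x) \<le> length ((u @ v) @ [r])" using len_le[OF S'] by simp
    also have "\<dots> < len x" using uv(1) reduced_len[OF \<omega>(1)] \<omega>(2) by simp
    finally show False using t by simp
  qed
  then have up: "len z < len (t \<otimes> z)" "len (t \<otimes> z) = Suc (len z)"
    using len_gen_mult[OF t(1) zc] by auto
  then have "bruhat_le (t \<otimes> z) y" using bruhat_lift(2)[OF zy t(1,2)] by blast
  then have "t \<otimes> z = y" using bruhat_len_eq up lz l by simp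
  then show "word_value (t # \<omega>) = y" by (simp add: z_def)
  show "reduced (t # \<omega>)" using R up t by (simp add: reduced_Cons_iff z_def)
qed

lemma ex_max_prefix:
  assumes "x \<in> carrier W"
  shows "\<exists>\<xi> \<nu>. reduced (\<xi> @ \<nu>) \<and> word_value (\<xi> @ \<nu>) = x \<and> set \<xi> \<subseteq> I \<and>
    (\<forall>\<xi>' \<nu>'. reduced (\<xi>' @ \<nu>') \<and> word_value (\<xi>' @ \<nu>') = x \<and> set \<xi>' \<subseteq> I \<longrightarrow> length \<xi>' \<le> length \<xi>)"
proof -
  define P where "P n \<longleftrightarrow> (\<exists>\<xi> \<nu>. reduced (\<xi> @ \<nu>) \<and> word_value (\<xi> @ \<nu>) = x \<and> set \<xi> \<subseteq> I \<and> length \<xi> = n)" for n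
  obtain \<omega> where "reduced \<omega>" "word_value \<omega> = x" using ex_reduced assms by blast
  then have "P 0" unfolding P_def by (intro exI[of _ "[]"] exI[of _ \<omega>]) simp
  moreover have "\<forall>n. P n \<longrightarrow> n \<le> len x" unfolding P_def using reduced_len by fastforce
  ultimately have "P (GREATEST n. P n)" "\<And>k. P k \<Longrightarrow> k \<le> (GREATEST n. P n)"
    using GreatestI_nat[of P 0 "len x"] Greatest_le_nat[of P _ "len x"] by simp_all
  then obtain n where n: "P n" "\<And>k. P k \<Longrightarrow> k \<le> n" by blast
  from n(1)[unfolded P_def]
  obtain \<xi> \<nu> where "reduced (\<xi> @ \<nu>)" "word_value (\<xi> @ \<nu>) = x" "set \<xi> \<subseteq> I" "length \<xi> = n" by metis
  moreover have "\<forall>\<xi>' \<nu>'. reduced (\<xi>' @ \<nu>') \<and> word_value (\<xi>' @ \<nu>') = x \<and> set \<xi>' \<subseteq> I \<longrightarrow> length \<xi>' \<le> length \<xi>"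
  proof (intro allI impI)
    fix \<xi>' \<nu>' assume "reduced (\<xi>' @ \<nu>') \<and> word_value (\<xi>' @ \<nu>') = x \<and> set \<xi>' \<subseteq> I"
    then have "P (length \<xi>')" unfolding P_def by metis
    then show "length \<xi>' \<le> length \<xi>" using n(2) calculation by simp
  qed
  ultimately show ?thesis by metis
qed

text \<open>If \<open>x \<noteq> y\<close> have the same coatoms, no left descent is shared.  For left descents \<open>s\<close> of \<open>x\<close> and
  \<open>t\<close> of \<open>y\<close>, deleting the last letter of \<open>x\<close> and prefixing \<open>t\<close> gives \<open>y\<close>, which makes the
  longest \<open>\<langle>s, t\<rangle>\<close>-prefix grow; the same holds from \<open>y\<close> to \<open>x\<close>, unless one of them is dihedral.\<close>

lemma coat_eq_imp_dihedral:
  assumes c: "x \<in> carrier W" "y \<in> carrier W" and ne: "x \<noteq> \<one>" "x \<noteq> y" and eq: "coat x = coat y"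
  shows "\<exists>s \<in> S. \<exists>t \<in> S. s \<noteq> t \<and> x \<in> parabolic {s, t} \<and> y \<in> parabolic {s, t}"
proof -
  obtain s where s: "s \<in> S" "len (s \<otimes> x) < len x" using ex_left_descent c ne by blast
  have "s \<otimes> x \<in> coat y" using left_descent_covered[OF s(1) c(1)] s eq by (auto simp: coat_def)
  then have l: "len x = len y" using len_gen_mult[OF s(1) c(1)] s by (auto simp: coat_def covered_by_iff)
  have "len y \<noteq> 0" using l s by simp
  then obtain t where t: "t \<in> S" "len (t \<otimes> y) < len y" using ex_left_descent[of y] c by fastforce
  have ds: "\<not> len (s \<otimes> y) < len y" using coat_descent_unique[OF c _ l s] eq ne by blast
  have dt: "\<not> len (t \<otimes> x) < len x" using coat_descent_unique[OF c _ l t(1)] t(2) eq ne by blast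
  have st: "s \<noteq> t" using dt s by blast
  define I where "I = {s, t}"
  have IS: "I \<subseteq> S" using s t by (simp add: I_def)
  have key: "\<nu> = []"
    if c: "x \<in> carrier W" "y \<in> carrier W" and eq: "coat x = coat y" and l: "len x = len y"
      and s: "s \<in> S" "s \<in> I" "len (s \<otimes> x) < len x" "\<not> len (s \<otimes> y) < len y"
      and t: "t \<in> S" "t \<in> I" "len (t \<otimes> y) < len y" "\<not> len (t \<otimes> x) < len x"
      and \<xi>: "reduced (\<xi> @ \<nu>)" "word_value (\<xi> @ \<nu>) = x" "set \<xi> \<subseteq> I"
      and \<xi>max: "\<And>\<xi>' \<nu>'. reduced (\<xi>' @ \<nu>') \<Longrightarrow> word_value (\<xi>' @ \<nu>') = x \<Longrightarrow> set \<xi>' \<subseteq> I \<Longrightarrow> length \<xi>' \<le> length \<xi>"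
    for x y s t \<xi> \<nu>
  proof (rule ccontr)
    assume "\<nu> \<noteq> []"
    then obtain \<nu>0 r where \<nu>: "\<nu> = \<nu>0 @ [r]" by (cases \<nu> rule: rev_cases) auto
    have y1: "reduced (t # \<xi> @ \<nu>0)" "word_value (t # \<xi> @ \<nu>0) = y"
      using coat_shift[OF c _ l t(1,3,4), of "\<xi> @ \<nu>0" r] eq \<xi> unfolding \<nu> by simp_all
    obtain \<eta> \<mu> where \<eta>: "reduced (\<eta> @ \<mu>)" "word_value (\<eta> @ \<mu>) = y" "set \<eta> \<subseteq> I"
      and \<eta>max: "\<And>\<xi>' \<nu>'. reduced (\<xi>' @ \<nu>') \<Longrightarrow> word_value (\<xi>' @ \<nu>') = y \<Longrightarrow> set \<xi>' \<subseteq> I \<Longrightarrow> length \<xi>' \<le> length \<eta>"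
      using ex_max_prefix[OF c(2), of I] by blast
    have g1: "Suc (length \<xi>) \<le> length \<eta>" using \<eta>max[of "t # \<xi>" \<nu>0] y1 t \<xi> by simp
    have "\<mu> = []"
    proof (rule ccontr)
      assume "\<mu> \<noteq> []"
      then obtain \<mu>0 r' where \<mu>: "\<mu> = \<mu>0 @ [r']" by (cases \<mu> rule: rev_cases) auto
      have "reduced (s # \<eta> @ \<mu>0)" "word_value (s # \<eta> @ \<mu>0) = x"
        using coat_shift[OF c(2,1) _ l[symmetric] s(1,3,4), of "\<eta> @ \<mu>0" r'] eq \<eta> unfolding \<mu> by simp_all
      then have "Suc (length \<eta>) \<le> length \<xi>" using \<xi>max[of "s # \<eta>" \<mu>0] s \<eta> by simp
      then show False using g1 by simp
    qed
    have "y \<in> parabolic I" using \<eta> \<open>\<mu> = []\<close> unfolding parabolic_def by auto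
    then have "set (t # \<xi> @ \<nu>0) \<subseteq> I" using reduced_parabolic_iff[OF y1(1) IS] y1(2) by simp
    then have sI: "set (\<xi> @ \<nu>0) \<subseteq> I" by simp
    \<comment> \<open>All letters of \<open>x\<close> except the last lie in \<open>I\<close>, so
      maximality of the prefix forces \<open>r\<close> outside \<open>I\<close>. But
      \<open>r\<close> still occurs in \<open>s \<otimes> x\<close>, which is a coatom of
      \<open>y\<close> and hence lies in the parabolic subgroup.\<close>
    have rI: "r \<notin> I"
    proof
      assume "r \<in> I"
      then have "length (\<xi> @ \<nu>0 @ [r]) \<le> length \<xi>" using \<xi>max[of "\<xi> @ \<nu>0 @ [r]" "[]"] \<xi> \<nu> sI by simp
      then show False by simp
    qed
    obtain \<omega> where \<omega>: "reduced \<omega>" "word_value \<omega> = s \<otimes> x" using ex_reduced[of "s \<otimes> x"] c s by auto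
    have "reduced (s # \<omega>)" "word_value (s # \<omega>) = x" using reduced_Cons_descent[OF s(1) c(1) s(3) \<omega>] by blast+
    then have "set (s # \<omega>) = set (\<xi> @ \<nu>)" using reduced_set_eq \<xi> by metis
    then have "r \<in> set \<omega>" using \<nu> rI s by auto
    moreover have "bruhat_le (s \<otimes> x) y"
      using left_descent_covered[OF s(1) c(1)] s eq by (auto simp: coat_def covered_by_iff)
    then have "s \<otimes> x \<in> parabolic I" using parabolic_bruhat \<open>y \<in> parabolic I\<close> IS by blast
    then have "set \<omega> \<subseteq> I" using reduced_parabolic_iff[OF \<omega>(1) IS] \<omega>(2) by simp
    ultimately show False using rI by blast
  qed
  have par: "x \<in> parabolic I"
    if c: "x \<in> carrier W" "y \<in> carrier W" and eq: "coat x = coat y" and l: "len x = len y"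
      and s: "s \<in> S" "s \<in> I" "len (s \<otimes> x) < len x" "\<not> len (s \<otimes> y) < len y"
      and t: "t \<in> S" "t \<in> I" "len (t \<otimes> y) < len y" "\<not> len (t \<otimes> x) < len x" for x y s t
  proof -
    obtain \<xi> \<nu> where \<xi>: "reduced (\<xi> @ \<nu>)" "word_value (\<xi> @ \<nu>) = x" "set \<xi> \<subseteq> I"
      and \<xi>max: "\<And>\<xi>' \<nu>'. reduced (\<xi>' @ \<nu>') \<Longrightarrow> word_value (\<xi>' @ \<nu>') = x \<Longrightarrow> set \<xi>' \<subseteq> I \<Longrightarrow> length \<xi>' \<le> length \<xi>"
      using ex_max_prefix[OF c(1), of I] by blast
    have "\<nu> = []" by (rule key[OF c eq l s t \<xi>]) (rule \<xi>max)
    then show ?thesis using \<xi> unfolding parabolic_def by auto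
  qed
  have "x \<in> parabolic I" using par[of x y s t] c eq l s t ds dt by (simp add: I_def)
  moreover have "y \<in> parabolic I" using par[of y x t s] c eq l s t ds dt by (simp add: I_def)
  ultimately show ?thesis using s(1) t(1) st unfolding I_def by blast
qed

text \<open>Left multiplication by a generator satisfies the coatom condition of a distinguished
  matching. This is the model with which \<open>\<phi>\<close> is compared.\<close>

lemma coat_gen_mult:
  assumes r: "r \<in> S" and w: "w \<in> carrier W" and up: "len w < len (r \<otimes> w)"
  shows "coat (r \<otimes> w) = {w} \<union> {r \<otimes> v | v. covered_by v w \<and> len v < len (r \<otimes> v)}"
proof (intro Set.set_eqI iffI)
  fix z assume "z \<in> coat (r \<otimes> w)"
  then have z: "bruhat_le z (r \<otimes> w)" "len (r \<otimes> w) = Suc (len z)" by (simp_all add: coat_def covered_by_iff)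
  have zc: "z \<in> carrier W" using bruhat_leD z by blast
  have lw: "len (r \<otimes> w) = Suc (len w)" using len_gen_mult[OF r w] up by auto
  have d: "len (r \<otimes> (r \<otimes> w)) < len (r \<otimes> w)" using up r w by simp
  show "z \<in> {w} \<union> {r \<otimes> v | v. covered_by v w \<and> len v < len (r \<otimes> v)}"
  proof (cases "len (r \<otimes> z) < len z")
    case True
    then have "bruhat_le (r \<otimes> z) (r \<otimes> (r \<otimes> w))" using bruhat_lift_down[OF z(1) r d] by blast
    then have "covered_by (r \<otimes> z) w" "len (r \<otimes> z) < len (r \<otimes> (r \<otimes> z))"
      using True len_gen_mult[OF r zc] lw z(2) r w zc by (simp_all add: covered_by_iff)
    moreover have "z = r \<otimes> (r \<otimes> z)" using r zc by simp
    ultimately show ?thesis by blast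
  next
    case False
    then have "len z < len (r \<otimes> z)" using len_gen_mult[OF r zc] by auto
    then have "bruhat_le z (r \<otimes> (r \<otimes> w))" using bruhat_lift(1)[OF z(1) r d] by blast
    then have "z = w" using bruhat_len_eq[of z w] lw z r w by simp
    then show ?thesis by simp
  qed
next
  fix z assume "z \<in> {w} \<union> {r \<otimes> v | v. covered_by v w \<and> len v < len (r \<otimes> v)}"
  then consider "z = w" | v where "z = r \<otimes> v" "covered_by v w" "len v < len (r \<otimes> v)" by blast
  then show "z \<in> coat (r \<otimes> w)"
  proof cases
    case 1
    then show ?thesis using gen_up_covered[OF r w up] by (simp add: coat_def)
  next
    case 2
    have v: "bruhat_le v w" "len w = Suc (len v)" using 2 by (simp_all add: covered_by_iff)
    have "len (r \<otimes> v) = Suc (len v)" "len (r \<otimes> w) = Suc (len w)"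
      using len_gen_mult[OF r w] len_gen_mult[OF r bruhat_leD(1)[OF v(1)]] 2 up by auto
    then show ?thesis using bruhat_gen_mult_up[OF v(1) r up] v 2 by (simp add: coat_def covered_by_iff)
  qed
qed

section \<open>Inversion and matchings\<close>

lemma covered_by_inv [simp]:
  "x \<in> carrier W \<Longrightarrow> y \<in> carrier W \<Longrightarrow> covered_by (inv x) (inv y) \<longleftrightarrow> covered_by x y"
  by (simp add: covered_by_iff)

lemma covered_closed: "covered_by x y \<Longrightarrow> x \<in> carrier W" "covered_by x y \<Longrightarrow> y \<in> carrier W"
  using bruhat_leD by (auto simp: covered_by_iff)

lemma coat_inv: "y \<in> carrier W \<Longrightarrow> coat (inv y) = (\<lambda>x. inv x) ` coat y"
proof (intro Set.set_eqI iffI)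
  fix x assume y: "y \<in> carrier W" and x: "x \<in> coat (inv y)"
  then have "covered_by (inv x) y" "x \<in> carrier W"
    using covered_by_inv[of "inv x" y] covered_closed[of x "inv y"] by (auto simp: coat_def)
  then show "x \<in> (\<lambda>x. inv x) ` coat y" by (intro image_eqI[of _ _ "inv x"]) (auto simp: coat_def)
qed (auto simp: coat_def covered_closed)

text \<open>Inversion preserves length and Bruhat order and swaps left and right multiplication, so
  each one-sided statement about matchings has a mirror image.\<close>

lemma mirror_matching:
  assumes pm: "partial_distinguished_matching Q \<phi>"
  shows "partial_distinguished_matching ((\<lambda>x. inv x) ` Q) (\<lambda>x. inv (\<phi> (inv x)))"
proof -
  have Q: "Q \<subseteq> carrier W" "decreasing Q" "\<phi> ` Q \<subseteq> Q" "\<And>u. u \<in> Q \<Longrightarrow> \<phi> (\<phi> u) = u"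
    "\<And>u. u \<in> Q \<Longrightarrow> covered_by u (\<phi> u) \<or> covered_by (\<phi> u) u"
    "\<And>u. u \<in> Q \<Longrightarrow> covered_by u (\<phi> u) \<Longrightarrow>
        coat (\<phi> u) = {u} \<union> {\<phi> v | v. covered_by v u \<and> covered_by v (\<phi> v)}"
    using pm unfolding partial_distinguished_matching_def by auto
  have cQ: "u \<in> carrier W" "\<phi> u \<in> Q" "\<phi> u \<in> carrier W" if "u \<in> Q" for u using Q(1,3) that by auto
  have down: "v \<in> Q" if "covered_by v u" "u \<in> Q" for u v
    using Q(2) that unfolding decreasing_def covered_by_iff by blast
  show ?thesis unfolding partial_distinguished_matching_def
  proof (intro conjI ballI impI)
    show "(\<lambda>x. inv x) ` Q \<subseteq> carrier W" using cQ by auto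
    show "decreasing ((\<lambda>x. inv x) ` Q)" unfolding decreasing_def
    proof (intro ballI allI impI)
      fix q x assume "q \<in> (\<lambda>x. inv x) ` Q" "bruhat_le x q"
      then obtain p where p: "p \<in> Q" "bruhat_le x (inv p)" by blast
      then have "bruhat_le (inv x) p" "x \<in> carrier W" using bruhat_inv[of x "inv p"] bruhat_leD(1) cQ(1) by auto
      then have "inv x \<in> Q" "x = inv (inv x)" using Q(2) p(1) unfolding decreasing_def by auto
      then show "x \<in> (\<lambda>x. inv x) ` Q" by blast
    qed
    show "(\<lambda>x. inv (\<phi> (inv x))) ` (\<lambda>x. inv x) ` Q \<subseteq> (\<lambda>x. inv x) ` Q" using cQ by auto
    fix u assume "u \<in> (\<lambda>x. inv x) ` Q"
    then obtain p where p: "p \<in> Q" "u = inv p" by blast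
    show "inv (\<phi> (inv (inv (\<phi> (inv u))))) = u" using p cQ Q(4) by simp
    show "covered_by u (inv (\<phi> (inv u))) \<or> covered_by (inv (\<phi> (inv u))) u" using p cQ Q(5) by simp
    assume "covered_by u (inv (\<phi> (inv u)))"
    then have up: "covered_by p (\<phi> p)" using p cQ by simp
    have "{inv (\<phi> (inv v)) | v. covered_by v (inv p) \<and> covered_by v (inv (\<phi> (inv v)))}
       = (\<lambda>x. inv x) ` {\<phi> v | v. covered_by v p \<and> covered_by v (\<phi> v)}" (is "?A = ?B")
    proof (intro Set.set_eqI iffI)
      fix x assume "x \<in> ?A"
      then obtain v where v: "x = inv (\<phi> (inv v))" "covered_by v (inv p)" "covered_by v (inv (\<phi> (inv v)))" by blast
      have vc: "v \<in> carrier W" using covered_closed v by blast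
      then have "covered_by (inv v) p" using covered_by_inv[of "inv v" p] v cQ p by simp
      moreover then have "covered_by (inv v) (\<phi> (inv v))"
        using covered_by_inv[of "inv v" "\<phi> (inv v)"] v cQ(3)[OF down[OF _ p(1)]] vc by simp
      ultimately show "x \<in> ?B" using v by blast
    next
      fix x assume "x \<in> ?B"
      then obtain v where v: "x = inv (\<phi> v)" "covered_by v p" "covered_by v (\<phi> v)" by blast
      note vc = covered_closed[OF v(3)]
      have "x = inv (\<phi> (inv (inv v)))" "covered_by (inv v) (inv p)" "covered_by (inv v) (inv (\<phi> (inv (inv v))))"
        using v vc cQ p by simp_all
      then show "x \<in> ?A" by blast
    qed
    then show "coat (inv (\<phi> (inv u))) =
       {u} \<union> {inv (\<phi> (inv v)) | v. covered_by v u \<and> covered_by v (inv (\<phi> (inv v)))}"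
      using p cQ Q(6)[OF p(1) up] coat_inv[of "\<phi> p"] by simp
  qed
qed

end

section \<open>Monotonicity and support of a single matching\<close>

locale distinguished_matching = coxeter_system +
  fixes Q :: "'a set" and \<phi> :: "'a \<Rightarrow> 'a"
  assumes matching: "partial_distinguished_matching Q \<phi>"
begin

lemma Q_closed [simp]: "u \<in> Q \<Longrightarrow> u \<in> carrier W"
  and phi_Q [simp]: "u \<in> Q \<Longrightarrow> \<phi> u \<in> Q"
  and phi_phi [simp]: "u \<in> Q \<Longrightarrow> \<phi> (\<phi> u) = u"
  and Q_down: "u \<in> Q \<Longrightarrow> bruhat_le x u \<Longrightarrow> x \<in> Q"
  and phi_cover: "u \<in> Q \<Longrightarrow> covered_by u (\<phi> u) \<or> covered_by (\<phi> u) u"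
  and coat_phi: "u \<in> Q \<Longrightarrow> covered_by u (\<phi> u) \<Longrightarrow>
        coat (\<phi> u) = {u} \<union> {\<phi> v | v. covered_by v u \<and> covered_by v (\<phi> v)}"
  using matching unfolding partial_distinguished_matching_def decreasing_def by auto

lemma phi_len: "u \<in> Q \<Longrightarrow> len (\<phi> u) = Suc (len u) \<or> len u = Suc (len (\<phi> u))"
  using phi_cover[of u] by (auto simp: covered_by_iff)

lemma up_iff: "u \<in> Q \<Longrightarrow> covered_by u (\<phi> u) \<longleftrightarrow> len u < len (\<phi> u)"
  using phi_cover[of u] by (auto simp: covered_by_iff)

lemma down_iff: "u \<in> Q \<Longrightarrow> covered_by (\<phi> u) u \<longleftrightarrow> len (\<phi> u) < len u"
  using phi_cover[of u] by (auto simp: covered_by_iff)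

lemma Q_cover: "u \<in> Q \<Longrightarrow> covered_by x u \<Longrightarrow> x \<in> Q"
  using Q_down by (auto simp: covered_by_iff)

lemma cover_up:
  assumes "u \<in> Q" "len u < len (\<phi> u)" "covered_by v u" "len v < len (\<phi> v)"
  shows "covered_by (\<phi> v) (\<phi> u)"
proof -
  have "covered_by v (\<phi> v)" using up_iff[of v] Q_cover[OF assms(1,3)] assms(4) by blast
  then have "\<phi> v \<in> coat (\<phi> u)" using coat_phi[OF assms(1)] up_iff[OF assms(1)] assms by blast
  then show ?thesis by (simp add: coat_def)
qed

text \<open>The coatom condition read from the top of an orbit: below an upper element
  \<open>u\<close>, every coatom other than \<open>\<phi> u\<close> is itself an upper element, and
  the partners again form a cover.\<close>

lemma cover_down:
  assumes u: "u \<in> Q" "len (\<phi> u) < len u" and v: "covered_by v u" "v \<noteq> \<phi> u"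
  shows "len (\<phi> v) < len v" "covered_by (\<phi> v) (\<phi> u)"
proof -
  have "covered_by (\<phi> u) (\<phi> (\<phi> u))" using down_iff u by simp
  then have "coat u = {\<phi> u} \<union> {\<phi> v | v. covered_by v (\<phi> u) \<and> covered_by v (\<phi> v)}"
    using coat_phi[of "\<phi> u"] u by simp
  moreover have "v \<in> coat u" using v by (simp add: coat_def)
  ultimately obtain v' where v': "v = \<phi> v'" "covered_by v' (\<phi> u)" "covered_by v' (\<phi> v')" using v(2) by blast
  have "v' \<in> Q" using Q_cover[OF _ v'(2)] u by simp
  then have "\<phi> v = v'" using v' by simp
  then show "len (\<phi> v) < len v" "covered_by (\<phi> v) (\<phi> u)" using v' by (auto simp: covered_by_iff)
qed

definition upper :: "'a \<Rightarrow> 'a" where "upper u = (if len u < len (\<phi> u) then \<phi> u else u)"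
definition lower :: "'a \<Rightarrow> 'a" where "lower u = (if len u < len (\<phi> u) then u else \<phi> u)"

lemma upper_Q [simp]: "u \<in> Q \<Longrightarrow> upper u \<in> Q"
  by (simp add: upper_def)

lemma le_upper: "u \<in> Q \<Longrightarrow> bruhat_le u (upper u)"
  using up_iff[of u] by (auto simp: upper_def covered_by_iff)

lemma phi_le_upper: "u \<in> Q \<Longrightarrow> bruhat_le (\<phi> u) (upper u)"
  using phi_cover[of u] by (auto simp: upper_def covered_by_iff)

lemma len_upper: "u \<in> Q \<Longrightarrow> len (upper u) \<le> Suc (len u)"
  using phi_len[of u] by (auto simp: upper_def)

text \<open>It suffices to treat covers. The critical case is a lower element \<open>x\<close>
  covered by an upper element \<open>z\<close>, where \<open>cover_down\<close> leaves only
  \<open>x = \<phi> z\<close>, so that both lie in one orbit.\<close>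

lemma upper_mono:
  assumes "bruhat_le v u" "u \<in> Q" shows "bruhat_le (upper v) (upper u)"
  using assms(1)
proof (induction rule: bruhat_chain_induct)
  case refl
  then show ?case using assms by simp
next
  case (cover x z)
  have z: "z \<in> Q" using Q_down assms(2) cover.hyps by blast
  have x: "x \<in> Q" using Q_cover z cover.hyps by blast
  have "bruhat_le (upper x) (upper z)"
  proof (cases "len x < len (\<phi> x)")
    case False
    then have "upper x = x" by (simp add: upper_def)
    then show ?thesis using cover.hyps(1) le_upper[OF z] bruhat_trans by (auto simp: covered_by_iff)
  next
    case True
    show ?thesis
    proof (cases "len z < len (\<phi> z)")
      case zT: True
      then show ?thesis using cover_up[OF z zT cover.hyps(1) True] True by (simp add: upper_def covered_by_iff)
    next
      case zF: False
      then have d: "len (\<phi> z) < len z" using phi_len[OF z] by simp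
      have "x = \<phi> z" using cover_down(1)[OF z d cover.hyps(1)] True by fastforce
      then have "upper x = z" "upper z = z" using d z zF by (simp_all add: upper_def)
      then show ?thesis using z by simp
    qed
  qed
  then show ?case using cover.IH bruhat_trans by blast
qed

lemma lower_mono:
  assumes "bruhat_le v u" "u \<in> Q" shows "bruhat_le (lower v) (lower u)"
  using assms(1)
proof (induction rule: bruhat_chain_induct)
  case refl
  then show ?case using assms by (simp add: lower_def)
next
  case (cover x z)
  have z: "z \<in> Q" using Q_down assms(2) cover.hyps by blast
  have x: "x \<in> Q" using Q_cover z cover.hyps by blast
  have lx: "bruhat_le (lower x) x" using phi_cover[OF x] x by (auto simp: lower_def covered_by_iff)
  have "bruhat_le (lower x) (lower z)"
  proof (cases "len z < len (\<phi> z)")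
    case True
    then have "lower z = z" by (simp add: lower_def)
    then show ?thesis using cover.hyps(1) lx bruhat_trans by (auto simp: covered_by_iff)
  next
    case False
    then have d: "len (\<phi> z) < len z" using phi_len[OF z] by simp
    show ?thesis
    proof (cases "x = \<phi> z")
      case True
      then show ?thesis using d z False by (simp add: lower_def)
    next
      case xF: False
      then show ?thesis using cover_down[OF z d cover.hyps(1)] False by (simp add: lower_def covered_by_iff)
    qed
  qed
  then show ?case using cover.IH bruhat_trans by blast
qed

definition base :: 'a where "base = \<phi> \<one>"

lemma one_Q: "u \<in> Q \<Longrightarrow> \<one> \<in> Q"
  using Q_down[of u \<one>] bruhat_one[of u] by simp

lemma base_gen: assumes "\<one> \<in> Q" shows "base \<in> S"
proof -
  have "len base = 1" using phi_len[OF assms] by (simp add: base_def)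
  moreover obtain \<omega> where \<omega>: "reduced \<omega>" "word_value \<omega> = base"
    using ex_reduced[of base] assms by (auto simp: base_def)
  ultimately have "length \<omega> = 1" using reduced_len[OF \<omega>(1)] by simp
  then obtain a where "\<omega> = [a]" by (auto simp: length_Suc_conv)
  then show ?thesis using \<omega> by (auto dest!: reducedD)
qed

lemma upper_one: "\<one> \<in> Q \<Longrightarrow> upper \<one> = base"
  using phi_len[of \<one>] by (auto simp: upper_def base_def)

lemma base_le_upper: "u \<in> Q \<Longrightarrow> bruhat_le base (upper u)"
  using upper_mono[of \<one> u] bruhat_one[of u] upper_one one_Q by simp

lemma lower_gen:
  assumes "a \<in> Q" "a \<in> S" "a \<noteq> base" shows "lower a = a" "len a < len (\<phi> a)"
proof -
  show "len a < len (\<phi> a)"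
  proof (rule ccontr)
    assume "\<not> ?thesis"
    then have "len (\<phi> a) = 0" using phi_len[OF assms(1)] assms by simp
    then have "\<phi> a = \<one>" using len_eq_0[of "\<phi> a"] assms by simp
    then show False using assms phi_phi[OF assms(1)] by (simp add: base_def)
  qed
  then show "lower a = a" by (simp add: lower_def)
qed

text \<open>A generator other than \<open>base\<close> is the lower element of its orbit, so
  monotonicity of \<open>lower\<close> keeps it below the lower element of any orbit in which it
  occurs. Hence \<open>\<phi>\<close> introduces no new letter except \<open>base\<close>.\<close>

lemma gen_le_phi:
  assumes u: "u \<in> Q" and a: "a \<in> S" "a \<noteq> base" "bruhat_le a (\<phi> u)" shows "bruhat_le a u"
proof (cases "len u < len (\<phi> u)")
  case True
  have aQ: "a \<in> Q" using Q_down[of "\<phi> u"] u a by simp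
  have "bruhat_le (lower a) (lower (\<phi> u))" using lower_mono[OF a(3)] u by simp
  then show ?thesis using True u lower_gen[OF aQ a(1,2)] by (simp add: lower_def)
next
  case False
  then have "covered_by (\<phi> u) u" using phi_cover[OF u] by (auto simp: covered_by_iff)
  then show ?thesis using a bruhat_trans by (auto simp: covered_by_iff)
qed

lemma phi_parabolic:
  assumes "u \<in> Q" "u \<in> parabolic I" "I \<subseteq> S" "base \<in> I" shows "\<phi> u \<in> parabolic I"
proof -
  obtain \<omega> where \<omega>: "reduced \<omega>" "word_value \<omega> = u" using ex_reduced assms by (meson Q_closed)
  obtain \<eta> where \<eta>: "reduced \<eta>" "word_value \<eta> = \<phi> u" using ex_reduced assms by (meson Q_closed phi_Q)
  have I: "set \<omega> \<subseteq> I" using reduced_parabolic_iff[OF \<omega>(1) assms(3)] \<omega> assms by simp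
  have "a \<in> I" if "a \<in> set \<eta>" for a
  proof (cases "a = base")
    case False
    have aS: "a \<in> S" using that reducedD[OF \<eta>(1)] by blast
    then have "bruhat_le a (\<phi> u)" using gen_le_iff[OF \<eta>(1)] that \<eta>(2) by simp
    then have "bruhat_le a u" using gen_le_phi assms aS False by blast
    then show ?thesis using gen_le_iff[OF \<omega>(1) aS] \<omega>(2) I by auto
  qed (use assms in simp)
  then have "set \<eta> \<subseteq> I" by blast
  then show ?thesis using \<eta>(2)[symmetric] unfolding parabolic_def by blast
qed

text \<open>Left regularity without stability of \<open>Q\<close>: this version can be tested on
  parabolic subgroups, and maximality supplies the stability afterwards.\<close>

definition left_commuting :: "'a \<Rightarrow> bool" where
  "left_commuting r \<longleftrightarrow> r \<in> S \<and> (\<forall>x \<in> Q. r \<otimes> x \<in> Q \<longrightarrow> \<phi> (r \<otimes> x) = r \<otimes> \<phi> x)"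

definition right_commuting :: "'a \<Rightarrow> bool" where
  "right_commuting r \<longleftrightarrow> r \<in> S \<and> (\<forall>x \<in> Q. x \<otimes> r \<in> Q \<longrightarrow> \<phi> (x \<otimes> r) = \<phi> x \<otimes> r)"

text \<open>The two conditions index the same coatoms of \<open>r \<otimes> \<phi> y\<close>: one
  through the elements covered by \<open>r \<otimes> y\<close>, the other through those covered by
  \<open>\<phi> y\<close>.\<close>

lemma cover_gen_mult_iff:
  assumes r: "r \<in> S" and v: "v \<in> Q" and down: "len (r \<otimes> v) < len v \<Longrightarrow> \<phi> v = r \<otimes> \<phi> (r \<otimes> v)"
  shows "len v < len (r \<otimes> v) \<and> covered_by (r \<otimes> v) (r \<otimes> \<phi> v) \<longleftrightarrow>
    covered_by v (\<phi> v) \<and> len (\<phi> v) < len (r \<otimes> \<phi> v)"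
proof -
  have c: "v \<in> carrier W" "\<phi> v \<in> carrier W" using v by simp_all
  note lv = len_gen_mult[OF r c(1)] and lp = len_gen_mult[OF r c(2)] and l = phi_len[OF v]
  show ?thesis
  proof
    assume a: "len v < len (r \<otimes> v) \<and> covered_by (r \<otimes> v) (r \<otimes> \<phi> v)"
    then have "len (r \<otimes> \<phi> v) = Suc (Suc (len v))" using lv by (auto simp: covered_by_iff)
    then have "len (\<phi> v) = Suc (len v) \<and> len (\<phi> v) < len (r \<otimes> \<phi> v)" using l lp by presburger
    then show "covered_by v (\<phi> v) \<and> len (\<phi> v) < len (r \<otimes> \<phi> v)" using up_iff[OF v] by simp
  next
    assume a: "covered_by v (\<phi> v) \<and> len (\<phi> v) < len (r \<otimes> \<phi> v)"
    then have le: "bruhat_le v (\<phi> v)" "len (\<phi> v) = Suc (len v)" by (simp_all add: covered_by_iff)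
    have "len v < len (r \<otimes> v)"
    proof (rule ccontr)
      assume "\<not> ?thesis"
      then have d: "len (r \<otimes> v) < len v" using lv by auto
      then have rvQ: "r \<otimes> v \<in> Q" using Q_down[OF v] bruhat_gen_down[OF r c(1)] by blast
      have "r \<otimes> \<phi> v = \<phi> (r \<otimes> v)" using down[OF d] r rvQ by (metis gen_cancel_left Q_closed phi_Q)
      then show False using phi_len[OF rvQ] d a le by auto
    qed
    moreover have "bruhat_le (r \<otimes> v) (r \<otimes> \<phi> v)" using bruhat_gen_mult_up[OF le(1) r] a by blast
    ultimately show "len v < len (r \<otimes> v) \<and> covered_by (r \<otimes> v) (r \<otimes> \<phi> v)"
      using lv lp a le by (auto simp: covered_by_iff)
  qed
qed

text \<open>The translate by \<open>r\<close> of the coatom condition at \<open>y\<close>. The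
  function \<open>f\<close> is kept abstract because it is \<open>\<phi>\<close> itself when
  commutation is proved and the extended map when the matching is enlarged.\<close>

lemma coat_gen_mult_phi:
  assumes r: "r \<in> S" and y: "y \<in> Q" "covered_by y (\<phi> y)" and up: "len y < len (r \<otimes> y)" "len (\<phi> y) < len (r \<otimes> \<phi> y)"
    and comm: "\<And>v. covered_by v y \<Longrightarrow> len (r \<otimes> v) < len v \<Longrightarrow> \<phi> v = r \<otimes> \<phi> (r \<otimes> v)"
    and f: "f y = \<phi> y" "\<And>v. covered_by v y \<Longrightarrow> len v < len (r \<otimes> v) \<Longrightarrow> f (r \<otimes> v) = r \<otimes> \<phi> v"
  shows "coat (r \<otimes> \<phi> y) = {r \<otimes> y} \<union> {f v | v. covered_by v (r \<otimes> y) \<and> covered_by v (f v)}"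
proof -
  have c: "y \<in> carrier W" "\<phi> y \<in> carrier W" using y by simp_all
  note iff = cover_gen_mult_iff[OF r Q_cover[OF y(1)] comm]
  have "{r \<otimes> z | z. covered_by z (\<phi> y) \<and> len z < len (r \<otimes> z)}
      = {r \<otimes> y} \<union> {r \<otimes> \<phi> v | v. covered_by v y \<and> (covered_by v (\<phi> v) \<and> len (\<phi> v) < len (r \<otimes> \<phi> v))}"
  proof -
    have cov: "covered_by z (\<phi> y) \<longleftrightarrow> z = y \<or> (\<exists>v. z = \<phi> v \<and> covered_by v y \<and> covered_by v (\<phi> v))" for z
      using coat_phi[OF y] by (auto simp: coat_def)
    show ?thesis using up(1) unfolding cov by auto
  qed
  also have "\<dots> = {r \<otimes> y} \<union> {r \<otimes> \<phi> v | v. covered_by v y \<and> (len v < len (r \<otimes> v) \<and> covered_by (r \<otimes> v) (r \<otimes> \<phi> v))}"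
    using iff by blast
  finally have L: "coat (r \<otimes> \<phi> y) = {\<phi> y} \<union> ({r \<otimes> y} \<union>
      {r \<otimes> \<phi> v | v. covered_by v y \<and> (len v < len (r \<otimes> v) \<and> covered_by (r \<otimes> v) (r \<otimes> \<phi> v))})"
    using coat_gen_mult[OF r c(2) up(2)] by simp
  have cv: "covered_by z (r \<otimes> y) \<longleftrightarrow> z = y \<or> (\<exists>v. z = r \<otimes> v \<and> covered_by v y \<and> len v < len (r \<otimes> v))" for z
    using coat_gen_mult[OF r c(1) up(1)] by (auto simp: coat_def)
  have "{f v | v. covered_by v (r \<otimes> y) \<and> covered_by v (f v)} = {\<phi> y} \<union>
      {r \<otimes> \<phi> v | v. covered_by v y \<and> (len v < len (r \<otimes> v) \<and> covered_by (r \<otimes> v) (r \<otimes> \<phi> v))}" (is "?A = ?B")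
  proof (intro Set.set_eqI iffI)
    fix x assume "x \<in> ?A"
    then obtain v where v: "x = f v" "covered_by v (r \<otimes> y)" "covered_by v (f v)" by blast
    show "x \<in> ?B"
    proof (cases "v = y")
      case True
      then show ?thesis using v f by simp
    next
      case False
      then obtain v' where v': "v = r \<otimes> v'" "covered_by v' y" "len v' < len (r \<otimes> v')" using v cv by blast
      then have "x = r \<otimes> \<phi> v'" "covered_by (r \<otimes> v') (r \<otimes> \<phi> v')" using v f(2)[OF v'(2,3)] by simp_all
      then show ?thesis using v' by blast
    qed
  next
    fix x assume "x \<in> ?B"
    then consider "x = \<phi> y" | v where "x = r \<otimes> \<phi> v" "covered_by v y" "len v < len (r \<otimes> v)" "covered_by (r \<otimes> v) (r \<otimes> \<phi> v)"
      by blast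
    then show "x \<in> ?A"
    proof cases
      case 1
      then have "x = f y" "covered_by y (r \<otimes> y)" "covered_by y (f y)"
        using f y gen_up_covered[OF r c(1) up(1)] by simp_all
      then show ?thesis by blast
    next
      case 2
      then have "x = f (r \<otimes> v)" "covered_by (r \<otimes> v) (r \<otimes> y)" "covered_by (r \<otimes> v) (f (r \<otimes> v))"
        using f(2)[OF 2(2,3)] cv by auto
      then show ?thesis by blast
    qed
  qed
  then show ?thesis using L by auto
qed

text \<open>An element outside all rank two parabolic subgroups is determined by its coatoms, so commutation of
  \<open>\<phi>\<close> with left multiplication by \<open>r\<close> propagates from the dihedral subgroups containing \<open>\<phi> 1\<close> and \<open>r\<close>.\<close>

lemma left_commuting_if_dihedral:
  assumes r: "r \<in> S"
    and dih: "\<And>t x. t \<in> S \<Longrightarrow> r \<in> {base, t} \<Longrightarrow> x \<in> Q \<Longrightarrow> x \<in> parabolic {base, t} \<Longrightarrow> r \<otimes> x \<in> Q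
      \<Longrightarrow> \<phi> (r \<otimes> x) = r \<otimes> \<phi> x"
  shows "left_commuting r"
proof -
  have main: "x \<in> Q \<Longrightarrow> r \<otimes> x \<in> Q \<Longrightarrow> len x < len (r \<otimes> x) \<Longrightarrow> \<phi> (r \<otimes> x) = r \<otimes> \<phi> x" for x
  proof (induction "len x" arbitrary: x rule: less_induct)
    case less
    note x = less.prems
    have c: "x \<in> carrier W" "\<phi> x \<in> carrier W" using x by simp_all
    have IH: "\<phi> (r \<otimes> v) = r \<otimes> \<phi> v"
      if "v \<in> Q" "r \<otimes> v \<in> Q" "len v < len x" "len v < len (r \<otimes> v)" for v
      using less.hyps that by blast
    have IH': "\<phi> v = r \<otimes> \<phi> (r \<otimes> v)" if v: "v \<in> Q" "len v \<le> len x" "len (r \<otimes> v) < len v" for v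
    proof -
      have "r \<otimes> v \<in> Q" using Q_down[OF v(1)] bruhat_gen_down[OF r _ v(3)] v by simp
      then show ?thesis using IH[of "r \<otimes> v"] v r by simp
    qed
    show ?case
    proof (cases "len x < len (\<phi> x)")
      \<comment> \<open>Here \<open>x\<close> is the upper element of its orbit; the induction
        hypothesis is applied to the shorter element \<open>\<phi> x\<close>, after checking that
        \<open>r\<close> lengthens it as well.\<close>
      case False
      then have lx: "len x = Suc (len (\<phi> x))" using phi_len[OF x(1)] by simp
      have "len (\<phi> x) < len (r \<otimes> \<phi> x)"
      proof (rule ccontr)
        assume "\<not> ?thesis"
        then have d: "len (r \<otimes> \<phi> x) < len (\<phi> x)" using len_gen_mult[OF r c(2)] by auto
        have q: "r \<otimes> \<phi> x \<in> Q" using Q_down[of "\<phi> x"] bruhat_gen_down[OF r c(2) d] x by simp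
        have "\<phi> (\<phi> x) = r \<otimes> \<phi> (r \<otimes> \<phi> x)" using IH'[of "\<phi> x"] d x lx by simp
        then have "\<phi> (r \<otimes> \<phi> x) = r \<otimes> x" using x(1) r q by (metis gen_cancel_left Q_closed phi_Q phi_phi)
        then show False using phi_len[OF q] d lx x(3) by auto
      qed
      moreover have "covered_by (\<phi> x) x" using down_iff x lx by simp
      then have "bruhat_le (r \<otimes> \<phi> x) (r \<otimes> x)" using bruhat_gen_mult_up[of "\<phi> x" x r] r x by (simp add: covered_by_iff)
      then have "r \<otimes> \<phi> x \<in> Q" using Q_down x by blast
      ultimately have "\<phi> (r \<otimes> \<phi> x) = r \<otimes> x" using IH[of "\<phi> x"] x lx by simp
      then show ?thesis using \<open>r \<otimes> \<phi> x \<in> Q\<close> phi_phi by metis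
    next
      case True
      have cx: "covered_by x (\<phi> x)" using up_iff x True by blast
      show ?thesis
      proof (cases "len (\<phi> x) < len (r \<otimes> \<phi> x)")
        case False
        then have d: "len (r \<otimes> \<phi> x) < len (\<phi> x)" using len_gen_mult[OF r c(2)] by auto
        have "bruhat_le (r \<otimes> x) (\<phi> x)" using bruhat_lift(2)[OF _ r d x(3)] cx by (simp add: covered_by_iff)
        then have "r \<otimes> x = \<phi> x" using bruhat_len_eq True phi_len[OF x(1)] x(3) len_gen_mult[OF r c(1)] by auto
        then show ?thesis using x r by (metis gen_cancel_left Q_closed phi_phi)
      next
        \<comment> \<open>The generic case: \<open>r \<otimes> \<phi> x\<close> and
          \<open>\<phi> (r \<otimes> x)\<close> are shown to have the same coatoms, so they can
          differ only inside a rank two parabolic subgroup.\<close>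
        case up: True
        have upr: "len (r \<otimes> x) < len (\<phi> (r \<otimes> x))"
        proof (rule ccontr)
          assume "\<not> ?thesis"
          then have d: "len (\<phi> (r \<otimes> x)) < len (r \<otimes> x)" using phi_len[OF x(2)] by auto
          have "x \<noteq> \<phi> (r \<otimes> x)"
          proof
            assume "x = \<phi> (r \<otimes> x)"
            then have "\<phi> x = r \<otimes> x" using x(2) phi_phi by metis
            then have "r \<otimes> \<phi> x = x" using r x by simp
            then show False using up True by simp
          qed
          then show False using cover_down(1)[OF x(2) d gen_up_covered[OF r c(1) x(3)]] True by simp
        qed
        then have cr: "covered_by (r \<otimes> x) (\<phi> (r \<otimes> x))" using up_iff x by blast
        have "coat (r \<otimes> \<phi> x) = {r \<otimes> x} \<union> {\<phi> v | v. covered_by v (r \<otimes> x) \<and> covered_by v (\<phi> v)}"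
        proof (rule coat_gen_mult_phi[OF r x(1) cx x(3) up])
          fix v assume v: "covered_by v x" "len (r \<otimes> v) < len v"
          then show "\<phi> v = r \<otimes> \<phi> (r \<otimes> v)" using IH'[of v] Q_cover[OF x(1) v(1)] by (simp add: covered_by_iff)
        next
          fix v assume v: "covered_by v x" "len v < len (r \<otimes> v)"
          have "bruhat_le (r \<otimes> v) (r \<otimes> x)" using bruhat_gen_mult_up[OF _ r x(3)] v by (simp add: covered_by_iff)
          then show "\<phi> (r \<otimes> v) = r \<otimes> \<phi> v"
            using IH[of v] Q_cover[OF x(1) v(1)] Q_down[OF x(2)] v by (simp add: covered_by_iff)
        qed simp
        then have co: "coat (r \<otimes> \<phi> x) = coat (\<phi> (r \<otimes> x))" using coat_phi[OF x(2) cr] by simp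
        show ?thesis
        proof (rule ccontr)
          assume neq: "\<phi> (r \<otimes> x) \<noteq> r \<otimes> \<phi> x"
          have "\<phi> (r \<otimes> x) \<noteq> \<one>" using upr by auto
          then obtain a b where ab: "a \<in> S" "b \<in> S" "a \<noteq> b" "\<phi> (r \<otimes> x) \<in> parabolic {a, b}"
            using coat_eq_imp_dihedral[of "\<phi> (r \<otimes> x)" "r \<otimes> \<phi> x"] neq co x r by auto
          have abS: "{a, b} \<subseteq> S" using ab by simp
          have bS: "base \<in> S" using base_gen one_Q x by blast
          have inab: "g \<in> {a, b}" if "g \<in> S" "bruhat_le g (\<phi> (r \<otimes> x))" for g
          proof -
            have "g \<in> parabolic {a, b}" using parabolic_bruhat that ab abS by blast
            moreover have "reduced [g]" using that(1) by (simp add: reduced_def)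
            ultimately show ?thesis using reduced_parabolic_iff[of "[g]" "{a, b}"] abS that(1) by simp
          qed
          \<comment> \<open>The exceptional dihedral subgroup contains both \<open>base\<close> and
            \<open>r\<close>, because both lie below \<open>\<phi> (r \<otimes> x)\<close>; so it is
            one of those covered by the hypothesis.\<close>
          have "base \<in> {a, b}" using inab bS base_le_upper[OF x(2)] upr by (simp add: upper_def)
          moreover have "bruhat_le r (r \<otimes> x)"
            using bruhat_gen_mult_up[OF bruhat_one[OF c(1)] r x(3)] r by simp
          then have "bruhat_le r (\<phi> (r \<otimes> x))" using cr bruhat_trans by (auto simp: covered_by_iff)
          then have "r \<in> {a, b}" using inab r by blast
          ultimately obtain t where t: "t \<in> S" "r \<in> {base, t}" "{a, b} = {base, t}" using ab by auto
          have "bruhat_le x (\<phi> (r \<otimes> x))"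
            using cr gen_up_covered[OF r c(1) x(3)] bruhat_trans by (auto simp: covered_by_iff)
          then have "x \<in> parabolic {base, t}" using parabolic_bruhat ab(4) abS t(3) by metis
          then show False using dih[OF t(1,2) x(1) _ x(2)] neq by blast
        qed
      qed
    qed
  qed
  show ?thesis unfolding left_commuting_def
  proof (intro conjI ballI impI)
    fix x assume x: "x \<in> Q" "r \<otimes> x \<in> Q"
    show "\<phi> (r \<otimes> x) = r \<otimes> \<phi> x"
    proof (cases "len x < len (r \<otimes> x)")
      case True
      then show ?thesis using main x by blast
    next
      case False
      then have "len (r \<otimes> x) < len (r \<otimes> (r \<otimes> x))" using len_gen_mult[OF r Q_closed[OF x(1)]] r x by auto
      then have "\<phi> x = r \<otimes> \<phi> (r \<otimes> x)" using main[of "r \<otimes> x"] x r by simp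
      then show ?thesis using r x by (metis gen_cancel_left Q_closed phi_Q)
    qed
  qed (rule r)
qed

text \<open>The map on the translate is forced by commutation with \<open>r\<close>. It is well
  defined on the overlap by hypothesis, and the coatom condition for new elements is the translated
  one.\<close>

lemma left_commuting_extension:
  assumes "left_commuting r"
  defines "Q' \<equiv> Q \<union> (\<lambda>x. r \<otimes> x) ` Q" and "\<phi>' \<equiv> \<lambda>x. if x \<in> Q then \<phi> x else r \<otimes> \<phi> (r \<otimes> x)"
  shows "partial_distinguished_matching Q' \<phi>'"
proof -
  have r: "r \<in> S" and comm: "\<And>x. x \<in> Q \<Longrightarrow> r \<otimes> x \<in> Q \<Longrightarrow> \<phi> (r \<otimes> x) = r \<otimes> \<phi> x"
    using assms(1) by (simp_all add: left_commuting_def)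
  \<comment> \<open>A new element is \<open>r \<otimes> y\<close> with \<open>y\<close> in
    \<open>Q\<close>. Both \<open>y\<close> and \<open>\<phi> y\<close> are lengthened by
    \<open>r\<close>, since otherwise the product would already lie in the decreasing set
    \<open>Q\<close>, and then by commutation so would the partner.\<close>
  have new: "r \<otimes> u \<in> Q \<and> u = r \<otimes> (r \<otimes> u) \<and> len (r \<otimes> u) < len u \<and> r \<otimes> \<phi> (r \<otimes> u) \<notin> Q
      \<and> len (\<phi> (r \<otimes> u)) < len (r \<otimes> \<phi> (r \<otimes> u))"
    if u: "u \<in> Q'" "u \<notin> Q" for u
  proof -
    obtain y where y: "y \<in> Q" "u = r \<otimes> y" using u by (auto simp: Q'_def)
    have ru: "r \<otimes> u = y" using y r by simp
    have nu: "r \<otimes> y \<notin> Q" using u y by simp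
    have up: "len z < len (r \<otimes> z)" if "z \<in> Q" "r \<otimes> z \<notin> Q" for z
      using that Q_down[of z] bruhat_gen_down[OF r Q_closed[OF that(1)]] len_gen_mult[OF r Q_closed[OF that(1)]] by auto
    have "r \<otimes> \<phi> y \<notin> Q"
    proof
      assume "r \<otimes> \<phi> y \<in> Q"
      then have "\<phi> (r \<otimes> \<phi> y) = r \<otimes> y" using comm[of "\<phi> y"] y by simp
      then show False using nu \<open>r \<otimes> \<phi> y \<in> Q\<close> phi_Q by metis
    qed
    then show ?thesis using ru y up[of y] up[of "\<phi> y"] nu by simp
  qed
  have f: "\<phi>' (r \<otimes> v) = r \<otimes> \<phi> v" if "v \<in> Q" for v
    using comm that r by (simp add: \<phi>'_def)
  show ?thesis unfolding partial_distinguished_matching_def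
  proof (intro conjI ballI impI)
    show "Q' \<subseteq> carrier W" using r by (auto simp: Q'_def)
    show "decreasing Q'" unfolding decreasing_def
    proof (intro ballI allI impI)
      fix q x assume q: "q \<in> Q'" and x: "bruhat_le x q"
      have xc: "x \<in> carrier W" using x bruhat_leD by blast
      show "x \<in> Q'"
      proof (cases "q \<in> Q")
        case True
        then show ?thesis using Q_down x by (auto simp: Q'_def)
      next
        case False
        note n = new[OF q False]
        show ?thesis
        proof (cases "len (r \<otimes> x) < len x")
          case True
          have "bruhat_le (r \<otimes> x) (r \<otimes> q)" using bruhat_lift_down[OF x r _ True] n by blast
          then have "r \<otimes> x \<in> Q" using n Q_down by blast
          moreover have "x = r \<otimes> (r \<otimes> x)" using r xc by simp
          ultimately show ?thesis unfolding Q'_def by blast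
        next
          case False
          then have "len x < len (r \<otimes> x)" using len_gen_mult[OF r xc] by auto
          then have "bruhat_le x (r \<otimes> q)" using bruhat_lift(1)[OF x r] n by blast
          then show ?thesis using n Q_down unfolding Q'_def by blast
        qed
      qed
    qed
    show "\<phi>' ` Q' \<subseteq> Q'"
    proof
      fix y assume "y \<in> \<phi>' ` Q'"
      then obtain u where u: "u \<in> Q'" "y = \<phi>' u" by blast
      show "y \<in> Q'" using u new[of u] by (cases "u \<in> Q") (auto simp: \<phi>'_def Q'_def)
    qed
    fix u assume u: "u \<in> Q'"
    show "\<phi>' (\<phi>' u) = u"
    proof (cases "u \<in> Q")
      case False
      note n = new[OF u False]
      have "\<phi>' (r \<otimes> \<phi> (r \<otimes> u)) = r \<otimes> \<phi> (\<phi> (r \<otimes> u))" using f[of "\<phi> (r \<otimes> u)"] n by simp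
      then show ?thesis using n False by (simp add: \<phi>'_def)
    qed (simp add: \<phi>'_def)
    show "covered_by u (\<phi>' u) \<or> covered_by (\<phi>' u) u"
    proof (cases "u \<in> Q")
      case True
      then show ?thesis using phi_cover by (simp add: \<phi>'_def)
    next
      case False
      note n = new[OF u False]
      define y where "y = r \<otimes> u"
      have y: "y \<in> Q" "u = r \<otimes> y" "len y < len (r \<otimes> y)" "len (\<phi> y) < len (r \<otimes> \<phi> y)"
        using n by (simp_all add: y_def)
      have l: "len (r \<otimes> y) = Suc (len y)" "len (r \<otimes> \<phi> y) = Suc (len (\<phi> y))"
        using len_gen_mult[OF r, of y] len_gen_mult[OF r, of "\<phi> y"] y by auto
      have "covered_by y (\<phi> y) \<or> covered_by (\<phi> y) y" using phi_cover y by blast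
      then have "covered_by (r \<otimes> y) (r \<otimes> \<phi> y) \<or> covered_by (r \<otimes> \<phi> y) (r \<otimes> y)"
        using bruhat_gen_mult_up[OF _ r y(3)] bruhat_gen_mult_up[OF _ r y(4)] l by (auto simp: covered_by_iff)
      moreover have "\<phi>' u = r \<otimes> \<phi> y" using False by (simp add: \<phi>'_def y_def)
      ultimately show ?thesis using y(2) by simp
    qed
    assume cu: "covered_by u (\<phi>' u)"
    show "coat (\<phi>' u) = {u} \<union> {\<phi>' v | v. covered_by v u \<and> covered_by v (\<phi>' v)}"
    proof (cases "u \<in> Q")
      case True
      then have "\<phi>' v = \<phi> v" if "covered_by v u" for v using Q_cover that by (simp add: \<phi>'_def)
      then have "{\<phi>' v | v. covered_by v u \<and> covered_by v (\<phi>' v)} = {\<phi> v | v. covered_by v u \<and> covered_by v (\<phi> v)}"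
        by metis
      then show ?thesis using coat_phi[of u] True cu by (simp add: \<phi>'_def)
    next
      case False
      note n = new[OF u False]
      define y where "y = r \<otimes> u"
      have y: "y \<in> Q" "u = r \<otimes> y" "len y < len (r \<otimes> y)" "len (\<phi> y) < len (r \<otimes> \<phi> y)" "\<phi>' u = r \<otimes> \<phi> y"
        using n False by (simp_all add: y_def \<phi>'_def)
      have l: "len (r \<otimes> y) = Suc (len y)" "len (r \<otimes> \<phi> y) = Suc (len (\<phi> y))"
        using len_gen_mult[OF r, of y] len_gen_mult[OF r, of "\<phi> y"] y by auto
      have cy: "covered_by y (\<phi> y)"
        using cu y l phi_cover[OF y(1)] by (auto simp: covered_by_iff)
      have "coat (r \<otimes> \<phi> y) = {r \<otimes> y} \<union> {\<phi>' v | v. covered_by v (r \<otimes> y) \<and> covered_by v (\<phi>' v)}"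
      proof (rule coat_gen_mult_phi[OF r y(1) cy y(3,4)])
        fix v assume v: "covered_by v y" "len (r \<otimes> v) < len v"
        have vQ: "v \<in> Q" using Q_cover y v by blast
        then have "r \<otimes> v \<in> Q" using Q_down bruhat_gen_down[OF r _ v(2)] by simp
        then show "\<phi> v = r \<otimes> \<phi> (r \<otimes> v)" using comm[of "r \<otimes> v"] vQ r by simp
      next
        fix v assume v: "covered_by v y"
        then show "\<phi>' (r \<otimes> v) = r \<otimes> \<phi> v" using f Q_cover y by blast
      qed (use y in \<open>simp add: \<phi>'_def\<close>)
      then show ?thesis using y by simp
    qed
  qed
qed

lemma left_regular_if_commuting:
  assumes max: "maximal_distinguished_matching Q \<phi>" and "left_commuting r"
  shows "left_regular Q \<phi> r"
proof -
  have r: "r \<in> S" and comm: "\<And>x. x \<in> Q \<Longrightarrow> r \<otimes> x \<in> Q \<Longrightarrow> \<phi> (r \<otimes> x) = r \<otimes> \<phi> x"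
    using assms(2) by (simp_all add: left_commuting_def)
  have "Q \<union> (\<lambda>x. r \<otimes> x) ` Q \<subseteq> Q"
  proof -
    have "matching_le Q \<phi> (Q \<union> (\<lambda>x. r \<otimes> x) ` Q) (\<lambda>x. if x \<in> Q then \<phi> x else r \<otimes> \<phi> (r \<otimes> x))"
      by (simp add: matching_le_def)
    with left_commuting_extension[OF assms(2)]
    have "matching_le (Q \<union> (\<lambda>x. r \<otimes> x) ` Q) (\<lambda>x. if x \<in> Q then \<phi> x else r \<otimes> \<phi> (r \<otimes> x)) Q \<phi>"
      using max unfolding maximal_distinguished_matching_def by blast
    then show ?thesis by (simp add: matching_le_def)
  qed
  then show ?thesis using r comm unfolding left_regular_def by blast
qed

end

section \<open>Transfer to right multiplication\<close>

context distinguished_matching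
begin

abbreviation "Q_inv \<equiv> (\<lambda>x. inv x) ` Q"
abbreviation "phi_inv \<equiv> \<lambda>x. inv (\<phi> (inv x))"

lemma Q_inv_iff: "x \<in> carrier W \<Longrightarrow> x \<in> Q_inv \<longleftrightarrow> inv x \<in> Q"
proof
  assume "x \<in> carrier W" "inv x \<in> Q"
  then show "x \<in> Q_inv" by (intro image_eqI[of _ _ "inv x"]) auto
qed auto

interpretation mirror: distinguished_matching W S m Q_inv phi_inv
  by unfold_locales (rule mirror_matching[OF matching])

lemma mirror_left_commuting: "mirror.left_commuting r \<longleftrightarrow> right_commuting r"
proof (cases "r \<in> S")
  case True
  have "(\<forall>x \<in> Q_inv. r \<otimes> x \<in> Q_inv \<longrightarrow> phi_inv (r \<otimes> x) = r \<otimes> phi_inv x) \<longleftrightarrow>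
     (\<forall>x \<in> Q. r \<otimes> inv x \<in> Q_inv \<longrightarrow> phi_inv (r \<otimes> inv x) = r \<otimes> inv (\<phi> x))"
    by simp
  also have "\<dots> \<longleftrightarrow> (\<forall>x \<in> Q. x \<otimes> r \<in> Q \<longrightarrow> \<phi> (x \<otimes> r) = \<phi> x \<otimes> r)"
  proof (rule ball_cong[OF refl])
    fix x assume x: "x \<in> Q"
    have i: "inv (r \<otimes> inv x) = x \<otimes> r" using x True by (simp add: inv_mult_group)
    have q: "r \<otimes> inv x \<in> Q_inv \<longleftrightarrow> x \<otimes> r \<in> Q" using Q_inv_iff[of "r \<otimes> inv x"] x True i by simp
    have "r \<otimes> inv (\<phi> x) = inv (\<phi> x \<otimes> r)" using x True by (simp add: inv_mult_group)
    moreover have "inv (\<phi> (x \<otimes> r)) = inv (\<phi> x \<otimes> r) \<longleftrightarrow> \<phi> (x \<otimes> r) = \<phi> x \<otimes> r" if "x \<otimes> r \<in> Q"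
      using x True that by (metis inv_inv Q_closed phi_Q m_closed gen_closed)
    ultimately show "(r \<otimes> inv x \<in> Q_inv \<longrightarrow> phi_inv (r \<otimes> inv x) = r \<otimes> inv (\<phi> x)) \<longleftrightarrow>
        (x \<otimes> r \<in> Q \<longrightarrow> \<phi> (x \<otimes> r) = \<phi> x \<otimes> r)"
      unfolding i q by simp
  qed
  finally show ?thesis unfolding mirror.left_commuting_def right_commuting_def by simp
qed (simp add: mirror.left_commuting_def right_commuting_def)

text \<open>Maximality is known for \<open>Q\<close> and not for its mirror image, so the extension
  made on the mirror side is inverted back before it is compared with \<open>Q\<close>.\<close>

lemma right_regular_if_commuting:
  assumes max: "maximal_distinguished_matching Q \<phi>" and "right_commuting r"
  shows "right_regular Q \<phi> r"
proof -
  have r: "r \<in> S" and comm: "\<And>x. x \<in> Q \<Longrightarrow> x \<otimes> r \<in> Q \<Longrightarrow> \<phi> (x \<otimes> r) = \<phi> x \<otimes> r"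
    using assms(2) by (simp_all add: right_commuting_def)
  define Q1 where "Q1 = Q_inv \<union> (\<lambda>x. r \<otimes> x) ` Q_inv"
  define \<phi>1 where "\<phi>1 x = (if x \<in> Q_inv then phi_inv x else r \<otimes> phi_inv (r \<otimes> x))" for x
  have "partial_distinguished_matching Q1 \<phi>1"
    unfolding Q1_def \<phi>1_def using mirror.left_commuting_extension[of r] assms(2) mirror_left_commuting by blast
  then have pm: "partial_distinguished_matching ((\<lambda>x. inv x) ` Q1) (\<lambda>x. inv (\<phi>1 (inv x)))"
    by (rule mirror_matching)
  have Q1: "inv x \<in> Q1" if "x \<in> Q" for x using that by (simp add: Q1_def)
  have "matching_le Q \<phi> ((\<lambda>x. inv x) ` Q1) (\<lambda>x. inv (\<phi>1 (inv x)))"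
    unfolding matching_le_def
  proof (intro conjI ballI subsetI)
    fix x assume x: "x \<in> Q"
    show "x \<in> (\<lambda>x. inv x) ` Q1" using Q1[OF x] x by (intro image_eqI[of _ _ "inv x"]) auto
    show "inv (\<phi>1 (inv x)) = \<phi> x" using x by (simp add: \<phi>1_def)
  qed
  then have "matching_le ((\<lambda>x. inv x) ` Q1) (\<lambda>x. inv (\<phi>1 (inv x))) Q \<phi>"
    using max pm unfolding maximal_distinguished_matching_def by blast
  then have sub: "(\<lambda>x. inv x) ` Q1 \<subseteq> Q" by (simp add: matching_le_def)
  have "x \<otimes> r \<in> Q" if x: "x \<in> Q" for x
  proof -
    have "r \<otimes> inv x \<in> Q1" using x by (simp add: Q1_def)
    then have "inv (r \<otimes> inv x) \<in> Q" using sub by blast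
    then show ?thesis using x r by (simp add: inv_mult_group)
  qed
  then show ?thesis using r comm unfolding right_regular_def by blast
qed

end

subsection \<open>Matchings on all rank two parabolic subgroups\<close>

lemma subseq_insertE:
  assumes "subseq \<omega> \<zeta>" "c \<in> set \<zeta>" "c \<notin> set \<omega>" "length \<zeta> \<le> Suc (length \<omega>)"
  obtains \<alpha> \<beta> where "\<zeta> = \<alpha> @ c # \<beta>" "\<omega> = \<alpha> @ \<beta>"
proof -
  have "\<exists>\<alpha> \<beta>. \<zeta> = \<alpha> @ c # \<beta> \<and> \<omega> = \<alpha> @ \<beta>"
    using assms
  proof (induction rule: list_emb.induct)
    case (list_emb_Cons xs ys y)
    show ?case
    proof (cases "xs = ys")
      case True
      then have "y = c" using list_emb_Cons.prems by auto
      then show ?thesis using True by (rule_tac x = "[]" in exI, rule_tac x = ys in exI) simp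
    next
      case False
      then have "length xs < length ys"
        using subseq_same_length[OF list_emb_Cons.hyps] list_emb_length[OF list_emb_Cons.hyps] by fastforce
      then show ?thesis using list_emb_Cons.prems by simp
    qed
  next
    case (list_emb_Cons2 x y xs ys)
    then have "c \<in> set ys" "c \<notin> set xs" "length ys \<le> Suc (length xs)" by auto
    then obtain \<alpha> \<beta> where "ys = \<alpha> @ c # \<beta>" "xs = \<alpha> @ \<beta>" using list_emb_Cons2.IH by blast
    then show ?case using list_emb_Cons2.hyps by (intro exI[of _ "x # \<alpha>"] exI[of _ \<beta>]) simp
  next
    case (list_emb_Nil ys)
    then obtain y where "ys = [y]" by (cases ys) auto
    then show ?case using list_emb_Nil by simp
  qed
  then show ?thesis using that by blast
qed

text \<open>With its mirror image below, this locates the single inserted letter \<open>c\<close>: a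
  subword starting with \<open>c\<close> bounds the part after it from below, one ending with
  \<open>c\<close> the part before it.\<close>

lemma subseq_Cons_splitD: "subseq (c # y) (\<alpha> @ c # \<beta>) \<Longrightarrow> c \<notin> set \<alpha> \<Longrightarrow> subseq y \<beta>"
  by (induction \<alpha>) auto

lemma subseq_snoc_splitD: "subseq (x @ [c]) (\<alpha> @ c # \<beta>) \<Longrightarrow> c \<notin> set \<beta> \<Longrightarrow> subseq x \<alpha>"
  using subseq_Cons_splitD[of c "rev x" "rev \<beta>" "rev \<alpha>"] subseq_rev[of "x @ [c]" "\<alpha> @ c # \<beta>"]
    subseq_rev[of "rev x" "rev \<alpha>"] by simp

lemma subseq_length_less: "subseq x y \<Longrightarrow> x \<noteq> y \<Longrightarrow> length x < length y"
  using subseq_same_length[of x y] list_emb_length[of "(=)" x y] by fastforce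

lemma subseq_butlast: "subseq x y \<Longrightarrow> x \<noteq> [] \<Longrightarrow> last x \<noteq> last y \<Longrightarrow> subseq x (butlast y)"
proof (induction y rule: rev_induct)
  case (snoc a y)
  obtain x' e where x: "x = x' @ [e]" using snoc.prems(2) by (cases x rule: rev_cases) auto
  have "subseq (rev x) (rev (y @ [a]))" using subseq_rev snoc.prems by blast
  then have "subseq (rev x) (rev y)" using snoc.prems x by simp
  then show ?case using subseq_rev[of "rev x" "rev y"] by simp
qed simp

context coxeter_system
begin

lemma parabolic_mult:
  assumes "I \<subseteq> S" "x \<in> parabolic I" "y \<in> parabolic I" shows "x \<otimes> y \<in> parabolic I"
proof -
  obtain u v where "x = word_value u" "set u \<subseteq> I" "y = word_value v" "set v \<subseteq> I"
    using assms unfolding parabolic_def by blast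
  then have "x \<otimes> y = word_value (u @ v)" "set (u @ v) \<subseteq> I" using assms(1) by auto
  then show ?thesis unfolding parabolic_def by blast
qed

lemma gen_parabolic: "a \<in> I \<Longrightarrow> I \<subseteq> S \<Longrightarrow> a \<in> parabolic I"
  unfolding parabolic_def by (rule CollectI, rule exI[of _ "[a]"]) auto

lemma one_parabolic [simp]: "\<one> \<in> parabolic I"
  unfolding parabolic_def by (rule CollectI, rule exI[of _ "[]"]) simp

lemma parabolic_inv:
  assumes "I \<subseteq> S" "x \<in> parabolic I" shows "inv x \<in> parabolic I"
proof -
  obtain \<omega> where "x = word_value \<omega>" "set \<omega> \<subseteq> I" using assms(2) unfolding parabolic_def by blast
  then have "inv x = word_value (rev \<omega>)" "set (rev \<omega>) \<subseteq> I" using assms(1) by (auto simp: word_value_rev)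
  then show ?thesis unfolding parabolic_def by blast
qed

text \<open>Take a shortest \<open>z\<close> in the coset of \<open>x\<close>. Every reduced subword
  of \<open>z @ u\<close> with the same value keeps all of \<open>z\<close> by minimality, hence all
  of \<open>u\<close>, so appending to \<open>z\<close> stays reduced. As \<open>x\<close> has no
  right descent in \<open>J\<close>, it is \<open>z\<close>.\<close>

lemma reduced_append_parabolic:
  assumes x: "reduced x" "\<And>a. a \<in> J \<Longrightarrow> \<not> len (word_value x \<otimes> a) < len (word_value x)"
    and y: "reduced y" "set y \<subseteq> J" and J: "J \<subseteq> S"
  shows "reduced (x @ y)"
proof -
  define P where "P n \<longleftrightarrow> (\<exists>z v. reduced z \<and> set v \<subseteq> J \<and> reduced v \<and> word_value z \<otimes> word_value v = word_value x \<and> length z = n)" for n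
  have "P (length x)" unfolding P_def using x by (intro exI[of _ x] exI[of _ "[]"]) simp
  then have "P (LEAST n. P n)" and least: "\<And>k. P k \<Longrightarrow> (LEAST n. P n) \<le> k"
    by (auto intro: LeastI Least_le)
  then obtain z v where z: "reduced z" "set v \<subseteq> J" "reduced v" "word_value z \<otimes> word_value v = word_value x"
    "length z = (LEAST n. P n)" unfolding P_def[of "LEAST n. P n"] by auto
  have add: "reduced (z @ u)" if u: "reduced u" "set u \<subseteq> J" for u
  proof -
    obtain \<eta> where \<eta>: "reduced \<eta>" "subseq \<eta> (z @ u)" "word_value \<eta> = word_value (z @ u)"
      using ex_reduced_subseq[of "z @ u"] z u by auto
    then obtain \<eta>1 \<eta>2 where e: "\<eta> = \<eta>1 @ \<eta>2" "subseq \<eta>1 z" "subseq \<eta>2 u"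
      using subseq_append_iff by metis
    note R = reduced_append[OF \<eta>(1)[unfolded e(1)]]
    have S\<eta>: "set \<eta>2 \<subseteq> J" using subseq_subset[OF e(3)] u by blast
    have c: "word_value \<eta>1 \<in> carrier W" "word_value \<eta>2 \<in> carrier W" "word_value z \<in> carrier W"
      "word_value u \<in> carrier W" "word_value v \<in> carrier W" using R z u by simp_all
    have eq: "word_value \<eta>1 \<otimes> word_value \<eta>2 = word_value z \<otimes> word_value u" using \<eta>(3) e R z u by simp
    have "set (\<eta>2 @ rev u @ v) \<subseteq> S" using R z u by simp
    from ex_reduced_subseq[OF this] obtain v' where v': "reduced v'" "subseq v' (\<eta>2 @ rev u @ v)"
      "word_value v' = word_value (\<eta>2 @ rev u @ v)" by blast
    have "set v' \<subseteq> J" using subseq_subset[OF v'(2)] S\<eta> u z by auto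
    moreover have "word_value \<eta>1 \<otimes> word_value v' = word_value x"
    proof -
      have "word_value v' = word_value \<eta>2 \<otimes> (inv (word_value u) \<otimes> word_value v)"
        using v'(3) R u z by (simp add: word_value_rev)
      then have "word_value \<eta>1 \<otimes> word_value v' = (word_value \<eta>1 \<otimes> word_value \<eta>2) \<otimes> (inv (word_value u) \<otimes> word_value v)"
        using c by (simp add: m_assoc)
      also have "\<dots> = word_value z \<otimes> word_value v" unfolding eq using c by (simp add: m_assoc)
      finally show ?thesis using z by simp
    qed
    ultimately have "P (length \<eta>1)" unfolding P_def using R v' by blast
    then have "length z \<le> length \<eta>1" using least z(5) by metis
    then have "\<eta>1 = z" using subseq_length_less[OF e(2)] by force
    then have "word_value \<eta>2 = word_value u" using eq c by simp
    then have "length \<eta>2 = length u" using reduced_len R u by metis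
    then have "\<eta>2 = u" using subseq_length_less[OF e(3)] by force
    then show ?thesis using \<eta> e \<open>\<eta>1 = z\<close> by simp
  qed
  have "v = []"
  proof (rule ccontr)
    assume "v \<noteq> []"
    then obtain v0 a where v: "v = v0 @ [a]" by (cases v rule: rev_cases) auto
    have aJ: "a \<in> J" "a \<in> S" using z v J by auto
    have zv: "reduced ((z @ v0) @ [a])" using add[OF z(3,2)] v by simp
    have S0: "set z \<subseteq> S" "set v0 \<subseteq> S" using z v J by auto
    have "word_value ((z @ v0) @ [a]) = word_value x" using z(4) S0 aJ v by (simp add: m_assoc)
    moreover have "len (word_value (z @ v0)) < len (word_value (z @ v0) \<otimes> a)" using zv reduced_snoc_iff by blast
    moreover have "word_value ((z @ v0) @ [a]) \<otimes> a = word_value (z @ v0)"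
      using S0 aJ by (simp add: m_assoc)
    moreover have "word_value ((z @ v0) @ [a]) = word_value (z @ v0) \<otimes> a"
      using reducedD[OF zv] aJ by (subst word_value_append) auto
    ultimately show False using x(2)[OF aJ(1)] by metis
  qed
  then have zx: "word_value z = word_value x" using z by simp
  have R: "reduced (z @ y)" using add y by blast
  show ?thesis using reduced_replace(1)[OF R x(1)] zx by simp
qed

lemma reduced_append_parabolic_left:
  assumes y: "reduced y" "\<And>a. a \<in> J \<Longrightarrow> \<not> len (a \<otimes> word_value y) < len (word_value y)"
    and x: "reduced x" "set x \<subseteq> J" and J: "J \<subseteq> S"
  shows "reduced (x @ y)"
proof -
  have "reduced (rev y @ rev x)"
  proof (rule reduced_append_parabolic)
    fix a assume a: "a \<in> J"
    have "word_value (rev y) \<otimes> a = inv (a \<otimes> word_value y)"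
      using a J y by (auto simp: word_value_rev inv_mult_group)
    then have "len (word_value (rev y) \<otimes> a) = len (a \<otimes> word_value y)"
      using a J y(1) len_inv[of "a \<otimes> word_value y"] by auto
    then show "\<not> len (word_value (rev y) \<otimes> a) < len (word_value (rev y))"
      using y a by (simp add: word_value_rev)
  qed (use x y J in simp_all)
  then show ?thesis using reduced_rev[of "x @ y"] by simp
qed

lemma unique_word_left_descent:
  assumes "unique_word \<omega>" "a \<in> S" "len (a \<otimes> word_value \<omega>) < len (word_value \<omega>)"
  shows "\<omega> \<noteq> [] \<and> hd \<omega> = a"
proof -
  have c: "word_value \<omega> \<in> carrier W" using assms(1) by simp
  then obtain \<eta> where \<eta>: "reduced \<eta>" "word_value \<eta> = a \<otimes> word_value \<omega>"
    using ex_reduced[of "a \<otimes> word_value \<omega>"] assms(2) by auto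
  have "a # \<eta> = \<omega>" using reduced_Cons_descent[OF assms(2) c assms(3) \<eta>] assms(1) unfolding unique_word_def by blast
  then show ?thesis by auto
qed

lemma right_descent_word:
  assumes "x \<in> carrier W" "a \<in> S" "len (x \<otimes> a) < len x" "reduced \<eta>" "word_value \<eta> = x \<otimes> a"
  shows "reduced (\<eta> @ [a])" "word_value (\<eta> @ [a]) = x"
  using assms by (auto simp: reduced_snoc_iff)

lemma unique_word_right_descent:
  assumes "unique_word \<omega>" "a \<in> S" "len (word_value \<omega> \<otimes> a) < len (word_value \<omega>)"
  shows "\<omega> \<noteq> [] \<and> last \<omega> = a"
proof -
  have c: "word_value \<omega> \<in> carrier W" using assms(1) by simp
  then obtain \<eta> where \<eta>: "reduced \<eta>" "word_value \<eta> = word_value \<omega> \<otimes> a"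
    using ex_reduced[of "word_value \<omega> \<otimes> a"] assms(2) by auto
  have "\<eta> @ [a] = \<omega>" using right_descent_word[OF c assms(2,3) \<eta>] assms(1) unfolding unique_word_def by blast
  then show ?thesis by auto
qed

lemma reduced_snoc_new:
  assumes "reduced \<omega>" "c \<in> S" "c \<notin> set \<omega>" shows "reduced (\<omega> @ [c])"
proof (rule ccontr)
  assume "\<not> reduced (\<omega> @ [c])"
  then have d: "len (word_value \<omega> \<otimes> c) < len (word_value \<omega>)"
    using reduced_snoc_iff[of \<omega> c] len_mult_gen[of c "word_value \<omega>"] assms by auto
  obtain \<eta> where \<eta>: "reduced \<eta>" "word_value \<eta> = word_value \<omega> \<otimes> c"
    using ex_reduced[of "word_value \<omega> \<otimes> c"] assms by auto
  have "set (\<eta> @ [c]) = set \<omega>"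
    using right_descent_word[OF _ assms(2) d \<eta>] reduced_set_eq[of "\<eta> @ [c]" \<omega>] assms(1) by simp
  then show False using assms(3) by auto
qed

lemma reduced_prefix_descent:
  assumes "reduced (u @ v)" "a \<in> S" "len (a \<otimes> word_value u) < len (word_value u)"
  shows "len (a \<otimes> word_value (u @ v)) < len (word_value (u @ v))"
proof -
  note R = reduced_append[OF assms(1)]
  have S: "set u \<subseteq> S" "set v \<subseteq> S" using R by simp_all
  have "len (a \<otimes> word_value (u @ v)) = len ((a \<otimes> word_value u) \<otimes> word_value v)"
    using S assms(2) by (simp add: m_assoc)
  also have "\<dots> \<le> len (a \<otimes> word_value u) + len (word_value v)" using S assms(2) by (intro len_mult_le) auto
  also have "\<dots> < length u + length v" using assms(3) R by (simp add: reduced_len)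
  finally show ?thesis using reduced_len[OF assms(1)] by simp
qed

lemma reduced_hd_descent: "reduced (a # \<omega>) \<Longrightarrow> len (a \<otimes> word_value (a # \<omega>)) < len (word_value (a # \<omega>))"
  by (auto simp: reduced_Cons_iff)

lemma reduced_last_descent:
  assumes "reduced (\<omega> @ [a])" shows "len (word_value (\<omega> @ [a]) \<otimes> a) < len (word_value (\<omega> @ [a]))"
proof -
  have "a \<in> S" "reduced \<omega>" "len (word_value \<omega>) < len (word_value \<omega> \<otimes> a)"
    using assms by (simp_all add: reduced_snoc_iff)
  then show ?thesis by simp
qed

end

context finite_order_coxeter_system
begin

lemma dihedral_word_cases:
  assumes "dihedral_word a c \<omega>"
  obtains "\<omega> = alternating (length \<omega>) a c" | "\<omega> = alternating (length \<omega>) c a"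
proof (cases "\<omega> = []")
  case False
  then consider "hd \<omega> = a" | "hd \<omega> = c" using dihedral_word_hd[OF assms] by blast
  then show ?thesis
  proof cases
    case 1
    then show ?thesis using that(1) dihedral_word_eq[OF assms False] by blast
  next
    case 2
    then show ?thesis
      using that(2) dihedral_word_eq[OF assms[unfolded dihedral_word_commute[of a c]] False] by blast
  qed
qed (use that in simp)

lemma dihedral_word_reduced:
  assumes "a \<in> S" "c \<in> S" "a \<noteq> c" "dihedral_word a c \<omega>" "length \<omega> \<le> ord a c"
  shows "reduced \<omega>"
  using assms(4)
proof (cases rule: dihedral_word_cases)
  case 1
  then show ?thesis using reduced_alternating[OF assms(1-3) m_ord assms(5)] assms by simp
next
  case 2
  then show ?thesis
    using reduced_alternating[OF assms(2,1) assms(3)[symmetric] m_ord, of "length \<omega>"] assms ord_sym by simp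
qed

lemma longest_word_eq:
  assumes "a \<in> S" "c \<in> S" "a \<noteq> c" "dihedral_word a c \<omega>" "dihedral_word a c \<eta>"
    "length \<omega> = ord a c" "length \<eta> = ord a c"
  shows "word_value \<omega> = word_value \<eta>"
  using alternating_longest_eq[OF assms(1-3) m_ord] dihedral_word_cases[OF assms(4)]
    dihedral_word_cases[OF assms(5)] assms by metis

text \<open>In a longer word, the last \<open>ord a c\<close> of its first
  \<open>ord a c + 1\<close> letters can be replaced by the other word of the longest element, which
  starts with the letter in front of it and cancels.\<close>

lemma reduced_dihedral_length_le:
  assumes a: "a \<in> S" "c \<in> S" "a \<noteq> c" and \<omega>: "reduced \<omega>" "set \<omega> \<subseteq> {a, c}"
  shows "length \<omega> \<le> ord a c"
proof (rule ccontr)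
  assume "\<not> ?thesis"
  then have l: "length \<omega> > ord a c" by simp
  define u where "u = take (Suc (ord a c)) \<omega>"
  have ru: "reduced u" using reduced_append(1)[of u "drop (Suc (ord a c)) \<omega>"] \<omega> by (simp add: u_def)
  have lu: "length u = Suc (ord a c)" using l by (simp add: u_def)
  have "set u \<subseteq> {a, c}" using \<omega>(2) set_take_subset[of "Suc (ord a c)" \<omega>] unfolding u_def by blast
  then have du: "dihedral_word a c u" using reduced_dihedral_word ru by blast
  obtain x u' where u: "u = x # u'" using lu by (cases u) auto
  have du': "dihedral_word a c u'" using du dihedral_word_append[of a c "[x]" u'] u by simp
  have k: "2 \<le> ord a c" using ord_ge_2 a by blast
  have "u' \<noteq> []" using lu u k by auto
  then have x: "x \<in> {a, c}" "hd u' \<in> {a, c}" "hd u' \<noteq> x"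
    using du dihedral_word_hd[OF du'] u by (auto simp: dihedral_word_def distinct_adj_Cons)
  define y where "y = (if x = a then c else a)"
  have y: "y \<in> {a, c}" "y \<noteq> x" using a by (auto simp: y_def)
  have d: "dihedral_word a c (alternating (ord a c) x y)"
    using x y a dihedral_word_alternating[of x y "ord a c"] dihedral_word_commute[of a c] by auto
  then have eq: "word_value (alternating (ord a c) x y) = word_value u'"
    using longest_word_eq[OF a _ du'] lu u by simp
  obtain j where j: "ord a c = Suc j" using k by (cases "ord a c") auto
  have S: "set (alternating j y x) \<subseteq> S" using alternating_closed x y a by blast
  have "word_value u = x \<otimes> (x \<otimes> word_value (alternating j y x))" using u eq j by simp
  also have "\<dots> = word_value (alternating j y x)" using S x a by auto
  finally have "len (word_value u) \<le> j" using len_le[OF S] by simp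
  then show False using reduced_len[OF ru] lu j by simp
qed

lemma parabolic_wordE:
  assumes a: "a \<in> S" "c \<in> S" "a \<noteq> c" and x: "x \<in> parabolic {a, c}"
  obtains \<omega> where "dihedral_word a c \<omega>" "length \<omega> \<le> ord a c" "reduced \<omega>" "word_value \<omega> = x"
proof -
  have I: "{a, c} \<subseteq> S" using a by simp
  obtain \<omega> where \<omega>: "reduced \<omega>" "word_value \<omega> = x" using ex_reduced parabolic_closed[OF I x] by blast
  then have s: "set \<omega> \<subseteq> {a, c}" using reduced_parabolic_iff[OF \<omega>(1) I] x by simp
  show ?thesis using that[OF reduced_dihedral_word[OF \<omega>(1) s] reduced_dihedral_length_le[OF a \<omega>(1) s] \<omega>] .
qed

end

text \<open>The consequences of a full orbit for the matching alone: \<open>Q\<close> is decreasing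
  and contains the top of the orbit, hence every longest dihedral element. So \<open>\<phi>\<close>
  restricts to each subgroup \<open>parabolic {base, t}\<close>.\<close>

locale full_matching = distinguished_matching + finite_order_coxeter_system +
  assumes longest_Q: "a \<in> S \<Longrightarrow> c \<in> S \<Longrightarrow> dihedral_longest a c \<in> Q"
    and one_in_Q: "\<one> \<in> Q"
begin

lemma base_S [simp]: "base \<in> S"
  using base_gen one_in_Q by blast

lemma phi_one: "\<phi> \<one> = base"
  by (simp add: base_def)

lemma phi_base: "\<phi> base = \<one>"
  using phi_phi[OF one_in_Q] by (simp add: base_def)

lemma dihedral_longest_value: "a \<in> S \<Longrightarrow> c \<in> S \<Longrightarrow> dihedral_longest a c = word_value (alternating (ord a c) a c)"
  by (simp add: dihedral_longest_def word_value_def ord_def)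

lemma gen_Q [simp]: "a \<in> S \<Longrightarrow> a \<in> Q"
  using longest_Q[of a a] dihedral_longest_value[of a a] matrix_diag[of a] by (simp add: ord_def one_enat_def)

lemma dihedral_word_le_longest:
  assumes a: "a \<in> S" "c \<in> S" "a \<noteq> c" and \<omega>: "dihedral_word a c \<omega>" "length \<omega> \<le> ord a c"
  shows "bruhat_le (word_value \<omega>) (dihedral_longest a c)"
proof -
  have *: "bruhat_le (word_value (alternating n x y)) (word_value (alternating (ord x y) x y))"
    if xy: "x \<in> S" "y \<in> S" "x \<noteq> y" "n \<le> ord x y" for x y n
  proof -
    have "alternating (n + (ord x y - n)) x y = alternating (ord x y) x y" using xy by simp
    then have "subseq (alternating n x y) (alternating (ord x y) x y)"
      using alternating_add[of n "ord x y - n" x y] by (metis subseq_rev_drop_many subseq_order.order_refl)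
    then show ?thesis using subseq_bruhat reduced_alternating[OF xy(1-3) m_ord[OF xy(1,2)]] by blast
  qed
  have e: "word_value (alternating (ord a c) a c) = word_value (alternating (ord a c) c a)"
    by (rule alternating_longest_eq[OF a m_ord[OF a(1,2)]])
  show ?thesis using \<omega>(1)
  proof (cases rule: dihedral_word_cases)
    case 1
    then show ?thesis using *[OF a \<omega>(2)] dihedral_longest_value[OF a(1,2)] by simp
  next
    case 2
    then show ?thesis using *[of c a "length \<omega>"] a \<omega>(2) ord_sym[OF a(1,2)] e dihedral_longest_value[OF a(1,2)] by simp
  qed
qed

lemma dihedral_word_Q:
  assumes a: "a \<in> S" "c \<in> S" "a \<noteq> c" and \<omega>: "dihedral_word a c \<omega>" "length \<omega> \<le> ord a c"
  shows "word_value \<omega> \<in> Q"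
  using Q_down[OF longest_Q[OF a(1,2)] dihedral_word_le_longest[OF assms]] .

lemma parabolic_Q:
  assumes "a \<in> S" "c \<in> S" "x \<in> parabolic {a, c}" shows "x \<in> Q"
proof (cases "a = c")
  case False
  then show ?thesis using parabolic_wordE[OF assms(1,2) False assms(3)] dihedral_word_Q[OF assms(1,2) False] by metis
next
  case True
  have I: "{a, c} \<subseteq> S" using assms by simp
  obtain \<omega> where \<omega>: "reduced \<omega>" "word_value \<omega> = x" using ex_reduced parabolic_closed[OF I assms(3)] by blast
  then have s: "set \<omega> \<subseteq> {a}" using reduced_parabolic_iff[OF \<omega>(1) I] assms True by simp
  have da: "distinct_adj \<omega>" using reduced_distinct_adj \<omega> by blast
  have "\<omega> = [] \<or> \<omega> = [a]"
  proof (cases \<omega>)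
    case (Cons x xs)
    then show ?thesis using s da by (cases xs) auto
  qed simp
  then show ?thesis using \<omega> assms one_in_Q by auto
qed

lemma right_commuting_if_dihedral:
  assumes r: "r \<in> S"
    and dih: "\<And>t x. t \<in> S \<Longrightarrow> r \<in> {base, t} \<Longrightarrow> x \<in> parabolic {base, t} \<Longrightarrow> \<phi> (x \<otimes> r) = \<phi> x \<otimes> r"
  shows "right_commuting r"
proof -
  interpret mirror: distinguished_matching W S m "(\<lambda>x. inv x) ` Q" "\<lambda>x. inv (\<phi> (inv x))"
    by unfold_locales (rule mirror_matching[OF matching])
  have b: "mirror.base = base" by (simp add: mirror.base_def phi_one)
  have "mirror.left_commuting r"
  proof (rule mirror.left_commuting_if_dihedral[OF r], unfold b)
    fix t x assume t: "t \<in> S" "r \<in> {base, t}" and x: "x \<in> parabolic {base, t}"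
    have I: "{base, t} \<subseteq> S" using t by simp
    have xc: "x \<in> carrier W" using parabolic_closed[OF I x] .
    have ix: "inv x \<in> parabolic {base, t}" using parabolic_inv[OF I x] .
    have "inv (r \<otimes> x) = inv x \<otimes> r" using xc r by (simp add: inv_mult_group)
    then have "inv (\<phi> (inv (r \<otimes> x))) = inv (\<phi> (inv x) \<otimes> r)" using dih[OF t ix] by simp
    also have "\<dots> = r \<otimes> inv (\<phi> (inv x))"
      using r parabolic_Q[OF base_S t(1) ix] by (simp add: inv_mult_group)
    finally show "inv (\<phi> (inv (r \<otimes> x))) = r \<otimes> inv (\<phi> (inv x))" .
  qed
  then show ?thesis using mirror_left_commuting by blast
qed

lemma phi_gen_cases:
  assumes t: "t \<in> S" "t \<noteq> base"
  shows "\<phi> t = t \<otimes> base \<or> \<phi> t = base \<otimes> t"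
proof -
  have tQ: "t \<in> Q" using t by simp
  have l: "len (\<phi> t) = 2" using lower_gen(2)[OF tQ t] phi_len[OF tQ] t by auto
  have par: "\<phi> t \<in> parabolic {base, t}"
    using phi_parabolic[OF tQ gen_parabolic] t by simp
  obtain \<omega> where \<omega>: "dihedral_word base t \<omega>" "reduced \<omega>" "word_value \<omega> = \<phi> t"
    using parabolic_wordE[OF base_S t(1) t(2)[symmetric] par] by metis
  then have "length \<omega> = 2" using reduced_len l by metis
  then obtain x y where "\<omega> = [x, y]" by (auto simp: length_Suc_conv numeral_2_eq_2)
  then show ?thesis using \<omega> t by (auto simp: dihedral_word_def)
qed

text \<open>If \<open>t\<close> commutes with \<open>base\<close>, then
  \<open>t \<otimes> base\<close> and \<open>base \<otimes> t\<close> coincide and the side is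
  meaningless; such generators are separated as \<open>central_type\<close>.\<close>

definition right_type :: "'a \<Rightarrow> bool" where
  "right_type t \<longleftrightarrow> t \<in> S \<and> t \<noteq> base \<and> t \<otimes> base \<noteq> base \<otimes> t \<and> \<phi> t = t \<otimes> base"

definition left_type :: "'a \<Rightarrow> bool" where
  "left_type t \<longleftrightarrow> t \<in> S \<and> t \<noteq> base \<and> t \<otimes> base \<noteq> base \<otimes> t \<and> \<phi> t = base \<otimes> t"

definition central_type :: "'a \<Rightarrow> bool" where
  "central_type t \<longleftrightarrow> t \<in> S \<and> t \<noteq> base \<and> t \<otimes> base = base \<otimes> t"

lemma type_cases:
  assumes "t \<in> S"
  obtains "t = base" | "right_type t" | "left_type t" | "central_type t"
  using phi_gen_cases[of t] assms unfolding right_type_def left_type_def central_type_def by blast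

lemma right_typeD: "right_type t \<Longrightarrow> t \<in> S \<and> t \<noteq> base"
  and left_typeD: "left_type t \<Longrightarrow> t \<in> S \<and> t \<noteq> base"
  and central_typeD: "central_type t \<Longrightarrow> t \<in> S \<and> t \<noteq> base"
  by (simp_all add: right_type_def left_type_def central_type_def)

lemma type_distinct:
  "right_type t \<Longrightarrow> \<not> left_type t" "right_type t \<Longrightarrow> \<not> central_type t" "left_type t \<Longrightarrow> \<not> central_type t"
  by (auto simp: right_type_def left_type_def central_type_def)

definition right_mult_on :: "'a \<Rightarrow> bool" where
  "right_mult_on t \<longleftrightarrow> (\<forall>x \<in> parabolic {base, t}. \<phi> x = x \<otimes> base)"

definition left_mult_on :: "'a \<Rightarrow> bool" where
  "left_mult_on t \<longleftrightarrow> (\<forall>x \<in> parabolic {base, t}. \<phi> x = base \<otimes> x)"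

lemma parabolic_gen_mult:
  assumes "t \<in> S" "f \<in> {base, t}" "x \<in> parabolic {base, t}"
  shows "f \<otimes> x \<in> parabolic {base, t}" "x \<otimes> f \<in> parabolic {base, t}"
proof -
  have I: "{base, t} \<subseteq> S" using assms by simp
  show "f \<otimes> x \<in> parabolic {base, t}" "x \<otimes> f \<in> parabolic {base, t}"
    using parabolic_mult[OF I] gen_parabolic[OF assms(2) I] assms(3) by blast+
qed

lemma parabolic_carrier: "t \<in> S \<Longrightarrow> x \<in> parabolic {base, t} \<Longrightarrow> x \<in> carrier W"
  using parabolic_closed[of "{base, t}" x] by simp

text \<open>The order is two, so there are at most four elements to check, and left and right
  multiplication by \<open>base\<close> agree on them.\<close>

lemma central_mult_on:
  assumes "central_type t" shows "right_mult_on t" "left_mult_on t"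
proof -
  have t: "t \<in> S" "t \<noteq> base" "t \<otimes> base = base \<otimes> t" using assms by (simp_all add: central_type_def)
  have "\<not> 3 \<le> ord base t"
  proof
    assume "3 \<le> ord base t"
    then have "word_value (alternating 2 base t) \<noteq> word_value (alternating 2 t base)"
      using alternating_value_neq[OF base_S t(1) t(2)[symmetric] m_ord[OF base_S t(1)], of 2] by simp
    then show False using t by (simp add: numeral_2_eq_2)
  qed
  then have o: "ord base t = 2" using ord_ge_2[OF base_S t(1)] t(2) by force
  have ft: "\<phi> t = t \<otimes> base" using phi_gen_cases[OF t(1,2)] t(3) by auto
  have ftb: "\<phi> (t \<otimes> base) = t" using ft phi_phi[of t] t by simp
  have "\<phi> x = x \<otimes> base \<and> \<phi> x = base \<otimes> x" if x: "x \<in> parabolic {base, t}" for x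
  proof -
    obtain \<omega> where \<omega>: "dihedral_word base t \<omega>" "length \<omega> \<le> 2" "reduced \<omega>" "word_value \<omega> = x"
      using parabolic_wordE[OF base_S t(1) t(2)[symmetric] x] o by metis
    consider "\<omega> = []" | "\<omega> = [base]" | "\<omega> = [t]" | "\<omega> = [t, base]" | "\<omega> = [base, t]"
    proof (cases \<omega>)
      case (Cons p \<omega>')
      then show ?thesis
        using \<omega>(1,2) that by (cases \<omega>') (auto simp: dihedral_word_def)
    qed (use that in simp)
    moreover have "base \<otimes> t \<otimes> base = t" using t by (simp add: m_assoc)
    moreover have "\<phi> (base \<otimes> t) = t" using ftb t(3) by simp
    ultimately show ?thesis
      unfolding \<omega>(4)[symmetric] using phi_one phi_base ft t by cases simp_all
  qed
  then show "right_mult_on t" "left_mult_on t" unfolding right_mult_on_def left_mult_on_def by blast+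
qed

text \<open>Right multiplication by \<open>base\<close> commutes with left multiplication by
  associativity. As \<open>t\<close> differs from \<open>base\<close>, the only dihedral subgroup to
  be tested is the one on which \<open>\<phi>\<close> is known.\<close>

lemma left_commuting_of_right_mult:
  assumes "t \<in> S" "t \<noteq> base" "right_mult_on t" shows "left_commuting t"
proof (rule left_commuting_if_dihedral[OF assms(1)])
  fix t' x assume *: "t' \<in> S" "t \<in> {base, t'}" "x \<in> parabolic {base, t'}"
  then have t': "t' = t" using assms by auto
  have "t \<otimes> x \<in> parabolic {base, t}" using parabolic_gen_mult(1)[of t t x] * t' by simp
  then show "\<phi> (t \<otimes> x) = t \<otimes> \<phi> x"
    using assms * t' parabolic_carrier[of t x] by (simp add: right_mult_on_def m_assoc)
qed

lemma right_commuting_of_left_mult: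
  assumes "t \<in> S" "t \<noteq> base" "left_mult_on t" shows "right_commuting t"
proof (rule right_commuting_if_dihedral[OF assms(1)])
  fix t' x assume *: "t' \<in> S" "t \<in> {base, t'}" "x \<in> parabolic {base, t'}"
  then have t': "t' = t" using assms by auto
  have "x \<otimes> t \<in> parabolic {base, t}" using parabolic_gen_mult(2)[of t t x] * t' by simp
  then show "\<phi> (x \<otimes> t) = \<phi> x \<otimes> t"
    using assms * t' parabolic_carrier[of t x] by (simp add: left_mult_on_def m_assoc)
qed

lemma right_mult_on_base: "right_mult_on base"
proof -
  have "\<phi> x = x \<otimes> base" if x: "x \<in> parabolic {base, base}" for x
  proof -
    have I: "{base, base} \<subseteq> S" by simp
    obtain \<omega> where \<omega>: "reduced \<omega>" "word_value \<omega> = x" using ex_reduced parabolic_closed[OF I x] by blast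
    then have s: "set \<omega> \<subseteq> {base}" using reduced_parabolic_iff[OF \<omega>(1) I] x by simp
    have "distinct_adj \<omega>" using reduced_distinct_adj \<omega> by blast
    then have "\<omega> = [] \<or> \<omega> = [base]" using s by (cases \<omega>; cases "tl \<omega>") auto
    then show ?thesis using \<omega> phi_one phi_base by auto
  qed
  then show ?thesis by (simp add: right_mult_on_def)
qed

lemma base_commutes_on:
  assumes t: "t \<in> S" and "right_mult_on t \<or> left_mult_on t" and x: "x \<in> parabolic {base, t}"
  shows "\<phi> (base \<otimes> x) = base \<otimes> \<phi> x" "\<phi> (x \<otimes> base) = \<phi> x \<otimes> base"
proof -
  have p: "base \<otimes> x \<in> parabolic {base, t}" "x \<otimes> base \<in> parabolic {base, t}"
    using parabolic_gen_mult[OF t _ x] by auto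
  have c: "x \<in> carrier W" using parabolic_carrier[OF t x] .
  show "\<phi> (base \<otimes> x) = base \<otimes> \<phi> x" "\<phi> (x \<otimes> base) = \<phi> x \<otimes> base"
    using assms(2) p x c by (auto simp: right_mult_on_def left_mult_on_def m_assoc)
qed

lemma not_left_commutingE:
  assumes "\<not> left_commuting f" "f \<in> S"
  obtains t x where "t \<in> S" "t \<noteq> base" "f \<in> {base, t}" "x \<in> parabolic {base, t}" "\<phi> (f \<otimes> x) \<noteq> f \<otimes> \<phi> x"
proof -
  obtain t x where *: "t \<in> S" "f \<in> {base, t}" "x \<in> parabolic {base, t}" "\<phi> (f \<otimes> x) \<noteq> f \<otimes> \<phi> x"
    using left_commuting_if_dihedral[OF assms(2)] assms(1) by blast
  have "t \<noteq> base"
  proof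
    assume "t = base"
    then show False using base_commutes_on(1)[of base x] right_mult_on_base * by auto
  qed
  then show ?thesis using that * by blast
qed

lemma not_right_commutingE:
  assumes "\<not> right_commuting f" "f \<in> S"
  obtains t x where "t \<in> S" "t \<noteq> base" "f \<in> {base, t}" "x \<in> parabolic {base, t}" "\<phi> (x \<otimes> f) \<noteq> \<phi> x \<otimes> f"
proof -
  obtain t x where *: "t \<in> S" "f \<in> {base, t}" "x \<in> parabolic {base, t}" "\<phi> (x \<otimes> f) \<noteq> \<phi> x \<otimes> f"
    using right_commuting_if_dihedral[OF assms(2)] assms(1) by blast
  have "t \<noteq> base"
  proof
    assume "t = base"
    then show False using base_commutes_on(2)[of base x] right_mult_on_base * by auto
  qed
  then show ?thesis using that * by blast
qed

end

lemma subseq_insert_cases: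
  assumes "subseq \<omega> \<zeta>" "length \<zeta> \<le> Suc (length \<omega>)"
  obtains "\<zeta> = \<omega>" | \<alpha> e \<beta> where "\<omega> = \<alpha> @ \<beta>" "\<zeta> = \<alpha> @ e # \<beta>"
proof -
  have "\<zeta> = \<omega> \<or> (\<exists>\<alpha> e \<beta>. \<omega> = \<alpha> @ \<beta> \<and> \<zeta> = \<alpha> @ e # \<beta>)"
    using assms
  proof (induction rule: list_emb.induct)
    case (list_emb_Nil ys)
    then show ?case by (cases ys) auto
  next
    case (list_emb_Cons xs ys y)
    then have "xs = ys" using subseq_length_less by force
    then show ?case by (metis append_Nil)
  next
    case (list_emb_Cons2 x y xs ys)
    then have "ys = xs \<or> (\<exists>\<alpha> e \<beta>. xs = \<alpha> @ \<beta> \<and> ys = \<alpha> @ e # \<beta>)" by simp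
    then show ?case using list_emb_Cons2.hyps(1) by (metis append_Cons)
  qed
  then show ?thesis using that by blast
qed

lemma dihedral_word_snocD: "dihedral_word a c (\<omega> @ [e]) \<Longrightarrow> \<omega> \<noteq> [] \<Longrightarrow> e \<noteq> last \<omega> \<and> e \<in> {a, c}"
  by (auto simp: dihedral_word_def distinct_adj_append_iff)

lemma dihedral_word_ConsD: "dihedral_word a c (f # \<omega>) \<Longrightarrow> \<omega> \<noteq> [] \<Longrightarrow> f \<noteq> hd \<omega> \<and> f \<in> {a, c}"
  by (auto simp: dihedral_word_def distinct_adj_Cons)

text \<open>The last letter of \<open>L\<close> that is \<open>a\<close> or \<open>c\<close>
  decides: it can be appended to the other of the two subwords.\<close>

lemma subseq_last_before:
  assumes "subseq (p @ [a]) L" "subseq (q @ [c]) L" "a \<noteq> c"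
  shows "subseq (p @ [a, c]) L \<or> subseq (q @ [c, a]) L"
  using assms
proof (induction L rule: rev_induct)
  case (snoc x L)
  have key: "subseq (u @ [b]) L" if "subseq (u @ [b]) (L @ [x])" "b \<noteq> x" for u b
    using subseq_butlast[OF that(1)] that(2) by simp
  consider "x \<noteq> a" "x \<noteq> c" | "x = a" "x \<noteq> c" | "x \<noteq> a" "x = c" using snoc.prems by blast
  then show ?case
  proof cases
    case 1
    then show ?thesis using snoc.IH key[of p a] key[of q c] snoc.prems subseq_rev_drop_many by metis
  next
    case 2
    then have "subseq (q @ [c]) L" using key snoc.prems by blast
    then have "subseq ((q @ [c]) @ [a]) (L @ [x])" using 2 by (intro list_emb_append_mono) auto
    then show ?thesis by simp
  next
    case 3
    then have "subseq (p @ [a]) L" using key snoc.prems by blast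
    then have "subseq ((p @ [a]) @ [c]) (L @ [x])" using 3 by (intro list_emb_append_mono) auto
    then show ?thesis by simp
  qed
qed simp

lemma subseq_interleave:
  assumes L: "\<not> subseq [l, s, t] L" and P: "subseq (p @ [s, t]) L" and R: "subseq (l # s # q) L"
    and d: "s \<noteq> t" "s \<noteq> l" "l \<noteq> t"
  shows "subseq (p @ [s, t, l, s] @ q) L \<or> subseq (p @ [s, l, t, s] @ q) L"
proof -
  have "\<exists>L1 L2. L = L1 @ t # L2 \<and> subseq (p @ [s]) L1"
  proof -
    have "subseq ((p @ [s]) @ [t]) L" using P by simp
    then obtain us vs where uv: "L = us @ vs" "subseq (p @ [s]) us" "subseq [t] vs"
      using list_emb_appendD by blast
    then obtain v1 v2 where "vs = v1 @ t # v2" by (auto simp: subseq_singleton_left dest: split_list)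
    then have "L = (us @ v1) @ t # v2" "subseq (p @ [s]) (us @ v1)" using uv subseq_rev_drop_many by simp_all
    then show ?thesis by blast
  qed
  then obtain L1 L2 where 1: "L = L1 @ t # L2" "subseq (p @ [s]) L1" by blast
  obtain L3 L4 where 2: "L = L3 @ l # L4" "subseq (s # q) L4"
    using list_emb_ConsD[OF R] by (metis)
  consider M where "L3 = L1 @ t # M" "L2 = M @ l # L4" | M where "L1 = L3 @ l # M" "L4 = M @ t # L2"
  proof -
    have "L1 @ t # L2 = L3 @ l # L4" using 1 2 by simp
    then consider us where "L1 @ us = L3" "t # L2 = us @ l # L4" | us where "L1 = L3 @ us" "us @ t # L2 = l # L4"
      unfolding append_eq_append_conv2 by metis
    then show ?thesis
    proof cases
      case (1 us)
      then show ?thesis using d that(1) by (cases us) auto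
    next
      case (2 us)
      then show ?thesis using d that(2) by (cases us) auto
    qed
  qed
  then show ?thesis
  proof cases
    case (1 M)
    have "subseq ((p @ [s]) @ [t] @ [l] @ s # q) (L1 @ [t] @ (M @ [l]) @ L4)"
      using \<open>subseq (p @ [s]) L1\<close> 2 by (intro list_emb_append_mono) auto
    moreover have "L1 @ [t] @ (M @ [l]) @ L4 = L" using 1 2 by simp
    ultimately show ?thesis by simp
  next
    case (2 M)
    note sub = \<open>subseq (s # q) L4\<close>
    have LL: "L = L3 @ l # M @ t # L2" using 1 2 by simp
    have "s \<notin> set M"
    proof
      assume "s \<in> set M"
      then have "subseq [s] M" by (simp add: subseq_singleton_left)
      then have "subseq ([] @ [l] @ [s] @ [t]) (L3 @ [l] @ M @ t # L2)"
        by (intro list_emb_append_mono) auto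
      then show False using L LL by simp
    qed
    have "subseq p L3 \<and> subseq (p @ [s]) L3"
    proof -
      have "subseq (p @ [s]) (L3 @ l # M)" using 1(2) 2 by simp
      then obtain u v where uv: "p @ [s] = u @ v" "subseq u L3" "subseq v (l # M)"
        using subseq_append_iff by metis
      have "v = []"
      proof (rule ccontr)
        assume "v \<noteq> []"
        then have "s \<in> set v" using uv(1) by (metis last_appendR last_in_set last_snoc)
        then have "s \<in> set (l # M)" using subseq_subset[OF uv(3)] by blast
        then show False using \<open>s \<notin> set M\<close> d by simp
      qed
      then have "subseq (p @ [s]) L3" using uv by simp
      moreover have "subseq p (p @ [s])" by (rule subseq_rev_drop_many) simp
      ultimately show ?thesis using subseq_order.order_trans by blast
    qed
    moreover have "subseq (s # q) L2"
    proof -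
      have "subseq (s # q) (M @ t # L2)" using sub 2 by simp
      then obtain u v where uv: "s # q = u @ v" "subseq u M" "subseq v (t # L2)"
        using subseq_append_iff by metis
      have "u = []" using uv subseq_subset[OF uv(2)] \<open>s \<notin> set M\<close> by (cases u) auto
      then show ?thesis using uv d by auto
    qed
    ultimately have "subseq ((p @ [s]) @ [l] @ [t] @ s # q) (L3 @ [l] @ (M @ [t]) @ L2)"
      by (intro list_emb_append_mono) auto
    then show ?thesis using LL by simp
  qed
qed

section \<open>Words of upper elements, and matchings on dihedral subgroups\<close>

context full_matching
begin

text \<open>A common source of contradictions: \<open>Z\<close> has at most one letter more than
  \<open>\<omega>0\<close>, but by monotonicity of \<open>upper\<close> it contains every unique
  word that lies below the upper element of some subword of \<open>\<omega>0\<close>.\<close>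

lemma upper_wordE:
  assumes "reduced \<omega>0" "word_value \<omega>0 \<in> Q"
  obtains Z where "reduced Z" "word_value Z = upper (word_value \<omega>0)" "length Z \<le> Suc (length \<omega>0)"
    "\<And>\<omega> \<eta>. unique_word \<omega> \<Longrightarrow> subseq \<eta> \<omega>0 \<Longrightarrow> bruhat_le (word_value \<omega>) (upper (word_value \<eta>)) \<Longrightarrow> subseq \<omega> Z"
    "\<And>\<omega> \<eta>. unique_word \<omega> \<Longrightarrow> subseq \<eta> \<omega>0 \<Longrightarrow> \<phi> (word_value \<eta>) = word_value \<omega> \<Longrightarrow> subseq \<omega> Z"
    "\<And>\<omega>. unique_word \<omega> \<Longrightarrow> subseq \<omega> \<omega>0 \<Longrightarrow> subseq \<omega> Z"
proof -
  obtain Z where Z: "reduced Z" "word_value Z = upper (word_value \<omega>0)"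
    using ex_reduced[of "upper (word_value \<omega>0)"] assms(2) by auto
  have len: "length Z \<le> Suc (length \<omega>0)"
    using len_upper[OF assms(2)] reduced_len[OF Z(1)] reduced_len[OF assms(1)] Z(2) by simp
  have a: "subseq \<omega> Z"
    if "unique_word \<omega>" "subseq \<eta> \<omega>0" "bruhat_le (word_value \<omega>) (upper (word_value \<eta>))" for \<omega> \<eta>
  proof -
    have "bruhat_le (word_value \<eta>) (word_value \<omega>0)" using subseq_bruhat[OF assms(1) that(2)] .
    then have "bruhat_le (word_value \<omega>) (upper (word_value \<omega>0))"
      using upper_mono[OF _ assms(2)] that(3) bruhat_trans by blast
    then show ?thesis using unique_word_subseq[OF that(1) _ Z] by blast
  qed
  have q: "word_value \<eta> \<in> Q" if "subseq \<eta> \<omega>0" for \<eta>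
    using subseq_bruhat[OF assms(1) that] Q_down[OF assms(2)] by blast
  show ?thesis
  proof (rule that[OF Z len])
    fix \<omega> \<eta> assume "unique_word \<omega>" "subseq \<eta> \<omega>0" "bruhat_le (word_value \<omega>) (upper (word_value \<eta>))"
    then show "subseq \<omega> Z" by (rule a)
  next
    fix \<omega> \<eta> assume u: "unique_word \<omega>" "subseq \<eta> \<omega>0" "\<phi> (word_value \<eta>) = word_value \<omega>"
    then show "subseq \<omega> Z" using a[OF u(1,2)] phi_le_upper[OF q[OF u(2)]] by simp
  next
    fix \<omega> assume u: "unique_word \<omega>" "subseq \<omega> \<omega>0"
    then show "subseq \<omega> Z" using a[OF u] le_upper[OF q[OF u(2)]] by simp
  qed
qed

lemma subword_Q: "reduced \<omega> \<Longrightarrow> word_value \<omega> \<in> Q \<Longrightarrow> subseq \<eta> \<omega> \<Longrightarrow> word_value \<eta> \<in> Q"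
  using subseq_bruhat Q_down by blast

lemma mirror_full_matching: "full_matching W S m ((\<lambda>x. inv x) ` Q) (\<lambda>x. inv (\<phi> (inv x)))"
proof -
  interpret mirror: distinguished_matching W S m "(\<lambda>x. inv x) ` Q" "\<lambda>x. inv (\<phi> (inv x))"
    by unfold_locales (rule mirror_matching[OF matching])
  show ?thesis
  proof unfold_locales
    fix a c assume ac: "a \<in> S" "c \<in> S"
    have I: "{a, c} \<subseteq> S" using ac by simp
    have "dihedral_longest a c \<in> parabolic {a, c}"
      using dihedral_longest_value[OF ac] set_alternating[of "ord a c" a c] unfolding parabolic_def by blast
    then have "inv (dihedral_longest a c) \<in> Q" "dihedral_longest a c \<in> carrier W"
      using parabolic_inv[OF I] parabolic_Q[OF ac] parabolic_closed[OF I] by blast+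
    then show "dihedral_longest a c \<in> (\<lambda>x. inv x) ` Q" using Q_inv_iff by blast
  next
    show "\<one> \<in> (\<lambda>x. inv x) ` Q" using one_in_Q by (intro image_eqI[of _ _ "\<one>"]) auto
  qed
qed

lemma noncommuting_unique: "a \<in> S \<Longrightarrow> c \<in> S \<Longrightarrow> a \<otimes> c \<noteq> c \<otimes> a \<Longrightarrow> unique_word [a, c]"
  using unique_word_dihedral[of a c "[a, c]"] ord_ge_3[of a c] by (auto simp: dihedral_word_def)

context
  fixes t :: 'a
  assumes t: "t \<in> S" "t \<noteq> base"
begin

lemma bt: "base \<in> S" "t \<in> S" "base \<noteq> t" "{base, t} \<subseteq> S"
  using t by auto

lemma dw_reduced: "dihedral_word base t \<omega> \<Longrightarrow> length \<omega> \<le> ord base t \<Longrightarrow> reduced \<omega>"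
  using dihedral_word_reduced[OF bt(1-3)] by blast

lemma dw_parabolic: "dihedral_word base t \<omega> \<Longrightarrow> word_value \<omega> \<in> parabolic {base, t}"
  unfolding parabolic_def dihedral_word_def by blast

lemma dw_Q: "dihedral_word base t \<omega> \<Longrightarrow> word_value \<omega> \<in> Q"
  using parabolic_Q[OF bt(1,2)] dw_parabolic by blast

lemma dw_unique: "dihedral_word base t \<omega> \<Longrightarrow> length \<omega> < ord base t \<Longrightarrow> unique_word \<omega>"
  using unique_word_dihedral[OF bt(1-3)] by blast

lemma dw_eqI:
  "dihedral_word base t \<omega> \<Longrightarrow> length \<omega> < ord base t \<Longrightarrow> reduced \<eta> \<Longrightarrow> word_value \<eta> = word_value \<omega> \<Longrightarrow> \<eta> = \<omega>"
  using dw_unique unfolding unique_word_def by blast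

lemma phi_parabolic_pair: "x \<in> parabolic {base, t} \<Longrightarrow> \<phi> x \<in> parabolic {base, t}"
  using phi_parabolic[OF parabolic_Q[OF bt(1,2)] _ bt(4)] by simp

lemma parabolic_word:
  assumes "x \<in> parabolic {base, t}"
  obtains \<omega> where "dihedral_word base t \<omega>" "length \<omega> \<le> ord base t" "reduced \<omega>" "word_value \<omega> = x"
  using parabolic_wordE[OF bt(1-3) assms] .

lemma dw_up_step:
  assumes \<omega>: "dihedral_word base t \<omega>" "\<omega> \<noteq> []" "length \<omega> < ord base t"
    and up: "len (word_value \<omega>) < len (\<phi> (word_value \<omega>))"
  obtains e where "dihedral_word base t (\<omega> @ [e])" "\<phi> (word_value \<omega>) = word_value (\<omega> @ [e])"
  | f where "dihedral_word base t (f # \<omega>)" "\<phi> (word_value \<omega>) = word_value (f # \<omega>)"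
proof -
  obtain \<eta> where \<eta>: "dihedral_word base t \<eta>" "reduced \<eta>" "word_value \<eta> = \<phi> (word_value \<omega>)"
    using parabolic_word[OF phi_parabolic_pair[OF dw_parabolic[OF \<omega>(1)]]] by metis
  have R: "reduced \<omega>" using dw_reduced \<omega> by simp
  have l: "length \<eta> = Suc (length \<omega>)"
    using phi_len[OF dw_Q[OF \<omega>(1)]] up reduced_len[OF R] reduced_len[OF \<eta>(2)] \<eta>(3) by simp
  then have ne: "\<eta> \<noteq> []" by auto
  have split: "\<eta> = hd \<eta> # tl \<eta>" "\<eta> = butlast \<eta> @ [last \<eta>]" using ne by simp_all
  have d: "dihedral_word base t (tl \<eta>)" "dihedral_word base t (butlast \<eta>)"
    using dihedral_word_append[of base t "[hd \<eta>]" "tl \<eta>"] dihedral_word_append[of base t "butlast \<eta>" "[last \<eta>]"] split \<eta>(1)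
    by simp_all
  show ?thesis
  proof (cases "hd \<eta> = hd \<omega>")
    case True
    have "hd (butlast \<eta>) = hd \<eta>" using l \<omega>(2) by (cases \<eta>) auto
    have "\<omega> = butlast \<eta>"
      by (rule dihedral_word_hd_eq[OF \<omega>(1) d(2)]) (use True l \<omega>(2) \<open>hd (butlast \<eta>) = hd \<eta>\<close> in simp_all)
    then show ?thesis using that(1) \<eta> split(2) by metis
  next
    case False
    have "tl \<eta> \<noteq> []" using l \<omega>(2) by (cases \<eta>) auto
    moreover have "hd (tl \<eta>) \<noteq> hd \<eta>" using \<eta>(1) calculation by (cases \<eta>) (auto simp: dihedral_word_def distinct_adj_Cons)
    ultimately have "hd (tl \<eta>) = hd \<omega>"
      using dihedral_word_hd[OF \<eta>(1) ne] dihedral_word_hd[OF d(1)] dihedral_word_hd[OF \<omega>(1,2)] False by auto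
    then have "tl \<eta> = \<omega>" using dihedral_word_hd_eq[OF \<omega>(1) d(1)] l \<omega>(2) by simp
    then show ?thesis using that(2) \<eta> split(1) by metis
  qed
qed

text \<open>The other dihedral word of the same length is a coatom of
  \<open>\<phi> (word_value \<omega>)\<close> different from its partner, so it is an upper element.
  Hence in each length below the order at most one of the two words goes up.\<close>

lemma dw_one_side_down:
  assumes \<omega>: "dihedral_word base t \<omega>" "\<omega> \<noteq> []" "length \<omega> < ord base t"
    and up: "len (word_value \<omega>) < len (\<phi> (word_value \<omega>))"
    and \<eta>: "dihedral_word base t \<eta>" "length \<eta> = length \<omega>" "\<eta> \<noteq> \<omega>"
  shows "len (\<phi> (word_value \<eta>)) < len (word_value \<eta>)"
proof -
  have ne: "\<eta> \<noteq> []" using \<eta> \<omega> by auto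
  have hd: "hd \<eta> \<noteq> hd \<omega>" using dihedral_word_hd_eq[OF \<eta>(1) \<omega>(1) \<eta>(2) ne] \<eta>(3) by blast
  obtain \<zeta> where \<zeta>: "dihedral_word base t \<zeta>" "\<phi> (word_value \<omega>) = word_value \<zeta>" "length \<zeta> = Suc (length \<omega>)" "subseq \<eta> \<zeta>"
  proof (rule dw_up_step[OF \<omega> up])
    fix e assume e: "dihedral_word base t (\<omega> @ [e])" "\<phi> (word_value \<omega>) = word_value (\<omega> @ [e])"
    obtain p \<omega>' where p: "\<omega> = p # \<omega>'" using \<omega>(2) by (cases \<omega>) auto
    have d: "dihedral_word base t (\<omega>' @ [e])" using dihedral_word_append[of base t "[p]" "\<omega>' @ [e]"] e(1) p by simp
    have "hd (\<omega>' @ [e]) \<noteq> p" using e(1) p by (auto simp: dihedral_word_def distinct_adj_Cons)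
    then have "hd \<eta> = hd (\<omega>' @ [e])"
      using hd p dihedral_word_hd[OF d] dihedral_word_hd[OF \<eta>(1) ne] dihedral_word_hd[OF \<omega>(1,2)] by auto
    then have "\<eta> = \<omega>' @ [e]" using dihedral_word_hd_eq[OF \<eta>(1) d] \<eta>(2) p ne by simp
    moreover have "subseq (\<omega>' @ [e]) (p # \<omega>' @ [e])" by (rule list_emb_Cons) simp
    ultimately show ?thesis using that[OF e] p by simp
  next
    fix f assume f: "dihedral_word base t (f # \<omega>)" "\<phi> (word_value \<omega>) = word_value (f # \<omega>)"
    have d: "dihedral_word base t (f # butlast \<omega>)"
      using dihedral_word_append[of base t "f # butlast \<omega>" "[last \<omega>]"] f(1) \<omega>(2) by simp
    have "f \<noteq> hd \<omega>" using f(1) \<omega>(2) by (auto simp: dihedral_word_def distinct_adj_Cons)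
    then have "hd \<eta> = f"
      using hd dihedral_word_hd[OF d] dihedral_word_hd[OF \<eta>(1) ne] dihedral_word_hd[OF \<omega>(1,2)] by auto
    then have e: "\<eta> = f # butlast \<omega>" using dihedral_word_hd_eq[OF \<eta>(1) d] \<eta>(2) \<omega>(2) ne by simp
    have "subseq (butlast \<omega>) (butlast \<omega> @ [last \<omega>])" by (rule subseq_rev_drop_many) simp
    then have "subseq \<eta> (f # \<omega>)" using e \<omega>(2) by simp
    then show ?thesis using that[OF f] by simp
  qed
  have R: "reduced \<zeta>" "reduced \<eta>" "reduced \<omega>" using dw_reduced \<zeta> \<eta> \<omega> by simp_all
  have "covered_by (word_value \<eta>) (\<phi> (word_value \<omega>))"
    using subseq_bruhat[OF R(1) \<zeta>(4)] reduced_len R \<zeta>(2,3) \<eta>(2) by (simp add: covered_by_iff)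
  moreover have "word_value \<eta> \<noteq> word_value \<omega>" using dw_eqI[OF \<omega>(1,3) R(2)] \<eta>(3) by blast
  ultimately show ?thesis using cover_down(1)[of "\<phi> (word_value \<omega>)" "word_value \<eta>"] dw_Q[OF \<omega>(1)] up by simp
qed

lemma dw_longest_eq:
  assumes "dihedral_word base t \<omega>" "dihedral_word base t \<eta>" "length \<omega> = ord base t" "length \<eta> = ord base t"
  shows "word_value \<omega> = word_value \<eta>"
  using longest_word_eq[OF bt(1-3) assms] .

end

text \<open>A \<open>left_step\<close> is an element of \<open>\<langle>base, t\<rangle>\<close> to which \<open>\<phi>\<close> adds a letter on the left although \<open>t\<close> is of right
  type; a \<open>left_violation\<close> is an element \<open>g\<close> that shows that \<open>\<phi>\<close> does not commute with left multiplication
  by \<open>f\<close>.\<close>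

definition left_step :: "'a \<Rightarrow> 'a list \<Rightarrow> 'a \<Rightarrow> bool" where
  "left_step t x b \<longleftrightarrow> dihedral_word base t (b # x) \<and> 2 \<le> length x \<and> length x + 2 \<le> ord base t \<and> last x = t
    \<and> \<phi> (word_value x) = word_value (b # x)"

definition right_step :: "'a \<Rightarrow> 'a list \<Rightarrow> 'a \<Rightarrow> bool" where
  "right_step t x e \<longleftrightarrow> dihedral_word base t (x @ [e]) \<and> 2 \<le> length x \<and> length x + 2 \<le> ord base t \<and> hd x = t
    \<and> \<phi> (word_value x) = word_value (x @ [e])"

text \<open>A shortest \<open>y\<close> on which \<open>\<phi>\<close> is not right multiplication
  by \<open>base\<close> is lengthened by both maps. Its word then ends in \<open>t\<close>, so the
  letter added by \<open>\<phi>\<close> must be added on the left.\<close>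

lemma ex_left_step:
  assumes rt: "right_type t" and nr: "\<not> right_mult_on t"
  shows "\<exists>x b. left_step t x b \<and> (\<forall>y \<in> parabolic {base, t}. len y < length x \<longrightarrow> \<phi> y = y \<otimes> base)"
proof -
  have t: "t \<in> S" "t \<noteq> base" "\<phi> t = t \<otimes> base" using rt by (simp_all add: right_type_def)
  define P where "P n \<longleftrightarrow> (\<exists>y \<in> parabolic {base, t}. len y = n \<and> \<phi> y \<noteq> y \<otimes> base)" for n
  have "\<exists>n. P n" using nr unfolding P_def right_mult_on_def by blast
  then have "P (LEAST n. P n)" by (rule LeastI_ex)
  then obtain y where y: "y \<in> parabolic {base, t}" "\<phi> y \<noteq> y \<otimes> base" and ly: "len y = (LEAST n. P n)"
    unfolding P_def by metis
  have min: "\<phi> z = z \<otimes> base" if "z \<in> parabolic {base, t}" "len z < len y" for z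
    using not_less_Least[of "len z" P] that ly unfolding P_def by metis
  have yQ: "y \<in> Q" "y \<in> carrier W" using parabolic_Q[OF base_S t(1) y(1)] by simp_all
  have yb: "y \<otimes> base \<in> parabolic {base, t}" using parabolic_gen_mult(2)[OF t(1) _ y(1)] by simp
  obtain \<omega> where \<omega>: "dihedral_word base t \<omega>" "length \<omega> \<le> ord base t" "reduced \<omega>" "word_value \<omega> = y"
    using parabolic_word[OF t(1,2) y(1)] by metis
  have up: "len y < len (y \<otimes> base)"
  proof (rule ccontr)
    assume "\<not> ?thesis"
    then have "len (y \<otimes> base) < len y" using len_mult_gen[OF base_S yQ(2)] by auto
    then have "\<phi> (y \<otimes> base) = y" using min[OF yb] yQ by simp
    then have "\<phi> y = y \<otimes> base" using phi_phi[OF parabolic_Q[OF base_S t(1) yb]] by simp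
    then show False using y by simp
  qed
  have up': "len y < len (\<phi> y)"
  proof (rule ccontr)
    assume "\<not> ?thesis"
    then have "len (\<phi> y) < len y" using phi_len[OF yQ(1)] by auto
    then have "\<phi> (\<phi> y) = \<phi> y \<otimes> base" using min phi_parabolic_pair[OF t(1,2) y(1)] by blast
    then have "y \<otimes> base = \<phi> y \<otimes> base \<otimes> base" using yQ by simp
    then show False using y yQ by simp
  qed
  have r1: "reduced (\<omega> @ [base])" using \<omega> up by (simp add: reduced_snoc_iff)
  have s1: "set (\<omega> @ [base]) \<subseteq> {base, t}" using \<omega>(1) by (simp add: dihedral_word_def)
  have d1: "dihedral_word base t (\<omega> @ [base])" using reduced_dihedral_word[OF r1 s1] .
  have l1: "length \<omega> < ord base t" using reduced_dihedral_length_le[OF base_S t(1) t(2)[symmetric] r1 s1] by simp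
  have ne: "\<omega> \<noteq> []" using \<omega>(4) y(2) phi_one by auto
  have last: "last \<omega> = t"
    using dihedral_word_last[OF \<omega>(1) ne] d1 ne by (auto simp: dihedral_word_def distinct_adj_append_iff)
  have "\<omega> \<noteq> [t]" using \<omega>(4) y(2) t by auto
  then have l2: "2 \<le> length \<omega>" using ne last by (cases \<omega>; cases "tl \<omega>") auto
  show ?thesis
  proof (rule dw_up_step[OF t(1,2) \<omega>(1) ne l1])
    show "len (word_value \<omega>) < len (\<phi> (word_value \<omega>))" using up' \<omega> by simp
  next
    fix e assume e: "dihedral_word base t (\<omega> @ [e])" "\<phi> (word_value \<omega>) = word_value (\<omega> @ [e])"
    have "e \<noteq> t" "e \<in> {base, t}" using e(1) last ne by (auto simp: dihedral_word_def distinct_adj_append_iff)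
    then have "\<phi> y = y \<otimes> base" using e(2) \<omega> by simp
    then show ?thesis using y by simp
  next
    fix b assume b: "dihedral_word base t (b # \<omega>)" "\<phi> (word_value \<omega>) = word_value (b # \<omega>)"
    \<comment> \<open>One letter below the longest element, adding a letter on the left or on the
      right gives the same element, so a genuine deviation occurs at least two letters
      below.\<close>
    have "length \<omega> + 2 \<le> ord base t"
    proof (rule ccontr)
      assume "\<not> ?thesis"
      then have "length (b # \<omega>) = ord base t" "length (\<omega> @ [base]) = ord base t" using l1 by simp_all
      then have "word_value (b # \<omega>) = word_value (\<omega> @ [base])" using dw_longest_eq[OF t(1,2) b(1) d1] by blast
      then show False using b(2) y(2) \<omega> by simp
    qed
    then have "left_step t \<omega> b" using b l2 last by (simp add: left_step_def)
    moreover have "length \<omega> = len y" using reduced_len \<omega> by metis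
    ultimately show ?thesis using min by metis
  qed
qed

definition left_violation :: "'a \<Rightarrow> 'a \<Rightarrow> 'a list \<Rightarrow> 'a \<Rightarrow> 'a \<Rightarrow> bool" where
  "left_violation t f g e f' \<longleftrightarrow> g \<noteq> [] \<and> f' \<noteq> f \<and> dihedral_word base t (f' # f # g) \<and> dihedral_word base t (g @ [e])
    \<and> \<phi> (word_value g) = word_value (g @ [e]) \<and> \<phi> (word_value (f # g)) = word_value (f' # f # g)
    \<and> length g + 3 \<le> ord base t"

definition right_violation :: "'a \<Rightarrow> 'a \<Rightarrow> 'a list \<Rightarrow> 'a \<Rightarrow> 'a \<Rightarrow> bool" where
  "right_violation t f g e f' \<longleftrightarrow> g \<noteq> [] \<and> f' \<noteq> f \<and> dihedral_word base t (g @ [f, f']) \<and> dihedral_word base t (e # g)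
    \<and> \<phi> (word_value g) = word_value (e # g) \<and> \<phi> (word_value (g @ [f])) = word_value (g @ [f, f'])
    \<and> length g + 3 \<le> ord base t"

text \<open>The set of elements where commutation with \<open>f\<close> fails is stable under
  \<open>f\<close> and under \<open>\<phi>\<close>. A shortest one is therefore lengthened by both,
  and the two added letters end up on different sides. The right type condition for
  \<open>f = t\<close> ensures that the identity is not such an element.\<close>

lemma ex_left_violation:
  assumes t: "t \<in> S" "t \<noteq> base" and f: "f = base \<or> f = t \<and> right_type t"
    and x: "x \<in> parabolic {base, t}" "\<phi> (f \<otimes> x) \<noteq> f \<otimes> \<phi> x"
  shows "\<exists>g e f'. left_violation t f g e f'"
proof -
  have fS: "f \<in> S" "f \<in> {base, t}" using f t by auto
  define bad where "bad y \<longleftrightarrow> y \<in> parabolic {base, t} \<and> \<phi> (f \<otimes> y) \<noteq> f \<otimes> \<phi> y" for y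
  have Q: "y \<in> Q \<and> y \<in> carrier W" if "y \<in> parabolic {base, t}" for y
    using parabolic_Q[OF base_S t(1) that] by simp
  have fp: "f \<otimes> y \<in> parabolic {base, t}" if "y \<in> parabolic {base, t}" for y
    using parabolic_gen_mult(1)[OF t(1) fS(2) that] .
  have badf: "bad (f \<otimes> y)" if "bad y" for y
  proof -
    have y: "y \<in> parabolic {base, t}" "\<phi> (f \<otimes> y) \<noteq> f \<otimes> \<phi> y" using that by (simp_all add: bad_def)
    have "\<phi> (f \<otimes> (f \<otimes> y)) \<noteq> f \<otimes> \<phi> (f \<otimes> y)"
    proof
      assume "\<phi> (f \<otimes> (f \<otimes> y)) = f \<otimes> \<phi> (f \<otimes> y)"
      then have "f \<otimes> \<phi> y = f \<otimes> (f \<otimes> \<phi> (f \<otimes> y))" using Q[OF y(1)] fS by simp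
      then show False using Q[OF fp[OF y(1)]] fS y(2) by simp
    qed
    then show ?thesis using fp y by (simp add: bad_def)
  qed
  have badphi: "bad (\<phi> y)" if "bad y" for y
  proof -
    have y: "y \<in> parabolic {base, t}" "\<phi> (f \<otimes> y) \<noteq> f \<otimes> \<phi> y" using that by (simp_all add: bad_def)
    have py: "\<phi> y \<in> parabolic {base, t}" using phi_parabolic_pair[OF t y(1)] .
    have "\<phi> (f \<otimes> \<phi> y) \<noteq> f \<otimes> \<phi> (\<phi> y)"
    proof
      assume "\<phi> (f \<otimes> \<phi> y) = f \<otimes> \<phi> (\<phi> y)"
      then have "\<phi> (f \<otimes> y) = \<phi> (\<phi> (f \<otimes> \<phi> y))" using Q[OF y(1)] by simp
      then show False using Q[OF fp[OF py]] y(2) by simp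
    qed
    then show ?thesis using py by (simp add: bad_def)
  qed
  define P where "P n \<longleftrightarrow> (\<exists>y. bad y \<and> len y = n)" for n
  have "\<exists>n. P n" using x unfolding P_def bad_def by blast
  then have "P (LEAST n. P n)" by (rule LeastI_ex)
  moreover have "\<not> P k" if "k < (LEAST n. P n)" for k using not_less_Least that by blast
  ultimately obtain y where y: "bad y" and min: "\<And>z. bad z \<Longrightarrow> len y \<le> len z"
    unfolding P_def by (metis not_less)
  have yp: "y \<in> parabolic {base, t}" "\<phi> (f \<otimes> y) \<noteq> f \<otimes> \<phi> y" using y by (simp_all add: bad_def)
  note yQ = Q[OF yp(1)]
  have up1: "len y < len (f \<otimes> y)" using min[OF badf[OF y]] len_gen_mult[OF fS(1), of y] yQ by auto
  have up2: "len y < len (\<phi> y)" using min[OF badphi[OF y]] phi_len[of y] yQ by auto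
  have neq: "\<phi> y \<noteq> f \<otimes> y"
  proof
    assume a: "\<phi> y = f \<otimes> y"
    then have "\<phi> (f \<otimes> y) = y" using yQ phi_phi by metis
    then show False using a yp(2) yQ fS by simp
  qed
  obtain g where g: "dihedral_word base t g" "length g \<le> ord base t" "reduced g" "word_value g = y"
    using parabolic_word[OF t yp(1)] by metis
  have gne: "g \<noteq> []"
  proof
    assume "g = []"
    then have y1: "y = \<one>" using g by simp
    then show False using f neq yp(2) fS phi_one by (auto simp: right_type_def)
  qed
  have rf: "reduced (f # g)" using g up1 fS by (simp add: reduced_Cons_iff)
  have sf: "set (f # g) \<subseteq> {base, t}" using g(1) fS by (simp add: dihedral_word_def)
  have df: "dihedral_word base t (f # g)" using reduced_dihedral_word[OF rf sf] .
  have lf: "length g < ord base t" using reduced_dihedral_length_le[OF base_S t(1) t(2)[symmetric] rf sf] by simp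
  have fh: "f \<noteq> hd g" using df gne by (auto simp: dihedral_word_def distinct_adj_Cons)
  have fy: "word_value (f # g) = f \<otimes> y" using g by simp
  obtain e where e: "dihedral_word base t (g @ [e])" "\<phi> y = word_value (g @ [e])"
  proof (rule dw_up_step[OF t g(1) gne lf])
    show "len (word_value g) < len (\<phi> (word_value g))" using up2 g by simp
  next
    fix e assume "dihedral_word base t (g @ [e])" "\<phi> (word_value g) = word_value (g @ [e])"
    then show thesis using that g by simp
  next
    fix f2 assume f2: "dihedral_word base t (f2 # g)" "\<phi> (word_value g) = word_value (f2 # g)"
    have "f2 \<noteq> hd g" "f2 \<in> {base, t}" using f2(1) gne by (auto simp: dihedral_word_def distinct_adj_Cons)
    then have "f2 = f" using fS(2) fh dihedral_word_hd[OF g(1) gne] by auto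
    then show thesis using f2(2) neq g by simp
  qed
  have lf2: "length g + 1 < ord base t"
  proof (rule ccontr)
    assume "\<not> ?thesis"
    then have "length (f # g) = ord base t" "length (g @ [e]) = ord base t" using lf by simp_all
    then have "word_value (f # g) = word_value (g @ [e])" using dw_longest_eq[OF t df e(1)] by blast
    then show False using e(2) fy neq by simp
  qed
  have fyQ: "f \<otimes> y \<in> Q" "len (f \<otimes> y) = Suc (len y)"
    using Q[OF fp[OF yp(1)]] len_gen_mult[OF fS(1), of y] up1 yQ by auto
  have up3: "len (f \<otimes> y) < len (\<phi> (f \<otimes> y))"
  proof (rule ccontr)
    assume "\<not> ?thesis"
    then have d: "len (\<phi> (f \<otimes> y)) < len (f \<otimes> y)" using phi_len[OF fyQ(1)] by auto
    have "y \<noteq> \<phi> (f \<otimes> y)"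
    proof
      assume "y = \<phi> (f \<otimes> y)"
      then have "\<phi> y = f \<otimes> y" using phi_phi[OF fyQ(1)] by metis
      then show False using neq by simp
    qed
    then show False using cover_down(1)[OF fyQ(1) d gen_up_covered[OF fS(1) _ up1]] up2 yQ by simp
  qed
  obtain f' where f': "dihedral_word base t (f' # f # g)" "\<phi> (f \<otimes> y) = word_value (f' # f # g)"
  proof (rule dw_up_step[OF t df])
    show "length (f # g) < ord base t" using lf2 by simp
    show "len (word_value (f # g)) < len (\<phi> (word_value (f # g)))" using up3 fy by simp
  next
    fix e2 assume e2: "dihedral_word base t ((f # g) @ [e2])" "\<phi> (word_value (f # g)) = word_value ((f # g) @ [e2])"
    have "e2 \<noteq> last g" "e2 \<in> {base, t}" "e \<noteq> last g" "e \<in> {base, t}"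
      using dihedral_word_snocD[OF e2(1)] dihedral_word_snocD[OF e(1)] gne by auto
    then have "e2 = e" using dihedral_word_last[OF g(1) gne] by auto
    then have "\<phi> (f \<otimes> y) = f \<otimes> \<phi> y" using e2(2) fy e(2) by simp
    then show thesis using yp by simp
  next
    fix f2 assume "dihedral_word base t (f2 # f # g)" "\<phi> (word_value (f # g)) = word_value (f2 # f # g)"
    then show thesis using that fy by simp
  qed simp
  have "length g + 3 \<le> ord base t"
  proof (rule ccontr)
    assume "\<not> ?thesis"
    then have l: "length (f' # f # g) = ord base t" "length (f # g @ [e]) = ord base t" using lf2 by simp_all
    have "dihedral_word base t (f # g @ [e])"
      using df e(1) gne by (auto simp: dihedral_word_def distinct_adj_Cons)
    then have "word_value (f' # f # g) = word_value (f # g @ [e])" using dw_longest_eq[OF t f'(1) _ l] by blast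
    then show False using f'(2) e(2) yp(2) by simp
  qed
  moreover have "f' \<noteq> f" using f'(1) by (auto simp: dihedral_word_def)
  ultimately have "left_violation t f g e f'" unfolding left_violation_def using gne f' e g by simp
  then show ?thesis by blast
qed

lemma mirror_value:
  assumes "set \<omega> \<subseteq> S" "set \<eta> \<subseteq> S" "word_value (rev \<omega>) \<in> Q" "inv (\<phi> (inv (word_value \<omega>))) = word_value \<eta>"
  shows "\<phi> (word_value (rev \<omega>)) = word_value (rev \<eta>)"
  using assms by (metis word_value_rev inv_inv phi_Q Q_closed)

lemma dihedral_word_rev [simp]: "dihedral_word a c (rev \<omega>) \<longleftrightarrow> dihedral_word a c \<omega>"
  by (simp add: dihedral_word_def)

interpretation mirror: full_matching W S m "(\<lambda>x. inv x) ` Q" "\<lambda>x. inv (\<phi> (inv x))"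
  by (rule mirror_full_matching)

lemma mirror_base: "mirror.base = base"
  by (simp add: mirror.base_def phi_one)

lemma ex_right_violation:
  assumes t: "t \<in> S" "t \<noteq> base" and x: "x \<in> parabolic {base, t}" "\<phi> (x \<otimes> base) \<noteq> \<phi> x \<otimes> base"
  shows "\<exists>g e f'. right_violation t base g e f'"
proof -
  note b = mirror_base
  have I: "{base, t} \<subseteq> S" using t by simp
  have xc: "x \<in> carrier W" using parabolic_closed[OF I x(1)] .
  have xQ: "x \<in> Q" "x \<otimes> base \<in> Q"
    using parabolic_Q[OF base_S t(1)] x(1) parabolic_gen_mult(2)[OF t(1) _ x(1), of base] by simp_all
  have "inv (\<phi> (inv (base \<otimes> inv x))) \<noteq> base \<otimes> inv (\<phi> (inv (inv x)))"
  proof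
    assume "inv (\<phi> (inv (base \<otimes> inv x))) = base \<otimes> inv (\<phi> (inv (inv x)))"
    then have "inv (\<phi> (x \<otimes> base)) = inv (\<phi> x \<otimes> base)" using xQ by (simp add: inv_mult_group)
    then have "inv (inv (\<phi> (x \<otimes> base))) = inv (inv (\<phi> x \<otimes> base))" by simp
    then show False using x(2) xQ by simp
  qed
  then obtain g e f' where v: "mirror.left_violation t base g e f'"
    using mirror.ex_left_violation[of t base "inv x"] t parabolic_inv[OF I x(1)] b by auto
  have S: "set g \<subseteq> S" "e \<in> S" "f' \<in> S"
    using v t I unfolding mirror.left_violation_def b dihedral_word_def by auto
  have d: "dihedral_word base t (f' # base # g)" "dihedral_word base t (g @ [e])" "g \<noteq> []" "f' \<noteq> base"
    using v unfolding mirror.left_violation_def b by simp_all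
  have dr: "dihedral_word base t (rev g)" "dihedral_word base t (rev (base # g))"
    using dihedral_word_append[of base t g "[e]"] dihedral_word_append[of base t "[f']" "base # g"] d
    by (simp_all only: dihedral_word_rev append_Cons append_Nil)
  have "\<phi> (word_value (rev g)) = word_value (rev (g @ [e]))"
    using mirror_value[of g "g @ [e]"] S v dw_Q[OF t dr(1)] unfolding mirror.left_violation_def by simp
  moreover have "\<phi> (word_value (rev (base # g))) = word_value (rev (f' # base # g))"
    using mirror_value[of "base # g" "f' # base # g"] S v dw_Q[OF t dr(2)] unfolding mirror.left_violation_def by simp
  moreover have "dihedral_word base t (rev (f' # base # g))" "dihedral_word base t (rev (g @ [e]))"
    using d by (simp_all only: dihedral_word_rev)
  ultimately have "right_violation t base (rev g) e f'"
    using d v unfolding right_violation_def mirror.left_violation_def b by simp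
  then show ?thesis by blast
qed

lemma mirror_right_type:
  assumes lt: "left_type t" shows "mirror.right_type t" "mirror.right_mult_on t \<Longrightarrow> left_mult_on t"
proof -
  note b = mirror_base
  have t: "t \<in> S" "t \<noteq> base" "t \<otimes> base \<noteq> base \<otimes> t" "\<phi> t = base \<otimes> t" using lt by (simp_all add: left_type_def)
  have I: "{base, t} \<subseteq> S" using t by simp
  show "mirror.right_type t" unfolding mirror.right_type_def b using t by (simp add: inv_mult_group)
  assume a: "mirror.right_mult_on t"
  have "\<phi> x = base \<otimes> x" if x: "x \<in> parabolic {base, t}" for x
  proof -
    have xQ: "x \<in> Q" using parabolic_Q[OF base_S t(1) x] .
    have "inv (\<phi> (inv (inv x))) = inv x \<otimes> base"
      using a parabolic_inv[OF I x] unfolding mirror.right_mult_on_def b by blast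
    then have "inv (inv (\<phi> x)) = inv (inv x \<otimes> base)" using xQ by simp
    then show ?thesis using xQ by (simp add: inv_mult_group)
  qed
  then show "left_mult_on t" unfolding left_mult_on_def by blast
qed

lemma ex_right_step:
  assumes lt: "left_type t" and nl: "\<not> left_mult_on t"
  shows "\<exists>x e. right_step t x e"
proof -
  note b = mirror_base
  have t: "t \<in> S" "t \<noteq> base" "t \<otimes> base \<noteq> base \<otimes> t" "\<phi> t = base \<otimes> t" using lt by (simp_all add: left_type_def)
  have I: "{base, t} \<subseteq> S" using t by simp
  have "mirror.right_type t" "\<not> mirror.right_mult_on t" using mirror_right_type[OF lt] nl by blast+
  then obtain x c where st: "mirror.left_step t x c" using mirror.ex_left_step by blast
  have d: "dihedral_word base t (c # x)" using st unfolding mirror.left_step_def b by simp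
  have S: "set x \<subseteq> S" "c \<in> S" using d I unfolding dihedral_word_def by auto
  have dr: "dihedral_word base t (rev x)" "dihedral_word base t (rev (c # x))"
    using dihedral_word_append[of base t "[c]" x] d by (simp_all only: dihedral_word_rev append_Cons append_Nil)
  have ne: "x \<noteq> []" using st unfolding mirror.left_step_def by auto
  have "\<phi> (word_value (rev x)) = word_value (rev (c # x))"
    using mirror_value[of x "c # x"] S st dw_Q[OF t(1,2) dr(1)] unfolding mirror.left_step_def by simp
  then have "right_step t (rev x) c"
    using dr(2) st ne unfolding right_step_def mirror.left_step_def b by (simp add: hd_rev)
  then show ?thesis by blast
qed

end

subsection \<open>Words outside the domain of a matching\<close>

context full_matching
begin

text \<open>Otherwise an upper word of at most three letters would contain \<open>[l, r]\<close>,
  \<open>[base, l]\<close> and \<open>[r, base]\<close>, which cannot be achieved by one insertion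
  into \<open>[l, r]\<close>.\<close>

lemma type_commute:
  assumes l: "left_type l" and r: "right_type r" shows "l \<otimes> r = r \<otimes> l"
proof (rule ccontr)
  assume nc: "l \<otimes> r \<noteq> r \<otimes> l"
  have S: "l \<in> S" "r \<in> S" "l \<noteq> base" "r \<noteq> base" using l r by (simp_all add: left_type_def right_type_def)
  have lr: "l \<noteq> r" using nc by auto
  have u: "unique_word [l, r]" "unique_word [base, l]" "unique_word [r, base]"
    using noncommuting_unique[of l r] noncommuting_unique[of base l] noncommuting_unique[of r base] nc S l r
    by (auto simp: left_type_def right_type_def)
  have "dihedral_word l r [l, r]" using lr by (simp add: dihedral_word_def)
  then have Q: "word_value [l, r] \<in> Q" using dihedral_word_Q[OF S(1,2) lr, of "[l, r]"] ord_ge_3[OF S(1,2) nc] by simp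
  obtain Z where Z: "length Z \<le> Suc (length [l, r])"
    and 1: "\<And>\<omega> \<eta>. unique_word \<omega> \<Longrightarrow> subseq \<eta> [l, r] \<Longrightarrow> \<phi> (word_value \<eta>) = word_value \<omega> \<Longrightarrow> subseq \<omega> Z"
    and 2: "\<And>\<omega>. unique_word \<omega> \<Longrightarrow> subseq \<omega> [l, r] \<Longrightarrow> subseq \<omega> Z"
    using upper_wordE[OF unique_word_reduced[OF u(1)] Q] by metis
  have s: "subseq [l, r] Z" using 2[OF u(1)] by simp
  have s1: "subseq [base, l] Z" using 1[OF u(2), of "[l]"] l S by (simp add: left_type_def)
  have s2: "subseq [r, base] Z" using 1[OF u(3), of "[r]"] r S by (simp add: right_type_def)
  from s Z show False
  proof (cases rule: subseq_insert_cases)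
    case 1
    then show False using s1 S lr by simp
  next
    case (2 \<alpha> e \<beta>)
    then show False using s1 s2 S lr by (auto simp: Cons_eq_append_conv split: if_splits)
  qed
qed

text \<open>The upper word contains \<open>[base, l]\<close> and \<open>[r, base]\<close>, and no
  single letter inserted into \<open>[l, base, r]\<close> produces both.\<close>

lemma left_base_right_notin:
  assumes l: "left_type l" and r: "right_type r" shows "word_value [l, base, r] \<notin> Q"
proof
  assume Q: "word_value [l, base, r] \<in> Q"
  have S: "l \<in> S" "r \<in> S" "l \<noteq> base" "r \<noteq> base" using l r by (simp_all add: left_type_def right_type_def)
  have nc: "l \<otimes> base \<noteq> base \<otimes> l" "base \<otimes> r \<noteq> r \<otimes> base" using l r by (auto simp: left_type_def right_type_def)
  have lr: "l \<noteq> r" using l r type_distinct by blast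
  have u: "unique_word [base, l]" "unique_word [r, base]" "unique_word [base, r]"
    using noncommuting_unique nc S by simp_all
  have u3: "unique_word [l, base, r]"
  proof (rule unique_word_Cons')
    show "\<not> prefix (alternating (ord l (hd [base, r])) l (hd [base, r])) [l, base, r]"
    proof
      assume p: "prefix (alternating (ord l (hd [base, r])) l (hd [base, r])) [l, base, r]"
      obtain j where "ord l base = Suc (Suc (Suc j))"
        using ord_ge_3[OF S(1) base_S nc(1)] le_Suc_ex[of 3 "ord l base"] by (auto simp: numeral_3_eq_3)
      then show False using p lr by simp
    qed
  qed (use S u in auto)
  obtain Z where Z: "length Z \<le> Suc (length [l, base, r])"
    and 1: "\<And>\<omega> \<eta>. unique_word \<omega> \<Longrightarrow> subseq \<eta> [l, base, r] \<Longrightarrow> \<phi> (word_value \<eta>) = word_value \<omega> \<Longrightarrow> subseq \<omega> Z"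
    and 2: "\<And>\<omega>. unique_word \<omega> \<Longrightarrow> subseq \<omega> [l, base, r] \<Longrightarrow> subseq \<omega> Z"
    using upper_wordE[OF unique_word_reduced[OF u3] Q] by metis
  have s: "subseq [l, base, r] Z" using 2[OF u3] by simp
  have s1: "subseq [base, l] Z" using 1[OF u(1), of "[l]"] l S by (simp add: left_type_def)
  have s2: "subseq [r, base] Z" using 1[OF u(2), of "[r]"] r S by (simp add: right_type_def)
  from s Z show False
  proof (cases rule: subseq_insert_cases)
    case 1
    then show False using s1 S lr by simp
  next
    case (2 \<alpha> e \<beta>)
    then show False using s1 s2 S lr by (auto simp: Cons_eq_append_conv split: if_splits)
  qed
qed

lemma no_left_base_right:
  assumes "left_type l" "right_type r" "reduced \<omega>" "word_value \<omega> \<in> Q"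
  shows "\<not> subseq [l, base, r] \<omega>"
  using subword_Q[OF assms(3,4)] left_base_right_notin[OF assms(1,2)] by blast

text \<open>If this element of length two were the upper one, its partner would be
  \<open>base\<close> or \<open>a\<close>; but the partner of \<open>base\<close> is
  \<open>\<one>\<close> and that of \<open>a\<close> is the other product.\<close>

lemma lower_pair:
  assumes a: "a \<in> S" "a \<noteq> base" "a \<otimes> base \<noteq> base \<otimes> a" and xy: "{x, y} = {a, base}" and ph: "\<phi> a \<noteq> x \<otimes> y"
  shows "lower (x \<otimes> y) = x \<otimes> y"
proof (rule ccontr)
  assume neq: "lower (x \<otimes> y) \<noteq> x \<otimes> y"
  have xyS: "x \<in> S" "y \<in> S" "x \<noteq> y" using xy a by (auto simp: doubleton_eq_iff)
  have d: "dihedral_word base a [x, y]" using xy xyS by (auto simp: dihedral_word_def)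
  have o: "3 \<le> ord base a" using ord_ge_3[OF base_S a(1)] a(3) by metis
  have r: "reduced [x, y]" using dw_reduced[OF a(1,2) d] o by simp
  have l2: "len (x \<otimes> y) = 2" using reduced_len[OF r] xyS by simp
  have q: "x \<otimes> y \<in> Q" using dw_Q[OF a(1,2) d] xyS by simp
  have "len (\<phi> (x \<otimes> y)) = 1" using neq phi_len[OF q] l2 by (auto simp: lower_def split: if_splits)
  moreover have "\<phi> (x \<otimes> y) \<in> parabolic {base, a}"
    using phi_parabolic_pair[OF a(1,2) dw_parabolic[OF a(1,2) d]] xyS by simp
  then obtain \<omega> where \<omega>: "dihedral_word base a \<omega>" "reduced \<omega>" "word_value \<omega> = \<phi> (x \<otimes> y)"
    using parabolic_word[OF a(1,2)] by metis
  ultimately have "length \<omega> = 1" using reduced_len[OF \<omega>(2)] by simp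
  then obtain z where z: "\<omega> = [z]" by (auto simp: length_Suc_conv)
  then have "z = base \<or> z = a" "\<phi> (x \<otimes> y) = z" using \<omega> a by (auto simp: dihedral_word_def)
  moreover have "\<phi> (\<phi> (x \<otimes> y)) = x \<otimes> y" using q by simp
  moreover have "x \<otimes> y \<noteq> \<one>" using l2 by fastforce
  ultimately show False using ph phi_base by metis
qed

text \<open>For \<open>v\<close> without the letter \<open>\<phi> 1\<close>, the element \<open>\<phi> v\<close> arises from a word of \<open>v\<close> by inserting this letter
  once.  A letter \<open>r\<close> with \<open>\<phi> r = r \<otimes> \<phi> 1\<close> cannot occur after it, because the element \<open>\<phi> 1 \<otimes> r\<close> is
  the lower element of its orbit and would lie below \<open>v\<close>.\<close>

lemma upper_without_base:
  assumes v: "reduced \<omega>" "word_value \<omega> \<in> Q" "base \<notin> set \<omega>"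
  obtains \<alpha> \<beta> where "reduced (\<alpha> @ \<beta>)" "word_value (\<alpha> @ \<beta>) = word_value \<omega>"
    "reduced (\<alpha> @ base # \<beta>)" "word_value (\<alpha> @ base # \<beta>) = upper (word_value \<omega>)"
    "\<And>a. a \<in> set \<alpha> \<Longrightarrow> right_type a \<or> central_type a" "\<And>a. a \<in> set \<beta> \<Longrightarrow> left_type a \<or> central_type a"
proof -
  let ?v = "word_value \<omega>"
  have nb: "\<not> bruhat_le base ?v" using gen_le_iff[OF v(1) base_S] v(3) by simp
  have bu: "bruhat_le base (upper ?v)" using base_le_upper v(2) .
  then have up: "len ?v < len (\<phi> ?v)" using nb by (auto simp: upper_def split: if_splits)
  have uv: "upper ?v = \<phi> ?v" using up by (simp add: upper_def)
  obtain Z where Z: "reduced Z" "word_value Z = upper ?v" using ex_reduced[of "upper ?v"] v(2) by auto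
  obtain \<eta> where \<eta>: "reduced \<eta>" "subseq \<eta> Z" "word_value \<eta> = ?v"
    using bruhat_subword[OF le_upper[OF v(2)] reducedD[OF Z(1)] Z(2)] by blast
  have "base \<notin> set \<eta>" using reduced_set_eq[OF \<eta>(1) v(1) \<eta>(3)] v(3) by simp
  moreover have "base \<in> set Z" using gen_le_iff[OF Z(1) base_S] Z(2) bu by simp
  moreover have "length Z \<le> Suc (length \<eta>)"
    using reduced_len[OF Z(1)] reduced_len[OF \<eta>(1)] Z(2) \<eta>(3) len_upper[OF v(2)] by simp
  ultimately obtain \<alpha> \<beta> where ab: "Z = \<alpha> @ base # \<beta>" "\<eta> = \<alpha> @ \<beta>" using subseq_insertE[OF \<eta>(2)] by metis
  have nb2: "base \<notin> set \<alpha>" "base \<notin> set \<beta>" using \<open>base \<notin> set \<eta>\<close> ab by auto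
  have S: "set \<alpha> \<subseteq> S" "set \<beta> \<subseteq> S" using reducedD[OF \<eta>(1)] ab by auto
  have no: False if p: "subseq [x, y] Z" and a: "a \<in> S" "a \<noteq> base" "a \<otimes> base \<noteq> base \<otimes> a"
    and xy: "{x, y} = {a, base}" "\<phi> a \<noteq> x \<otimes> y" for x y a
  proof -
    have xyS: "x \<in> S" "y \<in> S" using xy a by (auto simp: doubleton_eq_iff)
    have "bruhat_le (x \<otimes> y) (upper ?v)" using subseq_bruhat[OF Z(1) p] Z(2) xyS by simp
    then have "bruhat_le (lower (x \<otimes> y)) (lower (upper ?v))" using lower_mono v(2) by simp
    moreover have "lower (upper ?v) = ?v" using uv up v(2) by (simp add: lower_def)
    ultimately have "bruhat_le (x \<otimes> y) ?v" using lower_pair[OF a xy] by simp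
    moreover have "bruhat_le base (x \<otimes> y)"
    proof -
      have d: "dihedral_word base a [x, y]" using xy a by (auto simp: dihedral_word_def doubleton_eq_iff)
      have "3 \<le> ord base a" using ord_ge_3[OF base_S a(1)] a(3) by metis
      then have "reduced [x, y]" using dw_reduced[OF a(1,2) d] by simp
      then show ?thesis using gen_le_iff[of "[x, y]" base] xy(1) xyS by auto
    qed
    ultimately show False using nb bruhat_trans by blast
  qed
  show ?thesis
  proof (rule that[of \<alpha> \<beta>])
    fix a assume a: "a \<in> set \<alpha>"
    then have aS: "a \<in> S" "a \<noteq> base" using S nb2 by auto
    have "subseq [a] \<alpha>" using a by (simp add: subseq_singleton_left)
    then have "subseq ([a] @ [base]) (\<alpha> @ base # \<beta>)" by (intro list_emb_append_mono) auto
    then have p: "subseq [a, base] Z" using ab by simp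
    show "right_type a \<or> central_type a"
      using aS(1)
    proof (cases rule: type_cases)
      case 3
      then show ?thesis using no[OF p aS] by (auto simp: left_type_def)
    qed (use aS in auto)
  next
    fix a assume a: "a \<in> set \<beta>"
    then have aS: "a \<in> S" "a \<noteq> base" using S nb2 by auto
    have "subseq ([] @ [base, a]) (\<alpha> @ base # \<beta>)"
      using a by (intro list_emb_append_mono) (auto simp: subseq_singleton_left)
    then have p: "subseq [base, a] Z" using ab by simp
    show "left_type a \<or> central_type a"
      using aS(1)
    proof (cases rule: type_cases)
      case 2
      then show ?thesis using no[OF p aS] by (auto simp: right_type_def)
    qed (use aS in auto)
  qed (use ab Z \<eta> in simp_all)
qed

text \<open>The upper word is \<open>b # x\<close> with \<open>r\<close> inserted. The subword
  \<open>[r, base]\<close> leaves at least two letters of \<open>x\<close> after \<open>r\<close>,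
  while \<open>x\<close> without its last letter must fit before \<open>r\<close>. The lengths then
  force that part to be everything before \<open>r\<close>, so \<open>b\<close> would equal the
  first letter of \<open>x\<close>.\<close>

lemma left_step_right_type_notin:
  assumes t: "right_type t" and st: "left_step t x b" and r: "right_type r" "r \<noteq> t"
  shows "word_value (x @ [r]) \<notin> Q"
proof
  assume Q: "word_value (x @ [r]) \<in> Q"
  have tS: "t \<in> S" "t \<noteq> base" and rS: "r \<in> S" "r \<noteq> base" "r \<otimes> base \<noteq> base \<otimes> r" "\<phi> r = r \<otimes> base"
    using t r by (simp_all add: right_type_def)
  have d: "dihedral_word base t (b # x)" "2 \<le> length x" "length x + 2 \<le> ord base t" "last x = t"
    "\<phi> (word_value x) = word_value (b # x)" using st by (simp_all add: left_step_def)
  have dx: "dihedral_word base t x" using dihedral_word_append[of base t "[b]" x] d(1) by simp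
  have xne: "x \<noteq> []" using d(2) by auto
  obtain y where y: "x = y @ [t]" using xne d(4) by (metis append_butlast_last_id)
  have yne: "y \<noteq> []" using d(2) y by auto
  have dy: "dihedral_word base t y" using dihedral_word_append dx y by metis
  have ly: "last y = base" using dihedral_word_snocD[of base t y t] dx y yne dihedral_word_last[OF dy yne] by auto
  have rx: "r \<notin> {base, t}" using rS r by simp
  then have rn: "r \<notin> set (b # x)" using d(1) by (auto simp: dihedral_word_def)
  have red: "reduced (x @ [r])"
    using reduced_snoc_new[OF dw_reduced[OF tS dx] rS(1)] d(3) rn by simp
  have u1: "unique_word (b # x)" using dw_unique[OF tS d(1)] d(3) by simp
  have u2: "unique_word [r, base]" using noncommuting_unique rS by simp
  have u3: "unique_word (y @ [r])"
    using unique_word_dihedral_snoc[OF base_S tS(1) tS(2)[symmetric] rS(1) rx dy _ yne] d(3) y ly rS(3) by simp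
  obtain Z where Z: "length Z \<le> Suc (length (x @ [r]))"
    and 1: "\<And>\<omega> \<eta>. unique_word \<omega> \<Longrightarrow> subseq \<eta> (x @ [r]) \<Longrightarrow> \<phi> (word_value \<eta>) = word_value \<omega> \<Longrightarrow> subseq \<omega> Z"
    and 2: "\<And>\<omega>. unique_word \<omega> \<Longrightarrow> subseq \<omega> (x @ [r]) \<Longrightarrow> subseq \<omega> Z"
    using upper_wordE[OF red Q] by metis
  have s1: "subseq (b # x) Z" using 1[OF u1 subseq_rev_drop_many[OF subseq_order.order_refl] d(5)] .
  have s2: "subseq [r, base] Z" using 1[OF u2, of "[r]"] rS by (simp add: subseq_drop_many)
  have s3: "subseq (y @ [r]) Z" using 2[OF u3] y by (simp add: subseq_append')
  have "r \<in> set Z" using subseq_subset[OF s2] by simp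
  then obtain \<alpha> \<beta> where ab: "Z = \<alpha> @ r # \<beta>" "b # x = \<alpha> @ \<beta>" using subseq_insertE[OF s1 _ rn] Z by auto
  have nr: "r \<notin> set \<alpha>" "r \<notin> set \<beta>" using rn ab(2) by auto
  have "subseq [base] \<beta>" using subseq_Cons_splitD[of r "[base]" \<alpha> \<beta>] s2 ab nr by simp
  then have bb: "base \<in> set \<beta>" by (simp add: subseq_singleton_left)
  then have "\<beta> \<noteq> []" by auto
  then have "last \<beta> = t" using ab(2) d(4) xne by (metis last_ConsR last_appendR)
  then have lb: "2 \<le> length \<beta>" using bb tS by (cases \<beta>; cases "tl \<beta>") auto
  have ya: "subseq y \<alpha>" using subseq_snoc_splitD[of y r \<alpha> \<beta>] s3 ab(1) nr by simp
  have "length \<alpha> + length \<beta> = Suc (length x)" using arg_cong[OF ab(2), of length] by simp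
  then have "length \<alpha> \<le> length y" using lb y by simp
  then have "\<alpha> = y" using subseq_length_less[OF ya] by force
  then have "b = hd x" using ab(2) y yne by (metis hd_append2 list.sel(1))
  then show False using dihedral_word_ConsD[OF d(1) xne] by simp
qed

text \<open>The upper word is \<open>g @ [base, t]\<close> with \<open>l\<close> inserted. The
  subword \<open>[l, base]\<close> forces at least two letters after \<open>l\<close>, and
  \<open>e\<close> followed by \<open>g\<close> without its last letter must fit before it. Counting
  gives \<open>e = hd g\<close>, against alternation.\<close>

lemma right_violation_left_type_notin:
  assumes t: "right_type t" and v: "right_violation t base g e f'" and l: "left_type l"
  shows "word_value (g @ [l, base]) \<notin> Q"
proof
  assume Q: "word_value (g @ [l, base]) \<in> Q"
  have tS: "t \<in> S" "t \<noteq> base" "t \<otimes> base \<noteq> base \<otimes> t" "\<phi> t = t \<otimes> base" using t by (simp_all add: right_type_def)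
  have lS: "l \<in> S" "l \<noteq> base" "l \<otimes> base \<noteq> base \<otimes> l" "\<phi> l = base \<otimes> l" using l by (simp_all add: left_type_def)
  have lt: "l \<noteq> t" using l t type_distinct by blast
  have V: "g \<noteq> []" "f' \<noteq> base" "dihedral_word base t (g @ [base, f'])" "dihedral_word base t (e # g)"
    "\<phi> (word_value g) = word_value (e # g)" "\<phi> (word_value (g @ [base])) = word_value (g @ [base, f'])"
    "length g + 3 \<le> ord base t" using v by (simp_all add: right_violation_def)
  have f't: "f' = t" using V(2,3) by (auto simp: dihedral_word_def)
  have dg: "dihedral_word base t g" using dihedral_word_append[of base t "[e]" g] V(4) by simp
  have "dihedral_word base t (g @ [base])" using dihedral_word_append[of base t "g @ [base]" "[f']"] V(3) by simp
  then have lg: "last g = t" using dihedral_word_snocD V(1) dihedral_word_last[OF dg V(1)] by force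
  obtain g0 where g0: "g = g0 @ [t]" using V(1) lg by (metis append_butlast_last_id)
  have en: "e \<noteq> hd g" "e \<in> {base, t}" using dihedral_word_ConsD[OF V(4,1)] by simp_all
  have g0ne: "g0 \<noteq> []"
  proof
    assume "g0 = []"
    then have "\<phi> t = base \<otimes> t" using V(5) g0 en tS by auto
    then show False using tS by simp
  qed
  have dg0: "dihedral_word base t g0" using dihedral_word_append dg g0 by metis
  have lg0: "last g0 = base"
    using dihedral_word_snocD[of base t g0 t] dg g0 g0ne dihedral_word_last[OF dg0 g0ne] by auto
  have deg0: "dihedral_word base t (e # g0)" using dihedral_word_append[of base t "e # g0" "[t]"] V(4) g0 by simp
  have ln: "l \<notin> {base, t}" using lS lt by simp
  have u1: "unique_word (g @ [base, t])" using dw_unique[OF tS(1,2)] V(3,7) f't by simp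
  have u2: "unique_word [l, base]" using noncommuting_unique lS by simp
  have u3: "unique_word (e # g)" using dw_unique[OF tS(1,2) V(4)] V(7) by simp
  have u4: "unique_word (g0 @ [l])"
    using unique_word_dihedral_snoc[OF base_S tS(1) tS(2)[symmetric] lS(1) ln dg0 _ g0ne] V(7) g0 lg0 lS(3) by simp
  have u5: "unique_word ((e # g0) @ [l])"
    using unique_word_dihedral_snoc[OF base_S tS(1) tS(2)[symmetric] lS(1) ln deg0] V(7) g0 g0ne lg0 lS(3) by simp
  have redg: "reduced g" using dw_reduced[OF tS(1,2) dg] V(7) by simp
  have red: "reduced (g @ [l, base])"
  proof (rule reduced_append_parabolic_left)
    show "reduced [l, base]" using u2 by simp
    show "set g \<subseteq> {base, t}" using dg by (simp add: dihedral_word_def)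
    fix a assume a: "a \<in> {base, t}"
    then have "a \<in> S" "a \<noteq> l" using tS ln by auto
    then show "\<not> len (a \<otimes> word_value [l, base]) < len (word_value [l, base])"
      using unique_word_left_descent[OF u2, of a] by auto
  qed (use redg tS in simp_all)
  have red2: "reduced (g @ [l])" using reduced_append(1)[of "g @ [l]" "[base]"] red by simp
  have Q2: "word_value (g @ [l]) \<in> Q" using subword_Q[OF red Q, of "g @ [l]"] by (simp add: subseq_append')
  obtain Z where Z: "length Z \<le> Suc (length (g @ [l, base]))"
    and Z0: "\<And>\<omega> \<eta>. unique_word \<omega> \<Longrightarrow> subseq \<eta> (g @ [l, base]) \<Longrightarrow> bruhat_le (word_value \<omega>) (upper (word_value \<eta>)) \<Longrightarrow> subseq \<omega> Z"
    and Z1: "\<And>\<omega> \<eta>. unique_word \<omega> \<Longrightarrow> subseq \<eta> (g @ [l, base]) \<Longrightarrow> \<phi> (word_value \<eta>) = word_value \<omega> \<Longrightarrow> subseq \<omega> Z"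
    and Z2: "\<And>\<omega>. unique_word \<omega> \<Longrightarrow> subseq \<omega> (g @ [l, base]) \<Longrightarrow> subseq \<omega> Z"
    using upper_wordE[OF red Q] by metis
  \<comment> \<open>An intermediate orbit is needed to see that \<open>(e # g0) @ [l]\<close> lies
    below the final upper element. \<open>Y\<close> is \<open>e # g\<close> with \<open>l\<close>
    inserted; the part before \<open>l\<close> contains \<open>g0\<close> but starts with
    \<open>e\<close>, so it is longer and contains \<open>e # g0\<close>.\<close>
  obtain Y where Y: "reduced Y" "word_value Y = upper (word_value (g @ [l]))" "length Y \<le> Suc (length (g @ [l]))"
    and Y1: "\<And>\<omega> \<eta>. unique_word \<omega> \<Longrightarrow> subseq \<eta> (g @ [l]) \<Longrightarrow> \<phi> (word_value \<eta>) = word_value \<omega> \<Longrightarrow> subseq \<omega> Y"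
    and Y2: "\<And>\<omega>. unique_word \<omega> \<Longrightarrow> subseq \<omega> (g @ [l]) \<Longrightarrow> subseq \<omega> Y"
    using upper_wordE[OF red2 Q2] by metis
  have y1: "subseq (e # g) Y" using Y1[OF u3 _ V(5)] by (simp add: subseq_rev_drop_many)
  have y2: "subseq (g0 @ [l]) Y" using Y2[OF u4] g0 by (simp add: subseq_append')
  have "l \<in> set Y" using subseq_subset[OF y2] by simp
  moreover have lneg: "l \<notin> set (e # g)" using V(4) ln by (auto simp: dihedral_word_def)
  ultimately obtain \<alpha>1 \<beta>1 where ab1: "Y = \<alpha>1 @ l # \<beta>1" "e # g = \<alpha>1 @ \<beta>1" using subseq_insertE[OF y1] Y(3) by auto
  have n1: "l \<notin> set \<alpha>1" "l \<notin> set \<beta>1" using lneg ab1(2) by auto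
  have g0a: "subseq g0 \<alpha>1" using subseq_snoc_splitD[of g0 l \<alpha>1 \<beta>1] y2 ab1(1) n1 by simp
  then have a1ne: "\<alpha>1 \<noteq> []" using g0ne by (cases \<alpha>1) auto
  then have "hd \<alpha>1 = e" using ab1(2) by (cases \<alpha>1) auto
  then have "g0 \<noteq> \<alpha>1" using en g0 g0ne by (cases g0) auto
  then have la1: "length g \<le> length \<alpha>1" using subseq_length_less[OF g0a] g0 by simp
  have "\<alpha>1 = take (length \<alpha>1) (e # g)" using ab1(2) by simp
  then have "take (length g) \<alpha>1 = take (length g) (e # g)" using la1 by (metis min.absorb2 take_take min.commute)
  also have "\<dots> = e # g0" using g0 by (simp add: take_Cons')
  finally have "subseq (e # g0) \<alpha>1" by (metis prefix_imp_subseq take_is_prefix)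
  then have "subseq ((e # g0) @ [l]) (\<alpha>1 @ l # \<beta>1)" by (intro list_emb_append_mono) auto
  then have "bruhat_le (word_value ((e # g0) @ [l])) (upper (word_value (g @ [l])))"
    using subseq_bruhat[OF Y(1)] Y(2) ab1(1) by metis
  then have s5: "subseq ((e # g0) @ [l]) Z" by (rule Z0[OF u5, rotated]) (simp add: subseq_append')
  have s1: "subseq (g @ [base, t]) Z" using Z1[OF u1, of "g @ [base]"] V(6) f't by (simp add: subseq_append')
  have s2: "subseq [l, base] Z" using Z2[OF u2] by (simp add: subseq_drop_many)
  have ln2: "l \<notin> set (g @ [base, t])" using lneg ln by simp
  have "l \<in> set Z" using subseq_subset[OF s2] by simp
  then obtain \<alpha> \<beta> where ab: "Z = \<alpha> @ l # \<beta>" "g @ [base, t] = \<alpha> @ \<beta>" using subseq_insertE[OF s1 _ ln2] Z by auto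
  have n: "l \<notin> set \<alpha>" "l \<notin> set \<beta>" using ln2 ab(2) by auto
  have "subseq [base] \<beta>" using subseq_Cons_splitD[of l "[base]" \<alpha> \<beta>] s2 ab n by simp
  then have bb: "base \<in> set \<beta>" by (simp add: subseq_singleton_left)
  then have "\<beta> \<noteq> []" by auto
  then have "last \<beta> = last (g @ [base, t])" unfolding ab(2) by simp
  then have lb: "2 \<le> length \<beta>" using bb tS by (cases \<beta>; cases "tl \<beta>") auto
  have ega: "subseq (e # g0) \<alpha>" using subseq_snoc_splitD[of "e # g0" l \<alpha> \<beta>] s5 ab(1) n by simp
  have "length \<alpha> + length \<beta> = length g + 2" using arg_cong[OF ab(2), of length] by simp
  then have "length \<alpha> \<le> length (e # g0)" using lb g0 by simp
  then have "\<alpha> = e # g0" using subseq_length_less[OF ega] by force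
  then have "hd g = e" using ab(2) V(1) by (metis append_Cons hd_append2 list.sel(1))
  then show False using en by simp
qed

text \<open>The upper word is \<open>f' # f # g\<close> with \<open>c\<close> inserted. Before
  \<open>c\<close> there is \<open>x\<close> and more, because the first letter is
  \<open>f'\<close>; after it there is \<open>y @ [e]\<close> and more, because the last letter is
  that of \<open>g\<close>. This leaves no room unless \<open>w\<close> has two letters. A
  one-letter \<open>w\<close> allows \<open>c\<close> to be moved past a letter with which it
  commutes.\<close>

lemma left_violation_insert_notin:
  assumes t: "t \<in> S" "t \<noteq> base" and v: "left_violation t f g e f'"
    and split: "f # g = x @ w @ y" "length w \<le> 1" "x \<noteq> []" "y \<noteq> []"
    and c: "c \<in> S" "c \<notin> {base, t}" "c \<otimes> last x \<noteq> last x \<otimes> c" "c \<otimes> hd y \<noteq> hd y \<otimes> c"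
  shows "word_value (x @ c # w @ y) \<notin> Q"
proof
  assume Q: "word_value (x @ c # w @ y) \<in> Q"
  have V: "g \<noteq> []" "f' \<noteq> f" "dihedral_word base t (f' # f # g)" "dihedral_word base t (g @ [e])"
    "\<phi> (word_value g) = word_value (g @ [e])" "\<phi> (word_value (f # g)) = word_value (f' # f # g)"
    "length g + 3 \<le> ord base t" using v by (simp_all add: left_violation_def)
  have dfg: "dihedral_word base t (f # g)" using dihedral_word_append[of base t "[f']" "f # g"] V(3) by simp
  have dx: "dihedral_word base t x" and dwy: "dihedral_word base t (w @ y)" and dy: "dihedral_word base t y"
    using dihedral_word_append[of base t x "w @ y"] dihedral_word_append[of base t w y] dfg split(1) by simp_all
  have len: "length x + length w + length y = Suc (length g)" using arg_cong[OF split(1), of length] by simp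
  obtain x' where x': "x = f # x'" "g = x' @ w @ y" using split(1,3) by (cases x) auto
  have lyg: "last y = last g" using x'(2) split(4) by simp
  have eg: "e \<noteq> last g" using dihedral_word_snocD[OF V(4,1)] by simp
  have dye: "dihedral_word base t (y @ [e])"
    using dihedral_word_append[of base t "x' @ w" "y @ [e]"] V(4) x'(2) by simp
  have u1: "unique_word (f' # f # g)" using dw_unique[OF t V(3)] V(7) by simp
  have ux: "unique_word (x @ [c])"
    using unique_word_dihedral_snoc[OF base_S t(1) t(2)[symmetric] c(1,2) dx _ split(3) c(3)] len V(7) by simp
  have uy: "unique_word (c # y)"
    using unique_word_Cons_dihedral[OF base_S t(1) t(2)[symmetric] c(1,2) dy _ split(4) c(4)] len V(7) by simp
  have uye: "unique_word (c # y @ [e])"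
    using unique_word_Cons_dihedral[OF base_S t(1) t(2)[symmetric] c(1,2) dye] len V(7) split(3,4) c(4) by (cases x) auto
  have ug: "unique_word (g @ [e])" using dw_unique[OF t V(4)] V(7) by simp
  have red: "reduced (x @ c # w @ y)"
  proof -
    have "reduced ((x @ [c]) @ (w @ y))"
    proof (rule reduced_append_parabolic)
      show "reduced (x @ [c])" using ux by simp
      show "reduced (w @ y)" using dw_reduced[OF t dwy] len V(7) by simp
      show "set (w @ y) \<subseteq> {base, t}" using dwy by (simp add: dihedral_word_def)
      show "{base, t} \<subseteq> S" using t by simp
      fix a assume a: "a \<in> {base, t}"
      then have "a \<in> S" "a \<noteq> c" using t c by auto
      then show "\<not> len (word_value (x @ [c]) \<otimes> a) < len (word_value (x @ [c]))"
        using unique_word_right_descent[OF ux, of a] by auto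
    qed
    then show ?thesis by simp
  qed
  have sub1: "subseq (f # g) (x @ c # w @ y)" unfolding split(1) by (intro list_emb_append_mono) auto
  obtain Z where Z: "length Z \<le> Suc (length (x @ c # w @ y))"
    and Z0: "\<And>\<omega> \<eta>. unique_word \<omega> \<Longrightarrow> subseq \<eta> (x @ c # w @ y) \<Longrightarrow> bruhat_le (word_value \<omega>) (upper (word_value \<eta>)) \<Longrightarrow> subseq \<omega> Z"
    and Z1: "\<And>\<omega> \<eta>. unique_word \<omega> \<Longrightarrow> subseq \<eta> (x @ c # w @ y) \<Longrightarrow> \<phi> (word_value \<eta>) = word_value \<omega> \<Longrightarrow> subseq \<omega> Z"
    and Z2: "\<And>\<omega>. unique_word \<omega> \<Longrightarrow> subseq \<omega> (x @ c # w @ y) \<Longrightarrow> subseq \<omega> Z"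
    using upper_wordE[OF red Q] by metis
  have s1: "subseq (f' # f # g) Z" using Z1[OF u1 sub1 V(6)] .
  have s2: "subseq (x @ [c]) Z"
    by (rule Z2[OF ux]) (intro list_emb_append_mono, auto)
  have cn: "c \<notin> set (f' # f # g)" "c \<notin> set (g @ [e])"
    using V(3,4) c(2) unfolding dihedral_word_def by blast+
  have "c \<in> set Z" using subseq_subset[OF s2] by simp
  then obtain \<alpha> \<beta> where ab: "Z = \<alpha> @ c # \<beta>" "f' # f # g = \<alpha> @ \<beta>" using subseq_insertE[OF s1 _ cn(1)] Z len by auto
  have n: "c \<notin> set \<alpha>" "c \<notin> set \<beta>" using cn(1) ab(2) by auto
  have xa: "subseq x \<alpha>" using subseq_snoc_splitD[of x c \<alpha> \<beta>] s2 ab(1) n by simp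
  then have "\<alpha> \<noteq> []" using split(3) by (cases \<alpha>) auto
  then have "hd \<alpha> = f'" using ab(2) by (cases \<alpha>) auto
  then have "x \<noteq> \<alpha>" using x'(1) V(2) by auto
  then have la: "length x < length \<alpha>" using subseq_length_less[OF xa] by blast

  let ?\<omega>1 = "x' @ c # w @ y"
  have sub: "subseq ?\<omega>1 (x @ c # w @ y)" unfolding x'(1) append_Cons by (rule list_emb_Cons) simp
  have red1: "reduced ?\<omega>1" using red x'(1) reduced_ConsD by simp
  have Q1: "word_value ?\<omega>1 \<in> Q" using subword_Q[OF red Q sub] .
  \<comment> \<open>Without the first letter \<open>f\<close>, the upper word is
    \<open>g @ [e]\<close> with \<open>c\<close> inserted. After \<open>c\<close> it contains
    \<open>y\<close> and ends in \<open>e\<close>, which differs from the last letter of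
    \<open>y\<close>; hence \<open>c # y @ [e]\<close> is available.\<close>
  obtain Y where Y: "reduced Y" "word_value Y = upper (word_value ?\<omega>1)" "length Y \<le> Suc (length ?\<omega>1)"
    and Y1: "\<And>\<omega> \<eta>. unique_word \<omega> \<Longrightarrow> subseq \<eta> ?\<omega>1 \<Longrightarrow> \<phi> (word_value \<eta>) = word_value \<omega> \<Longrightarrow> subseq \<omega> Y"
    and Y2: "\<And>\<omega>. unique_word \<omega> \<Longrightarrow> subseq \<omega> ?\<omega>1 \<Longrightarrow> subseq \<omega> Y"
    using upper_wordE[OF red1 Q1] by metis
  have "subseq g ?\<omega>1" unfolding x'(2) by (intro list_emb_append_mono) auto
  then have y1: "subseq (g @ [e]) Y" using Y1[OF ug _ V(5)] by blast
  have "subseq ([] @ [c] @ y) (x' @ [c] @ (w @ y))" by (intro list_emb_append_mono) (auto simp: subseq_drop_many)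
  then have y2: "subseq (c # y) Y" using Y2[OF uy] by simp
  have "c \<in> set Y" using subseq_subset[OF y2] by simp
  moreover have "length Y \<le> Suc (length (g @ [e]))" using Y(3) len x' by simp
  ultimately obtain \<alpha>1 \<beta>1 where ab1: "Y = \<alpha>1 @ c # \<beta>1" "g @ [e] = \<alpha>1 @ \<beta>1"
    using subseq_insertE[OF y1 _ cn(2)] by metis
  have "c \<notin> set \<alpha>1" using cn(2) ab1(2) by auto
  then have yb1: "subseq y \<beta>1" using subseq_Cons_splitD y2 ab1(1) by metis
  then have b1ne: "\<beta>1 \<noteq> []" using split(4) by auto
  then have lb1: "last \<beta>1 = e" using ab1(2) by (metis last_appendR last_snoc)
  then have "subseq y (butlast \<beta>1)" using subseq_butlast[OF yb1 split(4)] lyg eg by simp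
  then have "subseq (y @ [e]) (butlast \<beta>1 @ [last \<beta>1])" using lb1 by (intro list_emb_append_mono) auto
  then have "subseq (y @ [e]) \<beta>1" using b1ne by simp
  then have "subseq ([] @ c # y @ [e]) (\<alpha>1 @ c # \<beta>1)" by (intro list_emb_append_mono) auto
  then have "bruhat_le (word_value (c # y @ [e])) (upper (word_value ?\<omega>1))"
    using subseq_bruhat[OF Y(1)] Y(2) ab1(1) by (metis append_Nil)
  then have "subseq (c # y @ [e]) Z" using Z0[OF uye sub] by blast
  then have yeb: "subseq (y @ [e]) \<beta>" using subseq_Cons_splitD ab(1) n by metis
  then have "\<beta> \<noteq> []" by auto
  then have "last \<beta> = last (f' # f # g)" unfolding ab(2) by simp
  then have "last \<beta> = last g" using V(1) by simp
  then have "y @ [e] \<noteq> \<beta>" using eg by auto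
  then have "length y + 1 < length \<beta>" using subseq_length_less[OF yeb] by simp
  moreover have "length \<alpha> + length \<beta> = length g + 2" using arg_cong[OF ab(2), of length] by simp
  ultimately show False using la len split(2) by simp
qed

text \<open>Both words occur in a reduced word of \<open>M\<close> and end in their own generators.
  Whichever of these comes later extends the other word, which
  \<open>left_step_right_type_notin\<close> forbids.\<close>

lemma left_step_unique:
  assumes t: "right_type t" "left_step t x b" and r: "right_type r" "left_step r y c"
    and M: "M \<in> Q" "bruhat_le (word_value x) M" "bruhat_le (word_value y) M"
  shows "r = t"
proof (rule ccontr)
  assume neq: "r \<noteq> t"
  have U: "unique_word x \<and> (\<exists>p. x = p @ [t])" if "right_type t" "left_step t x b" for t x b
  proof -
    have s: "t \<in> S" "t \<noteq> base" using that right_typeD by blast+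
    have d: "dihedral_word base t (b # x)" "2 \<le> length x" "length x + 2 \<le> ord base t" "last x = t"
      using that by (simp_all add: left_step_def)
    have "dihedral_word base t x" using dihedral_word_append[of base t "[b]" x] d(1) by simp
    then have "unique_word x" using dw_unique[OF s] d(3) by simp
    moreover have "x \<noteq> []" using d(2) by auto
    ultimately show ?thesis using d(4) append_butlast_last_id by metis
  qed
  obtain L where L: "reduced L" "word_value L = M" using ex_reduced M(1) by (meson Q_closed)
  obtain p q where pq: "x = p @ [t]" "y = q @ [r]" using U t r by meson
  have "subseq x L" "subseq y L" using unique_word_subseq[OF _ _ L] U t r M by blast+
  then have "subseq (p @ [t, r]) L \<or> subseq (q @ [r, t]) L" using subseq_last_before neq pq by metis
  then have "subseq (x @ [r]) L \<or> subseq (y @ [t]) L" using pq by simp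
  then show False
    using subword_Q[OF L(1)] L(2) M(1) left_step_right_type_notin[OF t r(1) neq]
      left_step_right_type_notin[OF r t(1) neq[symmetric]] by metis
qed

text \<open>Since \<open>[l, base, t]\<close> is forbidden, the two words can be interleaved with
  hardly any overlap. Applied to \<open>M\<close> this puts \<open>x @ w\<close> into
  \<open>Q\<close>; applied to its upper element it requires two letters more than
  \<open>x @ w\<close> has, one too many.\<close>

lemma left_step_right_step_False:
  assumes t: "right_type t" "left_step t x b" and l: "left_type l" "right_step l w e"
    and M: "M \<in> Q" "bruhat_le (word_value (b # x)) M" "bruhat_le (word_value (w @ [e])) M"
  shows False
proof -
  have tS: "t \<in> S" "t \<noteq> base" "l \<in> S" "l \<noteq> base" using right_typeD[OF t(1)] left_typeD[OF l(1)] by simp_all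
  have lt: "l \<noteq> t" using l t type_distinct by blast
  have d: "dihedral_word base t (b # x)" "2 \<le> length x" "length x + 2 \<le> ord base t" "last x = t"
    "\<phi> (word_value x) = word_value (b # x)" using t(2) by (simp_all add: left_step_def)
  have dl: "dihedral_word base l (w @ [e])" "2 \<le> length w" "length w + 2 \<le> ord base l" "hd w = l"
    "\<phi> (word_value w) = word_value (w @ [e])" using l(2) by (simp_all add: right_step_def)
  have dx: "dihedral_word base t x" using dihedral_word_append[of base t "[b]" x] d(1) by simp
  have dw: "dihedral_word base l w" using dihedral_word_append[OF dl(1)] by simp
  obtain p where p: "x = p @ [base, t]"
  proof -
    obtain y where y: "x = y @ [t]" using d(2,4) by (metis append_butlast_last_id list.size(3) not_numeral_le_zero)
    then have yne: "y \<noteq> []" using d(2) by auto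
    have dy: "dihedral_word base t y" using dihedral_word_append dx y by metis
    have "last y = base" using dihedral_word_snocD[of base t y t] dx y yne dihedral_word_last[OF dy yne] by auto
    then have "y = butlast y @ [base]" using yne by (metis append_butlast_last_id)
    then have "x = butlast y @ [base, t]" using y by simp
    then show ?thesis using that by blast
  qed
  obtain q where q: "w = l # base # q"
  proof -
    obtain y where y: "w = l # y" using dl(2,4) by (cases w) auto
    then have yne: "y \<noteq> []" using dl(2) by auto
    have dy: "dihedral_word base l y" using dihedral_word_append[of base l "[l]" y] dw y by simp
    have "hd y = base" using dihedral_word_ConsD[of base l l y] dw y yne dihedral_word_hd[OF dy yne] by auto
    then show ?thesis using that y yne by (cases y) auto
  qed
  have ux: "unique_word x" using dw_unique[OF tS(1,2) dx] d(3) by simp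
  have uw: "unique_word w" using dw_unique[OF tS(3,4) dw] dl(3) by simp
  have ub: "unique_word (b # x)" using dw_unique[OF tS(1,2) d(1)] d(3) by simp
  have ue: "unique_word (w @ [e])" using dw_unique[OF tS(3,4) dl(1)] dl(3) by simp
  have nsub: "\<not> subseq [l, base, t] L" if "reduced L" "word_value L \<in> Q" for L
    using no_left_base_right[OF l(1) t(1) that] .
  have il: "subseq ((b # p) @ [base, t, l, base] @ (q @ [e])) L \<or> subseq ((b # p) @ [base, l, t, base] @ (q @ [e])) L"
    if "reduced L" "word_value L \<in> Q" "subseq (b # x) L" "subseq (w @ [e]) L" for L
    using subseq_interleave[OF nsub[OF that(1,2)], of "b # p" "q @ [e]"] that(3,4) p q tS lt by simp
  have red: "reduced (x @ w)"
  proof (rule reduced_append_parabolic)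
    show "set w \<subseteq> {base, l}" using dw by (simp add: dihedral_word_def)
    fix a assume "a \<in> {base, l}"
    then have "a \<in> S" "a \<noteq> t" using tS lt by auto
    then show "\<not> len (word_value x \<otimes> a) < len (word_value x)"
      using unique_word_right_descent[OF ux, of a] d(4) by auto
  qed (use ux uw tS in simp_all)
  obtain L where L: "reduced L" "word_value L = M" using ex_reduced M(1) by (meson Q_closed)
  have "subseq (b # x) L" "subseq (w @ [e]) L"
    using unique_word_subseq[OF ub M(2) L] unique_word_subseq[OF ue M(3) L] by blast+
  then have "subseq ((b # p) @ [base, t, l, base] @ (q @ [e])) L \<or> subseq ((b # p) @ [base, l, t, base] @ (q @ [e])) L"
    using il L M by simp
  moreover have "subseq (x @ w) ((b # p) @ [base, t, l, base] @ (q @ [e]))"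
    unfolding append_Cons by (rule list_emb_Cons) (simp add: p q subseq_append' subseq_rev_drop_many)
  moreover have "subseq (p @ [base, l, t, base] @ q) ((b # p) @ [base, l, t, base] @ (q @ [e]))"
    unfolding append_Cons by (rule list_emb_Cons) (simp add: subseq_append' subseq_rev_drop_many)
  ultimately have "subseq (x @ w) L \<or> subseq (p @ [base, l, t, base] @ q) L"
    using subseq_order.order_trans by blast
  \<comment> \<open>The two interleavings differ by exchanging \<open>l\<close> and
    \<open>t\<close>, which commute by \<open>type_commute\<close>.\<close>
  moreover have "word_value (p @ [base, l, t, base] @ q) = word_value (x @ w)"
  proof -
    have S: "set p \<subseteq> S" "set q \<subseteq> S" using reducedD[OF red] p q by auto
    have "l \<otimes> (t \<otimes> z) = t \<otimes> (l \<otimes> z)" if "z \<in> carrier W" for z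
      using type_commute[OF l(1) t(1)] tS that by (simp flip: m_assoc)
    then show ?thesis using p q S tS by simp
  qed
  ultimately have Q: "word_value (x @ w) \<in> Q" using subword_Q[OF L(1)] L(2) M(1) by metis
  obtain Z where Z: "reduced Z" "word_value Z = upper (word_value (x @ w))" "length Z \<le> Suc (length (x @ w))"
    and Z1: "\<And>\<omega> \<eta>. unique_word \<omega> \<Longrightarrow> subseq \<eta> (x @ w) \<Longrightarrow> \<phi> (word_value \<eta>) = word_value \<omega> \<Longrightarrow> subseq \<omega> Z"
    using upper_wordE[OF red Q] by metis
  have "subseq (b # x) Z" using Z1[OF ub _ d(5)] by (simp add: subseq_rev_drop_many)
  moreover have "subseq (w @ [e]) Z" using Z1[OF ue _ dl(5)] by (simp add: subseq_drop_many)
  moreover have "word_value Z \<in> Q" using Z(2) Q by simp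
  ultimately have "subseq ((b # p) @ [base, t, l, base] @ (q @ [e])) Z \<or> subseq ((b # p) @ [base, l, t, base] @ (q @ [e])) Z"
    using il Z(1) by blast
  then have "length p + length q + 6 \<le> length Z" using list_emb_length by fastforce
  then show False using Z(3) p q by simp
qed

end

lemma dihedral_subseq:
  assumes "dihedral_word a c \<omega>" "dihedral_word a c \<zeta>" "length \<omega> < length \<zeta>"
  shows "subseq \<omega> \<zeta>"
proof -
  have pre: "subseq (alternating i x y) (alternating (i + j) x y)" for i j and x y :: 'a
    by (simp add: alternating_add subseq_rev_drop_many)
  have main: "subseq \<omega> (alternating (length \<zeta>) x y)" if xy: "{x, y} = {a, c}" for x y
  proof (cases "\<omega> = []")
    case False
    have d: "dihedral_word x y \<omega>" using assms(1) xy unfolding dihedral_word_def by simp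
    obtain j where j: "length \<zeta> = Suc (length \<omega> + j)" using assms(3) less_imp_Suc_add by blast
    consider "hd \<omega> = x" | "hd \<omega> = y" using dihedral_word_hd[OF d False] by blast
    then show ?thesis
    proof cases
      case 1
      have "subseq (alternating (length \<omega>) x y) (alternating (length \<omega> + Suc j) x y)" by (rule pre)
      then show ?thesis using dihedral_word_eq[OF d False 1] j by simp
    next
      case 2
      have "subseq (alternating (length \<omega>) y x) (x # alternating (length \<omega> + j) y x)"
        by (rule list_emb_Cons, rule pre)
      moreover have "\<omega> = alternating (length \<omega>) y x"
        using dihedral_word_eq[of y x \<omega>] d False 2 by (simp add: dihedral_word_commute[of y x])
      ultimately show ?thesis using j by simp
    qed
  qed simp
  have ne: "\<zeta> \<noteq> []" using assms(3) by auto
  then consider "hd \<zeta> = a" | "hd \<zeta> = c" using dihedral_word_hd[OF assms(2)] by blast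
  then show ?thesis
  proof cases
    case 1
    then show ?thesis using main[of a c] dihedral_word_eq[OF assms(2) ne] by simp
  next
    case 2
    then show ?thesis using main[of c a] dihedral_word_eq[of c a \<zeta>] assms(2) ne
      by (simp add: dihedral_word_commute[of c a] insert_commute)
  qed
qed

lemma dihedral_prefix:
  assumes "dihedral_word a c \<omega>" "dihedral_word a c \<zeta>" "length \<omega> \<le> length \<zeta>" "\<omega> \<noteq> []" "hd \<omega> = hd \<zeta>"
  obtains y where "\<zeta> = \<omega> @ y"
proof -
  have s: "\<zeta> = take (length \<omega>) \<zeta> @ drop (length \<omega>) \<zeta>" by simp
  have d: "dihedral_word a c (take (length \<omega>) \<zeta>)" using dihedral_word_append assms(2) s by metis
  have "hd (take (length \<omega>) \<zeta>) = hd \<zeta>" using assms(4) by simp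
  then have "\<omega> = take (length \<omega>) \<zeta>" using dihedral_word_hd_eq[OF assms(1) d] assms(3-5) by simp
  then show ?thesis using that s by metis
qed

lemma subseq_append_tail:
  assumes "subseq (\<xi> @ y) (\<xi> @ \<nu>)" shows "subseq y \<nu>"
  using assms by (simp add: subseq_append')

context coxeter_system
begin

lemma commuting_prefix:
  assumes "a \<in> S" "set p \<subseteq> S" "\<And>d. d \<in> set p \<Longrightarrow> a \<otimes> d = d \<otimes> a"
  shows "word_value p \<otimes> a = a \<otimes> word_value p"
  using assms(2,3)
proof (induction p)
  case (Cons d p)
  have d: "d \<in> S" "a \<otimes> d = d \<otimes> a" "word_value p \<in> carrier W" using Cons.prems by auto
  have "word_value (d # p) \<otimes> a = d \<otimes> (a \<otimes> word_value p)" using Cons d assms(1) by (simp add: m_assoc)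
  also have "\<dots> = (a \<otimes> d) \<otimes> word_value p" unfolding d(2) using d(1,3) assms(1) by (simp add: m_assoc)
  finally show ?case using d(1,3) assms(1) by (simp add: m_assoc)
qed (use assms in simp)

lemma commuting_prefix_descent:
  assumes r: "reduced (p @ a # q)" and c: "\<And>d. d \<in> set p \<Longrightarrow> a \<otimes> d = d \<otimes> a"
  shows "reduced (a # p @ q)" "word_value (a # p @ q) = word_value (p @ a # q)"
    "len (a \<otimes> word_value (p @ a # q)) < len (word_value (p @ a # q))"
proof -
  have S: "a \<in> S" "set p \<subseteq> S" "set q \<subseteq> S" using reducedD[OF r] by auto
  have "word_value (p @ a # q) = (word_value p \<otimes> a) \<otimes> word_value q" using S by (simp add: m_assoc)
  then show v: "word_value (a # p @ q) = word_value (p @ a # q)"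
    using S commuting_prefix[OF S(1,2) c] by (simp add: m_assoc)
  then show r': "reduced (a # p @ q)" using r S unfolding reduced_def by simp
  show "len (a \<otimes> word_value (p @ a # q)) < len (word_value (p @ a # q))"
    using reduced_hd_descent[OF r'] unfolding v .
qed

end

section \<open>Exclusions with letters commuting with \<open>base\<close>\<close>

context full_matching
begin

lemma central_commute: "central_type d \<Longrightarrow> base \<otimes> d = d \<otimes> base"
  by (simp add: central_type_def)

lemma alternating_shift_notin:
  assumes t: "right_type t" and k: "\<phi> (word_value [base, t]) = word_value [t, base, t]" "4 \<le> ord base t"
    and d: "central_type d" "d \<otimes> t \<noteq> t \<otimes> d"
  shows "word_value [base, t, base, d, t] \<notin> Q"
proof
  let ?w = "[base, t, base, d, t]"
  assume Q: "word_value ?w \<in> Q"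
  have tS: "t \<in> S" "t \<noteq> base" using right_typeD[OF t] by simp_all
  have dS: "d \<in> S" "d \<noteq> base" "d \<otimes> base = base \<otimes> d" using d(1) by (simp_all add: central_type_def)
  have dt: "d \<noteq> t" "d \<notin> {base, t}" using d dS by auto
  have u1: "unique_word [t, base, t]" "unique_word [base, t]" "unique_word [base, t, base]"
    using dw_unique[OF tS] k(2) tS by (simp_all add: dihedral_word_def)
  have u2: "unique_word ([t, base, t] @ [d])" "unique_word ([base, t] @ [d])"
    by (rule unique_word_dihedral_snoc[OF base_S tS(1) tS(2)[symmetric] dS(1) dt(2)];
        use k(2) d(2) tS in \<open>simp add: dihedral_word_def\<close>)+
  have u3: "unique_word (d # [t, base, t])"
    by (rule unique_word_Cons_dihedral[OF base_S tS(1) tS(2)[symmetric] dS(1) dt(2)];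
        use k(2) d(2) tS in \<open>simp add: dihedral_word_def\<close>)
  have u4: "unique_word [d, t]" using noncommuting_unique dS tS d(2) by blast
  have red: "reduced ?w"
  proof -
    have "reduced ([base, t, base] @ [d, t])"
    proof (rule reduced_append_parabolic_left)
      fix a assume a: "a \<in> {base, t}"
      then have "a \<in> S" "a \<noteq> d" using tS dt by auto
      then show "\<not> len (a \<otimes> word_value [d, t]) < len (word_value [d, t])"
        using unique_word_left_descent[OF u4, of a] by auto
    qed (use u1 u4 tS in auto)
    then show ?thesis by simp
  qed
  obtain Z where Z: "reduced Z" "word_value Z = upper (word_value ?w)" "length Z \<le> Suc (length ?w)"
    and Z0: "\<And>\<omega> \<eta>. unique_word \<omega> \<Longrightarrow> subseq \<eta> ?w \<Longrightarrow> bruhat_le (word_value \<omega>) (upper (word_value \<eta>)) \<Longrightarrow> subseq \<omega> Z"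
    and Z1: "\<And>\<omega> \<eta>. unique_word \<omega> \<Longrightarrow> subseq \<eta> ?w \<Longrightarrow> \<phi> (word_value \<eta>) = word_value \<omega> \<Longrightarrow> subseq \<omega> Z"
    using upper_wordE[OF red Q] by metis
  have z1: "subseq [t, base, t, d] Z"
  proof -
    let ?y = "[base, t, d]"
    have s: "subseq ?y ?w" by (simp add: list_emb_Cons)
    have Qy: "word_value ?y \<in> Q" using subword_Q[OF red Q s] .
    obtain Y where Y: "reduced Y" "word_value Y = upper (word_value ?y)" "length Y \<le> Suc (length ?y)"
      and Y1: "\<And>\<omega> \<eta>. unique_word \<omega> \<Longrightarrow> subseq \<eta> ?y \<Longrightarrow> \<phi> (word_value \<eta>) = word_value \<omega> \<Longrightarrow> subseq \<omega> Y"
      and Y2: "\<And>\<omega>. unique_word \<omega> \<Longrightarrow> subseq \<omega> ?y \<Longrightarrow> subseq \<omega> Y"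
      using upper_wordE[OF _ Qy] unique_word_reduced[OF u2(2)] by (metis append_Cons append_Nil)
    have y1: "subseq [t, base, t] Y" using Y1[OF u1(1) _ k(1)] by simp
    have y2: "subseq ([base, t] @ [d]) Y" using Y2[OF u2(2)] by simp
    have "d \<in> set Y" using subseq_subset[OF y2] by simp
    then obtain \<alpha> \<beta> where ab: "Y = \<alpha> @ d # \<beta>" "[t, base, t] = \<alpha> @ \<beta>"
      using subseq_insertE[OF y1, of d] dt dS Y(3) by auto
    have "d \<notin> set \<beta>" using ab(2) dt dS by (metis Un_iff empty_iff insert_iff list.set set_append)
    then have "subseq [base, t] \<alpha>" using subseq_snoc_splitD[of "[base, t]" d \<alpha> \<beta>] y2 ab(1) by simp
    then have "\<alpha> = [t, base, t]" using ab(2) tS by (auto simp: Cons_eq_append_conv split: if_splits)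
    then have "Y = [t, base, t, d]" using ab by simp
    then have "bruhat_le (word_value [t, base, t, d]) (upper (word_value ?y))" using Y by (metis bruhat_refl reduced_closed)
    then show ?thesis using Z0[OF _ s] u2(1) by simp
  qed
  have z2: "subseq [d, t, base, t] Z"
  proof -
    have s: "subseq [base, d, t] ?w" by (simp add: list_emb_Cons)
    \<comment> \<open>A central letter commutes with \<open>\<phi>\<close>, so the value at
      \<open>[base, d, t]\<close> is obtained from the one at \<open>[base, t]\<close> by pulling
      out \<open>d\<close>.\<close>
    have "left_commuting d" using left_commuting_of_right_mult dS central_mult_on(1)[OF d(1)] by blast
    moreover have "word_value [base, t] \<in> Q" using dw_Q[OF tS, of "[base, t]"] tS by (simp add: dihedral_word_def)
    moreover have e: "d \<otimes> word_value [base, t] = word_value [base, d, t]" using dS tS by (simp flip: m_assoc)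
    moreover have "word_value [base, d, t] \<in> Q" using subword_Q[OF red Q s] .
    ultimately have "\<phi> (word_value [base, d, t]) = d \<otimes> \<phi> (word_value [base, t])"
      unfolding left_commuting_def by metis
    then have "\<phi> (word_value [base, d, t]) = word_value [d, t, base, t]" using k(1) by simp
    then show ?thesis using Z1[OF u3 s] by simp
  qed
  have r3: "\<omega> = [base, d, t] \<or> \<omega> = [d, base, t]" if "reduced \<omega>" "word_value \<omega> = word_value [base, d, t]" for \<omega>
  proof -
    have r: "reduced [base, d, t]" using reduced_append(2)[of "[base, t]" "[base, d, t]"] red by simp
    have l: "length \<omega> = 3" using reduced_len[OF r] reduced_len[OF that(1)] that(2) by simp
    have "subseq [base, t] [base, d, t]" "subseq [d, t] [base, d, t]" by (simp_all add: list_emb_Cons)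
    then have "bruhat_le (word_value [base, t]) (word_value \<omega>)" "bruhat_le (word_value [d, t]) (word_value \<omega>)"
      unfolding that(2) using subseq_bruhat[OF r, of "[base, t]"] subseq_bruhat[OF r, of "[d, t]"] by blast+
    then have "subseq [base, t] \<omega>" "subseq [d, t] \<omega>"
      using unique_word_subseq[OF u1(2) _ that(1)] unique_word_subseq[OF u4 _ that(1)] by blast+
    moreover obtain p q r where "\<omega> = [p, q, r]" using l by (auto simp: length_Suc_conv numeral_3_eq_3)
    ultimately show ?thesis using dt dS tS by (auto split: if_splits)
  qed
  have r4: "\<exists>\<omega> \<in> {[base, d, t], [d, base, t]}. \<eta> = t # \<omega>"
    if "reduced \<eta>" "word_value \<eta> = word_value [t, base, d, t]" for \<eta>
  proof (rule reduced_words_Cons[where w = "word_value [base, d, t]"])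
    have "reduced [t, base, d, t]" using reduced_append(2)[of "[base]" "[t, base, d, t]"] red by simp
    then show "len (word_value [base, d, t]) < len (t \<otimes> word_value [base, d, t])"
      unfolding reduced_Cons_iff[of t] by blast
    fix \<omega> c assume \<omega>: "\<omega> \<in> {[base, d, t], [d, base, t]}" and c: "c \<in> S" "c \<noteq> t"
    show "\<not> prefix (alternating (the_enat (m t c)) t c) (t # \<omega>)"
    proof
      assume p: "prefix (alternating (the_enat (m t c)) t c) (t # \<omega>)"
      then have p: "prefix (alternating (ord t c) t c) (t # \<omega>)" by (simp add: ord_def)
      have h: "hd \<omega> = c" using prefix_alternating_ConsD[OF ord_ge_2[OF tS(1) c(1) c(2)[symmetric]] p] by blast
      have "3 \<le> ord t c"
      proof (cases "c = base")
        case True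
        then show ?thesis using k(2) ord_sym[OF base_S tS(1)] by simp
      next
        case False
        then have "c = d" using h \<omega> by auto
        then show ?thesis using ord_ge_3[OF tS(1) dS(1)] d(2) by metis
      qed
      then obtain j where "ord t c = Suc (Suc (Suc j))" using le_Suc_ex[of 3 "ord t c"] by (auto simp: numeral_3_eq_3)
      then show False using p \<omega> dt tS by auto
    qed
  qed (use tS dS r3 that orders_finite in auto)
  \<comment> \<open>The word is not unique because \<open>d\<close> commutes with
    \<open>base\<close>; its reduced words are therefore enumerated, and the insertion argument is
    made for each of them.\<close>
  have r5: "\<exists>\<omega> \<in> {[t, base, d, t], [t, d, base, t]}. \<eta> = base # \<omega>"
    if "reduced \<eta>" "word_value \<eta> = word_value ?w" for \<eta>
  proof (rule reduced_words_Cons[where w = "word_value [t, base, d, t]"])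
    show "len (word_value [t, base, d, t]) < len (base \<otimes> word_value [t, base, d, t])"
      using red unfolding reduced_Cons_iff[of base] by blast
    show "\<And>\<omega>. reduced \<omega> \<Longrightarrow> word_value \<omega> = word_value [t, base, d, t] \<Longrightarrow> \<omega> \<in> {[t, base, d, t], [t, d, base, t]}"
      using r4 by blast
    fix \<omega> c assume \<omega>: "\<omega> \<in> {[t, base, d, t], [t, d, base, t]}" and c: "c \<in> S" "c \<noteq> base"
    show "\<not> prefix (alternating (the_enat (m base c)) base c) (base # \<omega>)"
    proof
      assume "prefix (alternating (the_enat (m base c)) base c) (base # \<omega>)"
      then have p: "prefix (alternating (ord base c) base c) (base # \<omega>)" by (simp add: ord_def)
      have "hd \<omega> = c" using prefix_alternating_ConsD[OF ord_ge_2[OF base_S c(1) c(2)[symmetric]] p] by blast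
      then have "c = t" using \<omega> by auto
      moreover obtain j where "ord base t = Suc (Suc (Suc (Suc j)))"
        using k(2) le_Suc_ex[of 4 "ord base t"] by (auto simp: eval_nat_numeral)
      ultimately show False using p \<omega> dt dS by (auto simp: ord_def)
    qed
  qed (use tS dS that orders_finite in auto)
  obtain \<eta> where \<eta>: "reduced \<eta>" "subseq \<eta> Z" "word_value \<eta> = word_value ?w"
    using bruhat_subword[OF le_upper[OF Q] reducedD[OF Z(1)] Z(2)] by blast
  then consider "\<eta> = [base, t, base, d, t]" | "\<eta> = [base, t, d, base, t]" using r5 by blast
  then show False
  proof cases
    case 1
    from \<eta>(2) have "length Z \<le> Suc (length \<eta>) \<Longrightarrow> False"
      by (elim subseq_insert_cases; use z1 z2 dt dS tS 1 in \<open>auto simp: Cons_eq_append_conv split: if_splits\<close>)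
    then show False using Z(3) 1 by simp
  next
    case 2
    from \<eta>(2) have "length Z \<le> Suc (length \<eta>) \<Longrightarrow> False"
      by (elim subseq_insert_cases; use z1 z2 dt dS tS 2 in \<open>auto simp: Cons_eq_append_conv split: if_splits\<close>)
    then show False using Z(3) 2 by simp
  qed
qed

text \<open>Let \<open>v\<close> be the word without its first \<open>base\<close>. Its upper
  element is \<open>v \<otimes> base\<close>, and a reduced word of it must sit in the upper word
  \<open>Z\<close> of the whole together with \<open>[t, base, t]\<close>. There is only one letter
  to spare for both.\<close>

lemma central_block_notin:
  assumes t: "right_type t" and k: "\<phi> (word_value [base, t]) = word_value [t, base, t]" "4 \<le> ord base t"
    and \<alpha>: "\<And>a. a \<in> set \<alpha> \<Longrightarrow> a = t \<or> central_type a" "t \<in> set \<alpha>"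
    and red: "reduced (base # t # \<alpha>)"
    and desc: "\<And>a. a \<in> S \<Longrightarrow> len (a \<otimes> word_value (base # t # \<alpha>)) < len (word_value (base # t # \<alpha>)) \<Longrightarrow> a \<in> {base, t}"
  shows "word_value (base # t # \<alpha>) \<notin> Q"
proof
  let ?w = "base # t # \<alpha>"
  assume Q: "word_value ?w \<in> Q"
  have tS: "t \<in> S" "t \<noteq> base" using right_typeD[OF t] by simp_all
  have aS: "set \<alpha> \<subseteq> S" using reducedD[OF red] by simp
  have bn: "base \<notin> set (t # \<alpha>)" using \<alpha>(1) tS central_typeD by fastforce
  have u: "unique_word [t, base, t]" "unique_word [base, t]" "unique_word [t, base]"
    using dw_unique[OF tS] k(2) tS by (simp_all add: dihedral_word_def)
  have rv: "reduced (t # \<alpha>)" using reduced_ConsD[OF red] .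
  define v where "v = word_value (t # \<alpha>)"
  have vQ: "v \<in> Q" unfolding v_def by (rule subword_Q[OF red Q]) (simp add: list_emb_Cons)
  have lv: "len v = Suc (length \<alpha>)" using reduced_len[OF rv] by (simp add: v_def)
  have vc: "v \<in> carrier W" using vQ by simp
  \<comment> \<open>\<open>v\<close> has no letter \<open>base\<close> or of left type, so by
    \<open>upper_without_base\<close> only central letters follow the inserted \<open>base\<close>,
    which can then be moved to the right end.\<close>
  have uv: "upper v = v \<otimes> base" and lu: "len (v \<otimes> base) = Suc (len v)"
  proof -
    obtain \<alpha>1 \<beta>1 where ab: "reduced (\<alpha>1 @ \<beta>1)" "word_value (\<alpha>1 @ \<beta>1) = v"
      "reduced (\<alpha>1 @ base # \<beta>1)" "word_value (\<alpha>1 @ base # \<beta>1) = upper v"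
      "\<And>a. a \<in> set \<beta>1 \<Longrightarrow> left_type a \<or> central_type a"
      using upper_without_base[OF rv _ bn] vQ unfolding v_def by metis
    have S: "set \<alpha>1 \<subseteq> S" "set \<beta>1 \<subseteq> S" using reducedD[OF ab(1)] by auto
    have "set \<beta>1 \<subseteq> set (t # \<alpha>)" using reduced_set_eq[OF ab(1) rv] ab(2) by (auto simp: v_def)
    then have c: "central_type a" if "a \<in> set \<beta>1" for a
      using that ab(5)[of a] \<alpha>(1)[of a] type_distinct t by auto
    have "word_value \<beta>1 \<otimes> base = base \<otimes> word_value \<beta>1"
      using commuting_prefix[OF base_S S(2)] c central_commute by blast
    then show uv: "upper v = v \<otimes> base" using ab(2,4) S by (simp add: m_assoc flip: ab(2))
    show "len (v \<otimes> base) = Suc (len v)"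
      using reduced_len[OF ab(1)] reduced_len[OF ab(3)] ab(2,4) uv by simp
  qed
  obtain Z where Z: "reduced Z" "word_value Z = upper (word_value ?w)" "length Z \<le> Suc (length ?w)"
    and Z1: "\<And>\<omega> \<eta>. unique_word \<omega> \<Longrightarrow> subseq \<eta> ?w \<Longrightarrow> \<phi> (word_value \<eta>) = word_value \<omega> \<Longrightarrow> subseq \<omega> Z"
    using upper_wordE[OF red Q] by metis
  have z1: "subseq [t, base, t] Z" using Z1[OF u(1) _ k(1)] by simp
  have "bruhat_le v (word_value ?w)" unfolding v_def by (rule subseq_bruhat[OF red]) (simp add: list_emb_Cons)
  then have "bruhat_le (v \<otimes> base) (upper (word_value ?w))" using upper_mono[OF _ Q] uv by metis
  then obtain \<eta> where \<eta>: "reduced \<eta>" "subseq \<eta> Z" "word_value \<eta> = v \<otimes> base"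
    using bruhat_subword[OF _ reducedD[OF Z(1)] Z(2)] by blast
  have rvb: "reduced ((t # \<alpha>) @ [base])" using rv lu lv by (subst reduced_snoc_iff) (simp add: v_def)
  have vbv: "word_value ((t # \<alpha>) @ [base]) = v \<otimes> base" using aS tS by (simp add: v_def m_assoc)
  have nbt: "\<not> subseq [base, t] \<eta>"
  proof
    assume "subseq [base, t] \<eta>"
    then have "bruhat_le (word_value [base, t]) (v \<otimes> base)" using subseq_bruhat[OF \<eta>(1)] \<eta>(3) by metis
    then have "subseq [base, t] ((t # \<alpha>) @ [base])" using unique_word_subseq[OF u(2) _ rvb vbv] by blast
    then have "subseq [base, t] (t # \<alpha>)" using subseq_butlast[of "[base, t]" "(t # \<alpha>) @ [base]"] tS by simp
    then show False using subseq_subset[of "[base, t]" "t # \<alpha>"] bn by simp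
  qed
  have s\<eta>: "set \<eta> = insert base (set (t # \<alpha>))"
    using reduced_set_eq[OF \<eta>(1) rvb] vbv \<eta>(3) by auto
  \<comment> \<open>In any reduced word of \<open>v \<otimes> base\<close> no \<open>t\<close>
    follows \<open>base\<close>. Hence \<open>q\<close> is central, and all occurrences of
    \<open>t\<close> are in \<open>\<eta>1\<close>.\<close>
  then obtain \<eta>1 q where q: "\<eta> = \<eta>1 @ base # q" "base \<notin> set \<eta>1" by (metis insertI1 split_list_first)
  have tq: "t \<notin> set q"
  proof
    assume "t \<in> set q"
    then have "subseq ([] @ [base, t]) (\<eta>1 @ base # q)"
      by (intro list_emb_append_mono) (auto simp: subseq_singleton_left)
    then show False using nbt q by simp
  qed
  have S\<eta>: "set \<eta>1 \<subseteq> S" "set q \<subseteq> S" using reducedD[OF \<eta>(1)] q by auto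
  have bq: "base \<notin> set q"
  proof
    assume "base \<in> set q"
    then obtain q1 q2 where q12: "q = q1 @ base # q2" "base \<notin> set q1" by (metis split_list_first)
    have c: "base \<otimes> d = d \<otimes> base" if "d \<in> set q1" for d
    proof -
      have "d \<in> insert base (set (t # \<alpha>))" unfolding s\<eta>[symmetric] using that q q12 by simp
      moreover have "d \<noteq> base" "d \<noteq> t" using that q12 tq by auto
      ultimately show ?thesis using \<alpha>(1)[of d] central_commute by auto
    qed
    have r: "reduced (base # q1 @ base # q2)" using reduced_append(2)[of \<eta>1] \<eta>(1) q(1) q12(1) by simp
    have "reduced (base # base # q1 @ q2)"
      using reduced_replace2(1)[of "[base]" "q1 @ base # q2" "base # q1 @ q2"] r
        commuting_prefix_descent(1,2)[OF reduced_ConsD[OF r] c] by simp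
    then show False using reduced_distinct_adj[of "base # base # q1 @ q2"] by simp
  qed
  have cq: "central_type d" if "d \<in> set q" for d
  proof -
    have "d \<in> insert base (set (t # \<alpha>))" unfolding s\<eta>[symmetric] using that q by simp
    moreover have "d \<noteq> base" "d \<noteq> t" using that tq bq by auto
    ultimately show ?thesis using \<alpha>(1)[of d] by auto
  qed
  have vq: "word_value (\<eta>1 @ q) = v"
  proof -
    have "word_value q \<otimes> base = base \<otimes> word_value q"
      using commuting_prefix[OF base_S S\<eta>(2)] cq central_commute by blast
    then have "word_value (\<eta>1 @ q) \<otimes> base = v \<otimes> base" using \<eta>(3) q(1) S\<eta> by (simp add: m_assoc)
    then show ?thesis using S\<eta> vc word_value_closed[of "\<eta>1 @ q"] by (metis base_S gen_cancel_right set_append le_sup_iff)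
  qed
  have lq: "length \<eta>1 + length q = Suc (length \<alpha>)"
    using reduced_len[OF \<eta>(1)] \<eta>(3) lu lv q(1) by simp
  have rq: "reduced (\<eta>1 @ q)" unfolding reduced_def using S\<eta> vq lv lq by simp
  have sq: "set (\<eta>1 @ q) = set (t # \<alpha>)" using reduced_set_eq[OF rq rv] vq by (simp add: v_def)
  have t1: "t \<in> set \<eta>1" using sq tq by auto
  obtain \<zeta> where \<zeta>: "reduced \<zeta>" "subseq \<zeta> Z" "word_value \<zeta> = word_value ?w"
    using bruhat_subword[OF le_upper[OF Q] reducedD[OF Z(1)] Z(2)] by blast
  have l\<zeta>: "length \<zeta> = length ?w" using reduced_len[OF \<zeta>(1)] reduced_len[OF red] \<zeta>(3) by simp
  then obtain a \<omega> where a: "\<zeta> = a # \<omega>" by (cases \<zeta>) auto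
  \<comment> \<open>By the descent hypothesis the first letter is \<open>base\<close> or
    \<open>t\<close>. If it were \<open>t\<close>, then \<open>[t, base]\<close> would be a subword
    of the given word, whose only \<open>base\<close> is at the front.\<close>
  have "a = base"
  proof (rule ccontr)
    assume ab: "a \<noteq> base"
    have "a \<in> S" using \<zeta>(1) a by (simp add: reduced_Cons_iff)
    moreover have "len (a \<otimes> word_value ?w) < len (word_value ?w)"
      using reduced_hd_descent[of a \<omega>] \<zeta>(1) unfolding a[symmetric] \<zeta>(3) .
    ultimately have at: "a = t" using desc ab by blast
    have "base \<in> set \<zeta>" using reduced_set_eq[OF \<zeta>(1) red \<zeta>(3)] by simp
    then have "subseq [t, base] \<zeta>" using a at tS by (simp add: subseq_singleton_left)
    then have "bruhat_le (word_value [t, base]) (word_value ?w)" using subseq_bruhat[OF \<zeta>(1)] \<zeta>(3) by metis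
    then have "subseq [t, base] ?w" using unique_word_subseq[OF u(3) _ red] by blast
    then have "base \<in> set (t # \<alpha>)" using tS by (auto simp: subseq_singleton_left)
    then show False using bn by simp
  qed
  have r\<omega>: "reduced \<omega>" using \<zeta>(1) a reduced_ConsD by blast
  have v\<omega>: "word_value \<omega> = v" using \<zeta>(3) a \<open>a = base\<close> r\<omega> vc by (simp add: v_def)
  have b\<omega>: "base \<notin> set \<omega>" using reduced_set_eq[OF r\<omega> rv] v\<omega> bn by (simp add: v_def)
  have l\<omega>: "length \<omega> = Suc (length \<alpha>)" using l\<zeta> a by simp
  have zz: "\<zeta> = base # \<omega>" using a \<open>a = base\<close> by simp
  have nb: "\<not> subseq [t, base, t] (base # \<omega>')" if "base \<notin> set \<omega>'" for \<omega>'
    using subseq_subset[of "[t, base, t]" \<omega>'] that tS by auto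
  have "length Z \<le> Suc (length \<zeta>)" using Z(3) l\<zeta> by simp
  with \<zeta>(2) show False
  proof (cases rule: subseq_insert_cases)
    case 1
    then show False using z1 zz nb b\<omega> by simp
  next
    case (2 \<gamma> e \<delta>)
    show False
    proof (cases "e = base")
      case False
      have "\<gamma> = []"
      proof (rule ccontr)
        assume "\<gamma> \<noteq> []"
        then obtain \<gamma>' where g: "\<gamma> = base # \<gamma>'" "\<omega> = \<gamma>' @ \<delta>" using 2(1) zz by (cases \<gamma>) auto
        then have "Z = base # (\<gamma>' @ e # \<delta>)" "base \<notin> set (\<gamma>' @ e # \<delta>)" using 2(2) b\<omega> False by auto
        then show False using z1 nb by metis
      qed
      then have ZZ: "Z = e # base # \<omega>" using 2 zz by simp
      \<comment> \<open>With a single \<open>base\<close> in \<open>Z\<close>, the subword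
        \<open>[t, base, t]\<close> needs the new letter to be a \<open>t\<close> in front. Then
        \<open>\<eta>1\<close> fits into \<open>[t]\<close>, and \<open>\<alpha>\<close> has the
        same support as the central word \<open>q\<close>, which lacks \<open>t\<close>.\<close>
      have et: "e = t" using z1 ZZ nb[OF b\<omega>] by (auto split: if_splits)
      have "subseq (\<eta>1 @ base # q) ([t] @ base # \<omega>)" using \<eta>(2) q(1) ZZ et by simp
      moreover have "subseq (\<eta>1 @ [base]) (\<eta>1 @ base # q)" by (simp add: subseq_append')
      ultimately have "subseq (\<eta>1 @ [base]) ([t] @ base # \<omega>)" using subseq_order.order_trans by blast
      then have "subseq \<eta>1 [t]" using subseq_snoc_splitD[of \<eta>1 base "[t]" \<omega>] b\<omega> by simp
      then have "length \<eta>1 \<le> 1" using list_emb_length by fastforce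
      then have "\<eta>1 = [t]" using t1 by (cases \<eta>1) auto
      then have "word_value q = word_value \<alpha>" using vq tS S\<eta> aS by (simp add: v_def)
      then have "set q = set \<alpha>"
        using reduced_set_eq[OF reduced_append(2)[OF rq] reduced_ConsD[OF rv]] by simp
      then show False using \<alpha>(2) tq by simp
    next
      case True
      have "\<gamma> \<noteq> []"
      proof
        assume "\<gamma> = []"
        then have "Z = base # base # \<omega>" using 2 zz True by simp
        then show False using z1 nb[OF b\<omega>] tS by simp
      qed
      then obtain \<omega>1 where g: "\<gamma> = base # \<omega>1" "\<omega> = \<omega>1 @ \<delta>" using 2(1) zz by (cases \<gamma>) auto
      have ZZ: "Z = base # \<omega>1 @ base # \<delta>" using 2(2) g True by simp
      have n: "base \<notin> set \<omega>1" "base \<notin> set \<delta>" using b\<omega> g by auto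
      have "subseq [t, base, t] (\<omega>1 @ base # \<delta>)" using z1 ZZ tS by simp
      then have "subseq [base, t] (\<omega>1 @ base # \<delta>)" using subseq_Cons' by metis
      then have "subseq [t] \<delta>" using subseq_Cons_splitD n by metis
      then have td: "t \<in> set \<delta>" by (simp add: subseq_singleton_left)
      have ne: "\<eta>1 \<noteq> []" using t1 by auto
      have "hd \<eta>1 \<noteq> base" using q(2) ne hd_in_set by metis
      then have s: "subseq (\<eta>1 @ base # q) (\<omega>1 @ base # \<delta>)"
        using \<eta>(2) q(1) ZZ ne by (cases \<eta>1) auto
      have "subseq (\<eta>1 @ [base]) (\<eta>1 @ base # q)" "subseq (base # q) (\<eta>1 @ base # q)"
        by (simp_all add: subseq_append' subseq_drop_many)
      then have "subseq (\<eta>1 @ [base]) (\<omega>1 @ base # \<delta>)" "subseq (base # q) (\<omega>1 @ base # \<delta>)"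
        using s subseq_order.order_trans by blast+
      then have s1: "subseq \<eta>1 \<omega>1" and s2: "subseq q \<delta>"
        using subseq_snoc_splitD[of \<eta>1 base \<omega>1 \<delta>] subseq_Cons_splitD[of base q \<omega>1 \<delta>] n by simp_all
      \<comment> \<open>The parts before and after the second \<open>base\<close> are matched
        separately; equality of total lengths makes \<open>q\<close> equal to
        \<open>\<delta>\<close>, but only the latter contains \<open>t\<close>.\<close>
      have "length q = length \<delta>"
        using list_emb_length[OF s1] list_emb_length[OF s2] lq l\<omega> g(2) by simp
      then have "q = \<delta>" using subseq_same_length[OF s2] by simp
      then show False using td tq by simp
    qed
  qed
qed

end

subsection \<open>Irreducible orbits\<close>

lemma subseq_append_last_notin:
  assumes "subseq g (\<xi> @ \<nu>)" "g \<noteq> []" "last g \<notin> set \<nu>" shows "subseq g \<xi>"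
proof -
  obtain g1 g2 where g: "g = g1 @ g2" "subseq g1 \<xi>" "subseq g2 \<nu>" using assms(1) by (auto simp: subseq_append_iff)
  have "g2 = []" using g(1) assms(3) subseq_subset[OF g(3)] by (cases g2 rule: rev_cases) auto
  then show ?thesis using g by simp
qed

text \<open>Irreducibility is expressed by commutation, which is equivalent to regularity on a
  maximal matching; this form needs no maximality and is invariant under inversion.\<close>

locale irreducible_orbit = full_matching +
  fixes u :: 'a
  assumes u_Q: "u \<in> Q" and u_up: "len u < len (\<phi> u)"
    and longest_le: "a \<in> S \<Longrightarrow> c \<in> S \<Longrightarrow> bruhat_le (dihedral_longest a c) (\<phi> u)"
    and left_irreducible: "a \<in> S \<Longrightarrow> len (a \<otimes> u) < len u \<Longrightarrow> \<not> left_commuting a"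
    and right_irreducible: "a \<in> S \<Longrightarrow> len (u \<otimes> a) < len u \<Longrightarrow> \<not> right_commuting a"
begin

lemma gen_le_top: "a \<in> S \<Longrightarrow> bruhat_le a (\<phi> u)"
proof -
  assume a: "a \<in> S"
  have "m a a = enat 1" using matrix_diag[OF a] by (simp add: one_enat_def)
  then have "dihedral_longest a a = a" using a dihedral_longest_value[OF a a] by (simp add: ord_def)
  then show ?thesis using longest_le[OF a a] by simp
qed

text \<open>\<open>\<phi>\<close> preserves the subgroup, and by fullness every generator lies below
  \<open>\<phi> u\<close>. This is how the position of \<open>u\<close> bounds the rank.\<close>

lemma parabolic_bottom: "u \<in> parabolic I \<Longrightarrow> I \<subseteq> S \<Longrightarrow> base \<in> I \<Longrightarrow> S \<subseteq> I"
proof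
  fix a assume u: "u \<in> parabolic I" and I: "I \<subseteq> S" "base \<in> I" and a: "a \<in> S"
  have "a \<in> parabolic I" using parabolic_bruhat[OF gen_le_top[OF a] phi_parabolic[OF u_Q u I] I(1)] .
  moreover have "reduced [a]" "word_value [a] = a" using a by (simp_all add: reduced_def)
  ultimately show "a \<in> I" using reduced_parabolic_iff[of "[a]" I] I by simp
qed

lemma dihedral_le_top:
  assumes "t \<in> S" "t \<noteq> base" "dihedral_word base t \<omega>" "length \<omega> \<le> ord base t"
  shows "bruhat_le (word_value \<omega>) (\<phi> u)"
  using dihedral_word_le_longest[OF base_S assms(1) _ assms(3,4)] longest_le[OF base_S assms(1)] assms(2)
    bruhat_trans by blast

text \<open>The lower element of the orbit of the longest element has length at least
  \<open>ord base t - 1\<close> and lies below \<open>u\<close>. The bound on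
  \<open>\<omega>\<close> makes it strictly shorter, so that it is a subword whatever its first
  letter.\<close>

lemma dihedral_le_bottom:
  assumes t: "t \<in> S" "t \<noteq> base" and \<omega>: "dihedral_word base t \<omega>" "length \<omega> + 2 \<le> ord base t"
  shows "bruhat_le (word_value \<omega>) u"
proof -
  let ?l = "word_value (alternating (ord base t) base t)"
  have l: "?l = dihedral_longest base t" using dihedral_longest_value[OF base_S t(1)] by simp
  have d: "dihedral_word base t (alternating (ord base t) base t)" using dihedral_word_alternating t by metis
  have lQ: "?l \<in> Q" "?l \<in> parabolic {base, t}" using dw_Q[OF t d] dw_parabolic[OF t d] by simp_all
  have "lower ?l \<in> parabolic {base, t}" using lQ phi_parabolic_pair[OF t] by (simp add: lower_def)
  then obtain \<zeta> where \<zeta>: "dihedral_word base t \<zeta>" "reduced \<zeta>" "word_value \<zeta> = lower ?l"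
    using parabolic_word[OF t] by metis
  have "len ?l = ord base t" using reduced_len[OF dw_reduced[OF t d]] by simp
  then have "ord base t \<le> Suc (length \<zeta>)"
    using reduced_len[OF \<zeta>(2)] \<zeta>(3) phi_len[OF lQ(1)] by (auto simp: lower_def split: if_splits)
  then have "bruhat_le (word_value \<omega>) (word_value \<zeta>)"
    using subseq_bruhat[OF \<zeta>(2)] dihedral_subseq[OF \<omega>(1) \<zeta>(1)] \<omega>(2) by simp
  moreover have "bruhat_le (word_value \<zeta>) (lower (\<phi> u))"
    using lower_mono[OF longest_le[OF base_S t(1)]] u_Q l \<zeta>(3) by simp
  moreover have "lower (\<phi> u) = u" using u_up u_Q by (simp add: lower_def)
  ultimately show ?thesis using bruhat_trans by metis
qed

lemma suffix_right_descent: "reduced (\<eta> @ \<omega> @ [a]) \<Longrightarrow> word_value (\<eta> @ \<omega> @ [a]) = u \<Longrightarrow> len (u \<otimes> a) < len u"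
  using reduced_last_descent[of "\<eta> @ \<omega>" a] by simp

lemma hd_left_descent: "reduced (a # \<omega>) \<Longrightarrow> word_value (a # \<omega>) = u \<Longrightarrow> len (a \<otimes> u) < len u"
  using reduced_hd_descent by metis

text \<open>If \<open>\<phi>\<close> is one-sided on every dihedral subgroup, irreducibility makes
  all left descents of \<open>u\<close> of left type and all right descents of right type. A letter
  \<open>base\<close> between them is excluded; without it, \<open>upper_without_base\<close> yields
  a word that would start with a right type or central letter or end with a left type or central
  one, unless \<open>u\<close> is trivial.\<close>

lemma rank_le_2_without_long:
  assumes mult: "\<And>t. t \<in> S \<Longrightarrow> t \<noteq> base \<Longrightarrow> right_mult_on t \<or> left_mult_on t"
  shows "S \<subseteq> {base}"
proof (cases "u = \<one>")
  case True
  then show ?thesis using parabolic_bottom[of "{base}"] by simp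
next
  case False
  have L: "left_type a" if a: "a \<in> S" "len (a \<otimes> u) < len u" for a
  proof -
    have nl: "\<not> left_commuting a" using left_irreducible a by blast
    have nb: "a \<noteq> base"
    proof
      assume b: "a = base"
      obtain t x where "t \<in> S" "t \<noteq> base" "x \<in> parabolic {base, t}" "\<phi> (base \<otimes> x) \<noteq> base \<otimes> \<phi> x"
        using not_left_commutingE[OF nl a(1)] b by metis
      then show False using base_commutes_on(1) mult by metis
    qed
    have "\<not> right_mult_on a" using left_commuting_of_right_mult a(1) nb nl by blast
    then have "left_mult_on a" using mult a nb by blast
    then have "\<phi> a = base \<otimes> a" using gen_parabolic[of a "{base, a}"] a(1) by (simp add: left_mult_on_def)
    moreover have "\<not> central_type a" using central_mult_on(1) \<open>\<not> right_mult_on a\<close> by blast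
    ultimately show ?thesis using a(1) nb by (simp add: left_type_def central_type_def)
  qed
  have R: "right_type a" if a: "a \<in> S" "len (u \<otimes> a) < len u" for a
  proof -
    have nl: "\<not> right_commuting a" using right_irreducible a by blast
    have nb: "a \<noteq> base"
    proof
      assume b: "a = base"
      obtain t x where "t \<in> S" "t \<noteq> base" "x \<in> parabolic {base, t}" "\<phi> (x \<otimes> base) \<noteq> \<phi> x \<otimes> base"
        using not_right_commutingE[OF nl a(1)] b by metis
      then show False using base_commutes_on(2) mult by metis
    qed
    have "\<not> left_mult_on a" using right_commuting_of_left_mult a(1) nb nl by blast
    then have "right_mult_on a" using mult a nb by blast
    then have "\<phi> a = a \<otimes> base" using gen_parabolic[of a "{base, a}"] a(1) by (simp add: right_mult_on_def)
    moreover have "\<not> central_type a" using central_mult_on(2) \<open>\<not> left_mult_on a\<close> by blast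
    ultimately show ?thesis using a(1) nb by (simp add: right_type_def central_type_def)
  qed
  have hd_left: "left_type (hd \<omega>)" and last_right: "right_type (last \<omega>)"
    if \<omega>: "reduced \<omega>" "word_value \<omega> = u" for \<omega>
  proof -
    have ne: "\<omega> \<noteq> []" using \<omega> False by auto
    then obtain a \<eta> where a: "\<omega> = a # \<eta>" by (cases \<omega>) auto
    have "a \<in> S" using \<omega>(1) a by (simp add: reduced_Cons_iff)
    moreover have "len (a \<otimes> u) < len u" using hd_left_descent[of a \<eta>] \<omega> a by simp
    ultimately show "left_type (hd \<omega>)" using L a by simp
    obtain c \<zeta> where c: "\<omega> = \<zeta> @ [c]" using ne by (cases \<omega> rule: rev_cases) auto
    have "c \<in> S" using \<omega>(1) c by (simp add: reduced_snoc_iff)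
    moreover have "len (u \<otimes> c) < len u" using \<omega> suffix_right_descent[of "[]"] unfolding c by simp
    ultimately show "right_type (last \<omega>)" using R c by simp
  qed
  obtain \<omega> where \<omega>: "reduced \<omega>" "word_value \<omega> = u" using ex_reduced[OF Q_closed[OF u_Q]] by metis
  have nb: "base \<notin> set \<omega>"
  proof
    assume "base \<in> set \<omega>"
    then obtain p q where pq: "\<omega> = p @ base # q" by (metis split_list)
    have l: "left_type (hd \<omega>)" "hd \<omega> \<noteq> base" and r: "right_type (last \<omega>)" "last \<omega> \<noteq> base"
      using hd_left[OF \<omega>] last_right[OF \<omega>] left_typeD[of "hd \<omega>"] right_typeD[of "last \<omega>"] by simp_all
    have "p \<noteq> []" "q \<noteq> []" using l(2) r(2) pq by auto
    then have "subseq ([hd \<omega>] @ [base] @ [last \<omega>]) (p @ [base] @ q)" using pq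
      by (intro list_emb_append_mono) (auto simp: subseq_singleton_left)
    then have "subseq [hd \<omega>, base, last \<omega>] \<omega>" using pq by simp
    then show False using no_left_base_right[OF l(1) r(1) \<omega>(1)] \<omega>(2) u_Q by simp
  qed
  obtain \<alpha> \<beta> where ab: "reduced (\<alpha> @ \<beta>)" "word_value (\<alpha> @ \<beta>) = u"
    "\<And>a. a \<in> set \<alpha> \<Longrightarrow> right_type a \<or> central_type a" "\<And>a. a \<in> set \<beta> \<Longrightarrow> left_type a \<or> central_type a"
    using upper_without_base[OF \<omega>(1) _ nb] \<omega>(2) u_Q by metis
  have "\<alpha> = []"
  proof (rule ccontr)
    assume "\<alpha> \<noteq> []"
    then show False using hd_left[OF ab(1,2)] ab(3)[of "hd \<alpha>"] type_distinct by auto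
  qed
  moreover have "\<beta> = []"
  proof (rule ccontr)
    assume "\<beta> \<noteq> []"
    then show False using last_right[OF ab(1,2)] ab(4)[of "last \<beta>"] type_distinct by auto
  qed
  ultimately show ?thesis using ab(2) False by simp
qed

end

section \<open>Irreducible orbits with a shortest left step\<close>

locale long_irreducible_orbit = irreducible_orbit +
  fixes t :: 'a and x :: "'a list" and b :: 'a
  assumes t_right: "right_type t" and step: "left_step t x b"
    and step_min: "y \<in> parabolic {base, t} \<Longrightarrow> len y < length x \<Longrightarrow> \<phi> y = y \<otimes> base"
begin

lemma t_S: "t \<in> S" "t \<noteq> base" using right_typeD[OF t_right] by simp_all

lemma stepD: "dihedral_word base t (b # x)" "2 \<le> length x" "length x + 2 \<le> ord base t" "last x = t"
    "\<phi> (word_value x) = word_value (b # x)" "dihedral_word base t x" "x \<noteq> []"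
  using step dihedral_word_append[of base t "[b]" x] by (auto simp: left_step_def)

lemma b_hd: "b \<noteq> hd x" using dihedral_word_ConsD[OF stepD(1,7)] by simp

lemma top_Q: "\<phi> u \<in> Q" using u_Q by simp

lemma right_mult_other: "right_type r \<Longrightarrow> r \<noteq> t \<Longrightarrow> right_mult_on r"
proof (rule ccontr)
  assume r: "right_type r" "r \<noteq> t" "\<not> right_mult_on r"
  then obtain y c where y: "left_step r y c" using ex_left_step by blast
  have rS: "r \<in> S" "r \<noteq> base" using right_typeD[OF r(1)] by simp_all
  have "dihedral_word base r (c # y)" "length y + 2 \<le> ord base r" using y by (simp_all add: left_step_def)
  then have "bruhat_le (word_value y) (\<phi> u)"
    using dihedral_le_top[OF rS, of y] dihedral_word_append[of base r "[c]" y] by simp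
  then show False
    using left_step_unique[OF t_right step r(1) y top_Q dihedral_le_top[OF t_S stepD(6)]] stepD(3) r(2) by simp
qed

lemma left_mult_all: "left_type l \<Longrightarrow> left_mult_on l"
proof (rule ccontr)
  assume l: "left_type l" "\<not> left_mult_on l"
  then obtain y c where y: "right_step l y c" using ex_right_step by blast
  have lS: "l \<in> S" "l \<noteq> base" using left_typeD[OF l(1)] by simp_all
  have "dihedral_word base l (y @ [c])" "length y + 2 \<le> ord base l" using y by (simp_all add: right_step_def)
  then have "bruhat_le (word_value (y @ [c])) (\<phi> u)" using dihedral_le_top[OF lS, of "y @ [c]"] by simp
  then show False
    using left_step_right_step_False[OF t_right step l(1) y top_Q dihedral_le_top[OF t_S stepD(1)]] stepD(3) by simp
qed

lemma mult_other: "c \<in> S \<Longrightarrow> c \<noteq> base \<Longrightarrow> c \<noteq> t \<Longrightarrow> right_mult_on c \<or> left_mult_on c"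
  by (rule type_cases[of c]) (use right_mult_other left_mult_all central_mult_on in auto)

lemma step_le: "bruhat_le (word_value x) u"
  using dihedral_le_bottom[OF t_S stepD(6,3)] .

lemma base_t_order: "4 \<le> ord base t" using stepD(2,3) by simp

text \<open>Any other descent would have left type, by irreducibility; together with
  \<open>[base, t]\<close>, which lies below \<open>u\<close>, it would give the forbidden word
  \<open>[l, base, t]\<close>.\<close>

lemma left_descent_pair:
  assumes a: "a \<in> S" "len (a \<otimes> u) < len u" shows "a \<in> {base, t}"
proof (rule ccontr)
  assume n: "a \<notin> {base, t}"
  have nl: "\<not> left_commuting a" using left_irreducible a by blast
  have "\<not> right_mult_on a" using left_commuting_of_right_mult a(1) n nl by blast
  then have l: "left_type a" by (rule_tac type_cases[OF a(1)]) (use n right_mult_other central_mult_on in auto)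
  have "a \<otimes> u \<in> carrier W" using a(1) u_Q by simp
  then obtain \<omega> where \<omega>: "reduced \<omega>" "word_value \<omega> = a \<otimes> u" using ex_reduced by blast
  have r: "reduced (a # \<omega>)" "word_value (a # \<omega>) = u" using reduced_Cons_descent[OF a(1) _ a(2) \<omega>] u_Q by simp_all
  have d: "dihedral_word base t [base, t]" using t_S by (simp add: dihedral_word_def)
  have "subseq [base, t] (a # \<omega>)"
    using unique_word_subseq[OF dw_unique[OF t_S d] dihedral_le_bottom[OF t_S d] r] base_t_order by simp
  then have "subseq [a, base, t] (a # \<omega>)" using n by auto
  then show False using no_left_base_right[OF l t_right r(1)] r(2) u_Q by simp
qed

text \<open>Any other descent would have right type and could be appended to \<open>x\<close>,
  contrary to \<open>left_step_right_type_notin\<close>.\<close>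

lemma right_descent_pair:
  assumes a: "a \<in> S" "len (u \<otimes> a) < len u" shows "a \<in> {base, t}"
proof (rule ccontr)
  assume n: "a \<notin> {base, t}"
  have nl: "\<not> right_commuting a" using right_irreducible a by blast
  have "\<not> left_mult_on a" using right_commuting_of_left_mult a(1) n nl by blast
  then have l: "right_type a" by (rule_tac type_cases[OF a(1)]) (use n left_mult_all central_mult_on in auto)
  have "u \<otimes> a \<in> carrier W" using a(1) u_Q by simp
  then obtain \<omega> where \<omega>: "reduced \<omega>" "word_value \<omega> = u \<otimes> a" using ex_reduced by blast
  have r: "reduced (\<omega> @ [a])" "word_value (\<omega> @ [a]) = u" using right_descent_word[OF _ a \<omega>] u_Q by simp_all
  have "subseq x (\<omega> @ [a])" using unique_word_subseq[OF dw_unique[OF t_S stepD(6)] step_le r] stepD(3) by simp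
  then have "subseq x \<omega>" using subseq_append_last_notin[of x \<omega> "[a]"] stepD(4,7) n by auto
  then have "subseq (x @ [a]) (\<omega> @ [a])" by simp
  then show False using left_step_right_type_notin[OF t_right step l] n subword_Q[OF r(1)] r(2) u_Q by simp
qed

lemma ex_left_violation_descent:
  assumes f: "f \<in> S" "len (f \<otimes> u) < len u"
  obtains g e f' where "left_violation t f g e f'"
proof -
  have fI: "f \<in> {base, t}" using left_descent_pair f by blast
  obtain t' y where v: "t' \<in> S" "t' \<noteq> base" "f \<in> {base, t'}" "y \<in> parabolic {base, t'}" "\<phi> (f \<otimes> y) \<noteq> f \<otimes> \<phi> y"
    using not_left_commutingE[OF left_irreducible[OF f] f(1)] by metis
  have "t' = t"
  proof (rule ccontr)
    assume n: "t' \<noteq> t"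
    then have "f = base" using v(3) fI by auto
    then show False using base_commutes_on(1)[OF v(1) mult_other[OF v(1,2) n] v(4)] v(5) by simp
  qed
  then show ?thesis using that ex_left_violation[OF t_S, of f y] v fI t_right by blast
qed

lemma ex_right_violation_descent:
  assumes "len (u \<otimes> base) < len u"
  obtains g e f' where "right_violation t base g e f'"
proof -
  obtain t' y where v: "t' \<in> S" "t' \<noteq> base" "y \<in> parabolic {base, t'}" "\<phi> (y \<otimes> base) \<noteq> \<phi> y \<otimes> base"
    using not_right_commutingE[OF right_irreducible[OF base_S assms] base_S] by metis
  have "t' = t"
  proof (rule ccontr)
    assume n: "t' \<noteq> t"
    then show False using base_commutes_on(2)[OF v(1) mult_other[OF v(1,2) n] v(3)] v(4) by simp
  qed
  then show ?thesis using that ex_right_violation[OF t_S] v by blast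
qed

text \<open>Below the length of \<open>x\<close>, \<open>\<phi>\<close> is right multiplication and
  cannot add \<open>f'\<close> on the left. At that length only \<open>x\<close> goes up, with a
  letter on the left; so \<open>g\<close> cannot be \<open>x\<close>, and \<open>f # g\<close> of
  that length must be \<open>x\<close>.\<close>

lemma left_violation_length:
  assumes v: "left_violation t f g e f'"
  shows "length x \<le> Suc (length g)" "length g \<noteq> length x" "Suc (length g) = length x \<Longrightarrow> f # g = x"
proof -
  have V: "g \<noteq> []" "f' \<noteq> f" "dihedral_word base t (f' # f # g)" "dihedral_word base t (g @ [e])"
    "\<phi> (word_value g) = word_value (g @ [e])" "\<phi> (word_value (f # g)) = word_value (f' # f # g)"
    "length g + 3 \<le> ord base t" using v by (simp_all add: left_violation_def)
  have d: "dihedral_word base t g" "dihedral_word base t (f # g)"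
    using dihedral_word_append[of base t g "[e]"] dihedral_word_append[of base t "[f']" "f # g"] V by simp_all
  have len: "len (word_value \<omega>) = length \<omega>" if "dihedral_word base t \<omega>" "length \<omega> \<le> ord base t" for \<omega>
    using reduced_len[OF dw_reduced[OF t_S that]] .
  have lx: "len (word_value x) < len (\<phi> (word_value x))" using len[OF stepD(6)] len[OF stepD(1)] stepD(3,5) by simp
  have lg: "len (word_value g) < len (\<phi> (word_value g))" using len[OF d(1)] len[OF V(4)] V(5,7) by simp
  have lf: "len (word_value (f # g)) < len (\<phi> (word_value (f # g)))"
    using len[OF d(2)] len[OF V(3)] V(7) unfolding V(6) by simp
  have eqx: "\<eta> = x" if "dihedral_word base t \<eta>" "length \<eta> = length x" "len (word_value \<eta>) < len (\<phi> (word_value \<eta>))" for \<eta>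
    using dw_one_side_down[OF t_S stepD(6,7) _ lx that(1,2)] stepD(3) that(3) by fastforce
  show "length x \<le> Suc (length g)"
  proof (rule ccontr)
    assume "\<not> ?thesis"
    then have p: "\<phi> (word_value (f # g)) = word_value (f # g) \<otimes> base"
      using step_min[OF dw_parabolic[OF t_S d(2)]] len[OF d(2)] V(7) by simp
    have S: "set (f # g) \<subseteq> S" using reducedD[OF dw_reduced[OF t_S d(2)]] V(7) by simp
    have "word_value ((f # g) @ [base]) = word_value (f # g) \<otimes> base" using S by (subst word_value_append) simp_all
    then have w: "word_value ((f # g) @ [base]) = word_value (f' # f # g)" using p V(6) by metis
    then have "reduced ((f # g) @ [base])"
      using len[OF V(3)] V(7) S unfolding reduced_def by simp
    then have "(f # g) @ [base] = f' # f # g" using dw_eqI[OF t_S V(3) _ _ w] V(7) by simp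
    then show False using V(2) by simp
  qed
  show "length g \<noteq> length x"
  proof
    assume "length g = length x"
    then have gx: "g = x" using eqx[OF d(1) _ lg] by simp
    have r: "reduced (b # x)" using dw_reduced[OF t_S stepD(1)] stepD(3) by simp
    have "b # x = x @ [e]"
      using dw_eqI[OF t_S V(4) _ r] gx V(5,7) stepD(5) by simp
    then show False using b_hd stepD(7) by (metis hd_append2 list.sel(1))
  qed
  show "f # g = x" if "Suc (length g) = length x" using eqx[OF d(2) _ lf] that by simp
qed

text \<open>By minimality of the step, \<open>\<phi>\<close> still adds \<open>base\<close> on the
  right of \<open>tl x\<close> but adds \<open>b\<close> on the left of \<open>x\<close>. Three
  letters guarantee that \<open>tl x\<close> is not a single generator.\<close>

lemma step_violation:
  assumes "3 \<le> length x"
  shows "left_violation t (hd x) (tl x) base b"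
proof -
  have xs: "hd x # tl x = x" using stepD(7) by simp
  have ne: "tl x \<noteq> []" using assms by (cases x) auto
  have d: "dihedral_word base t (tl x)" using dihedral_word_append[of base t "[hd x]" "tl x"] xs stepD(6) by simp
  have lt: "last (tl x) = t" using stepD(4) ne xs by (metis last_tl)
  have db: "dihedral_word base t (tl x @ [base])"
    using d lt ne t_S by (auto simp: dihedral_word_def distinct_adj_append_iff)
  have r: "reduced (tl x)" using dw_reduced[OF t_S d] stepD(3) by simp
  have "\<phi> (word_value (tl x)) = word_value (tl x) \<otimes> base"
    using step_min[OF dw_parabolic[OF t_S d]] reduced_len[OF r] assms by simp
  then have "\<phi> (word_value (tl x)) = word_value (tl x @ [base])" using reducedD[OF r] by simp
  then show ?thesis unfolding left_violation_def xs using ne b_hd stepD db assms by auto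
qed

end

section \<open>The longest dihedral prefix and its suffix\<close>

locale prefixed_orbit = long_irreducible_orbit +
  fixes \<xi> \<nu> :: "'a list"
  assumes word: "reduced (\<xi> @ \<nu>)" "word_value (\<xi> @ \<nu>) = u" and prefix_set: "set \<xi> \<subseteq> {base, t}"
    and prefix_max: "\<And>\<xi>' \<nu>'. reduced (\<xi>' @ \<nu>') \<Longrightarrow> word_value (\<xi>' @ \<nu>') = u \<Longrightarrow> set \<xi>' \<subseteq> {base, t}
      \<Longrightarrow> length \<xi>' \<le> length \<xi>"
    and suffix_nonempty: "\<nu> \<noteq> []"
begin

lemma word_red: "reduced \<xi>" "reduced \<nu>" using reduced_append[OF word(1)] .

lemma prefix_dihedral: "dihedral_word base t \<xi>"
  using reduced_dihedral_word[OF word_red(1) prefix_set] .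

lemma sub_Q: "subseq \<eta> (\<xi> @ \<nu>) \<Longrightarrow> word_value \<eta> \<in> Q"
  using subword_Q[OF word(1)] word(2) u_Q by simp

lemma dihedral_sub:
  "dihedral_word base t \<omega> \<Longrightarrow> length \<omega> + 2 \<le> ord base t \<Longrightarrow> reduced \<zeta> \<Longrightarrow> word_value \<zeta> = u \<Longrightarrow> subseq \<omega> \<zeta>"
  using unique_word_subseq[OF dw_unique[OF t_S] dihedral_le_bottom[OF t_S]] by simp

lemma suffix_replace:
  assumes "reduced \<nu>'" "word_value \<nu>' = word_value \<nu>"
  shows "reduced (\<xi> @ \<nu>')" "word_value (\<xi> @ \<nu>') = u"
  using reduced_replace2[OF word(1) assms] word(2) by simp_all

lemma suffix_descent_word:
  assumes "reduced (c # \<nu>')" "word_value (c # \<nu>') = word_value \<nu>" shows "c \<notin> {base, t}"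
proof
  assume "c \<in> {base, t}"
  then have "length (\<xi> @ [c]) \<le> length \<xi>"
    using prefix_max[of "\<xi> @ [c]" \<nu>'] suffix_replace[OF assms] prefix_set by simp
  then show False by simp
qed

lemma suffix_hd: "hd \<nu> \<in> S" "hd \<nu> \<notin> {base, t}" "hd \<nu> # tl \<nu> = \<nu>"
  using suffix_nonempty word_red(2) suffix_descent_word[of "hd \<nu>" "tl \<nu>"] reducedD[OF word_red(2)] by (cases \<nu>; simp)+

lemma suffix_right_descents:
  assumes "reduced (\<nu>' @ [c])" "word_value (\<nu>' @ [c]) = word_value \<nu>" shows "c \<in> {base, t}"
proof (rule right_descent_pair)
  show "c \<in> S" using assms(1) by (simp add: reduced_snoc_iff)
  show "len (u \<otimes> c) < len u" using suffix_right_descent[of \<xi> \<nu>' c] suffix_replace[OF assms] by simp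
qed

text \<open>A first letter of the suffix that commutes with the prefix moves to the front of
  \<open>u\<close> and becomes a left descent outside \<open>{base, t}\<close>.\<close>

lemma suffix_descent_noncommuting:
  assumes c: "reduced (c # \<nu>')" "word_value (c # \<nu>') = word_value \<nu>" and \<xi>: "\<And>d. d \<in> set \<xi> \<Longrightarrow> c \<otimes> d = d \<otimes> c"
  shows False
proof -
  have "len (c \<otimes> u) < len u"
    using commuting_prefix_descent(3)[OF suffix_replace(1)[OF c] \<xi>] suffix_replace(2)[OF c] by simp
  moreover have "c \<in> S" using c(1) by (simp add: reduced_Cons_iff)
  ultimately show False using left_descent_pair suffix_descent_word[OF c] by blast
qed

lemma prefix_nonempty: "\<xi> \<noteq> []"
proof
  assume "\<xi> = []"
  then show False using suffix_descent_noncommuting[of "hd \<nu>" "tl \<nu>"] suffix_hd word_red(2) by simp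
qed

lemma prefix_violation:
  obtains g e f' where "left_violation t (hd \<xi>) g e f'" "dihedral_word base t (hd \<xi> # g)"
    "reduced (hd \<xi> # g)" "length g + 3 \<le> ord base t"
proof -
  obtain f \<xi>' where f: "\<xi> = f # \<xi>'" using prefix_nonempty by (cases \<xi>) auto
  have "f \<in> S" "len (f \<otimes> u) < len u"
    using word hd_left_descent[of f "\<xi>' @ \<nu>"] f reducedD[OF word(1)] by simp_all
  then obtain g e f' where v: "left_violation t f g e f'" using ex_left_violation_descent by blast
  then have d: "dihedral_word base t (f # g)" "length g + 3 \<le> ord base t"
    using dihedral_word_append[of base t "[f']" "f # g"] by (simp_all add: left_violation_def)
  then show ?thesis using that v f dw_reduced[OF t_S d(1)] by simp
qed

text \<open>The excess \<open>y\<close> of the violating word occurs in the suffix, so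
  \<open>c\<close> can be placed between \<open>\<xi>\<close> and \<open>y\<close> inside
  \<open>Q\<close>. The insertion lemma forces \<open>c\<close> to commute with a neighbouring
  letter. If that is the last letter of \<open>\<xi>\<close>, \<open>c\<close> moves one place to
  the left and is excluded there, or it commutes with all of \<open>\<xi>\<close>. So it is
  \<open>hd y\<close>; if \<open>y\<close> were longer, insertion across \<open>hd y\<close> would
  be excluded as well.\<close>

lemma short_prefix:
  assumes v: "left_violation t f g e f'" and split: "f # g = \<xi> @ y" "y \<noteq> []"
    and c: "reduced (c # \<nu>')" "word_value (c # \<nu>') = word_value \<nu>"
  shows "length y = 1" "c \<otimes> hd y = hd y \<otimes> c" "c \<otimes> last \<xi> \<noteq> last \<xi> \<otimes> c" "subseq y \<nu>'"
proof -
  have V: "dihedral_word base t (f # g)" "length (f # g) + 2 \<le> ord base t"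
    using v dihedral_word_append[of base t "[f']" "f # g"] by (simp_all add: left_violation_def)
  have dy: "dihedral_word base t y" using V(1) split(1) dihedral_word_append by metis
  have cI: "c \<notin> {base, t}" using suffix_descent_word[OF c] .
  have cS: "c \<in> S" using c(1) by (simp add: reduced_Cons_iff)
  note w = suffix_replace[OF c]
  have "subseq (\<xi> @ y) (\<xi> @ c # \<nu>')" using dihedral_sub[OF V w] split(1) by simp
  then have "subseq y (c # \<nu>')" using subseq_append_tail by blast
  moreover have "c \<notin> set y" using dy cI by (auto simp: dihedral_word_def)
  ultimately show sy: "subseq y \<nu>'" using split(2) by (cases y) (auto split: if_splits)
  have inQ: "word_value (\<xi> @ c # y) \<in> Q"
    using subword_Q[OF w(1), of "\<xi> @ c # y"] w(2) u_Q sy by (simp add: subseq_append')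
  have sets: "set \<xi> \<subseteq> S" "set y \<subseteq> S" using reducedD[OF word_red(1)] dy t_S by (auto simp: dihedral_word_def)
  have adj: "hd y \<noteq> last \<xi>" "hd y \<in> {base, t}" "last \<xi> \<in> {base, t}"
    using V(1) split prefix_nonempty dihedral_word_last[OF prefix_dihedral prefix_nonempty] dihedral_word_hd[OF dy split(2)]
    unfolding split(1) by (auto simp: dihedral_word_def distinct_adj_append_iff)
  then have pair: "{hd y, last \<xi>} = {base, t}" by auto
  have pS: "hd y \<in> S" "last \<xi> \<in> S" using adj t_S by auto
  have nc: "c \<otimes> hd y \<noteq> hd y \<otimes> c \<or> c \<otimes> last \<xi> \<noteq> last \<xi> \<otimes> c"
    using suffix_descent_noncommuting[OF c] prefix_set pair by (metis insertE singletonD subsetD)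
  have i1: "\<not> (c \<otimes> hd y \<noteq> hd y \<otimes> c \<and> c \<otimes> last \<xi> \<noteq> last \<xi> \<otimes> c)"
    using left_violation_insert_notin[OF t_S v, of \<xi> "[]" y c] split prefix_nonempty cS cI inQ by auto
  show ly: "c \<otimes> last \<xi> \<noteq> last \<xi> \<otimes> c"
  proof
    assume cl: "c \<otimes> last \<xi> = last \<xi> \<otimes> c"
    then have ch: "c \<otimes> hd y \<noteq> hd y \<otimes> c" using nc by blast
    obtain \<xi>' where \<xi>': "\<xi> = \<xi>' @ [last \<xi>]" using prefix_nonempty append_butlast_last_id by metis
    show False
    proof (cases "\<xi>' = []")
      case True
      then have "set \<xi> = {last \<xi>}" using \<xi>' by (metis append_Nil list.simps(15) empty_set)
      then show False using suffix_descent_noncommuting[OF c] cl by simp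
    next
      case False
      have d: "dihedral_word base t (\<xi>' @ [last \<xi>])" using prefix_dihedral \<xi>' by simp
      then have "last \<xi>' \<noteq> last \<xi>" using dihedral_word_snocD[OF d False] by metis
      moreover have "last \<xi>' \<in> {base, t}" using dihedral_word_last[of base t \<xi>'] dihedral_word_append[OF d] False by simp
      ultimately have h: "last \<xi>' = hd y" using pair by auto
      have s: "f # g = \<xi>' @ [last \<xi>] @ y" using split(1) \<xi>' by simp
      have "word_value (\<xi>' @ c # [last \<xi>] @ y) \<notin> Q"
        by (rule left_violation_insert_notin[OF t_S v s]) (use False split cS cI ch h in auto)
      moreover have "word_value (\<xi>' @ c # [last \<xi>] @ y) = word_value (\<xi>' @ [last \<xi>] @ c # y)"
      proof -
        have "set \<xi>' \<subseteq> S" using \<xi>' sets by (metis set_append le_sup_iff)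
        moreover have "c \<otimes> (last \<xi> \<otimes> word_value y) = last \<xi> \<otimes> (c \<otimes> word_value y)"
          using cl sets cS pS by (metis gen_closed m_assoc word_value_closed)
        ultimately show ?thesis using sets cS pS by simp
      qed
      moreover have "\<xi>' @ [last \<xi>] @ c # y = \<xi> @ c # y" using \<xi>' by (metis append_assoc)
      ultimately show False using inQ by metis
    qed
  qed
  show ch: "c \<otimes> hd y = hd y \<otimes> c" using i1 ly by blast
  show "length y = 1"
  proof (rule ccontr)
    assume l: "length y \<noteq> 1"
    obtain h y' where y: "y = h # y'" using split(2) by (cases y) auto
    have y'ne: "y' \<noteq> []" using l y by auto
    have dd: "dihedral_word base t (h # y')" using dy y by simp
    have "hd y' \<noteq> h" using dihedral_word_ConsD[OF dd y'ne] by metis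
    moreover have "hd y' \<in> {base, t}"
      using dd dihedral_word_hd[of base t y'] dihedral_word_append[of base t "[h]" y'] y'ne by simp
    ultimately have h: "hd y' = last \<xi>" using pair y by auto
    have s: "f # g = \<xi> @ [h] @ y'" using split(1) y by simp
    have "word_value (\<xi> @ c # [h] @ y') \<notin> Q"
      by (rule left_violation_insert_notin[OF t_S v s]) (use prefix_nonempty y'ne cS cI ly h in auto)
    then show False using inQ y by simp
  qed
qed

text \<open>If the prefix is long enough this is dihedral combinatorics. Otherwise \<open>x\<close>
  is \<open>\<xi>\<close> followed by \<open>t\<close>, and every possible first letter of the
  suffix turns out to be of left type; rearranging the suffix before its first \<open>base\<close>
  then brings a letter of right or central type to the front.\<close>

lemma step_sub_prefix: "subseq x \<xi>"
proof -
  obtain g e f' where v: "left_violation t (hd \<xi>) g e f'" "dihedral_word base t (hd \<xi> # g)" "reduced (hd \<xi> # g)"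
    "length g + 3 \<le> ord base t" by (rule prefix_violation)
  note L = left_violation_length[OF v(1)]
  consider "length x < length \<xi>" | "length \<xi> = length x" "Suc (length g) = length x" | "length \<xi> \<le> length g" "length \<xi> \<le> length x"
    using L(1,2) by linarith
  then show ?thesis
  proof cases
    case 1
    then show ?thesis using dihedral_subseq[OF stepD(6) prefix_dihedral] by simp
  next
    case 2
    have "\<xi> = x"
      using dihedral_word_hd_eq[OF prefix_dihedral v(2)] 2 L(3)[OF 2(2)] prefix_nonempty by auto
    then show ?thesis by simp
  next
    case 3
    obtain y where y: "hd \<xi> # g = \<xi> @ y"
      using dihedral_prefix[OF prefix_dihedral v(2)] 3 prefix_nonempty by auto
    have yne: "y \<noteq> []" using arg_cong[OF y, of length] 3 by auto
    have r0: "reduced (hd \<nu> # tl \<nu>)" "word_value (hd \<nu> # tl \<nu>) = word_value \<nu>" using suffix_hd(3) word_red by simp_all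
    obtain y0 where y0: "y = [y0]" using short_prefix(1)[OF v(1) y yne r0] by (auto simp: length_Suc_conv)
    have "length g = length \<xi>" using arg_cong[OF y, of length] y0 by simp
    then have x: "\<xi> @ [y0] = x" using L y y0 3 by simp
    then have y0t: "y0 = t" using stepD(4) by auto
    have "dihedral_word base t (\<xi> @ [t])" using x y0t stepD(6) by simp
    then have lb: "last \<xi> = base"
      using dihedral_word_snocD[of base t \<xi> t] dihedral_word_last[OF prefix_dihedral prefix_nonempty] prefix_nonempty by auto
    have left: "left_type c" if c: "reduced (c # \<nu>')" "word_value (c # \<nu>') = word_value \<nu>" for c \<nu>'
    proof -
      have cS: "c \<in> S" using c(1) by (simp add: reduced_Cons_iff)
      have cI: "c \<notin> {base, t}" using suffix_descent_word[OF c] .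
      note p = short_prefix[OF v(1) y yne c]
      have ct: "c \<otimes> t = t \<otimes> c" and cb: "c \<otimes> base \<noteq> base \<otimes> c" using p(2,3) y0 y0t lb by simp_all
      have "\<not> right_type c"
      proof
        assume r: "right_type c"
        have "subseq (\<xi> @ [c, t]) (\<xi> @ c # \<nu>')" using p(4) y0 y0t by (simp add: subseq_append')
        then have "word_value (\<xi> @ [c, t]) \<in> Q"
          using subword_Q[OF suffix_replace(1)[OF c]] suffix_replace(2)[OF c] u_Q by simp
        moreover have "word_value (\<xi> @ [c, t]) = word_value (x @ [c])"
          using ct x y0t cS t_S reducedD[OF word_red(1)] by auto
        ultimately show False using left_step_right_type_notin[OF t_right step r] cI by simp
      qed
      then show ?thesis by (rule_tac type_cases[OF cS]) (use cI cb in \<open>auto simp: central_type_def\<close>)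
    qed
    have "subseq [t] (tl \<nu>)" using short_prefix(4)[OF v(1) y yne r0] y0 y0t by simp
    then have t\<nu>: "t \<in> set \<nu>" by (metis suffix_hd(3) subseq_singleton_left list.set_intros(2))
    define p where "p = takeWhile (\<lambda>a. a \<noteq> base) \<nu>"
    \<comment> \<open>The first \<open>t\<close> cannot come after the first \<open>base\<close>,
      since the left type letter at the head would give \<open>[l, base, t]\<close>. So
      \<open>t\<close> occurs in the part \<open>p\<close> without \<open>base\<close>, to which
      \<open>upper_without_base\<close> applies.\<close>
    define q where "q = dropWhile (\<lambda>a. a \<noteq> base) \<nu>"
    have pq: "\<nu> = p @ q" by (simp add: p_def q_def)
    have bp: "base \<notin> set p" by (auto simp: p_def dest: set_takeWhileD)
    have lh: "left_type (hd \<nu>)" using left r0 by blast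
    have pne: "p \<noteq> []" using suffix_hd(2,3) by (cases \<nu>) (auto simp: p_def)
    have tp: "t \<in> set p"
    proof (rule ccontr)
      assume "t \<notin> set p"
      then have tq: "t \<in> set q" using t\<nu> pq by auto
      then have "q \<noteq> []" by auto
      then have "hd q = base" using hd_dropWhile[of "\<lambda>a. a \<noteq> base" \<nu>] by (simp add: q_def)
      then obtain q' where q': "q = base # q'" using \<open>q \<noteq> []\<close> by (cases q) auto
      have "subseq ([hd \<nu>] @ [base] @ [t]) (p @ [base] @ q')"
        by (intro list_emb_append_mono) (use pne pq tq q' t_S in \<open>auto simp: subseq_singleton_left\<close>)
      then have "subseq [hd \<nu>, base, t] \<nu>" using pq q' by simp
      then show False using no_left_base_right[OF lh t_right word_red(2)] sub_Q[of \<nu>] by (simp add: subseq_drop_many)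
    qed
    have rp: "reduced p" using reduced_append(1) word_red(2) pq by metis
    have "subseq p \<nu>" using pq by (simp add: subseq_rev_drop_many)
    then have pQ: "word_value p \<in> Q" using sub_Q[of p] subseq_drop_many by blast
    obtain \<alpha> \<beta> where ab: "reduced (\<alpha> @ \<beta>)" "word_value (\<alpha> @ \<beta>) = word_value p"
      "\<And>a. a \<in> set \<alpha> \<Longrightarrow> right_type a \<or> central_type a" "\<And>a. a \<in> set \<beta> \<Longrightarrow> left_type a \<or> central_type a"
      using upper_without_base[OF rp pQ bp] by metis
    have "t \<in> set (\<alpha> @ \<beta>)" using reduced_set_eq[OF ab(1) rp ab(2)] tp by simp
    then have "t \<in> set \<alpha>" using ab(4) t_right type_distinct by auto
    then obtain a \<alpha>' where a: "\<alpha> = a # \<alpha>'" by (cases \<alpha>) auto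
    have "reduced ((\<alpha> @ \<beta>) @ q)" "word_value ((\<alpha> @ \<beta>) @ q) = word_value (p @ q)"
      using reduced_replace[OF _ ab(1,2), of q] word_red(2) pq by simp_all
    then have "left_type a" using left[of a "\<alpha>' @ \<beta> @ q"] a pq by simp
    then show ?thesis using ab(3)[of a] a type_distinct by auto
  qed
qed

lemma no_right_type_suffix: "right_type r \<Longrightarrow> r \<noteq> t \<Longrightarrow> r \<notin> set \<nu>"
proof
  assume r: "right_type r" "r \<noteq> t" "r \<in> set \<nu>"
  have "subseq (x @ [r]) (\<xi> @ \<nu>)"
    using step_sub_prefix r(3) by (intro list_emb_append_mono) (auto simp: subseq_singleton_left)
  then show False using left_step_right_type_notin[OF t_right step r(1,2)] sub_Q by blast
qed

lemma suffix_type: "c \<in> set \<nu> \<Longrightarrow> c \<noteq> base \<Longrightarrow> c \<noteq> t \<Longrightarrow> left_type c \<or> central_type c"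
proof -
  assume c: "c \<in> set \<nu>" "c \<noteq> base" "c \<noteq> t"
  have "c \<in> S" using c(1) reducedD[OF word_red(2)] by blast
  then show ?thesis by (rule type_cases) (use c no_right_type_suffix in auto)
qed

end

context prefixed_orbit
begin

text \<open>A step of at least three letters is a violation into which \<open>d\<close> can be
  inserted, after moving it past \<open>base\<close>. Only the step \<open>[base, t]\<close> needs
  separate treatment, where the prefix turns out to be \<open>[base, t]\<close> or
  \<open>[t, base, t]\<close>.\<close>

lemma central_letter_before_t_False:
  assumes d: "central_type d" "d \<otimes> t \<noteq> t \<otimes> d" and pt: "\<nu> = p @ t # \<nu>'" "d \<in> set p" and bp: "base \<notin> set p" "t \<notin> set p"
  shows False
proof -
  have dS: "d \<in> S" "d \<notin> {base, t}" "base \<otimes> d = d \<otimes> base" using d by (auto simp: central_type_def)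
  have le: "subseq (\<eta> @ [d, t]) (\<xi> @ \<nu>)" if "subseq \<eta> \<xi>" for \<eta>
  proof -
    have "subseq ([d] @ [t] @ []) (p @ [t] @ \<nu>')" using pt(2)
      by (intro list_emb_append_mono) (auto simp: subseq_singleton_left)
    then show ?thesis using that pt(1) by (intro list_emb_append_mono) simp_all
  qed
  show False
  proof (cases "3 \<le> length x")
    case True
    obtain x1 where x1: "x = x1 @ [t]" using stepD(4,7) append_butlast_last_id by metis
    then have "x1 \<noteq> []" using True by auto
    then obtain x' z where x': "x1 = x' @ [z]" by (metis rev_exhaust)
    have ne: "x' \<noteq> []" using True x1 x' by auto
    have dx: "dihedral_word base t (x' @ [z] @ [t])" using stepD(6) x1 x' by simp
    have z: "z = base" using dx by (auto simp: dihedral_word_def distinct_adj_append_iff)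
    have dx': "dihedral_word base t (x' @ [z])" using dihedral_word_append[of base t "x' @ [z]" "[t]"] dx by simp
    have lx: "last x' = t"
      using dihedral_word_snocD[OF dx' ne] z dihedral_word_append[OF dx'] dihedral_word_last[of base t x'] ne by auto
    have xx: "x = x' @ [base] @ [t]" using x1 x' z by simp
    then have s: "hd x # tl x = x' @ [base] @ [t]" using stepD(7) by simp
    have "word_value (x' @ d # [base] @ [t]) \<notin> Q"
      by (rule left_violation_insert_notin[OF t_S step_violation[OF True] s]) (use ne dS d lx in auto)
    moreover have "word_value (x' @ d # [base] @ [t]) = word_value ((x' @ [base]) @ [d, t])"
    proof -
      have "set x' \<subseteq> S" using dx t_S by (auto simp: dihedral_word_def)
      then show ?thesis using dS t_S by (simp flip: m_assoc)
    qed
    moreover have "subseq (x' @ [base]) x" using xx by (simp add: subseq_append')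
    then have "subseq (x' @ [base]) \<xi>" using step_sub_prefix subseq_order.order_trans by blast
    ultimately show False using sub_Q[OF le] by metis
  next
    case False
    then have "length x = 2" using stepD(2) by simp
    then obtain z z' where "x = [z, z']" by (auto simp: length_Suc_conv numeral_2_eq_2)
    then have xx: "x = [base, t]" using stepD(4,6) by (auto simp: dihedral_word_def)
    have bt: "b = t" using stepD(1) xx by (auto simp: dihedral_word_def)
    \<comment> \<open>\<open>alternating_shift_notin\<close> now keeps
      \<open>[base, t, base]\<close> out of the prefix, which leaves only two possible prefixes
      containing \<open>[base, t]\<close>.\<close>
    have ph: "\<phi> (word_value [base, t]) = word_value [t, base, t]" using stepD(5) xx bt by simp
    have nsub: "\<not> subseq [base, t, base] \<xi>"
    proof
      assume "subseq [base, t, base] \<xi>"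
      then show False using alternating_shift_notin[OF t_right ph base_t_order d] sub_Q[OF le] by fastforce
    qed
    have alt: "\<exists>\<xi>'. \<omega> = y # z # \<xi>'" if "dihedral_word base t \<omega>" "2 \<le> length \<omega>" "hd \<omega> = y" "{y, z} = {base, t}" for \<omega> y z
      using that by (cases \<omega>; cases "tl \<omega>") (auto simp: dihedral_word_def doubleton_eq_iff)
    have l2: "2 \<le> length \<xi>" using list_emb_length[OF step_sub_prefix] xx by simp
    consider "hd \<xi> = base" | "hd \<xi> = t" using dihedral_word_hd[OF prefix_dihedral prefix_nonempty] by blast
    then show False
    proof cases
      case 1
      obtain \<xi>' where \<xi>': "\<xi> = base # t # \<xi>'" using alt[OF prefix_dihedral l2 1] by blast
      have "\<xi>' = []"
      proof (rule ccontr)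
        assume "\<xi>' \<noteq> []"
        then obtain c \<xi>'' where c: "\<xi>' = c # \<xi>''" by (cases \<xi>') auto
        then have "c = base" using prefix_dihedral \<xi>' by (auto simp: dihedral_word_def)
        then show False using nsub \<xi>' c by simp
      qed
      then have \<xi>bt: "\<xi> = [base, t]" using \<xi>' by simp
      define v where "v = p @ [t]"
      have vw: "\<xi> @ \<nu> = \<xi> @ v @ \<nu>'" using pt(1) by (simp add: v_def)
      have rv: "reduced (v @ \<nu>')" using word_red(2) pt(1) by (simp add: v_def)
      have rv': "reduced v" using reduced_append(1)[OF rv] .
      have vQ: "word_value v \<in> Q" by (rule sub_Q) (simp add: vw subseq_drop_many subseq_rev_drop_many)
      have bv: "base \<notin> set v" using bp t_S by (simp add: v_def)
      obtain \<alpha> \<beta> where ab: "reduced (\<alpha> @ \<beta>)" "word_value (\<alpha> @ \<beta>) = word_value v"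
        "\<And>a. a \<in> set \<alpha> \<Longrightarrow> right_type a \<or> central_type a" "\<And>a. a \<in> set \<beta> \<Longrightarrow> left_type a \<or> central_type a"
        using upper_without_base[OF rv' vQ bv] by metis
      have sv: "set (\<alpha> @ \<beta>) = set v" using reduced_set_eq[OF ab(1) rv' ab(2)] .
      have "t \<in> set (\<alpha> @ \<beta>)" using sv by (simp add: v_def)
      then have ta: "t \<in> set \<alpha>" using ab(4) t_right type_distinct by auto
      have "reduced ((\<alpha> @ \<beta>) @ \<nu>')" "word_value ((\<alpha> @ \<beta>) @ \<nu>') = word_value \<nu>"
        using reduced_replace[OF rv ab(1,2)] pt(1) by (simp_all add: v_def)
      then have r: "reduced (\<xi> @ \<alpha> @ \<beta> @ \<nu>')" "word_value (\<xi> @ \<alpha> @ \<beta> @ \<nu>') = u"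
        using suffix_replace[of "\<alpha> @ \<beta> @ \<nu>'"] by simp_all
      then have r': "reduced ((base # t # \<alpha>) @ \<beta> @ \<nu>')" "word_value ((base # t # \<alpha>) @ \<beta> @ \<nu>') = u"
        using \<xi>bt by simp_all
      have "word_value (base # t # \<alpha>) \<notin> Q"
      proof (rule central_block_notin[OF t_right ph base_t_order _ ta reduced_append(1)[OF r'(1)]])
        fix a assume a: "a \<in> set \<alpha>"
        then have "a \<in> set \<nu>" using sv pt(1) by (auto simp: v_def)
        then show "a = t \<or> central_type a" using ab(3)[OF a] no_right_type_suffix[of a] by blast
      next
        fix a assume "a \<in> S" "len (a \<otimes> word_value (base # t # \<alpha>)) < len (word_value (base # t # \<alpha>))"
        then show "a \<in> {base, t}" using reduced_prefix_descent[OF r'(1)] left_descent_pair r'(2) by metis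
      qed
      moreover have "word_value (base # t # \<alpha>) \<in> Q"
        by (rule subword_Q[OF r'(1)]) (use r'(2) u_Q in \<open>auto simp: subseq_rev_drop_many\<close>)
      ultimately show False by blast
    next
      case 2
      obtain \<xi>' where \<xi>': "\<xi> = t # base # \<xi>'" using alt[OF prefix_dihedral l2 2] by blast
      have "\<xi>' = [t]"
      proof -
        have "subseq [base, t] \<xi>" using step_sub_prefix xx by simp
        then have "subseq [t] \<xi>'" using \<xi>' t_S by simp
        then obtain c \<xi>'' where c: "\<xi>' = c # \<xi>''" by (cases \<xi>') auto
        then have ct: "c = t" using prefix_dihedral \<xi>' by (auto simp: dihedral_word_def)
        have "\<xi>'' = []"
        proof (rule ccontr)
          assume "\<xi>'' \<noteq> []"
          then obtain e \<xi>3 where e: "\<xi>'' = e # \<xi>3" by (cases \<xi>'') auto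
          then have "e = base" using prefix_dihedral \<xi>' c ct by (auto simp: dihedral_word_def)
          then show False using nsub \<xi>' c ct e t_S by simp
        qed
        then show ?thesis using c ct by simp
      qed
      then have \<xi>tbt: "\<xi> = [t, base, t]" using \<xi>' by simp
      obtain g e f' where v: "left_violation t (hd \<xi>) g e f'" "dihedral_word base t (hd \<xi> # g)" "reduced (hd \<xi> # g)"
        "length g + 3 \<le> ord base t" by (rule prefix_violation)
      note L = left_violation_length[OF v(1)]
      have "Suc (length g) \<noteq> length x"
      proof
        assume "Suc (length g) = length x"
        from L(3)[OF this] show False using xx 2 t_S by simp
      qed
      \<comment> \<open>The violating word starts with \<open>t\<close>, so it is not
        \<open>x\<close>, and it properly extends \<open>[t, base, t]\<close>. Its remainder starts
        with \<open>base\<close> and must occur after the first \<open>t\<close> of the suffix,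
        which allows \<open>d\<close> to be inserted before that \<open>t\<close>.\<close>
      then have lg: "3 \<le> length g" using L(1,2) xx by simp
      obtain y where y: "hd \<xi> # g = \<xi> @ y"
        using dihedral_prefix[OF prefix_dihedral v(2)] lg \<xi>tbt by auto
      have yne: "y \<noteq> []" using arg_cong[OF y, of length] lg \<xi>tbt by auto
      have "dihedral_word base t ([t, base] @ t # y)" using v(2) y \<xi>tbt by simp
      then have ty: "dihedral_word base t (t # y)" using dihedral_word_append[of base t "[t, base]" "t # y"] by simp
      then have hy: "hd y = base"
        using dihedral_word_ConsD[OF ty yne] dihedral_word_append[of base t "[t]" y] dihedral_word_hd[of base t y] yne by auto
      have "subseq (\<xi> @ y) (\<xi> @ \<nu>)"
        using dihedral_sub[OF v(2) _ word] v(4) unfolding y[symmetric] by simp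
      then have "subseq y \<nu>" using subseq_append_tail by blast
      moreover obtain y' where y': "y = base # y'" using yne hy by (cases y) auto
      ultimately have "subseq (base # y') (t # \<nu>')"
        using pt(1) bp
      proof (induction p arbitrary: \<nu>)
        case (Cons a p)
        then show ?case by (auto split: if_splits)
      qed simp
      then have "subseq y \<nu>'" using y' t_S by simp
      then have "subseq ([d] @ [t] @ y) (p @ [t] @ \<nu>')" using pt(2)
        by (intro list_emb_append_mono) (auto simp: subseq_singleton_left)
      then have "subseq ([t, base] @ [d, t] @ y) (\<xi> @ \<nu>)"
        using pt(1) \<xi>tbt by (intro list_emb_append_mono) simp_all
      then have "word_value ([t, base] @ [d, t] @ y) \<in> Q" by (rule sub_Q)
      moreover have "word_value ([t, base] @ [d, t] @ y) = word_value ([t] @ d # [base] @ t # y)"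
      proof -
        have "set y \<subseteq> S" using v(3) y reducedD[OF v(3)] by auto
        then have "word_value y \<in> carrier W" by blast
        then have "base \<otimes> (d \<otimes> (t \<otimes> word_value y)) = d \<otimes> (base \<otimes> (t \<otimes> word_value y))"
          using dS t_S by (metis base_S gen_closed m_assoc m_closed)
        then show ?thesis by simp
      qed
      moreover have "word_value ([t] @ d # [base] @ t # y) \<notin> Q"
      proof (rule left_violation_insert_notin[OF t_S v(1)])
        show "hd \<xi> # g = [t] @ [base] @ t # y" using y \<xi>tbt by simp
      qed (use dS d in auto)
      ultimately show False by simp
    qed
  qed
qed

text \<open>Before the first \<open>t\<close> there is no \<open>base\<close>, as such a
  \<open>base\<close> would be preceded by central letters only and could join the prefix. Some
  letter there does not commute with \<open>t\<close>, or \<open>t\<close> could join the prefix;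
  this letter is central, since left type letters commute with \<open>t\<close>.\<close>

lemma t_notin_suffix: "t \<notin> set \<nu>"
proof
  assume "t \<in> set \<nu>"
  then obtain p \<nu>' where pt: "\<nu> = p @ t # \<nu>'" "t \<notin> set p" by (metis split_list_first)
  have pS: "set p \<subseteq> S" using reducedD[OF word_red(2)] pt by simp
  have bp: "base \<notin> set p"
  proof
    assume "base \<in> set p"
    then obtain p1 p2 where p: "p = p1 @ base # p2" "base \<notin> set p1" by (metis split_list_first)
    have n: "\<nu> = p1 @ base # (p2 @ t # \<nu>')" using p pt by simp
    have "central_type a" if a: "a \<in> set p1" for a
    proof -
      have "\<not> left_type a"
      proof
        assume l: "left_type a"
        have "subseq ([a] @ [base] @ [t]) (p1 @ [base] @ (p2 @ t # \<nu>'))"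
          using a by (intro list_emb_append_mono) (auto simp: subseq_singleton_left)
        then have "subseq [a, base, t] \<nu>" using n by simp
        then show False using no_left_base_right[OF l t_right word_red(2)] sub_Q[of \<nu>] by (simp add: subseq_drop_many)
      qed
      moreover have "a \<in> set \<nu>" "a \<noteq> base" "a \<noteq> t" using a p pt by auto
      ultimately show ?thesis using suffix_type by blast
    qed
    then have c: "base \<otimes> a = a \<otimes> base" if "a \<in> set p1" for a using that central_commute by blast
    have r: "reduced (p1 @ base # (p2 @ t # \<nu>'))" using word_red(2) n by simp
    show False
      using suffix_descent_word[of base] commuting_prefix_descent(1,2)[OF r c] n by simp
  qed
  have "\<exists>d \<in> set p. d \<otimes> t \<noteq> t \<otimes> d"
  proof (rule ccontr)
    assume "\<not> ?thesis"
    then have c: "t \<otimes> a = a \<otimes> t" if "a \<in> set p" for a using that by metis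
    have r: "reduced (p @ t # \<nu>')" using word_red(2) pt by simp
    show False using suffix_descent_word[of t] commuting_prefix_descent(1,2)[OF r c] pt by simp
  qed
  then obtain d where d: "d \<in> set p" "d \<otimes> t \<noteq> t \<otimes> d" by blast
  have "d \<in> set \<nu>" "d \<noteq> base" "d \<noteq> t" using d bp pt by auto
  then have "central_type d" using suffix_type type_commute[OF _ t_right] d(2) by blast
  then show False using central_letter_before_t_False d pt bp by blast
qed

text \<open>Every reduced word of the suffix ends in \<open>base\<close>, so the letter before it is
  of left type; a central one could be moved to the end. Irreducibility on the right gives a
  violation \<open>g\<close> ending in \<open>t\<close>. It fits into the prefix, and
  \<open>g @ [d, base]\<close> is forbidden.\<close>

lemma no_prefixed_orbit: False
proof -
  have last_base: "c = base" if "reduced (\<nu>1 @ [c])" "word_value (\<nu>1 @ [c]) = word_value \<nu>" for c \<nu>1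
  proof -
    have "c \<in> set \<nu>" using reduced_set_eq[OF that(1) word_red(2) that(2)] by auto
    then show ?thesis using suffix_right_descents[OF that] t_notin_suffix by auto
  qed
  obtain \<nu>1 where \<nu>1: "\<nu> = \<nu>1 @ [base]"
  proof -
    obtain \<nu>1 c where n: "\<nu> = \<nu>1 @ [c]" using suffix_nonempty by (metis rev_exhaust)
    then have "c = base" using last_base[of \<nu>1 c] word_red(2) by simp
    then show ?thesis using that n by blast
  qed
  have "\<nu>1 \<noteq> []" using suffix_hd(2) \<nu>1 by auto
  then obtain q d where q: "\<nu>1 = q @ [d]" by (metis rev_exhaust)
  have n: "\<nu> = q @ [d, base]" using \<nu>1 q by simp
  have dn: "d \<in> set \<nu>" "d \<noteq> t" using n t_notin_suffix by auto
  have db: "d \<noteq> base" using reduced_distinct_adj[OF word_red(2)] n by (auto simp: distinct_adj_append_iff)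
  have S: "set q \<subseteq> S" "d \<in> S" using reducedD[OF word_red(2)] n by auto
  have "\<not> central_type d"
  proof
    assume c: "central_type d"
    have e: "word_value ((q @ [base]) @ [d]) = word_value \<nu>" using S central_commute[OF c] n by simp
    then have "reduced ((q @ [base]) @ [d])" using word_red(2) n S unfolding reduced_def by simp
    then show False using last_base[of "q @ [base]" d] e db by simp
  qed
  then have dl: "left_type d" using suffix_type[OF dn(1) db dn(2)] by blast
  have "len (u \<otimes> base) < len u" using suffix_right_descent[of \<xi> \<nu>1 base] word \<nu>1 by simp
  then obtain g e f' where v: "right_violation t base g e f'" using ex_right_violation_descent by blast
  have V: "g \<noteq> []" "dihedral_word base t (g @ [base, f'])" "length g + 3 \<le> ord base t" using v by (simp_all add: right_violation_def)
  have dg: "dihedral_word base t g" using dihedral_word_append[OF V(2)] by simp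
  have "last g \<noteq> base" using V(1,2) by (auto simp: dihedral_word_def distinct_adj_append_iff)
  then have lg: "last g = t" using dihedral_word_last[OF dg V(1)] by blast
  have "subseq g (\<xi> @ \<nu>)" using dihedral_sub[OF dg _ word] V(3) by simp
  then have "subseq g \<xi>" using subseq_append_last_notin V(1) lg t_notin_suffix by metis
  then have "subseq (g @ [d, base]) (\<xi> @ \<nu>)" using n
    by (intro list_emb_append_mono) (simp_all add: subseq_drop_many)
  then show False using right_violation_left_type_notin[OF t_right v dl] sub_Q by blast
qed

end

context long_irreducible_orbit
begin

lemma rank_le_2_of_long: "S \<subseteq> {base, t}"
proof (rule ccontr)
  assume n: "\<not> S \<subseteq> {base, t}"
  have I: "{base, t} \<subseteq> S" using t_S by simp
  obtain \<xi> \<nu> where w: "reduced (\<xi> @ \<nu>)" "word_value (\<xi> @ \<nu>) = u" "set \<xi> \<subseteq> {base, t}"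
    and max: "\<And>\<xi>' \<nu>'. reduced (\<xi>' @ \<nu>') \<Longrightarrow> word_value (\<xi>' @ \<nu>') = u \<Longrightarrow> set \<xi>' \<subseteq> {base, t}
      \<Longrightarrow> length \<xi>' \<le> length \<xi>"
    using ex_max_prefix[OF Q_closed[OF u_Q], of "{base, t}"] by metis
  have "\<nu> \<noteq> []"
  proof
    assume "\<nu> = []"
    then have "u \<in> parabolic {base, t}" using reduced_parabolic_iff[OF _ I, of \<xi>] w by simp
    then show False using parabolic_bottom I n by blast
  qed
  then interpret prefixed_orbit W S m Q \<phi> u t x b \<xi> \<nu>
    by unfold_locales (use w max in blast)+
  show False by (rule no_prefixed_orbit)
qed

end

section \<open>The rank bound and the theorem\<close>

context irreducible_orbit
begin

lemma rank_le_2_right: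
  assumes "right_type t" "\<not> right_mult_on t" shows "S \<subseteq> {base, t}"
proof -
  obtain x b where x: "left_step t x b" "\<And>y. y \<in> parabolic {base, t} \<Longrightarrow> len y < length x \<Longrightarrow> \<phi> y = y \<otimes> base"
    using ex_left_step[OF assms] by metis
  interpret long_irreducible_orbit W S m Q \<phi> u t x b
    by unfold_locales (use assms x in blast)+
  show ?thesis by (rule rank_le_2_of_long)
qed

lemma mirror_irreducible_orbit: "irreducible_orbit W S m ((\<lambda>x. inv x) ` Q) (\<lambda>x. inv (\<phi> (inv x))) (inv u)"
proof -
  interpret mirror: full_matching W S m "(\<lambda>x. inv x) ` Q" "\<lambda>x. inv (\<phi> (inv x))"
    by (rule mirror_full_matching)
  have uc: "u \<in> carrier W" "\<phi> u \<in> carrier W" using u_Q by simp_all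
  show ?thesis
  proof unfold_locales
    show "inv u \<in> (\<lambda>x. inv x) ` Q" using u_Q by simp
    show "len (inv u) < len (inv (\<phi> (inv (inv u))))" using u_up uc by simp
  next
    fix a c assume ac: "a \<in> S" "c \<in> S"
    define n where "n = ord a c"
    have S: "set (alternating n a c) \<subseteq> S" "set (alternating n c a) \<subseteq> S" using alternating_closed ac by simp_all
    \<comment> \<open>Reversal gives an alternating word with the same or the other first letter,
      depending on parity; both are longest elements known to lie below
      \<open>\<phi> u\<close>.\<close>
    have "inv (dihedral_longest a c) = word_value (rev (alternating n a c))"
      using dihedral_longest_value[OF ac] word_value_rev[OF S(1)] by (simp add: n_def)
    also have "\<dots> = dihedral_longest a c \<or> \<dots> = dihedral_longest c a"
      using dihedral_longest_value[OF ac] dihedral_longest_value[OF ac(2,1)] ord_sym[OF ac]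
      by (simp add: rev_alternating n_def)
    finally have "inv (dihedral_longest a c) = dihedral_longest a c \<or> inv (dihedral_longest a c) = dihedral_longest c a" .
    then have "bruhat_le (inv (dihedral_longest a c)) (\<phi> u)" using longest_le ac by metis
    then have "bruhat_le (inv (inv (dihedral_longest a c))) (inv (\<phi> u))" by (rule bruhat_inv)
    then show "bruhat_le (dihedral_longest a c) (inv (\<phi> (inv (inv u))))"
      using Q_closed[OF longest_Q[OF ac]] uc by simp
  next
    fix a assume a: "a \<in> S" "len (a \<otimes> inv u) < len (inv u)"
    have "a \<otimes> inv u = inv (u \<otimes> a)" using a(1) uc by (simp add: inv_mult_group)
    then have "len (u \<otimes> a) < len u" using a uc by simp
    then show "\<not> mirror.left_commuting a" using mirror_left_commuting right_irreducible a(1) by blast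
  next
    fix a assume a: "a \<in> S" "len (inv u \<otimes> a) < len (inv u)"
    have "inv u \<otimes> a = inv (a \<otimes> u)" using a(1) uc by (simp add: inv_mult_group)
    then have "len (a \<otimes> u) < len u" using a uc by simp
    then have nl: "\<not> left_commuting a" using left_irreducible a(1) by blast
    show "\<not> mirror.right_commuting a"
    proof
      assume r: "mirror.right_commuting a"
      have "\<phi> (a \<otimes> y) = a \<otimes> \<phi> y" if y: "y \<in> Q" "a \<otimes> y \<in> Q" for y
      proof -
        have e: "inv y \<otimes> a = inv (a \<otimes> y)" using a(1) y by (simp add: inv_mult_group)
        then have "inv y \<otimes> a \<in> (\<lambda>x. inv x) ` Q" using y by simp
        then have "inv (\<phi> (inv (inv y \<otimes> a))) = inv (\<phi> (inv (inv y))) \<otimes> a"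
          using r y(1) unfolding mirror.right_commuting_def by blast
        then have "inv (\<phi> (a \<otimes> y)) = inv (\<phi> y) \<otimes> a" unfolding e using y by simp
        also have "\<dots> = inv (a \<otimes> \<phi> y)" using a(1) y by (simp add: inv_mult_group)
        finally have "inv (inv (\<phi> (a \<otimes> y))) = inv (inv (a \<otimes> \<phi> y))" by simp
        then show ?thesis using y a(1) by simp
      qed
      then show False using nl a(1) unfolding left_commuting_def by blast
    qed
  qed
qed

text \<open>A deviation of right type is treated directly and one of left type by inversion; without
  either, \<open>\<phi>\<close> is one-sided on every dihedral subgroup.\<close>

lemma rank_le_2: "\<exists>t \<in> S. S \<subseteq> {base, t}"
proof (cases "\<exists>t. right_type t \<and> \<not> right_mult_on t")
  case True
  then show ?thesis using rank_le_2_right right_typeD by blast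
next
  case nr: False
  show ?thesis
  proof (cases "\<exists>t. left_type t \<and> \<not> left_mult_on t")
    case True
    then obtain t where t: "left_type t" "\<not> left_mult_on t" by blast
    have tS: "t \<in> S" using left_typeD t(1) by blast
    interpret mirror: irreducible_orbit W S m "(\<lambda>x. inv x) ` Q" "\<lambda>x. inv (\<phi> (inv x))" "inv u"
      by (rule mirror_irreducible_orbit)
    have b: "mirror.base = base" by (simp add: mirror.base_def phi_one)
    have "mirror.right_type t" "\<not> mirror.right_mult_on t" using mirror_right_type[OF t(1)] t(2) by blast+
    then have "S \<subseteq> {base, t}" using mirror.rank_le_2_right b by metis
    then show ?thesis using tS by blast
  next
    case nl: False
    have "right_mult_on t \<or> left_mult_on t" if "t \<in> S" "t \<noteq> base" for t
      by (rule type_cases[OF that(1)]) (use that nr nl central_mult_on in blast)+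
    then have "S \<subseteq> {base}" using rank_le_2_without_long by blast
    then show ?thesis using base_S by blast
  qed
qed

end

context coxeter_system
begin

lemma right_descent_covered:
  assumes "a \<in> S" "x \<in> carrier W" "len (x \<otimes> a) < len x" shows "covered_by (x \<otimes> a) x"
proof -
  have "a \<otimes> inv x = inv (x \<otimes> a)" using assms by (simp add: inv_mult_group)
  then have "covered_by (inv (x \<otimes> a)) (inv x)" using left_descent_covered[of a "inv x"] assms by simp
  then show ?thesis using assms by simp
qed

end

context distinguished_matching
begin

lemma reducible_if_maximal:
  assumes max: "maximal_distinguished_matching Q \<phi>" shows "reducible_matching Q \<phi>"
proof (rule ccontr)
  assume "\<not> reducible_matching Q \<phi>"
  then obtain u where big: "\<not> (finite S \<and> card S \<le> 2)" and full: "full_orbit Q \<phi> u" and irr: "\<not> reducible_orbit Q \<phi> u"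
    unfolding reducible_matching_def by blast
  have u: "u \<in> Q" "covered_by u (\<phi> u)" using full by (simp_all add: full_orbit_def orbit_bottom_def)
  have le: "bruhat_le (dihedral_longest a c) (\<phi> u)" and fin: "m a c \<noteq> \<infinity>" if "a \<in> S" "c \<in> S" for a c
    using full that by (auto simp: full_orbit_def full_element_def)
  have no_left: "\<not> left_commuting a" if "a \<in> S" "len (a \<otimes> u) < len u" for a
    using irr full left_regular_if_commuting[OF max] left_descent_covered[of a u] that u Q_closed[OF u(1)]
    unfolding reducible_orbit_def full_orbit_def left_descents_def by auto
  have no_right: "\<not> right_commuting a" if "a \<in> S" "len (u \<otimes> a) < len u" for a
    using irr full right_regular_if_commuting[OF max] right_descent_covered[of a u] that u Q_closed[OF u(1)]
    unfolding reducible_orbit_def full_orbit_def right_descents_def by auto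
  interpret irreducible_orbit W S m Q \<phi> u
  proof unfold_locales
    show "\<one> \<in> Q" using one_Q u(1) .
    show "len u < len (\<phi> u)" using up_iff u by simp
    show "dihedral_longest a c \<in> Q" if "a \<in> S" "c \<in> S" for a c using le[OF that] Q_down phi_Q u(1) by blast
  qed (use u le fin no_left no_right in auto)
  obtain t where "t \<in> S" "S \<subseteq> {base, t}" using rank_le_2 by blast
  then have "finite S" "card S \<le> card {base, t}" by (auto intro: finite_subset card_mono)
  moreover have "card {base, t} \<le> 2" by (simp add: card_insert_le_m1)
  ultimately show False using big by simp
qed

end

theorem mainTheorem3:
  fixes W :: "('a, 'b) monoid_scheme"
    and S :: "'a set"
    and m :: "'a \<Rightarrow> 'a \<Rightarrow> enat"
    and Q :: "'a set"
    and \<phi> :: "'a \<Rightarrow> 'a"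
  assumes "coxeter_system W S m"
    and "coxeter_system.maximal_distinguished_matching W S Q \<phi>"
  shows "coxeter_system.reducible_matching W S m Q \<phi>"
proof -
  interpret coxeter_system W S m by (rule assms(1))
  interpret distinguished_matching W S m Q \<phi>
    using assms(2) by unfold_locales (simp add: maximal_distinguished_matching_def)
  show ?thesis using reducible_if_maximal assms(2) .
qed

end
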